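(* Let $\phi\in\mathcal M^0$ and $(w,x)\in\mathcal H^\phi_+$, $x=(x_0,x_1)$. Let $V(w,x;\phi)=\sup\{J(c,B):\ (c,B,\theta)\in\Pi(w,x;\phi)\}$ be the value function. Then $$V(w,x;\phi)=\frac{f_\infty^{\gamma}\,\big(G^\phi(w,x)\big)^{1-\gamma}}{1-\gamma},$$ where $f_\infty=(1+\delta k^{-b})\nu>0$, $b=1-\frac1\gamma$ and $\nu=\dfrac{\gamma}{\rho+\delta-(1-\gamma)\big(r+\delta+\frac{\kappa^\top\kappa}{2\gamma}\big)}>0$. The optimal total wealth starting at $(w,x)$ is $\Gamma^*(t)=G^\phi\big(W^*(t),X(t)\big)$, where $X(t)=X^x(t;\phi)=(X_0(t),X_1(t))$ with $X_0(t)=y^x(t;\phi)$, $X_1(t)(s)=y^x(t+s;\phi)$ for $s\in[-d,0)$, and $W^*$ is the solution of the wealth equation starting at $w$ with the optimal controls, defined in feedback form by $$c^*(t)=f_\infty^{-1}\Gamma^*(t),\qquad B^*(t)=k^{-b}f_\infty^{-1}\Gamma^*(t),$$ $$\theta^*(t)=(\sigma\sigma^\top)^{-1}(\mu-r\mathbf 1)\frac{\Gamma^*(t)}{\gamma}-g^\phi_\infty X_0(t)(\sigma^\top)^{-1}\sigma_y .$$ As a consequence, $\Gamma^*$ is a Doléans exponential with dynamics $$d\Gamma^*(t)=\Gamma^*(t)\Big(r+\delta+\frac{\kappa^\top\kappa}{\gamma}-f_\infty^{-1}(1+\delta k^{-b})\Big)dt+\frac{\Gamma^*(t)}{\gamma}\kappa^\top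 dZ(t)$$ and initial condition $\Gamma^*(0)=w+g^\phi_\infty x_0+\langle h^\phi_\infty,x_1\rangle$.
   Context: Setting. $Z$ is an $n$-dimensional Brownian motion on $(\Omega,\mathcal F,P)$ with augmented natural filtration $\mathbb F=(\mathcal F_t)$. Constants: $r>0$, $\delta>0$, $\rho>0$, $k>0$, $d>0$, $\gamma\in(0,1)\cup(1,\infty)$, $\mu\in\mathbb R^n$, $\sigma\in\mathbb R^{n\times n}$ invertible, $\mu_y\in\mathbb R$, $\sigma_y\in\mathbb R^n$, $\mathbf 1=(1,\dots,1)^\top\in\mathbb R^n$, $\kappa=\sigma^{-1}(\mu-r\mathbf 1)$. $\mathcal M^0$ is the set of (signed) Radon measures on $[-d,0]$ with no atom at $0$. $M_2=\mathbb R\times L^2([-d,0);\mathbb R)$, a Hilbert space with the product inner product; $\langle\cdot,\cdot\rangle$ is the inner product in $L^2([-d,0);\mathbb R)$; $\mathcal H=\mathbb R\times M_2$. Labor income: for $x=(x_0,x_1)\in M_2$, $y=y^x(\cdot;\phi)$ is the unique strong continuous solution of $$dy(t)=\Big[\mu_y y(t)+\int_{-d}^0y(t+s)\phi(ds)\Big]dt+y(t)\sigma_y^\top dZ(t),\quad y(0)=x_0,\ y(s)=x_1(s)\ (s\in[-d,0)).$$ (For $x_1$ only in $L^2$, the delay term is understood through the continuous extension to $L^2([-d,T];\mathbb R)$ of the map $C([-d,T];\mathbb R)\to L^2([0,T];\mathbb R)$, $z\mapsto\int_{-d}^0z(\cdot+s)\phi(ds)$, for each $T>0$.) Controls: $\Pi^0$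 is the set of triplets $\pi=(c,B,\theta)$ of $\mathbb F$-predictable processes with $c,B\ge0$ in $L^1(\Omega\times[0,T])$ and $\theta\in L^2(\Omega\times[0,T];\mathbb R^n)$ for all $T>0$ (with respect to $P\otimes dt$). For $w\in\mathbb R$, the wealth $W=W^{w,x}(\cdot;\phi,\pi)$ solves $$dW(t)=\big[(r+\delta)W(t)+\theta(t)^\top(\mu-r\mathbf 1)+y(t)-c(t)-\delta B(t)\big]dt+\theta(t)^\top\sigma\,dZ(t),\quad W(0)=w.$$ Total wealth: let $\beta=r+\delta-\mu_y+\sigma_y^\top\kappa$, $\beta^\phi_\infty=\int_{-d}^0e^{(r+\delta)s}\phi(ds)$, $$g^\phi_\infty=\frac1{\beta-\beta^\phi_\infty},\quad h^\phi_\infty(s)=g^\phi_\infty\int_{-d}^se^{-(r+\delta)(s-\tau)}\phi(d\tau),\quad G^\phi(w,x_0,x_1)=w+g^\phi_\infty x_0+\langle h^\phi_\infty,x_1\rangle .$$ The total wealth is $\Gamma(t)=W(t)+\xi(t)^{-1}\mathbb E\big[\int_t^\infty\xi(u)y(u)du\,|\,\mathcal F_t\big]$, where $d\xi=-\xi(r+\delta)dt-\xi\kappa^\top dZ$, $\xi(0)=1$; by a known representation result it equals $G^\phi\big(W(t),y(t),y(t+\cdot)|_{[-d,0)}\big)$. The admissible set is $$\Pi(w,x;\phi)=\{\pi\in\Pi^0:\ G^\phi\big(W^{w,x}(t;\phi,\pi),y^x(t;\phi),y^x(t+\cdot;\phi)|_{[-d,0)}\big)\ge0\ \ \forall t\ge0\},$$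 and $\mathcal H^\phi_+=\{(w,x)\in\mathcal H: G^\phi(w,x)\ge0\}$. Objective: $$J(c,B)=\mathbb E\int_0^\infty e^{-(\rho+\delta)t}\Big(\frac{c(t)^{1-\gamma}}{1-\gamma}+\delta\frac{(kB(t))^{1-\gamma}}{1-\gamma}\Big)dt .$$ Standing assumptions: $\beta-\beta^\phi_\infty>0$ and $\rho+\delta-(1-\gamma)\big(r+\delta+\frac{\kappa^\top\kappa}{2\gamma}\big)>0$. Convention: $0^{1-\gamma}/(1-\gamma)$ equals $0$ if $\gamma\in(0,1)$ and $-\infty$ if $\gamma>1$. *)

theory Defs
  imports "HOL-Probability.Probability"
begin

section \<open>Signed measures on the delay window\<close>

text \<open>A signed Radon measure on \<open>[-d, 0]\<close> is a countably additive real-valued set function on the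
  Borel sets of the line that is concentrated on \<open>[-d, 0]\<close>; regularity is automatic for finite
  Borel measures on the line. Values on non-Borel sets are irrelevant.\<close>

definition signed_borel_measure :: "(real set \<Rightarrow> real) \<Rightarrow> bool" where
  "signed_borel_measure \<phi> \<longleftrightarrow> \<phi> {} = 0 \<and>
     (\<forall>A :: nat \<Rightarrow> real set. range A \<subseteq> sets borel \<longrightarrow> disjoint_family A \<longrightarrow>
        (\<lambda>i. \<phi> (A i)) sums \<phi> (\<Union>i. A i))"

definition radon_measures_no_atom :: "real \<Rightarrow> (real set \<Rightarrow> real) set" where
  "radon_measures_no_atom d = {\<phi>. signed_borel_measure \<phi> \<and>
     (\<forall>A\<in>sets borel. \<phi> A = \<phi> (A \<inter> {-d..0})) \<and> \<phi> {0} = 0}"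

text \<open>Integration against \<open>\<phi>\<close> goes through its Jordan decomposition. In \<open>positive_variation\<close> the
  truncation \<open>ennreal x = 0\<close> for \<open>x < 0\<close> is harmless, because \<open>B = {}\<close> is among the competitors.\<close>

definition positive_variation :: "(real set \<Rightarrow> real) \<Rightarrow> real measure" where
  "positive_variation \<phi> = measure_of UNIV (sets borel)
     (\<lambda>A. SUP B\<in>{B \<in> sets borel. B \<subseteq> A}. ennreal (\<phi> B))"

definition negative_variation :: "(real set \<Rightarrow> real) \<Rightarrow> real measure" where
  "negative_variation \<phi> = positive_variation (\<lambda>A. - \<phi> A)"

definition signed_integral :: "(real set \<Rightarrow> real) \<Rightarrow> real set \<Rightarrow> (real \<Rightarrow> real) \<Rightarrow> real" where
  "signed_integral \<phi> A f =
     (LINT s:A|positive_variation \<phi>. f s) - (LINT s:A|negative_variation \<phi>. f s)"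


section \<open>Brownian motion and its augmented filtration\<close>

text \<open>Processes are functions of time and outcome; only times \<open>t \<ge> 0\<close> matter, except for the
  labour income, which also carries its past on \<open>[-d, 0)\<close>.\<close>

definition natural_filtration ::
    "'w measure \<Rightarrow> (real \<Rightarrow> 'w \<Rightarrow> 'b::topological_space) \<Rightarrow> real \<Rightarrow> 'w measure" where
  "natural_filtration M Z t =
     sigma (space M) (\<Union>s\<in>{0..t}. {Z s -` A \<inter> space M | A. A \<in> sets borel})"

definition augmented_filtration ::
    "'w measure \<Rightarrow> (real \<Rightarrow> 'w \<Rightarrow> 'b::topological_space) \<Rightarrow> real \<Rightarrow> 'w measure" where
  "augmented_filtration M Z t =
     sigma (space M) (sets (natural_filtration M Z t) \<union> null_sets M)"

lemma space_natural_filtration: "space (natural_filtration M Z t) = space M"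
  unfolding natural_filtration_def by (rule space_measure_of) auto

lemma filtration_augmented: "filtration (space M) (augmented_filtration M Z)"
proof
  have sub: "sets (natural_filtration M Z t) \<union> null_sets M \<subseteq> Pow (space M)" for t
    using sets.sets_into_space[of _ "natural_filtration M Z t"]
      sets.sets_into_space[of _ M]
    by (auto simp: space_natural_filtration null_sets_def)
  show "space (augmented_filtration M Z t) = space M" for t
    unfolding augmented_filtration_def by (rule space_measure_of[OF sub])
  fix s t :: real assume "s \<le> t"
  then have "(\<Union>u\<in>{0..s}. {Z u -` A \<inter> space M | A. A \<in> sets borel})
      \<subseteq> (\<Union>u\<in>{0..t}. {Z u -` A \<inter> space M | A. A \<in> sets borel})"
    by (intro UN_mono) auto
  then have "sets (natural_filtration M Z s) \<subseteq> sets (natural_filtration M Z t)"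
    unfolding natural_filtration_def
    by (subst (1 2) sets_measure_of) (auto intro!: sigma_sets_mono')
  then show "sets (augmented_filtration M Z s) \<subseteq> sets (augmented_filtration M Z t)"
    unfolding augmented_filtration_def
    by (subst (1 2) sets_measure_of[OF sub]) (auto intro!: sigma_sets_mono')
qed

definition brownian_motion :: "'w measure \<Rightarrow> (real \<Rightarrow> 'w \<Rightarrow> real ^ 'n) \<Rightarrow> bool" where
  "brownian_motion M Z \<longleftrightarrow>
     (\<forall>t\<ge>0. Z t \<in> borel_measurable M) \<and>
     (AE \<omega> in M. Z 0 \<omega> = 0) \<and>
     (AE \<omega> in M. continuous_on {0..} (\<lambda>t. Z t \<omega>)) \<and>
     (\<forall>s\<ge>0. \<forall>t>s.
        distributed M lborel (\<lambda>\<omega>. Z t \<omega> - Z s \<omega>)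
          (\<lambda>x. \<Prod>i\<in>UNIV. ennreal (normal_density 0 (sqrt (t - s)) (x $ i))) \<and>
        prob_space.indep_set M (sets (natural_filtration M Z s))
          {(\<lambda>\<omega>. Z t \<omega> - Z s \<omega>) -` A \<inter> space M | A. A \<in> sets borel})"

definition adapted_continuous ::
    "'w measure \<Rightarrow> (real \<Rightarrow> 'w measure) \<Rightarrow> (real \<Rightarrow> 'w \<Rightarrow> real) \<Rightarrow> bool" where
  "adapted_continuous M F X \<longleftrightarrow>
     (\<forall>t\<ge>0. X t \<in> borel_measurable (F t)) \<and>
     (\<forall>\<omega>\<in>space M. continuous_on {0..} (\<lambda>t. X t \<omega>))"

definition predictable_algebra :: "'w measure \<Rightarrow> (real \<Rightarrow> 'w measure) \<Rightarrow> (real \<times> 'w) measure" where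
  "predictable_algebra M F = sigma ({0..} \<times> space M)
     ({{0} \<times> A | A. A \<in> sets (F 0)} \<union>
      {{s<..t} \<times> A | s t A. 0 \<le> s \<and> s \<le> t \<and> A \<in> sets (F s)})"

definition predictable ::
    "'w measure \<Rightarrow> (real \<Rightarrow> 'w measure) \<Rightarrow> (real \<Rightarrow> 'w \<Rightarrow> 'b::topological_space) \<Rightarrow> bool" where
  "predictable M F H \<longleftrightarrow> (\<lambda>(t, \<omega>). H t \<omega>) \<in> borel_measurable (predictable_algebra M F)"


section \<open>The Ito integral\<close>

text \<open>\<open>elementary_integral M Z H I\<close>: \<open>H\<close> is the step process with value \<open>\<xi> i\<close> on
  \<open>(\<tau> i, \<tau> (i+1)]\<close>, and \<open>I\<close> is its integral against \<open>Z\<close>.\<close>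

definition elementary_integral ::
    "'w measure \<Rightarrow> (real \<Rightarrow> 'w \<Rightarrow> real ^ 'n) \<Rightarrow> (real \<Rightarrow> 'w \<Rightarrow> real ^ 'n) \<Rightarrow> (real \<Rightarrow> 'w \<Rightarrow> real) \<Rightarrow> bool"
  where
  "elementary_integral M Z H I \<longleftrightarrow>
     (\<exists>(m::nat) (\<tau> :: nat \<Rightarrow> real) (\<xi> :: nat \<Rightarrow> 'w \<Rightarrow> real ^ 'n).
        0 \<le> \<tau> 0 \<and> (\<forall>i<m. \<tau> i \<le> \<tau> (Suc i)) \<and>
        (\<forall>i<m. \<xi> i \<in> borel_measurable (augmented_filtration M Z (\<tau> i))) \<and>
        (\<exists>C. \<forall>i<m. \<forall>\<omega>\<in>space M. norm (\<xi> i \<omega>) \<le> C) \<and>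
        H = (\<lambda>t \<omega>. \<Sum>i<m. indicator {\<tau> i<..\<tau> (Suc i)} t *\<^sub>R \<xi> i \<omega>) \<and>
        I = (\<lambda>t \<omega>. \<Sum>i<m. \<xi> i \<omega> \<bullet> (Z (min t (\<tau> (Suc i))) \<omega> - Z (min t (\<tau> i)) \<omega>)))"

text \<open>\<open>ito_integral M Z H I\<close>: \<open>H\<close> is predictable with a.s. locally square-integrable paths, and
  \<open>I\<close> is a continuous version of \<open>\<integral>\<^sub>0\<^sup>t H \<bullet> dZ\<close>, i.e. the limit, uniformly on compacts in
  probability, of integrals of step processes approximating \<open>H\<close> in \<open>L\<^sup>2([0,T])\<close> in probability. This
  determines \<open>I\<close> up to indistinguishability.\<close>

definition ito_integral ::
    "'w measure \<Rightarrow> (real \<Rightarrow> 'w \<Rightarrow> real ^ 'n) \<Rightarrow> (real \<Rightarrow> 'w \<Rightarrow> real ^ 'n) \<Rightarrow> (real \<Rightarrow> 'w \<Rightarrow> real) \<Rightarrow> bool"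
  where
  "ito_integral M Z H I \<longleftrightarrow>
     predictable M (augmented_filtration M Z) H \<and>
     (AE \<omega> in M. \<forall>T\<ge>0. (\<integral>\<^sup>+t\<in>{0..T}. ennreal ((norm (H t \<omega>))\<^sup>2) \<partial>lborel) < \<infinity>) \<and>
     adapted_continuous M (augmented_filtration M Z) I \<and>
     (\<exists>Hs Is. (\<forall>k::nat. elementary_integral M Z (Hs k) (Is k)) \<and>
        (\<forall>T\<ge>0. \<forall>\<epsilon>>0.
           (\<lambda>k. measure M {\<omega> \<in> space M.
              ennreal \<epsilon> < (\<integral>\<^sup>+t\<in>{0..T}. ennreal ((norm (Hs k t \<omega> - H t \<omega>))\<^sup>2) \<partial>lborel)})
             \<longlonglongrightarrow> 0 \<and>
           (\<lambda>k. measure M {\<omega> \<in> space M. \<exists>t\<in>{0..T}. \<epsilon> < \<bar>Is k t \<omega> - I t \<omega>\<bar>})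
             \<longlonglongrightarrow> 0))"

text \<open>\<open>ito_process M Z x a b X\<close> reads \<open>dX = a dt + b\<^sup>T dZ\<close>, \<open>X(0) = x\<close>. When \<open>a\<close> and \<open>b\<close> are
  expressions in \<open>X\<close>, it says that \<open>X\<close> is a strong solution of the corresponding equation.\<close>

definition ito_process ::
    "'w measure \<Rightarrow> (real \<Rightarrow> 'w \<Rightarrow> real ^ 'n) \<Rightarrow> real \<Rightarrow> (real \<Rightarrow> 'w \<Rightarrow> real) \<Rightarrow>
     (real \<Rightarrow> 'w \<Rightarrow> real ^ 'n) \<Rightarrow> (real \<Rightarrow> 'w \<Rightarrow> real) \<Rightarrow> bool" where
  "ito_process M Z x a b X \<longleftrightarrow>
     adapted_continuous M (augmented_filtration M Z) X \<and>
     (AE \<omega> in M. \<forall>t\<ge>0. set_integrable lborel {0..t} (\<lambda>s. a s \<omega>)) \<and>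
     (\<exists>I. ito_integral M Z b I \<and>
        (AE \<omega> in M. \<forall>t\<ge>0. X t \<omega> = x + (LINT s:{0..t}|lborel. a s \<omega>) + I t \<omega>))"

text \<open>The Doleans exponential of the semimartingale \<open>A(t) = \<alpha> t + v\<^sup>T Z(t)\<close>, i.e.
  \<open>exp (A - [A]/2)\<close> with \<open>[A](t) = \<bar>v\<bar>\<^sup>2 t\<close>.\<close>

definition doleans_exponential ::
    "(real \<Rightarrow> 'w \<Rightarrow> real ^ 'n) \<Rightarrow> real \<Rightarrow> real ^ 'n \<Rightarrow> real \<Rightarrow> 'w \<Rightarrow> real" where
  "doleans_exponential Z \<alpha> v t \<omega> = exp (\<alpha> * t + v \<bullet> Z t \<omega> - (v \<bullet> v) * t / 2)"


section \<open>The market\<close>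

text \<open>In the usual notation the fields are
  \<open>r, \<delta>, \<rho>, k, d, \<gamma>, \<mu>, \<sigma>, \<mu>\<^sub>y, \<sigma>\<^sub>y\<close>, in this order.\<close>

record ('n::finite) market =
  interest :: real
  mortality :: real
  discount :: real
  bequest :: real
  delay :: real
  aversion :: real
  drift :: "(real, 'n) vec"
  vol :: "((real, 'n) vec, 'n) vec"
  income_drift :: real
  income_vol :: "(real, 'n) vec"

definition excess_return :: "'n::finite market \<Rightarrow> real ^ 'n" where
  "excess_return p = drift p - interest p *\<^sub>R 1"

definition kappa :: "'n::finite market \<Rightarrow> real ^ 'n" where
  "kappa p = matrix_inv (vol p) *v excess_return p"

definition beta :: "'n::finite market \<Rightarrow> real" where
  "beta p = interest p + mortality p - income_drift p + income_vol p \<bullet> kappa p"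

definition beta_inf :: "'n::finite market \<Rightarrow> (real set \<Rightarrow> real) \<Rightarrow> real" where
  "beta_inf p \<phi> =
     signed_integral \<phi> {- delay p..0} (\<lambda>s. exp ((interest p + mortality p) * s))"

definition g_inf :: "'n::finite market \<Rightarrow> (real set \<Rightarrow> real) \<Rightarrow> real" where
  "g_inf p \<phi> = 1 / (beta p - beta_inf p \<phi>)"

definition h_inf :: "'n::finite market \<Rightarrow> (real set \<Rightarrow> real) \<Rightarrow> real \<Rightarrow> real" where
  "h_inf p \<phi> s = g_inf p \<phi> *
     signed_integral \<phi> {- delay p..s} (\<lambda>\<tau>. exp (- (interest p + mortality p) * (s - \<tau>)))"

text \<open>Elements of \<open>L\<^sup>2([-d,0))\<close> are represented by functions, on which \<open>G\<close> depends only through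
  their class.\<close>

definition L2_window :: "real \<Rightarrow> (real \<Rightarrow> real) set" where
  "L2_window d = {x1. set_borel_measurable lborel {-d..<0} x1 \<and>
     set_integrable lborel {-d..<0} (\<lambda>s. (x1 s)\<^sup>2)}"

definition G :: "'n::finite market \<Rightarrow> (real set \<Rightarrow> real) \<Rightarrow> real \<Rightarrow> real \<Rightarrow> (real \<Rightarrow> real) \<Rightarrow> real" where
  "G p \<phi> w x0 x1 =
     w + g_inf p \<phi> * x0 + (LINT s:{- delay p..<0}|lborel. h_inf p \<phi> s * x1 s)"

definition nu :: "'n::finite market \<Rightarrow> real" where
  "nu p = aversion p / (discount p + mortality p - (1 - aversion p) *
     (interest p + mortality p + kappa p \<bullet> kappa p / (2 * aversion p)))"

definition b_exp :: "'n::finite market \<Rightarrow> real" where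
  "b_exp p = 1 - 1 / aversion p"

definition f_inf :: "'n::finite market \<Rightarrow> real" where
  "f_inf p = (1 + mortality p * bequest p powr (- b_exp p)) * nu p"


section \<open>Labour income\<close>

definition tendsto_L2_on :: "real set \<Rightarrow> (nat \<Rightarrow> real \<Rightarrow> real) \<Rightarrow> (real \<Rightarrow> real) \<Rightarrow> bool" where
  "tendsto_L2_on A f g \<longleftrightarrow>
     (\<forall>k. set_borel_measurable lborel A (f k)) \<and> set_borel_measurable lborel A g \<and>
     (\<lambda>k. \<integral>\<^sup>+s\<in>A. ennreal ((f k s - g s)\<^sup>2) \<partial>lborel) \<longlonglongrightarrow> 0"

text \<open>\<open>delay_term \<phi> d z D\<close>: for each \<open>T > 0\<close>, \<open>D\<close> is on \<open>[0,T]\<close> the image of \<open>z\<close> under the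
  continuous extension to \<open>L\<^sup>2([-d,T])\<close> of the map \<open>z \<mapsto> \<integral> z(\<cdot>+s) \<phi>(ds)\<close> defined on
  \<open>C([-d,T])\<close>.\<close>

definition delay_term :: "(real set \<Rightarrow> real) \<Rightarrow> real \<Rightarrow> (real \<Rightarrow> real) \<Rightarrow> (real \<Rightarrow> real) \<Rightarrow> bool" where
  "delay_term \<phi> d z D \<longleftrightarrow>
     (\<forall>T>0. \<exists>zs :: nat \<Rightarrow> real \<Rightarrow> real.
        (\<forall>k. continuous_on {-d..T} (zs k)) \<and>
        tendsto_L2_on {-d..T} zs z \<and>
        tendsto_L2_on {0..T} (\<lambda>k t. signed_integral \<phi> {-d..0} (\<lambda>s. zs k (t + s))) D)"

definition labor_income ::
    "'w measure \<Rightarrow> (real \<Rightarrow> 'w \<Rightarrow> real ^ 'n) \<Rightarrow> 'n::finite market \<Rightarrow> (real set \<Rightarrow> real) \<Rightarrow>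
     real \<Rightarrow> (real \<Rightarrow> real) \<Rightarrow> (real \<Rightarrow> 'w \<Rightarrow> real) \<Rightarrow> bool" where
  "labor_income M Z p \<phi> x0 x1 y \<longleftrightarrow>
     (\<forall>\<omega>\<in>space M. y 0 \<omega> = x0 \<and> (\<forall>s\<in>{- delay p..<0}. y s \<omega> = x1 s)) \<and>
     (\<exists>D. (AE \<omega> in M. delay_term \<phi> (delay p) (\<lambda>t. y t \<omega>) (\<lambda>t. D t \<omega>)) \<and>
        ito_process M Z x0
          (\<lambda>t \<omega>. income_drift p * y t \<omega> + D t \<omega>)
          (\<lambda>t \<omega>. y t \<omega> *\<^sub>R income_vol p) y)"


section \<open>Controls, wealth and objective\<close>

type_synonym ('w, 'n) control =
  "(real \<Rightarrow> 'w \<Rightarrow> real) \<times> (real \<Rightarrow> 'w \<Rightarrow> real) \<times> (real \<Rightarrow> 'w \<Rightarrow> (real, 'n) vec)"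

definition controls ::
    "'w measure \<Rightarrow> (real \<Rightarrow> 'w \<Rightarrow> real ^ 'n) \<Rightarrow> ('w, 'n::finite) control set" where
  "controls M Z = {(c, B, \<theta>).
     predictable M (augmented_filtration M Z) c \<and>
     predictable M (augmented_filtration M Z) B \<and>
     predictable M (augmented_filtration M Z) \<theta> \<and>
     (AE (t, \<omega>) in lborel \<Otimes>\<^sub>M M. 0 \<le> t \<longrightarrow> 0 \<le> c t \<omega> \<and> 0 \<le> B t \<omega>) \<and>
     (\<forall>T>0.
        set_integrable (lborel \<Otimes>\<^sub>M M) ({0..T} \<times> space M) (\<lambda>(t, \<omega>). c t \<omega>) \<and>
        set_integrable (lborel \<Otimes>\<^sub>M M) ({0..T} \<times> space M) (\<lambda>(t, \<omega>). B t \<omega>) \<and>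
        set_integrable (lborel \<Otimes>\<^sub>M M) ({0..T} \<times> space M) (\<lambda>(t, \<omega>). (norm (\<theta> t \<omega>))\<^sup>2))}"

fun wealth ::
    "'w measure \<Rightarrow> (real \<Rightarrow> 'w \<Rightarrow> real ^ 'n) \<Rightarrow> 'n::finite market \<Rightarrow> real \<Rightarrow> (real \<Rightarrow> 'w \<Rightarrow> real) \<Rightarrow>
     ('w, 'n) control \<Rightarrow> (real \<Rightarrow> 'w \<Rightarrow> real) \<Rightarrow> bool" where
  "wealth M Z p w y (c, B, \<theta>) W \<longleftrightarrow>
     ito_process M Z w
       (\<lambda>t \<omega>. (interest p + mortality p) * W t \<omega> + \<theta> t \<omega> \<bullet> excess_return p
               + y t \<omega> - c t \<omega> - mortality p * B t \<omega>)
       (\<lambda>t \<omega>. transpose (vol p) *v \<theta> t \<omega>) W"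

definition total_wealth ::
    "'n::finite market \<Rightarrow> (real set \<Rightarrow> real) \<Rightarrow> (real \<Rightarrow> 'w \<Rightarrow> real) \<Rightarrow> (real \<Rightarrow> 'w \<Rightarrow> real) \<Rightarrow>
     real \<Rightarrow> 'w \<Rightarrow> real" where
  "total_wealth p \<phi> y W t \<omega> = G p \<phi> (W t \<omega>) (y t \<omega>) (\<lambda>s. y (t + s) \<omega>)"

text \<open>Below, \<open>y\<close> is the labour income started at \<open>x\<close>. It is unique up to indistinguishability, so
  the admissible controls and the value function depend on it only through \<open>x\<close>.\<close>

definition admissible ::
    "'w measure \<Rightarrow> (real \<Rightarrow> 'w \<Rightarrow> real ^ 'n) \<Rightarrow> 'n::finite market \<Rightarrow> (real set \<Rightarrow> real) \<Rightarrow> real \<Rightarrow>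
     (real \<Rightarrow> 'w \<Rightarrow> real) \<Rightarrow> ('w, 'n) control set" where
  "admissible M Z p \<phi> w y = {\<pi> \<in> controls M Z.
     \<exists>W. wealth M Z p w y \<pi> W \<and> (AE \<omega> in M. \<forall>t\<ge>0. 0 \<le> total_wealth p \<phi> y W t \<omega>)}"

definition crra :: "real \<Rightarrow> real \<Rightarrow> ereal" where
  "crra \<gamma> x = (if x = 0 \<and> 1 < \<gamma> then -\<infinity> else ereal (x powr (1 - \<gamma>) / (1 - \<gamma>)))"

definition running_utility ::
    "'n::finite market \<Rightarrow> (real \<Rightarrow> 'w \<Rightarrow> real) \<Rightarrow> (real \<Rightarrow> 'w \<Rightarrow> real) \<Rightarrow> real \<Rightarrow> 'w \<Rightarrow> ereal" where
  "running_utility p c B t \<omega> =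
     ereal (exp (- (discount p + mortality p) * t)) *
     (crra (aversion p) (c t \<omega>) + ereal (mortality p) * crra (aversion p) (bequest p * B t \<omega>))"

text \<open>The running utility has constant sign (that of \<open>1 - \<gamma>\<close>), so that one of the two terms below
  vanishes; \<open>e2ennreal\<close> is the positive part.\<close>

definition J ::
    "'w measure \<Rightarrow> 'n::finite market \<Rightarrow> (real \<Rightarrow> 'w \<Rightarrow> real) \<Rightarrow> (real \<Rightarrow> 'w \<Rightarrow> real) \<Rightarrow> ereal" where
  "J M p c B =
     enn2ereal (\<integral>\<^sup>+\<omega>. (\<integral>\<^sup>+t\<in>{0..}. e2ennreal (running_utility p c B t \<omega>) \<partial>lborel) \<partial>M) -
     enn2ereal (\<integral>\<^sup>+\<omega>. (\<integral>\<^sup>+t\<in>{0..}. e2ennreal (- running_utility p c B t \<omega>) \<partial>lborel) \<partial>M)"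

definition value_function ::
    "'w measure \<Rightarrow> (real \<Rightarrow> 'w \<Rightarrow> real ^ 'n) \<Rightarrow> 'n::finite market \<Rightarrow> (real set \<Rightarrow> real) \<Rightarrow> real \<Rightarrow>
     (real \<Rightarrow> 'w \<Rightarrow> real) \<Rightarrow> ereal" where
  "value_function M Z p \<phi> w y = (SUP (c, B, \<theta>)\<in>admissible M Z p \<phi> w y. J M p c B)"


section \<open>The feedback controls\<close>

definition c_star ::
    "'n::finite market \<Rightarrow> (real set \<Rightarrow> real) \<Rightarrow> (real \<Rightarrow> 'w \<Rightarrow> real) \<Rightarrow> (real \<Rightarrow> 'w \<Rightarrow> real) \<Rightarrow>
     real \<Rightarrow> 'w \<Rightarrow> real" where
  "c_star p \<phi> y W t \<omega> = inverse (f_inf p) * total_wealth p \<phi> y W t \<omega>"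

definition B_star ::
    "'n::finite market \<Rightarrow> (real set \<Rightarrow> real) \<Rightarrow> (real \<Rightarrow> 'w \<Rightarrow> real) \<Rightarrow> (real \<Rightarrow> 'w \<Rightarrow> real) \<Rightarrow>
     real \<Rightarrow> 'w \<Rightarrow> real" where
  "B_star p \<phi> y W t \<omega> =
     bequest p powr (- b_exp p) * inverse (f_inf p) * total_wealth p \<phi> y W t \<omega>"

definition theta_star ::
    "'n::finite market \<Rightarrow> (real set \<Rightarrow> real) \<Rightarrow> (real \<Rightarrow> 'w \<Rightarrow> real) \<Rightarrow> (real \<Rightarrow> 'w \<Rightarrow> real) \<Rightarrow>
     real \<Rightarrow> 'w \<Rightarrow> real ^ 'n" where
  "theta_star p \<phi> y W t \<omega> =
     (total_wealth p \<phi> y W t \<omega> / aversion p) *\<^sub>R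
       (matrix_inv (vol p ** transpose (vol p)) *v excess_return p) -
     (g_inf p \<phi> * y t \<omega>) *\<^sub>R (matrix_inv (transpose (vol p)) *v income_vol p)"

definition feedback ::
    "'n::finite market \<Rightarrow> (real set \<Rightarrow> real) \<Rightarrow> (real \<Rightarrow> 'w \<Rightarrow> real) \<Rightarrow> (real \<Rightarrow> 'w \<Rightarrow> real) \<Rightarrow>
     ('w, 'n) control" where
  "feedback p \<phi> y W = (c_star p \<phi> y W, B_star p \<phi> y W, theta_star p \<phi> y W)"

text \<open>Wealth in closed loop: the controls are functions of the wealth process they generate.\<close>

definition closed_loop_wealth ::
    "'w measure \<Rightarrow> (real \<Rightarrow> 'w \<Rightarrow> real ^ 'n) \<Rightarrow> 'n::finite market \<Rightarrow> (real set \<Rightarrow> real) \<Rightarrow> real \<Rightarrow>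
     (real \<Rightarrow> 'w \<Rightarrow> real) \<Rightarrow> (real \<Rightarrow> 'w \<Rightarrow> real) \<Rightarrow> bool" where
  "closed_loop_wealth M Z p \<phi> w y W \<longleftrightarrow> wealth M Z p w y (feedback p \<phi> y W) W"

end

(* Write R = r + delta and C = c + delta B.  For every integrable path y the memory term
   F(t) = int_{-d}^0 h(s) y(t+s) ds is absolutely continuous (Fubini), and its derivative contains
   exactly the delay term of the income equation with the opposite sign.  Hence the total wealth X
   has the delay-free dynamics dX = (R X - C) dt + psi . (kappa dt + dZ).  The deflator
   exp(-R t) N(t), N the exponential martingale of -kappa, prices the gains psi . (kappa dt + dZ) at
   zero; this is checked on elementary integrands and extended by the isometry, so that Ito's formula
   is not needed.  This gives the budget inequality E int_0^infinity exp(-R t) N C dt <= X(0).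
   At the candidate optimum the discounted marginal utility is a multiple of the deflator, so the
   tangent inequality of the concave utility and the budget inequality bound J by the claimed value.
   Under the feedback controls X solves a linear equation, whose only solution (Gronwall for second
   moments localised to {sup |X| <= N}) is a stochastic exponential, and the bound is attained. *)
theory Submission
  imports Defs
begin

text \<open>The delay term of the income equation is the value of an L2-continuous extension, hence
  known only for almost every time. An L2 bound identifies it with the delay integral of the path,
  so the memory term is differentiated through an identity between time integrals. The constant
  \<open>g_inf\<close> is chosen so that the income terms in the drift of total wealth add up to
  \<open>g_inf * y\<close> times \<open>income_vol p\<close> . \<open>kappa p\<close>, the premium
  of the income risk. An exponential is recognised as a stochastic integral by a direct estimate:
  over a time h its growth factor differs from 1 + v . (increment of Z) by an error with second
  moment o(h). Errors of different cells are orthogonal, so their total vanishes with the mesh.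
  Utility may integrate to infinity. The tangent inequality is therefore integrated with positive
  and negative parts on opposite sides, and finite terms are cancelled at the end. Initial total
  wealth 0 is treated apart: no positive reference consumption exists there, but the budget then
  forces all consumption to vanish.\<close>

abbreviation esq :: "real => ennreal" where
 "esq x \<equiv> ennreal (x^2)"

abbreviation lebesgue_nn :: "(real => ennreal) => ennreal" (binder "\<L>" 10) where
 "lebesgue_nn f \<equiv> \<integral>\<^sup>+x. f x \<partial>lborel"

abbreviation nnint :: "real set => (real => ennreal) => ennreal" where
 "nnint A f \<equiv> \<integral>\<^sup>+x\<in>A. f x \<partial>lborel"

section \<open>The variations of a signed measure\<close>

lemma signed_borel_measure_uminus:
 assumes "signed_borel_measure \<phi>" shows "signed_borel_measure (%A. - \<phi> A)"
 using assms unfolding signed_borel_measure_def by (auto intro: sums_minus)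

lemma signed_borel_measure_Un:
 assumes "signed_borel_measure \<phi>" "A \<in> sets borel" "B \<in> sets borel" "A \<inter> B = {}"
 shows "\<phi> (A \<union> B) = \<phi> A + \<phi> B"
proof -
 define C where "C = (%i::nat. if i = 0 then A else if i = 1 then B else {})"
 have "range C \<subseteq> sets borel" "disjoint_family C" "(\<Union>i. C i) = A \<union> B"
  using assms by (auto simp: C_def disjoint_family_on_def split: if_splits)
 hence "(%i. \<phi> (C i)) sums \<phi> (A \<union> B)"
  using assms(1) unfolding signed_borel_measure_def by metis
 moreover have "(%i. \<phi> (C i)) sums (\<Sum>i\<in>{0, 1}. \<phi> (C i))"
  using assms(1) by (intro sums_finite) (auto simp: C_def signed_borel_measure_def)
 ultimately have "\<phi> (A \<union> B) = (\<Sum>i\<in>{0, 1}. \<phi> (C i))"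
  by (rule sums_unique2)
 thus ?thesis by (simp add: C_def)
qed

lemma ennreal_sums_le:
 assumes "x sums (s::real)" shows "ennreal s <= (\<Sum>i. ennreal (x i))"
proof (rule LIMSEQ_le_const2)
 show "(%n. ennreal (\<Sum>i<n. x i)) \<longlonglongrightarrow> ennreal s"
  using assms unfolding sums_def by (intro tendsto_ennrealI)
 have "ennreal (\<Sum>i<n. x i) <= (\<Sum>i. ennreal (x i))" for n
 proof -
  have "(\<Sum>i<n. x i) <= (\<Sum>i<n. max 0 (x i))" by (intro sum_mono) auto
  hence "ennreal (\<Sum>i<n. x i) <= ennreal (\<Sum>i<n. max 0 (x i))" by (rule ennreal_leI)
  also have "... = (\<Sum>i<n. ennreal (max 0 (x i)))" by (rule sum_ennreal[symmetric]) auto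
  also have "... = (\<Sum>i<n. ennreal (x i))"
   by (intro sum.cong refl) (auto simp: max_def ennreal_neg)
  also have "... <= (\<Sum>i. ennreal (x i))" by (intro sum_le_suminf) auto
  finally show ?thesis .
 qed
 thus "\<exists>N. \<forall>n\<ge>N. ennreal (\<Sum>i<n. x i) <= (\<Sum>i. ennreal (x i))" by blast
qed

lemma space_positive_variation [simp]: "space (positive_variation \<phi>) = UNIV"
 unfolding positive_variation_def by (rule space_measure_of) auto

lemma sets_positive_variation [simp, measurable_cong]: "sets (positive_variation \<phi>) = sets borel"
 unfolding positive_variation_def using sets.sigma_sets_eq[of "borel :: real measure"]
 by (subst sets_measure_of) auto

text \<open>Additivity rests on two inequalities. Competitors inside disjoint sets join to a
  competitor inside the union, which makes the supremum superadditive; and a competitor inside a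
  countable union is cut along the pieces, whose signed measures sum to its own.\<close>

lemma emeasure_positive_variation:
 assumes \<phi>: "signed_borel_measure \<phi>" and "A \<in> sets borel"
 shows "emeasure (positive_variation \<phi>) A = (SUP B\<in>{B \<in> sets borel. B \<subseteq> A}. ennreal (\<phi> B))"
proof -
 define f where "f = (%A. SUP B\<in>{B \<in> sets borel. B \<subseteq> A}. ennreal (\<phi> B))"
 have f_upper: "ennreal (\<phi> B) <= f A" if "B \<in> sets borel" "B \<subseteq> A" for A B
  unfolding f_def using that by (intro SUP_upper) auto
 have f_mono: "f A <= f B" if "A \<subseteq> B" for A B
  unfolding f_def using that by (intro SUP_subset_mono) auto
 have superadd: "f A + f B <= f (A \<union> B)" if "A \<in> sets borel" "B \<in> sets borel" "A \<inter> B = {}" for A B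
 proof -
  have 1: "ennreal (\<phi> C) + ennreal (\<phi> D) <= f (A \<union> B)"
   if "C \<in> sets borel" "C \<subseteq> A" "D \<in> sets borel" "D \<subseteq> B" for C D
  \<comment> \<open>A competitor of negative measure counts as 0 and would spoil the union; the
    other one alone then suffices.\<close>
  proof (cases "0 <= \<phi> C \<and> 0 <= \<phi> D")
   case True
   hence "ennreal (\<phi> C) + ennreal (\<phi> D) = ennreal (\<phi> C + \<phi> D)" by simp
   also have "\<phi> C + \<phi> D = \<phi> (C \<union> D)"
    using that \<open>A \<inter> B = {}\<close> by (intro signed_borel_measure_Un[OF \<phi>, symmetric]) auto
   also have "ennreal ... <= f (A \<union> B)" using that by (intro f_upper) auto
   finally show ?thesis .
  next
   case False
   hence "ennreal (\<phi> C) = 0 \<or> ennreal (\<phi> D) = 0" by (auto simp: ennreal_neg)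
   moreover have "ennreal (\<phi> C) <= f (A \<union> B)" "ennreal (\<phi> D) <= f (A \<union> B)"
    using that by (auto intro!: f_upper)
   ultimately show ?thesis by auto
  qed
  have 2: "ennreal (\<phi> C) + f B <= f (A \<union> B)" if "C \<in> sets borel" "C \<subseteq> A" for C
  proof -
   have "ennreal (\<phi> C) + f B = (SUP D\<in>{D \<in> sets borel. D \<subseteq> B}. ennreal (\<phi> C) + ennreal (\<phi> D))"
    unfolding f_def by (intro ennreal_SUP_add_right) auto
   also have "... <= f (A \<union> B)" using 1 that by (intro SUP_least) auto
   finally show ?thesis .
  qed
  have "f A + f B = (SUP C\<in>{C \<in> sets borel. C \<subseteq> A}. ennreal (\<phi> C) + f B)"
   unfolding fun_cong[OF f_def, of A] by (intro ennreal_SUP_add_left[symmetric]) auto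
  also have "... <= f (A \<union> B)" using 2 by (intro SUP_least) auto
  finally show ?thesis .
 qed
 have f0: "f {} = 0" using \<phi> by (simp add: f_def signed_borel_measure_def)
 have "countably_additive (sets borel) f"
 proof (rule countably_additiveI)
  fix A :: "nat => real set"
  assume A: "range A \<subseteq> sets borel" "disjoint_family A"
  have fin: "(\<Sum>i<n. f (A i)) <= f (\<Union>i<n. A i)" for n
  proof (induction n)
   case (Suc n)
   have "(\<Union>i<n. A i) \<inter> A n = {}"
    using A(2) unfolding disjoint_family_on_def
    by (metis (no_types, lifting) UNIV_I UN_E disjoint_iff lessThan_iff less_irrefl_nat)
   hence "f (\<Union>i<n. A i) + f (A n) <= f ((\<Union>i<n. A i) \<union> A n)"
    using A(1) by (intro superadd) auto
   hence "(\<Sum>i<Suc n. f (A i)) <= f ((\<Union>i<n. A i) \<union> A n)"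
    using Suc by (simp add: add_right_mono order_trans[OF add_right_mono])
   also have "(\<Union>i<n. A i) \<union> A n = (\<Union>i<Suc n. A i)" by (auto simp: less_Suc_eq)
   finally show ?case .
  qed (simp add: f0)
  have "(\<Sum>i. f (A i)) <= f (\<Union>i. A i)"
   unfolding suminf_eq_SUP using fin by (intro SUP_least) (meson f_mono UN_mono order_trans subset_UNIV order_refl)
  moreover have "f (\<Union>i. A i) <= (\<Sum>i. f (A i))"
  proof -
   have "ennreal (\<phi> B) <= (\<Sum>i. f (A i))" if B: "B \<in> sets borel" "B \<subseteq> (\<Union>i. A i)" for B
   proof -
    have "(%i. \<phi> (B \<inter> A i)) sums \<phi> (\<Union>i. B \<inter> A i)"
     using \<phi> A B unfolding signed_borel_measure_def
     by (elim conjE allE[of _ "%i. B \<inter> A i"]) (auto simp: disjoint_family_on_def)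
    also have "(\<Union>i. B \<inter> A i) = B" using B by auto
    finally have "ennreal (\<phi> B) <= (\<Sum>i. ennreal (\<phi> (B \<inter> A i)))" by (rule ennreal_sums_le)
    also have "... <= (\<Sum>i. f (A i))"
     using A B by (intro suminf_le f_upper) auto
    finally show ?thesis .
   qed
   thus ?thesis unfolding fun_cong[OF f_def, of "\<Union>i. A i"] by (intro SUP_least) auto
  qed
  ultimately show "(\<Sum>i. f (A i)) = f (\<Union>i. A i)" by simp
 qed
 moreover have "positive (sets borel) f" by (simp add: positive_def f0)
 ultimately show ?thesis
  unfolding positive_variation_def f_def[symmetric] using assms(2)
  using sets.sigma_algebra_axioms[of "borel :: real measure"]
  by (subst emeasure_measure_of_sigma) (auto simp: f_def)
qed

text \<open>A set of infinite variation contains a subset of infinite variation whose remainder has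
  signed measure of modulus at least 1. Iteration produces disjoint remainders, whose measures would
  form a convergent series without tending to 0.\<close>

lemma finite_positive_variation:
 assumes \<phi>: "signed_borel_measure \<phi>" shows "finite_measure (positive_variation \<phi>)"
proof (rule finite_measureI, rule notI)
 define f where "f = emeasure (positive_variation \<phi>)"
 assume "emeasure (positive_variation \<phi>) (space (positive_variation \<phi>)) = \<infinity>"
 hence inf: "f UNIV = \<infinity>" by (simp add: f_def)
 have step: "\<exists>B. (B \<in> sets borel \<and> f B = \<infinity>) \<and> B \<subseteq> A \<and> 1 <= \<bar>\<phi> (A - B)\<bar>"
  if A: "A \<in> sets borel \<and> f A = \<infinity>" for A
 proof -
  \<comment> \<open>The threshold gives both \<open>D\<close> and \<open>A - D\<close> a signed
    measure of modulus at least 1, so whichever of the two has infinite variation can be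
    kept.\<close>
  have "ennreal (\<bar>\<phi> A\<bar> + 1) < (SUP B\<in>{B \<in> sets borel. B \<subseteq> A}. ennreal (\<phi> B))"
   using A emeasure_positive_variation[OF \<phi>, of A] by (simp add: f_def)
  then obtain D where D: "D \<in> sets borel" "D \<subseteq> A" "ennreal (\<bar>\<phi> A\<bar> + 1) < ennreal (\<phi> D)"
   unfolding less_SUP_iff by auto
  hence D3: "\<bar>\<phi> A\<bar> + 1 <= \<phi> D" using ennreal_less_iff[of "\<bar>\<phi> A\<bar> + 1" "\<phi> D"] by simp
  have "\<phi> (D \<union> (A - D)) = \<phi> D + \<phi> (A - D)"
   using A D by (intro signed_borel_measure_Un[OF \<phi>]) auto
  moreover have "D \<union> (A - D) = A" using D by auto
  ultimately have AD: "\<phi> A = \<phi> D + \<phi> (A - D)" by simp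
  have "f (D \<union> (A - D)) = f D + f (A - D)"
   unfolding f_def using A D by (intro plus_emeasure[symmetric]) auto
  hence "f D + f (A - D) = \<infinity>" using A \<open>D \<union> (A - D) = A\<close> by simp
  then consider "f D = \<infinity>" | "f (A - D) = \<infinity>" by (auto simp: ennreal_add_eq_top)
  thus ?thesis
  proof cases
   case 1 thus ?thesis using A D D3 AD by (intro exI[of _ D]) auto
  next
   case 2
   moreover have "A - (A - D) = D" using D by auto
   ultimately show ?thesis using A D D3 by (intro exI[of _ "A - D"]) auto
  qed
 qed
 have "\<exists>E. \<forall>n. (E n \<in> sets borel \<and> f (E n) = \<infinity>) \<and> E (Suc n) \<subseteq> E n \<and> 1 <= \<bar>\<phi> (E n - E (Suc n))\<bar>"
 proof (rule dependent_nat_choice)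
  show "\<exists>B. B \<in> sets borel \<and> f B = \<infinity>" using inf by (intro exI[of _ UNIV]) simp
  show "\<exists>B. (B \<in> sets borel \<and> f B = \<infinity>) \<and> B \<subseteq> A \<and> 1 <= \<bar>\<phi> (A - B)\<bar>"
   if "A \<in> sets borel \<and> f A = \<infinity>" for A and n :: nat using that by (rule step)
 qed
 then obtain E where E: "\<And>n. E n \<in> sets borel \<and> f (E n) = \<infinity>"
  "\<And>n. E (Suc n) \<subseteq> E n \<and> 1 <= \<bar>\<phi> (E n - E (Suc n))\<bar>"
  by blast
 define C where "C = (%n. E n - E (Suc n))"
 have dec: "E n \<subseteq> E m" if "m <= n" for m n
  using lift_Suc_antimono_le[of E m n] that E(2) by blast
 have "C m \<inter> C n = {}" if "m < n" for m n
  using dec[of "Suc m" n] that by (auto simp: C_def)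
 hence "disjoint_family C"
  unfolding disjoint_family_on_def by (metis inf_commute linorder_neqE_nat)
 moreover have "range C \<subseteq> sets borel" using E(1) by (auto simp: C_def)
 ultimately have "(%i. \<phi> (C i)) sums \<phi> (\<Union>i. C i)"
  using \<phi> unfolding signed_borel_measure_def by blast
 hence "(%i. \<phi> (C i)) \<longlonglongrightarrow> 0" by (intro summable_LIMSEQ_zero sums_summable)
 hence "eventually (%i. \<bar>\<phi> (C i)\<bar> < 1) sequentially"
  using order_tendstoD(2)[OF tendsto_rabs_zero, of _ sequentially 1] by simp
 thus False using E(2) by (auto simp: C_def eventually_sequentially) (meson not_less order_refl)
qed

section \<open>Delay kernels\<close>

lemma LINT_singleton: "(LINT s:{c}|lborel. f s) = (0 :: real)" for c :: real
 unfolding set_lebesgue_integral_def using AE_lborel_singleton[of c]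
 by (intro integral_eq_zero_AE) (auto elim!: eventually_mono)

lemma exp_integral:
 fixes R :: real
 assumes "a <= b" shows "has_bochner_integral lborel (%s. indicator {a..b} s * (R * exp (- R * s))) (exp (- R * a) - exp (- R * b))"
proof -
 have "has_bochner_integral lborel (%s. indicator {a..b} s *\<^sub>R (R * exp (- R * s))) (- exp (- R * b) - (- exp (- R * a)))"
  by (rule has_bochner_integral_FTC_Icc[OF assms])
   (auto intro!: derivative_eq_intros continuous_intros simp: has_real_derivative_iff_has_vector_derivative[symmetric])
 thus ?thesis by simp
qed

lemma set_integrable_exp_mult:
 fixes g :: "real => real"
 assumes g: "set_integrable lborel {0..T} g"
 shows "set_integrable lborel {0..T} (%s. exp (- R * s) * g s)"
proof -
 let ?a = "%s. indicator {0..T} s *\<^sub>R g s"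
 have e: "indicator {0..T} s *\<^sub>R (exp (- R * s) * g s) = exp (- R * s) * (indicator {0..T} s *\<^sub>R g s)" for s by simp
 have i: "integrable lborel ?a" using g unfolding set_integrable_def .
 have m [measurable]: "?a \<in> borel_measurable borel"
  using borel_measurable_integrable[OF i] by simp
 have le: "exp (- R * s) <= exp (\<bar>R\<bar> * T)" if "0 <= s" "s <= T" for s
  using mult_mono[of "- R" "\<bar>R\<bar>" s T] that by simp
 show ?thesis unfolding set_integrable_def e
 proof (rule Bochner_Integration.integrable_bound[OF integrable_mult_right[OF i, of "exp (\<bar>R\<bar> * T)"]])
  show "(%s. exp (- R * s) * (indicator {0..T} s *\<^sub>R g s)) \<in> borel_measurable lborel" by measurable
 qed (use le in \<open>auto simp: abs_mult indicator_def intro!: AE_I2 mult_right_mono\<close>)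
qed

lemma continuous_on_LINT:
 fixes h :: "real => real"
 assumes h: "set_integrable lborel {0..T} h"
 shows "continuous_on {0..T} (%t. LINT s:{0..t}|lborel. h s)"
proof -
 have "continuous_on {0..T} (%t. integral {0..t} h)"
  by (intro indefinite_integral_continuous_1 set_borel_integral_eq_integral(1) h)
 thus ?thesis
 proof (rule continuous_on_cong[THEN iffD1, OF refl, rotated])
  fix t assume "t \<in> {0..T}"
  thus "integral {0..t} h = (LINT s:{0..t}|lborel. h s)"
   by (intro set_borel_integral_eq_integral(2)[symmetric] set_integrable_subset[OF h]) auto
 qed
qed

text \<open>Fubini's theorem on the triangle \<open>0 \<le> u \<le> s \<le> T\<close>.\<close>

lemma discounted_primitive:
 fixes g :: "real => real"
 assumes g: "set_integrable lborel {0..T} g" and T: "0 <= T"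
 shows "(LINT s:{0..T}|lborel. R * exp (- R * s) * (LINT u:{0..s}|lborel. g u))
  = (LINT s:{0..T}|lborel. exp (- R * s) * g s) - exp (- R * T) * (LINT s:{0..T}|lborel. g s)"
proof -
 let ?a = "lborel \<Otimes>\<^sub>M lborel"
 define G' where "G' = (%u. indicator {0..T} u *\<^sub>R g u)"
 have G': "integrable lborel G'" using g unfolding set_integrable_def G'_def .
 have [measurable]: "G' \<in> borel_measurable borel" using borel_measurable_integrable[OF G'] by simp
 \<comment> \<open>The indicator of \<open>{u..}\<close> cuts out the triangle. Integrating over u
   first produces the primitive of g, integrating over s first the difference of two
   exponentials.\<close>
 define k where "k = (%s u. indicator {0..T} s * (indicator {u..} s * (R * exp (- R * s))) * G' u)"
 define c where "c = \<bar>R\<bar> * exp (\<bar>R\<bar> * T)"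
 have le: "exp (- R * s) <= exp (\<bar>R\<bar> * T)" if "0 <= s" "s <= T" for s
  using mult_mono[of "- R" "\<bar>R\<bar>" s T] that by simp
 have fin: "integrable ?a (%(s, u). indicator {0..T} s * (c * G' u))"
 proof (rule lborel_pair.Fubini_integrable)
  have e: "(LINT u|lborel. norm (case (s, u) of (s, u) => indicator {0..T} s * (c * G' u))) = indicator {0..T} s * (LINT u|lborel. \<bar>c * G' u\<bar>)" for s
   by (simp add: abs_mult)
  have "integrable lborel (%s. indicator {0..T} s * (LINT u|lborel. \<bar>c * G' u\<bar>))"
   by (intro integrable_mult_left integrable_real_indicator) (auto simp: emeasure_lborel_Icc_eq)
  thus "integrable lborel (%s. LINT u|lborel. norm (case (s, u) of (s, u) => indicator {0..T} s * (c * G' u)))" unfolding e .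
  show "AE s in lborel. integrable lborel (%u. case (s, u) of (s, u) => indicator {0..T} s * (c * G' u))" using G' by simp
 qed measurable
 have km: "(%(s, u). k s u) \<in> borel_measurable ?a"
 proof -
  have "(%(s, u). indicator {0..T} s * ((if u <= s then 1 else 0) * (R * exp (- R * s))) * G' u) \<in> borel_measurable ?a"
   by measurable
  thus ?thesis by (rule measurable_cong[THEN iffD1, rotated]) (auto simp: k_def indicator_def)
 qed
 have ki: "integrable ?a (%(s, u). k s u)"
 proof (rule Bochner_Integration.integrable_bound[OF fin km], rule AE_I2)
  fix x :: "real \<times> real"
  show "norm (case x of (s, u) => k s u) <= norm (case x of (s, u) => indicator {0..T} s * (c * G' u))"
   using le by (cases x) (auto simp: k_def c_def indicator_def abs_mult intro!: mult_right_mono mult_left_mono)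
 qed
 have in1: "(LINT u|lborel. k s u) = indicator {0..T} s * (R * exp (- R * s) * (LINT u:{0..s}|lborel. g u))" for s
 proof (cases "s \<in> {0..T}")
  case True
  hence "k s u = R * exp (- R * s) * (indicator {0..s} u *\<^sub>R g u)" for u by (auto simp: k_def G'_def indicator_def)
  thus ?thesis using True by (simp add: set_lebesgue_integral_def)
 qed (simp add: k_def)
 have in2: "(LINT s|lborel. k s u) = indicator {0..T} u * (exp (- R * u) * g u - exp (- R * T) * g u)" for u
 proof (cases "u \<in> {0..T}")
  case True
  hence "k s u = indicator {u..T} s * (R * exp (- R * s)) * g u" for s by (auto simp: k_def G'_def indicator_def)
  thus ?thesis using has_bochner_integral_integral_eq[OF exp_integral[of u T R]] True by (simp add: left_diff_distrib)
 qed (simp add: k_def G'_def)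
 have "(LINT s|lborel. (LINT u|lborel. k s u)) = (LINT u|lborel. (LINT s|lborel. k s u))"
  by (rule lborel_pair.Fubini_integral[symmetric]) (rule ki)
 hence "(LINT s:{0..T}|lborel. R * exp (- R * s) * (LINT u:{0..s}|lborel. g u)) = (LINT u:{0..T}|lborel. exp (- R * u) * g u - exp (- R * T) * g u)"
  unfolding in1 in2 set_lebesgue_integral_def by simp
 also have "... = (LINT s:{0..T}|lborel. exp (- R * s) * g s) - exp (- R * T) * (LINT s:{0..T}|lborel. g s)"
  using set_integral_diff(2)[OF set_integrable_exp_mult[OF g], of "%s. exp (- R * T) * g s"] g by simp
 finally show ?thesis .
qed

text \<open>One of the two finite measures of the Jordan decomposition, to which Fubini's theorem
  applies. With \<open>0 <= R\<close> the weights \<open>exp (- R * u)\<close> stay below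
  \<open>exp (R * d)\<close> for u at least -d.\<close>

locale delay_window = finite_measure \<mu> for \<mu> :: "real measure" +
 fixes d R :: real
 assumes sets_mu [simp, measurable_cong]: "sets \<mu> = sets borel" and d: "0 < d" and R: "0 <= R"
begin

lemma space_mu [simp]: "space \<mu> = UNIV"
 using sets_eq_imp_space_eq[OF sets_mu] by simp

sublocale P: pair_sigma_finite lborel \<mu> ..

definition primitive :: "(real => real) => real => real" where
 "primitive y t = (LINT u:{-d..t}|lborel. exp (- R * u) * y u)"

definition kernel :: "real => real" where
 "kernel s = (LINT \<tau>:{-d..s}|\<mu>. exp (- R * (s - \<tau>)))"

text \<open>The shape that the integral of \<open>kernel\<close> against the past takes after
  Fubini. Here y enters through its discounted primitive, so it can be differentiated in time
  without continuity of y.\<close>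

definition delayed :: "(real => real) => real => real" where
 "delayed y t = (LINT \<tau>:{-d..0}|\<mu>. exp (R * (t + \<tau>)) * (primitive y t - primitive y (t + \<tau>)))"

definition delay_drift :: "(real => real) => real => real" where
 "delay_drift z t = (LINT s:{-d..0}|\<mu>. z (t + s))"

lemma integrable_lift:
 assumes [measurable]: "integrable lborel (f :: real => real)"
 shows "integrable (lborel \<Otimes>\<^sub>M \<mu>) (%(s, \<tau>). f s)"
 by (rule P.Fubini_integrable) (use assms in \<open>auto simp: case_prod_beta\<close>)

lemma integrable_weighted:
 assumes y: "integrable lborel y"
 shows "integrable lborel (%u. indicator {-d..t} u *\<^sub>R (exp (- R * u) * y u))"
proof (rule Bochner_Integration.integrable_bound)
 show "integrable lborel (%u. exp (R * d) * y u)" using y by simp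
 have "exp (- R * u) <= exp (R * d)" if "-d <= u" for u
  using mult_left_mono[OF that R] by simp
 thus "AE u in lborel. norm (indicator {-d..t} u *\<^sub>R (exp (- R * u) * y u)) <= norm (exp (R * d) * y u)"
  by (intro AE_I2) (auto simp: indicator_def abs_mult intro!: mult_right_mono)
qed (use y in auto)

lemma primitive_bound:
 assumes y: "integrable lborel y"
 shows "\<bar>primitive y t\<bar> <= exp (R * d) * (LINT u|lborel. \<bar>y u\<bar>)"
proof -
 have 1: "exp (- R * u) <= exp (R * d)" if "-d <= u" for u
  using mult_left_mono[OF that R] by simp
 have "\<bar>primitive y t\<bar> <= (LINT u|lborel. \<bar>indicator {-d..t} u *\<^sub>R (exp (- R * u) * y u)\<bar>)"
  unfolding primitive_def set_lebesgue_integral_def by (rule integral_abs_bound)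
 also have "... <= (LINT u|lborel. exp (R * d) * \<bar>y u\<bar>)"
 proof (rule integral_mono)
  show "integrable lborel (%u. \<bar>indicator {-d..t} u *\<^sub>R (exp (- R * u) * y u)\<bar>)"
   by (intro integrable_abs integrable_weighted[OF y])
  show "integrable lborel (%u. exp (R * d) * \<bar>y u\<bar>)" using y by simp
 qed (use 1 in \<open>auto simp: indicator_def abs_mult intro!: mult_right_mono\<close>)
 finally show ?thesis by simp
qed

lemma borel_measurable_primitive [measurable]:
 assumes [measurable]: "y \<in> borel_measurable borel"
 shows "primitive y \<in> borel_measurable borel"
proof -
 have "(%t. LINT u|lborel. indicator {u. -d <= u \<and> u <= t} u *\<^sub>R (exp (- R * u) * y u)) \<in> borel_measurable borel"
  by measurable
 moreover have "{u. -d <= u \<and> u <= t} = {-d..t}" for t by auto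
 ultimately show ?thesis unfolding primitive_def[abs_def] set_lebesgue_integral_def by simp
qed

lemma delayed_integrand_bound:
 assumes y: "integrable lborel y" and "t <= T" "q <= 0"
 shows "\<bar>exp (R * (t + q)) * (primitive y t - primitive y (t + q))\<bar>
  <= 2 * exp (R * T) * exp (R * d) * (LINT u|lborel. \<bar>y u\<bar>)"
proof -
 let ?a = "exp (R * d) * (LINT u|lborel. \<bar>y u\<bar>)"
 have "\<bar>primitive y t - primitive y (t + q)\<bar> <= 2 * ?a"
  using primitive_bound[OF y, of t] primitive_bound[OF y, of "t + q"] by linarith
 moreover have "exp (R * (t + q)) <= exp (R * T)" using assms R by (auto intro: mult_left_mono)
 ultimately have "exp (R * (t + q)) * \<bar>primitive y t - primitive y (t + q)\<bar>
   <= exp (R * T) * (2 * ?a)"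
  by (intro mult_mono) auto
 thus ?thesis by (simp add: abs_mult mult_ac)
qed

lemma integrable_delayed_integrand:
 assumes y: "integrable lborel y"
 shows "integrable \<mu> (%q. indicator {-d..0} q *\<^sub>R (exp (R * (t + q)) * (primitive y t - primitive y (t + q))))"
proof (rule integrable_const_bound)
 show "AE q in \<mu>. norm (indicator {-d..0} q *\<^sub>R (exp (R * (t + q)) * (primitive y t - primitive y (t + q))))
   <= 2 * exp (R * t) * exp (R * d) * (LINT u|lborel. \<bar>y u\<bar>)"
  using delayed_integrand_bound[OF y order_refl, of _ t] by (intro AE_I2) (auto simp: indicator_def)
 have [measurable]: "y \<in> borel_measurable borel" using y by auto
 show "(%q. indicator {-d..0} q *\<^sub>R (exp (R * (t + q)) * (primitive y t - primitive y (t + q)))) \<in> borel_measurable \<mu>"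
  by measurable
qed

lemma borel_measurable_kernel [measurable]: "kernel \<in> borel_measurable borel"
proof -
 have "(%s. LINT q|\<mu>. indicator {q. -d <= q \<and> q <= s} q *\<^sub>R exp (- R * (s - q))) \<in> borel_measurable borel"
  by measurable
 moreover have "{q. -d <= q \<and> q <= s} = {-d..s}" for s by auto
 ultimately show ?thesis unfolding kernel_def[abs_def] set_lebesgue_integral_def by simp
qed

lemma integrable_kernel_integrand:
 "integrable \<mu> (%q. indicator {-d..s} q *\<^sub>R exp (- R * (s - q)))"
 using R by (intro integrable_const_bound[where B = 1] AE_I2) (auto simp: indicator_def)

lemma kernel_bound: "\<bar>kernel s\<bar> <= measure \<mu> UNIV"
proof -
 have "\<bar>kernel s\<bar> <= (LINT q|\<mu>. \<bar>indicator {-d..s} q *\<^sub>R exp (- R * (s - q))\<bar>)"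
  unfolding kernel_def set_lebesgue_integral_def by (rule integral_abs_bound)
 also have "... <= (LINT q|\<mu>. 1)"
  using R integrable_kernel_integrand[of s] by (intro integral_mono integrable_abs) (auto simp: indicator_def)
 finally show ?thesis by simp
qed

text \<open>Fubini exchanges s with the point r of the measure. For fixed r the substitution u = t +
  s leaves a weighted integral of y between t + r and t; it is a difference of primitives because t
  + r is at least -d when t is nonnegative.\<close>

lemma kernel_integral:
 assumes y: "integrable lborel y" and t: "0 <= t"
 shows "(LINT s:{-d..<0}|lborel. kernel s * y (t + s)) = delayed y t"
  and "set_integrable lborel {-d..<0} (%s. kernel s * y (t + s))"
proof -
 let ?a = "%u r. indicator {-d..t} u *\<^sub>R (exp (- R * u) * y u) - indicator {-d..t + r} u *\<^sub>R (exp (- R * u) * y u)"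
 have [measurable]: "y \<in> borel_measurable borel" using y by auto
 have ys: "integrable lborel (%s. y (t + s))"
  using lborel_integrable_real_affine[OF y, of 1 t] by simp
 define \<Phi> where "\<Phi> = (%s r. (if -d <= r \<and> r <= s \<and> s < 0 then exp (- R * (s - r)) * y (t + s) else 0))"
 have \<Phi>: "integrable (lborel \<Otimes>\<^sub>M \<mu>) (case_prod \<Phi>)"
 proof (rule Bochner_Integration.integrable_bound[OF integrable_lift[OF ys]])
  show "case_prod \<Phi> \<in> borel_measurable (lborel \<Otimes>\<^sub>M \<mu>)" unfolding \<Phi>_def by measurable
  show "AE x in lborel \<Otimes>\<^sub>M \<mu>. norm (case_prod \<Phi> x) <= norm (case x of (s, r) => y (t + s))"
   using R by (intro AE_I2) (auto simp: \<Phi>_def abs_mult mult_le_cancel_right1 intro!: mult_left_le_one_le)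
 qed
 show "set_integrable lborel {-d..<0} (%s. kernel s * y (t + s))"
  unfolding set_integrable_def
 proof (rule Bochner_Integration.integrable_bound)
  show "integrable lborel (%s. measure \<mu> UNIV * y (t + s))" using ys by simp
  show "AE s in lborel. norm (indicator {-d..<0} s *\<^sub>R (kernel s * y (t + s))) <= norm (measure \<mu> UNIV * y (t + s))"
   using kernel_bound by (intro AE_I2) (auto simp: indicator_def abs_mult intro!: mult_right_mono)
 qed measurable
 have 1: "(LINT r|\<mu>. \<Phi> s r) = indicator {-d..<0} s *\<^sub>R (kernel s * y (t + s))" for s
 proof -
  have "(LINT r|\<mu>. \<Phi> s r) = (LINT r|\<mu>. (indicator {-d..s} r *\<^sub>R exp (- R * (s - r))) * (indicator {-d..<0} s * y (t + s)))"
   by (intro Bochner_Integration.integral_cong) (auto simp: \<Phi>_def indicator_def)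
  thus ?thesis by (simp add: kernel_def set_lebesgue_integral_def)
 qed
 have 2: "(LINT s|lborel. \<Phi> s r) = indicator {-d..0} r *\<^sub>R (exp (R * (t + r)) * (primitive y t - primitive y (t + r)))" for r
 proof (cases "r \<in> {-d..0}")
  case True
  define q where "q = (%u. (if t + r <= u \<and> u < t then exp (- R * (u - t - r)) * y u else 0))"
  have "(LINT u|lborel. q u) = (LINT s|lborel. q (t + 1 * s))"
   by (subst lborel_integral_real_affine[of 1 q t]) auto
  also have "... = (LINT s|lborel. \<Phi> s r)"
   using True by (intro Bochner_Integration.integral_cong) (auto simp: q_def \<Phi>_def)
  also have "(LINT u|lborel. q u) = (LINT u|lborel. exp (R * (t + r)) * (?a u r))"
  proof (rule integral_cong_AE)
   \<comment> \<open>Half-open and closed intervals differ at their end points only.\<close>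
   have "AE u in lborel. u ~= t" "AE u in lborel. u ~= t + r" by (auto simp: AE_lborel_singleton)
   thus "AE u in lborel. q u = exp (R * (t + r)) * (?a u r)"
   proof eventually_elim
    case (elim u)
    have "exp (- R * (u - t - r)) = exp (R * (t + r)) * exp (- R * u)"
     by (simp add: exp_add[symmetric] algebra_simps)
    thus ?case using elim True t by (auto simp: q_def indicator_def)
   qed
  qed (auto simp: q_def)
  also have "... = exp (R * (t + r)) * (primitive y t - primitive y (t + r))"
   unfolding primitive_def set_lebesgue_integral_def
   unfolding integral_mult_right_zero
   by (subst Bochner_Integration.integral_diff[OF integrable_weighted[OF y] integrable_weighted[OF y]]) (rule refl)
  finally show ?thesis using True by simp
 next
  case False
  thus ?thesis by (auto simp: \<Phi>_def intro!: integral_zero)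
    (subst Bochner_Integration.integral_cong[of lborel lborel _ "%_. 0"], auto)
 qed
 show "(LINT s:{-d..<0}|lborel. kernel s * y (t + s)) = delayed y t"
  using P.Fubini_integral[OF \<Phi>] unfolding 1 2 by (simp add: delayed_def set_lebesgue_integral_def)
qed

end

section \<open>The memory term as a function of time, and the L2 bound of the delay integral\<close>

context delay_window
begin

lemma borel_measurable_delay_drift [measurable]:
 assumes [measurable]: "z \<in> borel_measurable borel"
 shows "delay_drift z \<in> borel_measurable borel"
 unfolding delay_drift_def[abs_def] set_lebesgue_integral_def by measurable

lemma integrable_shift:
 assumes z: "integrable lborel (z :: real => real)" shows "integrable (lborel \<Otimes>\<^sub>M \<mu>) (%(s, q). z (s + q))"
proof (rule integrableI_bounded)
 let ?a = "\<integral>\<^sup>+x. ennreal (norm (case x of (s, q) => z (s + q))) \<partial>(lborel \<Otimes>\<^sub>M \<mu>)"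
 let ?b = "\<integral>\<^sup>+q. (\<L> s. ennreal \<bar>z s\<bar>) \<partial>\<mu>"
 have [measurable]: "z \<in> borel_measurable borel" using z by auto
 show "(%(s, q). z (s + q)) \<in> borel_measurable (lborel \<Otimes>\<^sub>M \<mu>)" by measurable
 have e: "(\<L> s. ennreal \<bar>z (s + q)\<bar>) = (\<L> s. ennreal \<bar>z s\<bar>)" for q
  by (subst (2) nn_integral_real_affine[of _ 1 q]) (auto simp: add.commute)
 have "?a = ?b"
  by (subst P.nn_integral_snd[symmetric]) (auto simp: e)
 also have "?b < \<infinity>"
  using z unfolding integrable_iff_bounded by (simp add: ennreal_mult_less_top) (simp add: less_top[symmetric])
 finally show "?a < \<infinity>" .
qed

text \<open>For a merely integrable z the delay integral may diverge at some times. Fubini gives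
  convergence at almost every time, which is enough under a time integral.\<close>

lemma AE_integrable_shift:
 assumes "integrable lborel z"
 shows "AE s in lborel. integrable \<mu> (%q. indicator {-d..0} q *\<^sub>R (z (s + q) :: real))"
 using P.AE_integrable_fst'[OF integrable_shift[OF assms]]
proof eventually_elim
 case (elim s)
 thus ?case by (intro integrable_mult_indicator) auto
qed

lemma delay_drift_diff:
 assumes "integrable lborel a" "integrable lborel b"
 shows "AE s in lborel. delay_drift (%u. a u - b u) s = delay_drift a s - delay_drift b s"
 using AE_integrable_shift[OF assms(1)] AE_integrable_shift[OF assms(2)]
 by eventually_elim (simp add: delay_drift_def set_lebesgue_integral_def right_diff_distrib)

lemma primitive_increment:
 assumes z: "integrable lborel z" and q: "-d <= q" and s: "0 <= s"
 shows "primitive z (s + q) - primitive z q = (LINT u:{0..s}|lborel. exp (- R * (u + q)) * z (u + q))"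
  and "set_integrable lborel {0..s} (%u. exp (- R * (u + q)) * z (u + q))"
proof -
 define w where "w = (%u. exp (- R * u) * z u)"
 have i: "set_integrable lborel {-d..t} w" for t using integrable_weighted[OF z] unfolding set_integrable_def w_def .
 have iw: "integrable lborel (%u. indicator {q..s + q} u *\<^sub>R w u)"
  using set_integrable_subset[OF i[of "s + q"], of "{q..s + q}"] q unfolding set_integrable_def by auto
 have sh: "indicator {0..s} u *\<^sub>R w (u + q) = indicator {q..s + q} (q + 1 * u) *\<^sub>R w (q + 1 * u)" for u
  by (auto simp: indicator_def add.commute)
 from lborel_integrable_real_affine[OF iw, of 1 q] show "set_integrable lborel {0..s} (%u. exp (- R * (u + q)) * z (u + q))"
  unfolding sh[symmetric] set_integrable_def by (simp add: w_def)
 have e: "(LINT u:{0..s}|lborel. w (u + q)) = (LINT u:{q..s + q}|lborel. w u)"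
  unfolding set_lebesgue_integral_def sh by (subst lborel_integral_real_affine[of 1 "%u. indicator {q..s + q} u *\<^sub>R w u" q]) auto
 have "integral {-d..q} w + integral {q..s + q} w = integral {-d..s + q} w"
  using q s set_borel_integral_eq_integral(1)[OF i[of "s + q"]] by (intro Henstock_Kurzweil_Integration.integral_combine) auto
 moreover have "set_integrable lborel {q..s + q} w" using iw unfolding set_integrable_def .
 ultimately have "(LINT u:{-d..q}|lborel. w u) + (LINT u:{q..s + q}|lborel. w u) = (LINT u:{-d..s + q}|lborel. w u)"
  using set_borel_integral_eq_integral(2) i by metis
 thus "primitive z (s + q) - primitive z q = (LINT u:{0..s}|lborel. exp (- R * (u + q)) * z (u + q))"
  using e by (simp add: primitive_def w_def)
qed

text \<open>The coefficient of \<open>exp (R * (s + q))\<close> is the primitive of \<open>g\<close> up to a constant, so that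
 the equation is integration by parts.\<close>

lemma delayed_integrand_FTC:
 assumes z: "integrable lborel z" and q: "-d <= q" "q <= 0" and t: "0 <= t"
 defines "f \<equiv> %s. exp (R * (s + q)) * (primitive z s - primitive z (s + q))"
 shows "(LINT s:{0..t}|lborel. R * f s + exp (R * q) * z s - z (s + q)) = f t - f 0"
proof -
 let ?a = "%E. LINT s:{0..t}|lborel. R * exp (R * s) * E s"
 let ?b = "%g. LINT s:{0..t}|lborel. exp (R * s) * g s"
 define g where "g = (%u. exp (- R * u) * z u - exp (- R * (u + q)) * z (u + q))"
 define c where "c = primitive z 0 - primitive z q"
 define E where "E = (%s. LINT u:{0..s}|lborel. g u)"
 have g: "set_integrable lborel {0..t} g"
  using primitive_increment(2)[OF z _ t, of 0] primitive_increment(2)[OF z q(1) t] d unfolding g_def by (intro set_integral_diff(1)) auto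
 have fE: "f s = exp (R * q) * (exp (R * s) * (c + E s))" if "0 <= s" for s
 proof -
  have "E s = (primitive z s - primitive z 0) - (primitive z (s + q) - primitive z q)"
   using primitive_increment[OF z _ that, of 0] primitive_increment[OF z q(1) that] d unfolding E_def g_def by (simp add: set_integral_diff(2))
  thus ?thesis by (simp add: f_def c_def distrib_left exp_add mult_ac)
 qed
 have gz: "exp (R * s) * g s * exp (R * q) = exp (R * q) * z s - z (s + q)" for s
 proof -
  have "exp (R * s) * exp (- R * s) = 1" "exp (R * s) * exp (R * q) * exp (- R * (s + q)) = 1" by (simp_all add: exp_add[symmetric] algebra_simps)
  note e = this
  have "exp (R * s) * g s * exp (R * q) = (exp (R * s) * exp (- R * s)) * (exp (R * q) * z s) - (exp (R * s) * exp (R * q) * exp (- R * (s + q))) * z (s + q)"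
   by (simp only: g_def right_diff_distrib left_diff_distrib mult_ac)
  thus ?thesis unfolding e by simp
 qed
 have 1: "(?a E) = exp (R * t) * E t - (?b g)"
  using discounted_primitive[OF g t, of "- R"] by (simp add: E_def set_lebesgue_integral_def)
 have 2: "(LINT s:{0..t}|lborel. R * exp (R * s)) = exp (R * t) - 1"
  using has_bochner_integral_integral_eq[OF exp_integral[OF t, of "- R"]] unfolding set_lebesgue_integral_def by simp
 have i: "set_integrable lborel {0..t} (%s. R * exp (R * s) * c)" "set_integrable lborel {0..t} (%s. R * exp (R * s) * E s)" "set_integrable lborel {0..t} (%s. exp (R * s) * g s)"
  using continuous_on_LINT[OF g] set_integrable_exp_mult[OF g, of "- R"] unfolding E_def[symmetric]
  by (auto intro!: borel_integrable_atLeastAtMost' continuous_intros)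
 have "(LINT s:{0..t}|lborel. R * f s + exp (R * q) * z s - z (s + q))
  = (LINT s:{0..t}|lborel. exp (R * q) * ((R * exp (R * s) * c + R * exp (R * s) * E s) + exp (R * s) * g s))"
 proof (intro set_lebesgue_integral_cong allI impI)
  fix s assume "s \<in> {0..t}"
  thus "R * f s + exp (R * q) * z s - z (s + q) = exp (R * q) * ((R * exp (R * s) * c + R * exp (R * s) * E s) + exp (R * s) * g s)"
   using gz[of s] fE[of s] by (simp add: algebra_simps)
 qed simp
 also have "... = exp (R * q) * (((LINT s:{0..t}|lborel. R * exp (R * s) * c) + (?a E)) + (?b g))"
  unfolding set_integral_mult_right set_integral_add(2)[OF set_integral_add(1)[OF i(1,2)] i(3)] set_integral_add(2)[OF i(1,2)] ..
 also have "(LINT s:{0..t}|lborel. R * exp (R * s) * c) = (exp (R * t) - 1) * c" unfolding set_integral_mult_left 2 ..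
 also have "exp (R * q) * (((exp (R * t) - 1) * c + (?a E)) + (?b g)) = f t - f 0"
  unfolding 1 using fE[of 0] fE[OF t] by (simp add: E_def LINT_singleton algebra_simps)
 finally show ?thesis .
qed

text \<open>\<open>delayed_integrand_FTC\<close> is integrated against \<mu> and the order of
  integration exchanged. The inner integral agrees with g only almost everywhere, because
  \<open>delay_drift z\<close> can be split off only at times where its integrand is
  integrable.\<close>

lemma delayed_FTC:
 assumes z: "integrable lborel z" and t: "0 <= t"
 defines "g \<equiv> %s. R * delayed z s + (LINT q:{-d..0}|\<mu>. exp (R * q)) * z s - delay_drift z s"
 shows "set_integrable lborel {0..t} g" and "delayed z t - delayed z 0 = (LINT s:{0..t}|lborel. g s)"
proof -
 let ?a = "lborel \<Otimes>\<^sub>M \<mu>"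
 let ?b = "%x A. case x of (s, q) => indicator {0..t} s * A + \<bar>z s\<bar>"
 have [measurable]: "z \<in> borel_measurable borel" using z by auto
 define f where "f = (%q s. exp (R * (s + q)) * (primitive z s - primitive z (s + q)))"
 define r where "r = (%s q. indicator {0..t} s * (indicator {-d..0} q * (R * f q s + exp (R * q) * z s - z (s + q))))"
 define A where "A = R * (2 * exp (R * t) * exp (R * d) * (LINT u|lborel. \<bar>z u\<bar>))"
 have [measurable]: "(%(s, q). f q s) \<in> borel_measurable (borel \<Otimes>\<^sub>M borel)" unfolding f_def by measurable
 have f_int: "integrable \<mu> (%q. indicator {-d..0} q *\<^sub>R f q s)" for s unfolding f_def by (rule integrable_delayed_integrand[OF z])
 have e_int: "integrable \<mu> (%q. indicator {-d..0} q *\<^sub>R exp (R * q))"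
  using R by (intro integrable_const_bound[where B = 1] AE_I2) (auto simp: indicator_def mult_nonneg_nonpos)
 have bnd: "\<bar>R * f q s + exp (R * q) * z s - z (s + q)\<bar> <= A + \<bar>z s\<bar> + \<bar>z (s + q)\<bar>" if "s \<in> {0..t}" "q \<in> {-d..0}" for s q
 proof -
  have "\<bar>R * f q s\<bar> <= A" unfolding A_def f_def
   using delayed_integrand_bound[OF z, of s t q] that R by (auto simp: abs_mult intro!: mult_left_mono)
  moreover have "\<bar>exp (R * q) * z s\<bar> <= \<bar>z s\<bar>" using that R by (auto simp: abs_mult mult_nonneg_nonpos intro!: mult_left_le_one_le)
  ultimately show ?thesis by linarith
 qed
 have r: "integrable ?a (case_prod r)"
 proof (rule Bochner_Integration.integrable_bound)
  have "integrable lborel (%s. indicator {0..t} s * A + \<bar>z s\<bar>)"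
   using z by (intro Bochner_Integration.integrable_add integrable_mult_left integrable_real_indicator) (auto simp: emeasure_lborel_Icc_eq)
  from Bochner_Integration.integrable_add[OF integrable_lift[OF this] integrable_abs[OF integrable_shift[OF z]]]
  show "integrable ?a (%x. (?b x A) + \<bar>case x of (s, q) => z (s + q)\<bar>)" .
  show "case_prod r \<in> borel_measurable ?a" unfolding r_def by measurable
  show "AE x in lborel \<Otimes>\<^sub>M \<mu>. norm (case_prod r x) <= norm ((?b x A) + \<bar>case x of (s, q) => z (s + q)\<bar>)"
   using order_trans[OF bnd abs_ge_self] by (intro AE_I2) (auto simp: r_def indicator_def)
 qed
 have 1: "(LINT s|lborel. r s q) = indicator {-d..0} q *\<^sub>R f q t - indicator {-d..0} q *\<^sub>R f q 0" for q
  using delayed_integrand_FTC[OF z _ _ t, of q] by (cases "q \<in> {-d..0}") (auto simp: r_def f_def set_lebesgue_integral_def)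
 have 2: "AE s in lborel. (LINT q|\<mu>. r s q) = indicator {0..t} s *\<^sub>R g s"
  using AE_integrable_shift[OF z]
 proof eventually_elim
  case (elim s)
  have "(LINT q|\<mu>. r s q) = (LINT q|\<mu>. indicator {0..t} s * (R * (indicator {-d..0} q *\<^sub>R f q s)
    + (indicator {-d..0} q *\<^sub>R exp (R * q)) * z s - indicator {-d..0} q *\<^sub>R z (s + q)))"
   by (intro Bochner_Integration.integral_cong) (auto simp: r_def algebra_simps)
  also have "... = indicator {0..t} s * (R * (LINT q|\<mu>. indicator {-d..0} q *\<^sub>R f q s)
    + (LINT q|\<mu>. indicator {-d..0} q *\<^sub>R exp (R * q)) * z s - (LINT q|\<mu>. indicator {-d..0} q *\<^sub>R z (s + q)))"
   using f_int[of s] e_int elim by simp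
  finally show ?case by (simp add: g_def delayed_def delay_drift_def set_lebesgue_integral_def f_def)
 qed
 have gm: "(%s. indicator {0..t} s *\<^sub>R g s) \<in> borel_measurable lborel"
  unfolding g_def delayed_def delay_drift_def set_lebesgue_integral_def by measurable
 have 3: "integrable lborel (%s. LINT q|\<mu>. r s q)" using P.integrable_fst'[OF r] by simp
 thus "set_integrable lborel {0..t} g"
  unfolding set_integrable_def by (rule integrable_cong_AE_imp[OF _ gm]) (use 2 in auto)
 have "(LINT q|\<mu>. (LINT s|lborel. r s q)) = delayed z t - delayed z 0"
  unfolding 1 using f_int[of t] f_int[of 0] by (simp add: delayed_def set_lebesgue_integral_def f_def)
 moreover have "(LINT s|lborel. (LINT q|\<mu>. r s q)) = (LINT s:{0..t}|lborel. g s)"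
  unfolding set_lebesgue_integral_def by (rule integral_cong_AE[OF borel_measurable_integrable[OF 3] gm 2])
 ultimately show "delayed z t - delayed z 0 = (LINT s:{0..t}|lborel. g s)" using P.Fubini_integral[OF r] by simp
qed

text \<open>One factor of the total mass comes from Cauchy-Schwarz in \<mu>, the other from
  integrating the shifted squares over \<mu>. This continuity is what lets the delay map extend from
  continuous to square-integrable paths.\<close>

lemma delay_drift_L2:
 assumes [measurable]: "z \<in> borel_measurable borel"
 shows "nnint {0..t} (%s. esq (delay_drift z s))
  <= esq (measure \<mu> UNIV) * nnint {-d..t} (%u. esq (z u))"
proof -
 let ?a = "%s. \<integral>\<^sup>+r. esq (z (s + r)) * indicator {-d..0} r * indicator {0..t} s \<partial>\<mu>"
 let ?b = "%s r. \<L> s. esq (z (s + r)) * indicator {-d..0} r * indicator {0..t} s"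
 let ?c = "%u. esq (z u)"
 let ?d = "%s. \<integral>\<^sup>+r. esq (z (s + r)) * indicator {-d..0} r \<partial>\<mu>"
 let ?e = "%q. \<integral>\<^sup>+r. (ennreal \<bar>q r\<bar>)^2 \<partial>\<mu>"
 let ?f = "%q. \<integral>\<^sup>+r. ennreal \<bar>q r\<bar> * 1 \<partial>\<mu>"
 let ?g = "nnint {0..t} (%s. esq (delay_drift z s))"
 have pt: "esq (delay_drift z s) <= emeasure \<mu> UNIV * (?d s)" for s
 proof -
  define q where "q = (%r. indicator {-d..0} r *\<^sub>R z (s + r))"
  have [measurable]: "q \<in> borel_measurable \<mu>" unfolding q_def by measurable
  have "ennreal \<bar>LINT r|\<mu>. q r\<bar> <= (?f q)"
  \<comment> \<open>A divergent integral has the value 0 by convention, and the bound is then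
    trivial.\<close>
  proof (cases "integrable \<mu> q")
   case True
   thus ?thesis using integral_norm_bound_ennreal[OF True] by simp
  qed (simp add: not_integrable_integral_eq)
  hence "(ennreal \<bar>LINT r|\<mu>. q r\<bar>)^2 <= (?f q)^2" by (rule power_mono) simp
  also have "... <= (?e q) * (\<integral>\<^sup>+r. 1^2 \<partial>\<mu>)"
   by (rule Cauchy_Schwarz_nn_integral) auto
  also have "(?e q) = (?d s)"
   by (intro nn_integral_cong) (auto simp: q_def indicator_def ennreal_power)
  finally show ?thesis
   by (simp add: delay_drift_def set_lebesgue_integral_def q_def ennreal_power mult.commute)
 qed
 have "?g
   <= (\<L> s. emeasure \<mu> UNIV * (?a s))"
  using pt by (intro nn_integral_mono) (auto simp: indicator_def)
 also have "... = emeasure \<mu> UNIV * (\<L> s. (?a s))"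
  by (intro nn_integral_cmult) measurable
 also have "(\<L> s. (?a s))
   = (\<integral>\<^sup>+r. (?b s r) \<partial>\<mu>)"
  by (rule P.Fubini'[symmetric]) measurable
 also have "... <= (\<integral>\<^sup>+r. nnint {-d..t} ?c \<partial>\<mu>)"
 proof (rule nn_integral_mono)
  fix r
  have "nnint {-d..t} ?c = (\<L> s. esq (z (r + 1 * s)) * indicator {-d..t} (r + 1 * s))"
   by (subst nn_integral_real_affine[of _ 1 r]) auto
  also have "... \<ge> (?b s r)"
   by (intro nn_integral_mono) (auto simp: indicator_def add.commute)
  finally show "(?b s r)
    <= nnint {-d..t} ?c" .
 qed
 also have "... = nnint {-d..t} ?c * emeasure \<mu> UNIV" by simp
 finally have "?g
   <= emeasure \<mu> UNIV * (nnint {-d..t} ?c * emeasure \<mu> UNIV)"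
  by (simp add: mult_left_mono)
 thus ?thesis
  by (simp add: emeasure_eq_measure ennreal_mult power2_eq_square mult_ac)
qed

end

lemma continuous_on_halfline:
 fixes f :: "real => 'b::topological_space"
 assumes "\<And>T. a <= T ==> continuous_on {a..T} f"
 shows "continuous_on {a..} f"
 unfolding continuous_on_eq_continuous_within
proof
 fix x assume x: "x \<in> {a..}"
 have "(at x within {a..x+1}) = (at x within {a..})"
  by (rule at_within_nhd[of x "{..<x+1}"]) auto
 moreover have "continuous (at x within {a..x+1}) f"
  using assms[of "x+1"] x unfolding continuous_on_eq_continuous_within by auto
 ultimately show "continuous (at x within {a..}) f" by (simp add: continuous_within)
qed

lemma sq_tendsto_ennreal_zero:
 fixes u :: "nat => ennreal"
 assumes v: "v \<longlonglongrightarrow> 0" and c: "c < \<top>" and le: "\<And>k. (u k)^2 <= v k * c"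
 shows "u \<longlonglongrightarrow> 0"
proof (rule order_tendstoI)
 fix a :: ennreal assume a: "0 < a"
 have "(%k. c * v k) \<longlonglongrightarrow> c * 0" using c v by (intro ennreal_tendsto_cmult) auto
 moreover have "0 < a^2" using a by (simp add: power2_eq_square ennreal_zero_less_mult_iff)
 ultimately have "\<forall>\<^sub>F k in sequentially. c * v k < a^2" by (auto dest!: order_tendstoD(2))
 thus "\<forall>\<^sub>F k in sequentially. u k < a"
 proof eventually_elim
  case (elim k)
  hence "(u k)^2 < a^2" using le[of k] by (simp add: mult.commute)
  thus ?case by (meson leI not_less power_mono zero_le)
 qed
qed simp

lemma set_integrable_of_square:
 fixes y :: "real => real"
 assumes m: "set_borel_measurable lborel {a..b} y"
  and fin: "nnint {a..b} (%s. esq (y s)) < \<infinity>"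
 shows "set_integrable lborel {a..b} y"
 unfolding set_integrable_def
proof (rule integrableI_bounded)
 let ?a = "%s. indicator {a..b} s *\<^sub>R y s"
 show [measurable]: "(%s. indicator {a..b} s *\<^sub>R y s) \<in> borel_measurable lborel"
  using m unfolding set_borel_measurable_def .
 have "(\<L> s. ennreal (norm (?a s)))
   <= (\<L> s. indicator {a..b} s + esq (?a s))"
 proof (rule nn_integral_mono)
  fix s
  have "\<bar>y s\<bar> <= 1 + (y s)^2"
   using sum_squares_bound[of "\<bar>y s\<bar>" 1] abs_ge_zero[of "y s"] by simp
  thus "ennreal (norm (?a s)) <= indicator {a..b} s + esq (?a s)"
   by (auto simp: indicator_def ennreal_plus[symmetric] ennreal_1[symmetric] simp del: ennreal_plus ennreal_1 intro!: ennreal_leI)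
 qed
 also have "... = emeasure lborel {a..b} + nnint {a..b} (%s. esq (y s))"
 proof -
  have "(%s. esq (?a s)) \<in> borel_measurable lborel" by measurable
  from nn_integral_add[OF _ this, of "indicator {a..b}"] show ?thesis
   by (auto intro!: nn_integral_cong simp: indicator_def)
 qed
 also have "... < \<infinity>" using fin by (simp add: emeasure_lborel_Icc_eq)
 finally show "(\<L> s. ennreal (norm (?a s))) < \<infinity>" .
qed

section \<open>The signed measure as a difference of two finite measures\<close>

definition delay_const :: "(real set => real) => real" where
 "delay_const \<phi> = 2 * ((measure (positive_variation \<phi>) UNIV)^2 + (measure (negative_variation \<phi>) UNIV)^2)"

locale signed_delay =
 fixes \<phi> :: "real set => real" and d R :: real
 assumes \<phi>: "\<phi> \<in> radon_measures_no_atom d" and d: "0 < d" and R: "0 <= R"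
begin

lemma signed: "signed_borel_measure \<phi>"
 using \<phi> by (simp add: radon_measures_no_atom_def)

sublocale P: delay_window "positive_variation \<phi>" d R
 using finite_positive_variation[OF signed] d R
 by (auto simp: delay_window_def delay_window_axioms_def)

sublocale N: delay_window "negative_variation \<phi>" d R
 using finite_positive_variation[OF signed_borel_measure_uminus[OF signed]] d R
 by (auto simp: delay_window_def delay_window_axioms_def negative_variation_def)

text \<open>With R the sum of the interest and mortality rates, this is \<open>h_inf\<close> without
  its factor \<open>g_inf\<close>. Likewise \<open>mass\<close> is \<open>beta_inf\<close>, and
  \<open>memory\<close> is the share of the past in total wealth, again without the factor
  \<open>g_inf\<close>.\<close>

definition signed_kernel :: "real => real" where
 "signed_kernel s = signed_integral \<phi> {-d..s} (%\<tau>. exp (- R * (s - \<tau>)))"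

definition mass :: real where
 "mass = signed_integral \<phi> {-d..0} (%s. exp (R * s))"

definition memory :: "(real => real) => real => real" where
 "memory y t = (LINT s:{-d..<0}|lborel. signed_kernel s * y (t + s))"

lemma signed_kernel_eq: "signed_kernel s = P.kernel s - N.kernel s"
 by (simp add: signed_kernel_def signed_integral_def P.kernel_def N.kernel_def)

lemma borel_measurable_signed_kernel [measurable]: "signed_kernel \<in> borel_measurable borel"
 unfolding signed_kernel_eq[abs_def] by measurable

text \<open>The formulas for a single measure ask for a function that is integrable on the whole
  line, so the path is cut off at the horizon T; values at times up to T are not affected.\<close>

lemma memory_eq:
 assumes y: "set_integrable lborel {-d..T} y" and t: "0 <= t" "t <= T"
 shows "memory y t = P.delayed (%u. indicator {-d..T} u * y u) t - N.delayed (%u. indicator {-d..T} u * y u) t"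
proof -
 define z where "z = (%u. indicator {-d..T} u * y u)"
 have z: "integrable lborel z" using y by (simp add: set_integrable_def z_def)
 have "memory y t = (LINT s:{-d..<0}|lborel. P.kernel s * z (t + s) - N.kernel s * z (t + s))"
  unfolding memory_def
  by (rule set_lebesgue_integral_cong) (use t in \<open>auto simp: signed_kernel_eq z_def algebra_simps\<close>)
 also have "... = P.delayed z t - N.delayed z t"
  using P.kernel_integral[OF z t(1)] N.kernel_integral[OF z t(1)] by (simp add: set_integral_diff(2))
 finally show ?thesis unfolding z_def .
qed

definition signed_drift :: "(real => real) => real => real" where
 "signed_drift z s = P.delay_drift z s - N.delay_drift z s"

lemma memory_increment:
 assumes y: "set_integrable lborel {-d..T} y" and t: "0 <= t" "t <= T"
 defines "g \<equiv> %s. R * memory y s + mass * y s - signed_drift (%u. indicator {-d..T} u * y u) s"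
 shows "set_integrable lborel {0..t} g" and "memory y t - memory y 0 = (LINT s:{0..t}|lborel. g s)"
proof -
 let ?a = "LINT q:{-d..0}|positive_variation \<phi>. exp (R * q)"
 let ?b = "LINT q:{-d..0}|negative_variation \<phi>. exp (R * q)"
 define z where "z = (%u. indicator {-d..T} u * y u)"
 have z: "integrable lborel z" using y by (simp add: set_integrable_def z_def)
 note i = set_integral_diff[OF P.delayed_FTC(1)[OF z t(1)] N.delayed_FTC(1)[OF z t(1)]]
 have m: "mass = ?a - ?b"
  by (simp add: mass_def signed_integral_def)
 have e: "(R * P.delayed z s + ?a * z s - P.delay_drift z s)
  - (R * N.delayed z s + ?b * z s - N.delay_drift z s) = g s" if "s \<in> {0..t}" for s
 proof -
  have me: "memory y s = P.delayed z s - N.delayed z s" and ys: "y s = z s" using memory_eq[OF y, of s] that t d unfolding z_def by auto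
  show ?thesis unfolding g_def me m signed_drift_def z_def[symmetric] ys by (simp add: algebra_simps)
 qed
 show "set_integrable lborel {0..t} g" using i(1) by (subst set_integrable_cong[OF refl refl e[symmetric]])
 have "memory y t - memory y 0 = (P.delayed z t - P.delayed z 0) - (N.delayed z t - N.delayed z 0)"
  using memory_eq[OF y] t unfolding z_def by simp
 also have "... = (LINT s:{0..t}|lborel. g s)"
  unfolding P.delayed_FTC(2)[OF z t(1)] N.delayed_FTC(2)[OF z t(1)] i(2)[symmetric] by (intro set_lebesgue_integral_cong) (auto simp: e)
 finally show "memory y t - memory y 0 = (LINT s:{0..t}|lborel. g s)" .
qed

lemma continuous_on_memory:
 assumes y: "\<And>T. 0 <= T ==> set_integrable lborel {-d..T} y"
 shows "continuous_on {0..} (memory y)"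
proof (rule continuous_on_halfline)
 let ?a = "%t T. LINT s:{0..t}|lborel. R * memory y s + mass * y s - signed_drift (%u. indicator {-d..T} u * y u) s"
 fix T :: real assume T: "0 <= T"
 note i = memory_increment[OF y[OF T]]
 have "continuous_on {0..T} (%t. memory y 0 + (?a t T))"
  by (intro continuous_intros continuous_on_LINT i(1) T) auto
 thus "continuous_on {0..T} (memory y)"
 proof (rule continuous_on_eq)
  fix t assume "t \<in> {0..T}"
  thus "memory y 0 + (?a t T) = memory y t"
   using i(2)[of t] by simp
 qed
qed

text \<open>The factor 2 in \<open>delay_const\<close> comes from (a - b)^2 <= 2 a^2 + 2 b^2,
  applied to the contributions of the two variations.\<close>

lemma signed_drift_L2:
 assumes "z \<in> borel_measurable borel"
 shows "nnint {0..t} (%s. esq (signed_drift z s)) <= ennreal (delay_const \<phi>) * nnint {-d..t} (%u. esq (z u))"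
proof -
 let ?a = "%u. esq (z u)"
 note [measurable] = P.borel_measurable_delay_drift[OF assms] N.borel_measurable_delay_drift[OF assms]
 have "esq (signed_drift z s) <= 2 * esq (P.delay_drift z s) + 2 * esq (N.delay_drift z s)" for s
 proof -
  have "(signed_drift z s)^2 <= 2 * (P.delay_drift z s)^2 + 2 * (N.delay_drift z s)^2"
   using sum_squares_bound[of "P.delay_drift z s" "- N.delay_drift z s"] by (simp add: signed_drift_def power2_diff)
  from ennreal_leI[OF this] show ?thesis by (simp add: ennreal_plus ennreal_mult)
 qed
 hence "nnint {0..t} (%s. esq (signed_drift z s))
  <= (\<L> s. 2 * (esq (P.delay_drift z s) * indicator {0..t} s) + 2 * (esq (N.delay_drift z s) * indicator {0..t} s))"
  by (intro nn_integral_mono) (auto simp: indicator_def)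
 also have "... = 2 * nnint {0..t} (%s. esq (P.delay_drift z s)) + 2 * nnint {0..t} (%s. esq (N.delay_drift z s))"
  by (simp add: nn_integral_add nn_integral_cmult)
 also have "... <= 2 * (esq (measure (positive_variation \<phi>) UNIV) * nnint {-d..t} ?a)
  + 2 * (esq (measure (negative_variation \<phi>) UNIV) * nnint {-d..t} ?a)"
  by (intro add_mono mult_left_mono P.delay_drift_L2 N.delay_drift_L2 assms) auto
 also have "... = ennreal (delay_const \<phi>) * nnint {-d..t} ?a"
  by (simp add: delay_const_def ennreal_mult ennreal_plus distrib_left distrib_right mult.assoc)
 finally show ?thesis .
qed

text \<open>\<open>delay_term\<close> presents D as an L2 limit of delay integrals of continuous
  paths. By \<open>signed_drift_L2\<close> the same integrals converge to
  \<open>signed_drift\<close> of the path cut off at T, so both limits agree almost everywhere on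
  \<open>{0..T}\<close>. The claims for D are then those for \<open>signed_drift\<close>.\<close>

theorem delay_term_identity:
 assumes ym: "set_borel_measurable lborel {-d..T} y"
  and y2: "nnint {-d..T} (%s. esq (y s)) < \<infinity>"
  and D: "delay_term \<phi> d y D" and T: "0 < T" and t: "0 <= t" "t <= T"
 shows "memory y t - memory y 0 = (LINT s:{0..t}|lborel. R * memory y s + mass * y s - D s)"
  and "set_integrable lborel {0..t} (%s. R * memory y s + mass * y s - D s)"
  and "nnint {0..t} (%s. esq (D s))
   <= ennreal (delay_const \<phi>) * nnint {-d..t} (%s. esq (y s))"
  and "(%s. indicator {0..t} s *\<^sub>R D s) \<in> borel_measurable borel"
proof -
 let ?a = "borel_measurable borel"
 let ?b = "delay_const \<phi>"
 let ?c = "borel_measurable lborel"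
 let ?d = "%h zs k. %u. h (zs k) u - h y u"
 let ?e = "%s. R * memory y s + mass * y s - D s"
 obtain zs where zs: "\<And>k. continuous_on {-d..T} (zs k)" "tendsto_L2_on {-d..T} zs y"
  "tendsto_L2_on {0..T} (%k t. signed_integral \<phi> {-d..0} (%s. zs k (t + s))) D"
  using D T unfolding delay_term_def by blast
 define h where "h = (%y u::real. indicator {-d..T} u * (y u :: real))"
 define Dk where "Dk = (%k s. signed_integral \<phi> {-d..0} (%u. zs k (s + u)))"
 have yint: "set_integrable lborel {-d..T} y" by (rule set_integrable_of_square[OF ym y2])
 have hy: "integrable lborel (h y)" using yint by (simp add: set_integrable_def h_def)
 have hz: "integrable lborel (h (zs k))" for k using borel_integrable_atLeastAtMost'[OF zs(1)[of k]] by (simp add: set_integrable_def h_def)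
 have hm: "h y \<in> ?a" "(?d h zs k) \<in> ?a" for k using hz[of k] hy by auto
 have [measurable]: "signed_drift z \<in> ?a" if "z \<in> ?a" for z
  unfolding signed_drift_def[abs_def] using P.borel_measurable_delay_drift[OF that] N.borel_measurable_delay_drift[OF that] by measurable
 have Dk_eq: "Dk k s = signed_drift (h (zs k)) s" if "0 <= s" "s <= T" for k s
 proof -
  have "(LINT u:{-d..0}|M. zs k (s + u)) = (LINT u:{-d..0}|M. h (zs k) (s + u))" if "sets M = sets borel" for M :: "real measure"
   using that \<open>0 \<le> s\<close> \<open>s \<le> T\<close> by (intro set_lebesgue_integral_cong) (auto simp: h_def)
  thus ?thesis by (simp add: Dk_def signed_drift_def signed_integral_def P.delay_drift_def N.delay_drift_def)
 qed
 define A where "A = (%k. nnint {0..T} (%s. esq (Dk k s - D s)))"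
 define E where "E = (%k. nnint {-d..T} (%s. esq (h (zs k) s - h y s)))"
 have A: "A \<longlonglongrightarrow> 0" using zs(3) unfolding A_def Dk_def tendsto_L2_on_def by blast
 have "E = (%k. nnint {-d..T} (%s. esq (zs k s - y s)))" unfolding E_def by (intro ext nn_integral_cong) (auto simp: h_def indicator_def)
 hence E: "E \<longlonglongrightarrow> 0" using zs(2) unfolding tendsto_L2_on_def by simp
 have Dm: "(%s. indicator {0..T} s *\<^sub>R D s) \<in> ?a"
  using zs(3) unfolding tendsto_L2_on_def set_borel_measurable_def by simp
 \<comment> \<open>The difference of the two limits. Its squared L2 norm is bounded by the distances
   of the k-th approximant to both, for every k, and is therefore 0.\<close>
 define q where "q = (%s. indicator {0..T} s *\<^sub>R D s - indicator {0..T} s *\<^sub>R signed_drift (h y) s)"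
 have qm [measurable]: "q \<in> ?a" unfolding q_def using Dm hm(1) by measurable
 have "(\<L> s. esq (q s)) <= 2 * A k + 2 * (ennreal ?b * E k)" for k
 proof -
  have Am: "(%s. esq (Dk k s - D s) * indicator {0..T} s) \<in> ?c"
  proof -
   note [measurable] = Dm
   have [measurable]: "h (zs k) \<in> ?a" using hz[of k] by auto
   have "(%s. esq (signed_drift (h (zs k)) s - indicator {0..T} s *\<^sub>R D s) * indicator {0..T} s) \<in> ?c" by measurable
   thus ?thesis by (rule measurable_cong[THEN iffD1, rotated]) (auto simp: Dk_eq indicator_def)
  qed
  have "(\<L> s. esq (q s)) <= (\<L> s. 2 * (esq (Dk k s - D s) * indicator {0..T} s)
   + 2 * (esq (signed_drift (?d h zs k) s) * indicator {0..T} s))"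
  proof (rule nn_integral_mono_AE)
   show "AE s in lborel. esq (q s) <= 2 * (esq (Dk k s - D s) * indicator {0..T} s)
    + 2 * (esq (signed_drift (?d h zs k) s) * indicator {0..T} s)"
    using P.delay_drift_diff[OF hz[of k] hy] N.delay_drift_diff[OF hz[of k] hy]
   proof eventually_elim
    case (elim s)
    have l: "signed_drift (?d h zs k) s = signed_drift (h (zs k)) s - signed_drift (h y) s"
     unfolding signed_drift_def elim by simp
    show ?case
    proof (cases "s \<in> {0..T}")
     case True
     define a b where "a = Dk k s - D s" and "b = signed_drift (?d h zs k) s"
     have "q s = b - a" using True Dk_eq[of s k] by (simp add: q_def a_def b_def l)
     hence "(q s)^2 <= 2 * a^2 + 2 * b^2" using sum_squares_bound[of b "- a"] by (simp add: power2_diff)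
     from ennreal_leI[OF this] show ?thesis using True by (simp add: ennreal_plus ennreal_mult a_def b_def)
    qed (simp add: q_def)
   qed
  qed
  also have "... = 2 * A k + 2 * nnint {0..T} (%s. esq (signed_drift (?d h zs k) s))"
   unfolding A_def using Am hm(2)[of k] by (simp add: nn_integral_add nn_integral_cmult)
  also have "... <= 2 * A k + 2 * (ennreal ?b * E k)"
   unfolding E_def by (intro add_left_mono mult_left_mono signed_drift_L2 hm) auto
  finally show ?thesis .
 qed
 moreover have "(%k. 2 * A k + 2 * (ennreal ?b * E k)) \<longlonglongrightarrow> 2 * 0 + 2 * (ennreal ?b * 0)"
  by (rule tendsto_add[OF ennreal_tendsto_cmult[OF _ A] ennreal_tendsto_cmult[OF _ ennreal_tendsto_cmult[OF _ E]]]) simp_all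
 ultimately have "(\<L> s. esq (q s)) <= 0" by (intro LIMSEQ_le_const[of _ "0 :: ennreal"]) auto
 hence "(\<L> s. esq (q s)) = 0" by simp
 hence "AE s in lborel. q s = 0" by (subst (asm) nn_integral_0_iff_AE) auto
 hence ae: "AE s in lborel. s \<in> {0..T} \<longrightarrow> D s = signed_drift (h y) s" by eventually_elim (auto simp: q_def)
 show Dmt: "(%s. indicator {0..t} s *\<^sub>R D s) \<in> ?a"
 proof -
  note [measurable] = Dm
  have "(%s. indicator {0..t} s *\<^sub>R (indicator {0..T} s *\<^sub>R D s)) \<in> ?a" by measurable
  thus ?thesis by (rule measurable_cong[THEN iffD1, rotated]) (use t in \<open>auto simp: indicator_def\<close>)
 qed
 define g g' where "g = (%s. R * memory y s + mass * y s - signed_drift (h y) s)" and "g' = ?e"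
 have inc: "set_integrable lborel {0..t} g" "memory y t - memory y 0 = (LINT s:{0..t}|lborel. g s)"
  unfolding g_def h_def by (rule memory_increment[OF yint t])+
 have gg: "AE s in lborel. indicator {0..t} s *\<^sub>R g s = indicator {0..t} s *\<^sub>R g' s"
  using ae by eventually_elim (use t in \<open>auto simp: g_def g'_def indicator_def\<close>)
 have gm: "(%s. indicator {0..t} s *\<^sub>R g s) \<in> ?c"
  using inc(1) unfolding set_integrable_def by (rule borel_measurable_integrable)
 have gm': "(%s. indicator {0..t} s *\<^sub>R g' s) \<in> ?c"
 proof -
  note [measurable] = gm Dmt hm(1)
  have "(%s. indicator {0..t} s *\<^sub>R g s + indicator {0..t} s *\<^sub>R signed_drift (h y) s - indicator {0..t} s *\<^sub>R D s) \<in> ?c" by measurable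
  thus ?thesis by (simp add: g_def g'_def algebra_simps)
 qed
 show "set_integrable lborel {0..t} ?e"
  using integrable_cong_AE_imp[OF inc(1)[unfolded set_integrable_def] gm'] gg unfolding set_integrable_def g'_def by auto
 show "memory y t - memory y 0 = (LINT s:{0..t}|lborel. R * memory y s + mass * y s - D s)"
  unfolding inc(2) using integral_cong_AE[OF gm gm' gg] unfolding set_lebesgue_integral_def g'_def .
 have "nnint {0..t} (%s. esq (D s)) = nnint {0..t} (%s. esq (signed_drift (h y) s))"
  using ae t by (intro nn_integral_cong_AE) (auto elim!: eventually_mono simp: indicator_def)
 also have "... <= ennreal ?b * nnint {-d..t} (%s. esq (h y s))" by (rule signed_drift_L2[OF hm(1)])
 also have "nnint {-d..t} (%s. esq (h y s)) = nnint {-d..t} (%s. esq (y s))"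
  using t by (intro nn_integral_cong) (auto simp: h_def indicator_def)
 finally show "nnint {0..t} (%s. esq (D s)) <= ennreal ?b * nnint {-d..t} (%s. esq (y s))" .
qed

end

section \<open>Gaussian integrals\<close>

lemma lborel_integral_prod:
 fixes f :: "'a::euclidean_space => real => real"
 assumes f: "\<And>b. b \<in> Basis ==> integrable lborel (f b)"
 shows "integrable lborel (%x. \<Prod>b\<in>Basis. f b (x \<bullet> b))"
  and "(LINT x|lborel. (\<Prod>b\<in>Basis. f b (x \<bullet> b))) = (\<Prod>b\<in>Basis. (LINT x|lborel. f b x))"
proof -
 let ?a = "%f. \<Sum>b\<in>Basis. f b *\<^sub>R (b::'a)"
 interpret product_sigma_finite "%_::'a. lborel :: real measure" ..
 have [measurable]: "f b \<in> borel_measurable borel" if "b \<in> Basis" for b using f[OF that] by auto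
 have eq: "lborel = distr (\<Pi>\<^sub>M b\<in>Basis. lborel) borel ?a"
  by (subst lborel_def) (simp add: lborel_eq_real)
 have m: "(%x::'a. \<Prod>b\<in>Basis. f b (x \<bullet> b)) \<in> borel_measurable borel" by measurable
 have m': "?a \<in> measurable (\<Pi>\<^sub>M b\<in>Basis. lborel) borel" by measurable
 have *: "(\<Prod>b\<in>Basis. f b ((\<Sum>b\<in>Basis. x b *\<^sub>R b) \<bullet> b)) = (\<Prod>b\<in>Basis. f b (x b))" for x :: "'a => real"
  by (intro prod.cong) (auto simp: inner_sum_left inner_Basis if_distrib cong: if_cong)
 show "integrable lborel (%x. \<Prod>b\<in>Basis. f b (x \<bullet> b))"
  by (subst eq, subst integrable_distr_eq[OF m' m], unfold *) (rule product_integrable_prod[OF finite_Basis f])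
 show "(LINT x|lborel. (\<Prod>b\<in>Basis. f b (x \<bullet> b))) = (\<Prod>b\<in>Basis. (LINT x|lborel. f b x))"
  by (subst eq, subst integral_distr[OF m' m], unfold *) (rule product_integral_prod[OF finite_Basis f])
qed

text \<open>Completing the square: the tilt by \<open>exp (a * x)\<close> moves the mean of the
  normal law to \<open>a * h\<close>, so tilted moments are moments of a shifted normal law.\<close>

lemma normal_density_exp:
 assumes "0 < h"
 shows "normal_density 0 (sqrt h) x * exp (a * x) = exp (a^2 * h / 2) * normal_density (a * h) (sqrt h) x"
proof -
 have "- (x^2 / (2 * h)) + a * x = a^2 * h / 2 - (x - a * h)^2 / (2 * h)"
  using assms by (simp add: field_simps power2_eq_square)
 thus ?thesis
  using assms by (simp add: normal_density_def exp_add[symmetric] mult.assoc mult.left_commute)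
qed

lemma normal_exp_moments:
 assumes "0 < h"
 shows "has_bochner_integral lborel (%x. normal_density 0 (sqrt h) x * exp (a * x)) (exp (a^2 * h / 2))"
  and "has_bochner_integral lborel (%x. normal_density 0 (sqrt h) x * exp (a * x) * x) (a * h * exp (a^2 * h / 2))"
proof -
 let ?a = "a^2 * h / 2"
 have h: "0 < sqrt h" using assms by simp
 have "has_bochner_integral lborel (normal_density (a * h) (sqrt h)) 1"
  using integrable_normal_density[OF h] integral_normal_density[OF h] by (simp add: has_bochner_integral_iff)
 from has_bochner_integral_mult_right[OF this, of "exp ?a"]
 show "has_bochner_integral lborel (%x. normal_density 0 (sqrt h) x * exp (a * x)) (exp ?a)"
  by (simp add: normal_density_exp[OF assms])
 from has_bochner_integral_mult_right[OF normal_moment_nz_1[OF h, of "a * h"], of "exp ?a"]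
 show "has_bochner_integral lborel (%x. normal_density 0 (sqrt h) x * exp (a * x) * x) (a * h * exp ?a)"
  unfolding normal_density_exp[OF assms] by (simp only: mult_ac)
qed

lemma normal_second_moment:
 assumes "0 < h" shows "has_bochner_integral lborel (%x. normal_density 0 (sqrt h) x * (x * x)) h"
 using normal_moment_even[of "sqrt h" 0 1] assms by (simp add: power2_eq_square fact_numeral)

lemma prod_Basis_vec:
 "(\<Prod>b\<in>Basis. q (b :: real ^ 'n)) = (\<Prod>i\<in>UNIV. q (axis i 1))"
proof -
 have "(Basis :: (real ^ 'n) set) = (%i. axis i 1) ` UNIV" by (auto simp: Basis_vec_def)
 thus ?thesis using prod.reindex[of "%i. axis i (1::real)" UNIV q] by (simp add: inj_on_def axis_eq_axis)
qed

lemma lborel_integral_prod_vec: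
 fixes f :: "'n::finite => real => real"
 assumes "\<And>i. has_bochner_integral lborel (f i) (m i)"
 shows "has_bochner_integral lborel (%x :: real ^ 'n. \<Prod>i\<in>UNIV. f i (x $ i)) (\<Prod>i\<in>UNIV. m i)"
proof -
 \<comment> \<open>Basis vectors are named by their coordinate; \<open>SOME\<close> finds the right
   one because \<open>axis\<close> is injective in the index.\<close>
 define q where "q = (%b::real ^ 'n. f (SOME i. b = axis i 1))"
 have [simp]: "q (axis i 1) = f i" for i unfolding q_def by (simp add: axis_eq_axis)
 have "integrable lborel (q b)" if "b \<in> Basis" for b
  using that assms by (auto simp: Basis_vec_def has_bochner_integral_iff)
 from lborel_integral_prod[of q, OF this] show ?thesis
  using assms by (simp add: prod_Basis_vec has_bochner_integral_iff inner_axis)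
qed

section \<open>Brownian motion\<close>

locale brownian = prob_space M for M :: "'w measure" +
 fixes Z :: "real => 'w => real ^ 'n::finite"
 assumes complete_M: "complete_measure M" and BM: "brownian_motion M Z"
begin

abbreviation nn_expect :: "('w => ennreal) => ennreal" (binder "\<E>" 10) where
 "nn_expect f \<equiv> \<integral>\<^sup>+w. f w \<partial>M"

abbreviation F :: "real => 'w measure" where "F \<equiv> augmented_filtration M Z"

lemma measurable_Z [measurable]: "0 <= t ==> Z t \<in> borel_measurable M"
 using BM unfolding brownian_motion_def by blast

lemma sets_natural: "sets (natural_filtration M Z t) \<subseteq> sets M"
 unfolding natural_filtration_def
 by (subst sets_measure_of) (auto intro!: sets.sigma_sets_subset measurable_sets[OF measurable_Z])

lemma F_gen_subset: "sets (natural_filtration M Z t) \<union> null_sets M \<subseteq> Pow (space M)"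
 using subset_trans[OF sets_natural sets.space_closed] null_sets.space_closed by (metis Un_least)

lemma sets_F_eq: "sets (F t) = sigma_sets (space M) (sets (natural_filtration M Z t) \<union> null_sets M)"
 unfolding augmented_filtration_def by (rule sets_measure_of[OF F_gen_subset])

lemma space_F [simp]: "space (F t) = space M"
 unfolding augmented_filtration_def by (rule space_measure_of[OF F_gen_subset])

lemma sets_F: "A \<in> sets (F t) ==> A \<in> sets M"
 using sets.sigma_sets_subset[of "sets (natural_filtration M Z t) \<union> null_sets M" M] sets_natural[of t]
 unfolding sets_F_eq by auto

lemma F_mono: "s <= t ==> sets (F s) \<subseteq> sets (F t)"
 using filtration_augmented[of M Z] unfolding filtration_def by blast

lemma null_in_F: "A \<in> null_sets M ==> A \<in> sets (F t)"
 unfolding sets_F_eq by auto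

lemma measurable_F_mono: "X \<in> measurable (F s) N ==> s <= t ==> X \<in> measurable (F t) N"
 by (rule measurable_from_subalg[of "F t" "F s"]) (auto simp: subalgebra_def F_mono[THEN subsetD])

lemma measurable_F_M: "X \<in> measurable (F s) N ==> X \<in> measurable M N"
 by (rule measurable_from_subalg[of M "F s"]) (auto simp: subalgebra_def sets_F)

lemma Z_F: "0 <= s ==> s <= t ==> Z s \<in> borel_measurable (F t)"
proof (rule measurableI)
 fix A :: "(real ^ 'n) set" assume "0 <= s" "s <= t" "A \<in> sets borel"
 hence "Z s -` A \<inter> space M \<in> sets (natural_filtration M Z t)"
  unfolding natural_filtration_def by (subst sets_measure_of) (auto intro!: sigma_sets.Basic bexI[of _ s] intro: exI[of _ A])
 thus "Z s -` A \<inter> space (F t) \<in> sets (F t)" unfolding sets_F_eq by auto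
qed auto

lemma null_complete: "A \<subseteq> B ==> B \<in> null_sets M ==> A \<in> null_sets M"
 using complete_measure.complete[OF complete_M] by (metis (no_types) emeasure_eq_0 null_setsD1 null_setsD2 null_setsI)

lemma AE_null: "AE w in M. P w ==> {w \<in> space M. \<not> P w} \<in> null_sets M"
 by (auto elim!: AE_E intro: null_complete)

text \<open>Completeness of the space places every part of a null set in the augmented filtration,
  so an almost sure modification of an event stays in it.\<close>

lemma F_cong:
 assumes A: "A \<in> sets (F t)" and B: "B \<subseteq> space M" and ae: "AE w in M. w \<in> A \<longleftrightarrow> w \<in> B"
 shows "B \<in> sets (F t)"
proof -
 define N where "N = {w \<in> space M. \<not> (w \<in> A \<longleftrightarrow> w \<in> B)}"
 have N: "N \<in> null_sets M" unfolding N_def by (rule AE_null[OF ae])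
 have "B = (A - N) \<union> (B \<inter> N)" using B sets.sets_into_space[OF A] by (auto simp: N_def)
 moreover have "B \<inter> N \<in> sets (F t)" "N \<in> sets (F t)" using N by (auto intro!: null_in_F intro: null_complete)
 ultimately show ?thesis using A by (metis sets.Diff sets.Un)
qed

lemma M_cong:
 assumes A: "A \<in> sets M" and B: "B \<subseteq> space M" and ae: "AE w in M. w \<in> A \<longleftrightarrow> w \<in> B"
 shows "B \<in> sets M"
proof -
 define N where "N = {w \<in> space M. \<not> (w \<in> A \<longleftrightarrow> w \<in> B)}"
 have N: "N \<in> null_sets M" unfolding N_def by (rule AE_null[OF ae])
 have "B = (A - N) \<union> (B \<inter> N)" using B sets.sets_into_space[OF A] by (auto simp: N_def)
 moreover have "B \<inter> N \<in> sets M" "N \<in> sets M" using N null_complete[of "B \<inter> N" N] by auto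
 ultimately show ?thesis using A by (metis sets.Diff sets.Un)
qed

lemma measurable_F_cong:
 fixes X Y :: "'w => 'b::topological_space"
 assumes X: "X \<in> borel_measurable (F t)" and ae: "AE w in M. X w = Y w"
 shows "Y \<in> borel_measurable (F t)"
proof (rule measurableI)
 fix A :: "'b set" assume A: "A \<in> sets borel"
 show "Y -` A \<inter> space (F t) \<in> sets (F t)"
  by (rule F_cong[OF measurable_sets[OF X A]]) (use ae in auto)
qed auto

text \<open>Induction over the generation of the \<sigma>-algebra. Independence of the increments is
  postulated for the natural filtration; this approximation carries it over to the augmented
  one.\<close>

lemma F_approx_natural:
 assumes "A \<in> sets (F t)"
 shows "A \<in> sets M \<and> (\<exists>B\<in>sets (natural_filtration M Z t). AE w in M. w \<in> A \<longleftrightarrow> w \<in> B)"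
 using assms unfolding sets_F_eq
proof induction
 case (Basic a)
 show ?case
 proof (cases "a \<in> sets (natural_filtration M Z t)")
  case True thus ?thesis using sets_natural by auto
 next
  case False
  hence "a \<in> null_sets M" using Basic by auto
  thus ?thesis by (intro conjI bexI[of _ "{}"]) (auto dest: AE_not_in)
 qed
next
 case Empty thus ?case by auto
next
 case (Compl a)
 then obtain B where "B \<in> sets (natural_filtration M Z t)" "AE w in M. w \<in> a \<longleftrightarrow> w \<in> B" by auto
 thus ?case using Compl
  using sets.compl_sets[of B "natural_filtration M Z t"]
  by (intro conjI bexI[of _ "space M - B"]) (auto simp: space_natural_filtration)
next
 case (Union a)
 hence "\<forall>i. \<exists>B\<in>sets (natural_filtration M Z t). AE w in M. w \<in> a i \<longleftrightarrow> w \<in> B" by auto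
 then obtain B where B: "\<And>i. B i \<in> sets (natural_filtration M Z t)" "\<And>i. AE w in M. w \<in> a i \<longleftrightarrow> w \<in> B i" by metis
 have "AE w in M. \<forall>i. w \<in> a i \<longleftrightarrow> w \<in> B i" using B(2) by (subst AE_all_countable) auto
 hence "AE w in M. w \<in> (\<Union>i. a i) \<longleftrightarrow> w \<in> (\<Union>i. B i)" by eventually_elim auto
 thus ?case using B(1) Union by (intro conjI bexI[of _ "\<Union>i. B i"]) auto
qed

lemma increment_distributed:
 "0 <= s ==> s < t ==> distributed M lborel (%w. Z t w - Z s w)
     (%x. \<Prod>i\<in>UNIV. ennreal (normal_density 0 (sqrt (t - s)) (x $ i)))"
 using BM unfolding brownian_motion_def by blast

text \<open>Kept general in U and g so that it serves products of real variables as well as of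
  extended nonnegative ones.\<close>

lemma indep_increment:
 assumes st: "0 <= s" "s < t" and U: "U \<in> measurable (F s) N" and g: "g \<in> measurable borel L"
 shows "indep_var N U L (%w. g (Z t w - Z s w))"
proof -
 let ?D = "%w. Z t w - Z s w"
 let ?a = "%A. sigma_sets (space M) {(%w. g (?D w)) -` A \<inter> space M |A. A \<in> sets L}"
 let ?b = "%A. sigma_sets (space M) {U -` A \<inter> space M |A. A \<in> sets N}"
 let ?c = "%w. g (?D w)"
 have D: "?D \<in> borel_measurable M" using st by auto
 have ind: "indep_set (sets (natural_filtration M Z s)) {?D -` A \<inter> space M | A. A \<in> sets borel}"
  using BM st unfolding brownian_motion_def by blast
 show ?thesis unfolding indep_var_eq
 proof (intro conjI indep_setI)
  show "random_variable N U" using U by (rule measurable_F_M)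
  show gD: "random_variable L ?c" using measurable_compose[OF D g] .
  show "?b A \<subseteq> events"
   using \<open>random_variable N U\<close> by (auto intro!: sets.sigma_sets_subset intro: measurable_sets)
  show "?a A \<subseteq> events"
   using gD by (auto intro!: sets.sigma_sets_subset intro: measurable_sets)
  fix a b assume a: "a \<in> ?b A"
   and b: "b \<in> ?a A"
  have "?b A \<subseteq> sets (F s)"
  proof -
   have "{U -` A \<inter> space M |A. A \<in> sets N} \<subseteq> sets (F s)"
    using measurable_sets[OF U] by (simp add: subset_eq) blast
   from sets.sigma_sets_subset[OF this] show ?thesis by simp
  qed
  hence aF: "a \<in> sets (F s)" using a by auto
  have "?a A = {?c -` A \<inter> space M |A. A \<in> sets L}"
   using sets_vimage_algebra[of "space M" "%w. g (?D w)" L] sets_vimage_algebra2[of "%w. g (?D w)" "space M" L]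
    measurable_space[OF gD] by auto
  then obtain A where "A \<in> sets L" "b = ?c -` A \<inter> space M" using b by auto
  hence bB: "b \<in> {?D -` A \<inter> space M | A. A \<in> sets borel}"
   using measurable_sets[OF g] by (auto intro!: exI[of _ "g -` A"])
  obtain a' where a': "a' \<in> sets (natural_filtration M Z s)" "AE w in M. w \<in> a \<longleftrightarrow> w \<in> a'"
   using F_approx_natural[OF aF] by auto
  have ms: "a \<in> events" "a' \<in> events" "b \<in> events"
   using sets_F[OF aF] subsetD[OF sets_natural a'(1)] bB measurable_sets[OF D] by blast+
  have "prob (a \<inter> b) = prob (a' \<inter> b)"
   using a'(2) ms by (intro finite_measure_eq_AE) auto
  also have "... = prob a' * prob b" by (rule indep_setD[OF ind a'(1) bB])
  also have "prob a' = prob a" using a'(2) ms by (intro finite_measure_eq_AE) auto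
  finally show "prob (a \<inter> b) = prob a * prob b" .
 qed
qed

lemma indep_mult:
 fixes U :: "'w => real"
 assumes st: "0 <= s" "s < t" and U: "U \<in> borel_measurable (F s)" "integrable M U"
  and g: "g \<in> borel_measurable borel" "integrable M (%w. g (Z t w - Z s w))"
 shows "integrable M (%w. U w * g (Z t w - Z s w))"
  and "expectation (%w. U w * g (Z t w - Z s w)) = expectation U * expectation (%w. g (Z t w - Z s w))"
 using indep_var_integrable[OF indep_increment[OF st U(1) g(1)] U(2) g(2)]
  indep_var_lebesgue_integral[OF indep_increment[OF st U(1) g(1)] U(2) g(2)] by auto

lemma indep_mult_nn:
 fixes U :: "'w => ennreal"
 assumes st: "0 <= s" "s < t" and U: "U \<in> borel_measurable (F s)" and g: "g \<in> borel_measurable borel"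
 shows "(\<E> w. U w * g (Z t w - Z s w)) = (\<E> w. U w) * (\<E> w. g (Z t w - Z s w))"
proof -
 have "indep_vars (%_. borel) (case_bool U (%w. g (Z t w - Z s w))) UNIV"
  using indep_increment[OF st U g] unfolding indep_var_def
  by (rule indep_vars_cong[THEN iffD1, rotated 3]) (auto split: bool.split)
 from indep_vars_nn_integral[OF _ this] show ?thesis by (simp add: UNIV_bool mult.commute)
qed

lemma increment_integral:
 assumes st: "0 <= s" "s < t" and g: "g \<in> borel_measurable borel"
  and f: "has_bochner_integral lborel (%x. (\<Prod>i\<in>UNIV. normal_density 0 (sqrt (t - s)) (x $ i)) * g x) m"
 shows "has_bochner_integral M (%w. g (Z t w - Z s w)) (m :: real)"
proof -
 define p where "p = (%x::real ^ 'n. \<Prod>i\<in>UNIV. normal_density 0 (sqrt (t - s)) (x $ i))"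
 have D: "distributed M lborel (%w. Z t w - Z s w) (%x. ennreal (p x))"
  using increment_distributed[OF st] unfolding p_def by (simp add: prod_ennreal)
 have "0 <= p x" for x unfolding p_def by (intro prod_nonneg) auto
 thus ?thesis
  using distributed_integrable[OF D, of g] distributed_integral[OF D, of g] f g
  by (auto simp: has_bochner_integral_iff p_def)
qed

lemma increment_exp:
 assumes "0 <= s" "s <= t"
 shows "has_bochner_integral M (%w. exp (v \<bullet> (Z t w - Z s w))) (exp ((v \<bullet> v) * (t - s) / 2))"
proof (cases "s < t")
 case True
 let ?n = "normal_density 0 (sqrt (t - s))"
 have "has_bochner_integral lborel (%x. \<Prod>i\<in>UNIV. ?n (x $ i) * exp (v $ i * x $ i)) (\<Prod>i\<in>UNIV. exp ((v $ i)^2 * (t - s) / 2))"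
  using True by (intro lborel_integral_prod_vec normal_exp_moments) auto
 hence "has_bochner_integral lborel (%x. (\<Prod>i\<in>UNIV. ?n (x $ i)) * exp (v \<bullet> x)) (exp ((v \<bullet> v) * (t - s) / 2))"
  by (simp add: prod.distrib exp_sum[symmetric] inner_vec_def sum_divide_distrib sum_distrib_right power2_eq_square)
 thus ?thesis by (intro increment_integral[OF assms(1) True]) auto
next
 case False
 thus ?thesis using assms by (simp add: has_bochner_integral_iff prob_space)
qed

text \<open>The coordinates of the increment are independent normal variables, so the integral
  factorises: the j-th factor is a tilted first moment, every other factor a tilted mass.\<close>

lemma increment_coordinate_exp:
 assumes "0 <= s" "s <= t"
 shows "has_bochner_integral M (%w. exp (v \<bullet> (Z t w - Z s w)) * (Z t w - Z s w) $ j) (v $ j * (t - s) * exp ((v \<bullet> v) * (t - s) / 2))"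
proof (cases "s < t")
 let ?a = "%i. if i = j then v $ i * (t - s) * exp ((v $ i)^2 * (t - s) / 2) else exp ((v $ i)^2 * (t - s) / 2)"
 let ?b = "\<Prod>i\<in>UNIV. exp ((v $ i)^2 * (t - s) / 2)"
 let ?c = "\<Prod>i\<in>UNIV. (?a i)"
 case True
 let ?n = "normal_density 0 (sqrt (t - s))"
 have "has_bochner_integral lborel (%x. \<Prod>i\<in>UNIV. (if i = j then ?n (x $ i) * exp (v $ i * x $ i) * x $ i else ?n (x $ i) * exp (v $ i * x $ i)))
   ?c"
  by (rule lborel_integral_prod_vec[of "%i x. if i = j then ?n x * exp (v $ i * x) * x else ?n x * exp (v $ i * x)"])
    (use True in \<open>auto intro!: normal_exp_moments\<close>)
 moreover have *: "(\<Prod>i\<in>UNIV. (if i = j then a i * c else a i)) = (\<Prod>i\<in>UNIV. a i) * c" for a :: "'n => real" and c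
  using prod.distrib[of a "%i. if i = j then c else 1" UNIV] by (simp add: if_distrib cong: if_cong)
 have "(\<Prod>i\<in>UNIV. (if i = j then ?n (x $ i) * exp (v $ i * x $ i) * x $ i else ?n (x $ i) * exp (v $ i * x $ i)))
   = (\<Prod>i\<in>UNIV. ?n (x $ i)) * (exp (v \<bullet> x) * x $ j)" for x
  using *[of "%i. ?n (x $ i) * exp (v $ i * x $ i)" "x $ j"]
  by (simp add: prod.distrib exp_sum[symmetric] inner_vec_def cong: if_cong)
 moreover have "?c
  = v $ j * (t - s) * exp ((v \<bullet> v) * (t - s) / 2)"
 proof -
  have "?c
   = (\<Prod>i\<in>UNIV. (if i = j then exp ((v $ i)^2 * (t - s) / 2) * (v $ j * (t - s)) else exp ((v $ i)^2 * (t - s) / 2)))"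
   by (intro prod.cong) auto
  also have "... = ?b * (v $ j * (t - s))" by (rule *)
  also have "?b = exp ((v \<bullet> v) * (t - s) / 2)"
   by (simp add: exp_sum[symmetric] inner_vec_def sum_divide_distrib sum_distrib_right power2_eq_square)
  finally show ?thesis by simp
 qed
 ultimately show ?thesis by (intro increment_integral[OF assms(1) True]) auto
next
 case False
 thus ?thesis using assms by (simp add: has_bochner_integral_iff prob_space)
qed

lemma increment_coordinates:
 assumes "0 <= s" "s <= t"
 shows "has_bochner_integral M (%w. (Z t w - Z s w) $ i * (Z t w - Z s w) $ j) (if i = j then t - s else 0)"
proof (cases "s < t")
 let ?a = "\<Prod>k\<in>UNIV. if k = i \<and> k = j then t - s else if k = i \<or> k = j then 0 else 1"
 case True
 let ?n = "normal_density 0 (sqrt (t - s))"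
 define f where "f = (%k x. ?n x * ((if k = i then x else 1) * (if k = j then x else 1)))"
 have n0: "has_bochner_integral lborel ?n 1"
  using True integrable_normal_density[of "sqrt (t - s)" 0] integral_normal_density[of "sqrt (t - s)" 0] by (simp add: has_bochner_integral_iff)
 have n1: "has_bochner_integral lborel (%x. ?n x * x) 0" using True normal_moment_nz_1[of "sqrt (t - s)" 0] by simp
 have n2: "has_bochner_integral lborel (%x. ?n x * (x * x)) (t - s)" using True by (intro normal_second_moment) simp
 have "has_bochner_integral lborel (%x. \<Prod>k\<in>UNIV. f k (x $ k))
   ?a"
  by (rule lborel_integral_prod_vec) (use n0 n1 n2 in \<open>auto simp: f_def\<close>)
 moreover have "?a = (if i = j then t - s else 0)"
 proof (cases "i = j")
  case True thus ?thesis by (simp cong: if_cong)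
 next
  case False thus ?thesis by (auto intro!: prod_zero exI[of _ i])
 qed
 moreover have "(\<Prod>k\<in>UNIV. f k (x $ k)) = (\<Prod>k\<in>UNIV. ?n (x $ k)) * (x $ i * x $ j)" for x
 proof -
  have "(\<Prod>k\<in>UNIV. if k = l then x $ k else 1) = x $ l" for l by (simp cong: if_cong)
  thus ?thesis by (simp add: f_def prod.distrib)
 qed
 ultimately show ?thesis by (intro increment_integral[OF assms(1) True]) auto
next
 case False
 thus ?thesis using assms by (simp add: has_bochner_integral_iff prob_space)
qed

end

section \<open>Elementary integrals\<close>

definition step_H :: "nat => (nat => real) => (nat => 'w => real ^ 'n) => real => 'w => real ^ 'n" where
 "step_H m \<tau> \<xi> = (%t w. \<Sum>i<m. indicator {\<tau> i<..\<tau> (Suc i)} t *\<^sub>R \<xi> i w)"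

text \<open>Only cells whose left end lies in \<open>{a..<b}\<close> contribute, and their
  increments telescope. Used once for indicators and once for the paths of Z, it shows that refining
  the grid changes neither a step integrand nor its integral.\<close>

lemma sum_grid_telescope:
 fixes f :: "real => 'a::real_vector" and \<sigma> :: "nat => real"
 assumes mono: "\<And>i j. i < j ==> j <= n ==> \<sigma> i < \<sigma> j"
  and "a \<in> \<sigma> ` {..n}" "b \<in> \<sigma> ` {..n}" "a <= b"
 shows "(\<Sum>j<n. indicator {a..<b} (\<sigma> j) *\<^sub>R (f (\<sigma> (Suc j)) - f (\<sigma> j))) = f b - f a"
proof -
 obtain p q where pq: "p <= n" "q <= n" "a = \<sigma> p" "b = \<sigma> q" using assms by auto
 have lt: "\<sigma> i < \<sigma> j \<longleftrightarrow> i < j" if "i <= n" "j <= n" for i j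
  using mono[of i j] mono[of j i] that by (metis less_asym' linorder_neqE_nat order.irrefl)
 have "p <= q" using \<open>a \<le> b\<close> pq lt[of q p] by auto
 have "(\<Sum>j<n. indicator {a..<b} (\<sigma> j) *\<^sub>R (f (\<sigma> (Suc j)) - f (\<sigma> j)))
   = (\<Sum>j\<in>{p..<q}. f (\<sigma> (Suc j)) - f (\<sigma> j))"
  by (rule sum.mono_neutral_cong_right) (use pq lt in \<open>auto simp: indicator_def not_less[symmetric]\<close>)
 thus ?thesis using sum_Suc_diff'[OF \<open>p \<le> q\<close>, of "%j. f (\<sigma> j)"] pq by simp
qed

lemma indicator_Ioc_diff:
 "a <= b ==> indicator {a<..b} t = (indicator {t..} b - indicator {t..} a :: real)" for t :: real
 by (auto simp: indicator_def)

context brownian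
begin

definition step_I :: "nat => (nat => real) => (nat => 'w => real ^ 'n) => real => 'w => real" where
 "step_I m \<tau> \<xi> = (%t w. \<Sum>i<m. \<xi> i w \<bullet> (Z (min t (\<tau> (Suc i))) w - Z (min t (\<tau> i)) w))"

text \<open>The quadratic variation of the step integral at time t.\<close>

definition step_Q :: "nat => (nat => real) => (nat => 'w => real ^ 'n) => real => 'w => real" where
 "step_Q m \<tau> \<xi> = (%t w. \<Sum>i<m. (norm (\<xi> i w))^2 * (min t (\<tau> (Suc i)) - min t (\<tau> i)))"

definition step_data :: "nat => (nat => real) => (nat => 'w => real ^ 'n) => bool" where
 "step_data m \<tau> \<xi> \<longleftrightarrow> 0 <= \<tau> 0 \<and> (\<forall>i<m. \<tau> i <= \<tau> (Suc i)) \<and>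
   (\<forall>i<m. \<xi> i \<in> borel_measurable (F (\<tau> i))) \<and> (\<exists>C. \<forall>i<m. \<forall>w\<in>space M. norm (\<xi> i w) <= C)"

lemma elementary_integral_iff:
 "elementary_integral M Z H I \<longleftrightarrow> (\<exists>m q r. step_data m q r \<and> H = step_H m q r \<and> I = step_I m q r)"
 unfolding elementary_integral_def step_data_def step_H_def step_I_def by auto

lemma step_data_mono:
 assumes "step_data m q \<xi>" "i <= j" "j <= m" shows "q i <= q j"
 using assms(2,3)
proof (induction j rule: dec_induct)
 case (step k)
 thus ?case using assms(1) unfolding step_data_def by (auto intro: order_trans)
qed simp

lemma step_data_nonneg: "step_data m q \<xi> ==> i <= m ==> 0 <= q i"
 using step_data_mono[of m q \<xi> 0 i] unfolding step_data_def by auto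

lemma step_data_Suc: "step_data (Suc m) \<tau> \<xi> ==> step_data m \<tau> \<xi>"
 unfolding step_data_def by (metis less_SucI)

lemma step_data_bound:
 assumes "step_data m \<tau> q" obtains C where "0 <= C" "\<And>i w. i < m ==> w \<in> space M ==> norm (q i w) <= C"
proof -
 obtain C where C: "\<forall>i<m. \<forall>w\<in>space M. norm (q i w) <= C" using assms unfolding step_data_def by auto
 show ?thesis by (rule that[of "\<bar>C\<bar>"]) (use C in \<open>auto intro: order_trans[OF _ abs_ge_self]\<close>)
qed

text \<open>On each cell of the finer grid the new coefficient is the old one in force at the left
  end of the cell. With S the union of the partition points of two step processes, both are brought
  to a common grid, which reduces linearity to the coefficients.\<close>

lemma step_refine:
 assumes sd: "step_data m q r" and S: "finite S" "q ` {..m} \<subseteq> S" "S \<subseteq> {0..}"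
 defines "n \<equiv> card S - 1" and "\<sigma> \<equiv> (%j. sorted_list_of_set S ! j)"
 shows "\<exists>u. step_data n \<sigma> u \<and> step_H n \<sigma> u = step_H m q r \<and> step_I n \<sigma> u = step_I m q r"
proof -
 let ?a = "%i j t w. indicator {q i..<q (Suc i)} (\<sigma> j) *\<^sub>R (Z (min t (\<sigma> (Suc j))) w - Z (min t (\<sigma> j)) w)"
 define u where "u = (%j w. \<Sum>i<m. indicator {q i..<q (Suc i)} (\<sigma> j) *\<^sub>R r i w)"
 have "S ~= {}" using S(2) by auto
 hence n: "card S = Suc n" using S(1) by (simp add: n_def card_gt_0_iff)
 have ss: "sorted_wrt (<) (sorted_list_of_set S)" "set (sorted_list_of_set S) = S" "length (sorted_list_of_set S) = Suc n"
  using S(1) n by auto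
 have mono: "\<sigma> i < \<sigma> j" if "i < j" "j <= n" for i j
  unfolding \<sigma>_def using sorted_wrt_nth_less[OF ss(1)] that ss(3) by auto
 have img: "\<sigma> ` {..n} = S"
  using ss(2,3) unfolding \<sigma>_def by (auto simp: set_conv_nth less_Suc_eq_le)
 have tele_cond: "q i \<in> \<sigma> ` {..n}" "q (Suc i) \<in> \<sigma> ` {..n}" "q i <= q (Suc i)" if "i < m" for i
  using that S(2) sd by (auto simp: img step_data_def)
 note tele = sum_grid_telescope[OF mono tele_cond]
 have "step_data n \<sigma> u" unfolding step_data_def
 proof (intro conjI allI impI)
  have "\<sigma> 0 \<in> S" using img by auto
  thus "0 <= \<sigma> 0" using S(3) by auto
  show "\<sigma> i <= \<sigma> (Suc i)" if "i < n" for i using mono[of i "Suc i"] that by auto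
  show "u j \<in> borel_measurable (F (\<sigma> j))" if "j < n" for j
   unfolding u_def
  proof (rule borel_measurable_sum)
   fix i assume "i \<in> {..<m}"
   hence r: "r i \<in> borel_measurable (F (q i))" using sd unfolding step_data_def by auto
   show "(%w. indicator {q i..<q (Suc i)} (\<sigma> j) *\<^sub>R r i w) \<in> borel_measurable (F (\<sigma> j))"
   \<comment> \<open>A coefficient that is only known after \<sigma> j carries the weight 0, so the
     sum is measurable at \<sigma> j.\<close>
   proof (cases "q i <= \<sigma> j")
    case True
    from measurable_F_mono[OF r this] show ?thesis by (rule borel_measurable_scaleR[OF borel_measurable_const])
   qed simp
  qed
  obtain C where C: "0 <= C" "\<And>i w. i < m ==> w \<in> space M ==> norm (r i w) <= C" by (rule step_data_bound[OF sd]) blast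
  show "\<exists>C. \<forall>j<n. \<forall>w\<in>space M. norm (u j w) <= C"
  proof (intro exI allI impI ballI)
   fix j w assume "w \<in> space M"
   have "norm (u j w) <= (\<Sum>i<m. norm (indicator {q i..<q (Suc i)} (\<sigma> j) *\<^sub>R r i w))" unfolding u_def by (rule norm_sum)
   also have "... <= (\<Sum>i<m. C)" using C \<open>w \<in> space M\<close> by (intro sum_mono) (auto simp: indicator_def)
   finally show "norm (u j w) <= (\<Sum>i<m. C)" .
  qed
 qed
 moreover have "step_H n \<sigma> u t w = step_H m q r t w" for t w
 proof -
  have "step_H n \<sigma> u t w = (\<Sum>j<n. \<Sum>i<m. (indicator {\<sigma> j<..\<sigma> (Suc j)} t * indicator {q i..<q (Suc i)} (\<sigma> j)) *\<^sub>R r i w)"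
   by (simp only: step_H_def u_def scaleR_sum_right scaleR_scaleR)
  also have "... = (\<Sum>i<m. \<Sum>j<n. (indicator {\<sigma> j<..\<sigma> (Suc j)} t * indicator {q i..<q (Suc i)} (\<sigma> j)) *\<^sub>R r i w)"
   by (rule sum.swap)
  also have "... = (\<Sum>i<m. (\<Sum>j<n. indicator {q i..<q (Suc i)} (\<sigma> j) *\<^sub>R (indicator {t..} (\<sigma> (Suc j)) - indicator {t..} (\<sigma> j))) *\<^sub>R r i w)"
   unfolding scaleR_sum_left
  proof (intro sum.cong refl)
   fix i j assume "j \<in> {..<n}"
   hence "\<sigma> j <= \<sigma> (Suc j)" using mono[of j "Suc j"] by auto
   thus "(indicator {\<sigma> j<..\<sigma> (Suc j)} t * indicator {q i..<q (Suc i)} (\<sigma> j)) *\<^sub>R r i w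
    = (indicator {q i..<q (Suc i)} (\<sigma> j) *\<^sub>R (indicator {t..} (\<sigma> (Suc j)) - indicator {t..} (\<sigma> j))) *\<^sub>R r i w"
    by (simp only: indicator_Ioc_diff real_scaleR_def mult.commute)
  qed
  also have "... = step_H m q r t w"
   unfolding step_H_def using tele_cond by (intro sum.cong refl) (simp only: tele lessThan_iff indicator_Ioc_diff)
  finally show ?thesis .
 qed
 moreover have "step_I n \<sigma> u t w = step_I m q r t w" for t w
 proof -
  have "step_I n \<sigma> u t w = (\<Sum>j<n. \<Sum>i<m. r i w \<bullet> (?a i j t w))"
   by (simp only: step_I_def u_def inner_sum_left inner_scaleR_left inner_scaleR_right)
  also have "... = (\<Sum>i<m. \<Sum>j<n. r i w \<bullet> (?a i j t w))"
   by (rule sum.swap)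
  also have "... = step_I m q r t w"
   unfolding step_I_def by (intro sum.cong refl) (simp only: inner_sum_right[symmetric] lessThan_iff tele[where f = "%s. Z (min t s) w"])
  finally show ?thesis .
 qed
 ultimately show ?thesis by blast
qed

lemma elementary_pair:
 assumes "elementary_integral M Z H I" "elementary_integral M Z H' I'"
 obtains n \<sigma> u u' where "step_data n \<sigma> u" "step_data n \<sigma> u'" "H = step_H n \<sigma> u" "H' = step_H n \<sigma> u'"
  "I = step_I n \<sigma> u" "I' = step_I n \<sigma> u'"
proof -
 obtain m q r where 1: "step_data m q r" "H = step_H m q r" "I = step_I m q r"
  using assms(1) unfolding elementary_integral_iff by auto
 obtain m' q' r' where 2: "step_data m' q' r'" "H' = step_H m' q' r'" "I' = step_I m' q' r'"
  using assms(2) unfolding elementary_integral_iff by auto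
 let ?S = "q ` {..m} \<union> q' ` {..m'}"
 have "finite ?S" "?S \<subseteq> {0..}" using step_data_nonneg[OF 1(1)] step_data_nonneg[OF 2(1)] by auto
 from step_refine[OF 1(1) this(1) _ this(2)] step_refine[OF 2(1) this(1) _ this(2)] show ?thesis
  using that 1 2 by auto
qed

lemma step_linear:
 "step_H n \<sigma> (%i w. a *\<^sub>R q i w + b *\<^sub>R q' i w) t w = a *\<^sub>R step_H n \<sigma> q t w + b *\<^sub>R step_H n \<sigma> q' t w"
 "step_I n \<sigma> (%i w. a *\<^sub>R q i w + b *\<^sub>R q' i w) t w = a * step_I n \<sigma> q t w + b * step_I n \<sigma> q' t w"
 unfolding step_H_def step_I_def
 by (simp_all only: scaleR_sum_right sum_distrib_left sum.distrib[symmetric] inner_add_left inner_scaleR_left scaleR_add_right scaleR_left_commute)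

lemma step_data_linear:
 assumes "step_data n \<sigma> q" "step_data n \<sigma> q'"
 shows "step_data n \<sigma> (%i w. a *\<^sub>R q i w + b *\<^sub>R q' i w)"
proof -
 obtain C where C: "0 <= C" "\<And>i w. i < n ==> w \<in> space M ==> norm (q i w) <= C" by (rule step_data_bound[OF assms(1)]) blast
 obtain C' where C': "0 <= C'" "\<And>i w. i < n ==> w \<in> space M ==> norm (q' i w) <= C'" by (rule step_data_bound[OF assms(2)]) blast
 have "norm (a *\<^sub>R q i w + b *\<^sub>R q' i w) <= \<bar>a\<bar> * C + \<bar>b\<bar> * C'" if "i < n" "w \<in> space M" for i w
  using C(2)[OF that] C'(2)[OF that] by (intro order_trans[OF norm_triangle_ineq] add_mono) (auto intro: mult_left_mono)
 moreover have "(%w. a *\<^sub>R q i w + b *\<^sub>R q' i w) \<in> borel_measurable (F (\<sigma> i))" if "i < n" for i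
  using assms that unfolding step_data_def
  by (intro borel_measurable_add borel_measurable_scaleR borel_measurable_const) auto
 ultimately show ?thesis using assms(1) unfolding step_data_def by blast
qed

lemma elementary_linear:
 assumes "elementary_integral M Z H I" "elementary_integral M Z H' I'"
 shows "elementary_integral M Z (%t w. a *\<^sub>R H t w + b *\<^sub>R H' t w) (%t w. a * I t w + b * I' t w)"
proof -
 obtain n \<sigma> q q' where *: "step_data n \<sigma> q" "step_data n \<sigma> q'" "H = step_H n \<sigma> q" "H' = step_H n \<sigma> q'"
  "I = step_I n \<sigma> q" "I' = step_I n \<sigma> q'" by (rule elementary_pair[OF assms])
 show ?thesis unfolding elementary_integral_iff
  by (intro exI[of _ n] exI[of _ \<sigma>] exI[of _ "%i w. a *\<^sub>R q i w + b *\<^sub>R q' i w"])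
    (auto simp: * step_data_linear step_linear fun_eq_iff)
qed

lemma norm_step_H:
 assumes sd: "step_data m q r"
 shows "(norm (step_H m q r t w))^2 = (\<Sum>i<m. indicator {q i<..q (Suc i)} t * (norm (r i w))^2)"
proof (cases "\<exists>i<m. t \<in> {q i<..q (Suc i)}")
 case True
 then obtain i where i: "i < m" "q i < t" "t <= q (Suc i)" by auto
 have "t \<notin> {q j<..q (Suc j)}" if "j < m" "j ~= i" for j
 proof (cases "j < i")
  case True
  hence "q (Suc j) <= q i" using i by (intro step_data_mono[OF sd]) auto
  thus ?thesis using i by auto
 next
  case False
  hence "q (Suc i) <= q j" using that by (intro step_data_mono[OF sd]) auto
  thus ?thesis using i by auto
 qed
 hence ind: "indicator {q j<..q (Suc j)} t = (if j = i then 1 else 0 :: real)" if "j < m" for j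
  using that i by (auto simp: indicator_def)
 have "(\<Sum>j<m. indicat_real {q j<..q (Suc j)} t *\<^sub>R r j w) = (\<Sum>j<m. if j = i then r j w else 0)"
  by (intro sum.cong) (auto simp: ind)
 moreover have "(\<Sum>j<m. indicat_real {q j<..q (Suc j)} t * (norm (r j w))^2) = (\<Sum>j<m. if j = i then (norm (r j w))^2 else 0)"
  by (intro sum.cong) (auto simp: ind)
 ultimately show ?thesis using i by (simp add: step_H_def)
next
 case False
 hence "indicator {q j<..q (Suc j)} t = (0::real)" if "j < m" for j using that by (auto simp: indicator_def)
 thus ?thesis unfolding step_H_def by (subst (1 2) sum.neutral) auto
qed

lemma step_Q_integral:
 assumes sd: "step_data m q r" and t: "0 <= t"
 shows "nnint {0..t} (%s. esq (norm (step_H m q r s w))) = ennreal (step_Q m q r t w)"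
proof -
 let ?a = "%s. \<Sum>i<m. esq (norm (r i w)) * indicator {min t (q i)<..min t (q (Suc i))} s"
 let ?b = "%i. (norm (r i w))^2 * (min t (q (Suc i)) - min t (q i))"
 let ?c = "%s. esq (norm (step_H m q r s w)) * indicator {0..t} s"
 have le: "q i <= q (Suc i)" "0 <= q i" if "i < m" for i
  using sd that step_data_nonneg[OF sd, of i] by (auto simp: step_data_def)
 have "nnint {0..t} (%s. esq (norm (step_H m q r s w)))
   = (\<L> s. (?a s))"
 proof (rule nn_integral_cong)
  fix s
  have "?c s
    = (\<Sum>i<m. ennreal (indicator {q i<..q (Suc i)} s * (norm (r i w))^2)) * indicator {0..t} s"
   unfolding norm_step_H[OF sd] by (subst sum_ennreal) auto
  also have "... = (?a s)"
   unfolding sum_distrib_right using le t by (intro sum.cong refl) (force simp: indicator_def min_def)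
  finally show "?c s
    = (?a s)" .
 qed
 also have "... = (\<Sum>i<m. esq (norm (r i w)) * emeasure lborel {min t (q i)<..min t (q (Suc i))})"
  by (subst nn_integral_sum) (auto simp: nn_integral_cmult_indicator)
 also have "... = (\<Sum>i<m. ennreal (?b i))"
 proof (intro sum.cong refl)
  fix i assume "i \<in> {..<m}"
  hence "min t (q i) <= min t (q (Suc i))" using le by (intro min.mono) auto
  thus "esq (norm (r i w)) * emeasure lborel {min t (q i)<..min t (q (Suc i))}
   = ennreal (?b i)"
   by (simp add: emeasure_lborel_Ioc ennreal_mult)
 qed
 also have "... = ennreal (step_Q m q r t w)"
  unfolding step_Q_def using le min.mono[OF order_refl le(1), of _ t]
  by (subst sum_ennreal) (auto intro!: mult_nonneg_nonneg simp del: min_less_iff_conj)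
 finally show ?thesis .
qed

lemma increment_mean:
 assumes st: "0 <= s" "s <= t" and U: "U \<in> borel_measurable (F s)" "integrable M (%w. norm (U w))"
 shows "integrable M (%w. U w \<bullet> (Z t w - Z s w))" "expectation (%w. U w \<bullet> (Z t w - Z s w)) = 0"
proof -
 let ?a = "%w. U w \<bullet> (Z t w - Z s w)"
 have "has_bochner_integral M (%w. U w $ i * (Z t w - Z s w) $ i) 0" for i
 proof (cases "s < t")
  case True
  have Ui: "(%w. U w $ i) \<in> borel_measurable (F s)" "integrable M (%w. U w $ i)"
   using measurable_compose[OF U(1) borel_measurable_nth] measurable_compose[OF measurable_F_M[OF U(1)] borel_measurable_nth]
   by (auto intro!: Bochner_Integration.integrable_bound[OF U(2)] AE_I2 component_le_norm_cart)
  have "has_bochner_integral M (%w. (Z t w - Z s w) $ i) 0"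
   using increment_coordinate_exp[OF st, of 0 i] by simp
  thus ?thesis
   using indep_mult[OF st(1) True Ui, of "%x. x $ i"] by (auto simp: has_bochner_integral_iff)
 next
  case False
  thus ?thesis using st by (simp add: has_bochner_integral_zero)
 qed
 from has_bochner_integral_sum[OF this]
 have "has_bochner_integral M (%w. \<Sum>i\<in>UNIV. U w $ i * (Z t w - Z s w) $ i) (\<Sum>i\<in>(UNIV :: 'n set). 0)" .
 thus "integrable M ?a" "expectation ?a = 0"
  by (simp_all add: has_bochner_integral_iff inner_vec_def)
qed

lemma increment_square:
 assumes st: "0 <= s" "s <= t" and U: "U \<in> borel_measurable (F s)" "integrable M (%w. (norm (U w))^2)"
 shows "integrable M (%w. (U w \<bullet> (Z t w - Z s w))^2)"
  "expectation (%w. (U w \<bullet> (Z t w - Z s w))^2) = (t - s) * expectation (%w. (norm (U w))^2)"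
proof -
 let ?a = "\<Sum>i\<in>UNIV. \<Sum>j\<in>UNIV. if i = j then (t - s) * expectation (%w. U w $ i * U w $ i) else 0"
 let ?b = "(t - s) * expectation (%w. (norm (U w))^2)"
 let ?c = "%w. (U w \<bullet> (Z t w - Z s w))^2"
 let ?d = "%w i j. (Z t w - Z s w) $ i * (Z t w - Z s w) $ j"
 have UM: "U \<in> borel_measurable M" by (rule measurable_F_M[OF U(1)])
 have Uij: "integrable M (%w. U w $ i * U w $ j)" for i j
 proof (rule Bochner_Integration.integrable_bound[OF U(2)])
  show "(%w. U w $ i * U w $ j) \<in> borel_measurable M"
   by (intro borel_measurable_times measurable_compose[OF UM borel_measurable_nth])
  show "AE w in M. norm (U w $ i * U w $ j) <= norm ((norm (U w))^2)"
   by (intro AE_I2) (auto simp: abs_mult power2_eq_square intro!: mult_mono component_le_norm_cart)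
 qed
 have "has_bochner_integral M (%w. (U w $ i * U w $ j) * (?d w i j))
  (if i = j then (t - s) * expectation (%w. U w $ i * U w $ i) else 0)" for i j
 proof (cases "s < t")
  case True
  have m: "(%w. U w $ i * U w $ j) \<in> borel_measurable (F s)"
   by (intro borel_measurable_times measurable_compose[OF U(1) borel_measurable_nth])
  from increment_coordinates[OF st, of i j] indep_mult[OF st(1) True m Uij, of "%x. x $ i * x $ j"] show ?thesis
   by (auto simp: has_bochner_integral_iff)
 next
  case False
  thus ?thesis using st by (simp add: has_bochner_integral_zero)
 qed
 hence "has_bochner_integral M (%w. \<Sum>i\<in>UNIV. \<Sum>j\<in>UNIV. (U w $ i * U w $ j) * (?d w i j))
   ?a"
  by (rule has_bochner_integral_sum[OF has_bochner_integral_sum])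
 moreover have "(\<Sum>i\<in>UNIV. \<Sum>j\<in>UNIV. (U w $ i * U w $ j) * (?d w i j))
   = (U w \<bullet> (Z t w - Z s w))^2" for w
  by (simp only: inner_vec_def power2_eq_square sum_product inner_real_def mult_ac)
 moreover have "?a
   = ?b"
  using Uij by (simp add: sum_distrib_left[symmetric] power2_norm_eq_inner inner_vec_def)
 ultimately show "integrable M ?c"
  "expectation ?c = ?b"
  by (simp_all add: has_bochner_integral_iff)
qed

text \<open>The time \<open>min t (q m)\<close> instead of t is what the induction in
  \<open>step_isometry\<close> uses: the integral over the first m cells is known when the next
  increment starts.\<close>

lemma step_I_measurable:
 assumes sd: "step_data m q r" and t: "0 <= t"
 shows "step_I m q r t \<in> borel_measurable (F (min t (q m)))"
 unfolding step_I_def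
proof (rule borel_measurable_sum)
 let ?a = "borel_measurable (F (min t (q m)))"
 fix i assume i: "i \<in> {..<m}"
 have le: "q i <= q (Suc i)" "q (Suc i) <= q m" "0 <= q i" "r i \<in> borel_measurable (F (q i))"
  using i step_data_mono[OF sd, of i "Suc i"] step_data_mono[OF sd, of "Suc i" m] step_data_nonneg[OF sd, of i] sd
  by (auto simp: step_data_def)
 show "(%w. r i w \<bullet> (Z (min t (q (Suc i))) w - Z (min t (q i)) w)) \<in> ?a"
 proof (cases "q i <= t")
  case True
  have "r i \<in> ?a" using True le by (intro measurable_F_mono[OF le(4)]) auto
  moreover have "Z (min t (q (Suc i))) \<in> ?a" "Z (min t (q i)) \<in> ?a"
   using le t by (auto intro!: Z_F simp: min_def)
  ultimately show ?thesis by measurable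
 next
  case False
  thus ?thesis using le by (simp add: min_def)
 qed
qed

text \<open>Induction on the number of cells. The square of the new term has as its mean the new
  part of the quadratic variation, and the cross term has mean 0 because the new increment is
  independent of everything known at its start.\<close>

lemma step_isometry:
 assumes "step_data m q r" and t: "0 <= t"
 shows "integrable M (%w. (step_I m q r t w)^2) \<and> integrable M (step_Q m q r t) \<and>
  expectation (%w. (step_I m q r t w)^2) = expectation (step_Q m q r t)"
 using assms(1)
proof (induction m)
 case 0
 thus ?case by (simp add: step_I_def step_Q_def)
next
 case (Suc m)
 note sd = Suc.prems
 note IH = Suc.IH[OF step_data_Suc[OF sd]]
 let ?a = "min t (q m)" and ?b = "min t (q (Suc m))"
 let ?I = "step_I m q r t" and ?d = "%w. r m w \<bullet> (Z ?b w - Z ?a w)"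
 have ab: "0 <= ?a" "?a <= ?b" using step_data_nonneg[OF sd, of m] t sd by (auto simp: step_data_def min_def)
 obtain C where C: "0 <= C" "\<And>i w. i < Suc m ==> w \<in> space M ==> norm (r i w) <= C" by (rule step_data_bound[OF sd]) blast
 have meas: "r m \<in> borel_measurable (F (q m))" using sd by (auto simp: step_data_def)
 have I_meas: "?I \<in> borel_measurable (F ?a)" by (rule step_I_measurable[OF step_data_Suc[OF sd] t])
 have [measurable]: "r m \<in> borel_measurable M" "?I \<in> borel_measurable M"
  by (rule measurable_F_M[OF meas], rule measurable_F_M[OF I_meas])
 have r2: "integrable M (%w. (norm (r m w))^2)"
  using C by (intro integrable_const_bound[where B = "C^2"] AE_I2) (auto intro: power_mono)
 have d: "integrable M (%w. (?d w)^2) \<and> expectation (%w. (?d w)^2) = (?b - ?a) * expectation (%w. (norm (r m w))^2) \<and>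
   integrable M (%w. ?I w * ?d w) \<and> expectation (%w. ?I w * ?d w) = 0"
 proof (cases "q m <= t")
  case True
  hence a: "?a = q m" by simp
  hence mF: "r m \<in> borel_measurable (F ?a)" using meas by simp
  have I1: "integrable M ?I" by (rule square_integrable_imp_integrable) (use IH in auto)
  have "integrable M (%w. norm (?I w *\<^sub>R r m w))"
  proof (rule Bochner_Integration.integrable_bound)
   show "integrable M (%w. C * ?I w)" using I1 by simp
   show "AE w in M. norm (norm (?I w *\<^sub>R r m w)) <= norm (C * ?I w)"
    using C by (intro AE_I2) (auto simp: abs_mult mult.commute[of C] intro!: mult_left_mono)
  qed measurable
  moreover have "(%w. ?I w *\<^sub>R r m w) \<in> borel_measurable (F ?a)" using I_meas mF by measurable
  ultimately show ?thesis
   using increment_square[OF ab mF r2] increment_mean[OF ab, of "%w. ?I w *\<^sub>R r m w"] by simp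
 next
  case False
  hence "?b = ?a" using sd by (auto simp: step_data_def min_def)
  thus ?thesis by simp
 qed
 have eqI: "(step_I (Suc m) q r t w)^2 = (?I w)^2 + 2 * (?I w * ?d w) + (?d w)^2" for w
 proof -
  have "step_I (Suc m) q r t w = ?I w + ?d w" by (simp add: step_I_def)
  thus ?thesis by (simp add: power2_sum)
 qed
 have eqQ: "step_Q (Suc m) q r t = (%w. step_Q m q r t w + (?b - ?a) * (norm (r m w))^2)"
  by (simp add: step_Q_def fun_eq_iff)
 show ?case unfolding eqI eqQ using IH d r2 by simp
qed

lemma step_Q_nonneg: "step_data m \<tau> \<xi> ==> 0 <= step_Q m \<tau> \<xi> t w"
 unfolding step_Q_def step_data_def by (intro sum_nonneg mult_nonneg_nonneg) (auto simp: min_def)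

text \<open>The terms are nonnegative, so the ones that are kept form an initial segment, possibly
  empty, and the test for its last term bounds the sum by q.\<close>

lemma truncated_sum_le:
 fixes a :: "nat => real"
 assumes "\<And>i. i < m ==> 0 <= a i" "0 <= q"
 shows "(\<Sum>i<m. (if (\<Sum>j\<le>i. a j) <= q then a i else 0)) <= q"
 using assms
proof (induction m)
 case (Suc m)
 have "(\<Sum>i<m. (if (\<Sum>j\<le>i. a j) <= q then a i else 0)) <= (\<Sum>i<m. a i)" using Suc.prems by (intro sum_mono) auto
 thus ?case using Suc by (auto simp: lessThan_Suc_atMost[symmetric] not_le less_imp_le)
qed simp

text \<open>Stop the integrand as soon as its quadratic variation exceeds \<open>e\<close>.\<close>

lemma step_Lenglart:
 assumes sd: "step_data m q u" and t: "0 <= t" and A: "A \<in> sets M" and pos: "0 < r" "0 < e"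
 shows "prob (A \<inter> {w \<in> space M. r < \<bar>step_I m q u t w\<bar>}) <= prob (A \<inter> {w \<in> space M. e < step_Q m q u t w}) + e / r^2"
proof -
 let ?a = "A \<inter> {w \<in> space M. e < step_Q m q u t w}"
 let ?b = "%i. borel_measurable (F (q i))"
 let ?c = "A \<inter> {w \<in> space M. r < \<bar>step_I m q u t w\<bar>}"
 let ?d = "%v. ?a \<union> {w \<in> space M. r^2 <= (step_I m q v t w)^2}"
 define a where "a = (%i w. (norm (u i w))^2 * (min t (q (Suc i)) - min t (q i)))"
 \<comment> \<open>The test includes the variation of the i-th cell itself. It is known at the start
   of the cell, because the coefficient is known there and the length of the cell is deterministic;
   hence v is adapted and its variation never exceeds e.\<close>
 define v where "v = (%i w. if (\<Sum>j\<le>i. a j w) <= e then u i w else 0)"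
 have a_nn: "0 <= a i w" if "i < m" for i w
  using sd that unfolding a_def step_data_def by (intro mult_nonneg_nonneg) (auto simp: min_def)
 have sd': "step_data m q v"
 proof -
  have "v i \<in> ?b i" if i: "i < m" for i
  proof -
   have [measurable]: "u j \<in> ?b i" if "j <= i" for j
   proof (rule measurable_F_mono)
    show "u j \<in> ?b j" using sd that i unfolding step_data_def by simp
    show "q j <= q i" using step_data_mono[OF sd that] i by simp
   qed
   have "(%w. \<Sum>j\<le>i. a j w) \<in> ?b i"
    unfolding a_def by (intro borel_measurable_sum borel_measurable_times borel_measurable_power borel_measurable_norm) auto
   from borel_measurable_le[OF this borel_measurable_const[of e]]
   have "{w \<in> space (F (q i)). (\<Sum>j\<le>i. a j w) <= e} \<in> sets (F (q i))" .
   moreover have "u i \<in> ?b i" by simp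
   ultimately show ?thesis unfolding v_def by (intro measurable_If borel_measurable_const)
  qed
  moreover obtain C where C: "0 <= C" "\<And>i w. i < m ==> w \<in> space M ==> norm (u i w) <= C"
   by (rule step_data_bound[OF sd]) blast
  have "norm (v i w) <= C" if "i < m" "w \<in> space M" for i w using C(1) C(2)[OF that] by (simp add: v_def)
  ultimately show ?thesis using sd unfolding step_data_def by blast
 qed
 have Q': "step_Q m q v t w <= e" for w
 proof -
  have "step_Q m q v t w = (\<Sum>i<m. (if (\<Sum>j\<le>i. a j w) <= e then a i w else 0))"
   unfolding step_Q_def by (intro sum.cong) (auto simp: v_def a_def)
  also have "... <= e" using a_nn pos by (intro truncated_sum_le) auto
  finally show ?thesis .
 qed
 have eq: "step_I m q v t w = step_I m q u t w" if "step_Q m q u t w <= e" for w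
 proof -
  have "(\<Sum>j\<le>i. a j w) <= e" if "i < m" for i
  proof -
   have "(\<Sum>j\<le>i. a j w) <= (\<Sum>j<m. a j w)" using that a_nn by (intro sum_mono2) auto
   also have "... <= e" using \<open>step_Q m q u t w \<le> e\<close> by (simp add: step_Q_def a_def)
   finally show ?thesis .
  qed
  thus ?thesis unfolding step_I_def by (intro sum.cong) (auto simp: v_def)
 qed
 have [measurable]: "step_I m q v t \<in> borel_measurable M" "step_I m q u t \<in> borel_measurable M"
  by (rule measurable_F_M[OF step_I_measurable[OF sd' t]], rule measurable_F_M[OF step_I_measurable[OF sd t]])
 have [measurable]: "step_Q m q u t \<in> borel_measurable M" using step_isometry[OF sd t] by blast
 note iso = step_isometry[OF sd' t]
 have "expectation (step_Q m q v t) <= e" using integral_mono[of M "step_Q m q v t" "%_. e"] iso Q' by (simp add: prob_space)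
 hence "prob {w \<in> space M. r^2 <= (step_I m q v t w)^2} <= e / r^2"
  using integral_Markov_inequality_measure[of M "%w. (step_I m q v t w)^2" "{}" "r^2"] iso pos
  by (auto intro: order_trans[OF _ divide_right_mono])
 moreover have "prob (A \<inter> {w \<in> space M. r < \<bar>step_I m q u t w\<bar>})
   <= prob (?a \<union> {w \<in> space M. r^2 <= (step_I m q v t w)^2})"
 proof (rule finite_measure_mono)
  show "?c \<subseteq> ?d v"
  proof
   fix x assume x: "x \<in> ?c"
   show "x \<in> ?d v"
    using eq[of x] x pos abs_le_square_iff[of r "step_I m q v t x"] by (cases "e < step_Q m q u t x") auto
  qed
 qed (use A in measurable)
 moreover have "... <= prob ?a + prob {w \<in> space M. r^2 <= (step_I m q v t w)^2}"
  using A by (intro measure_Un_le) auto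
 ultimately show ?thesis by linarith
qed

end

section \<open>Predictable processes and convergence in probability\<close>

context brownian
begin

lemma measurable_M_cong:
 fixes X Y :: "'w => 'b::topological_space"
 assumes X: "X \<in> borel_measurable M" and ae: "AE w in M. X w = Y w"
 shows "Y \<in> borel_measurable M"
proof (rule measurableI)
 fix A :: "'b set" assume A: "A \<in> sets borel"
 show "Y -` A \<inter> space M \<in> sets M"
  by (rule M_cong[OF measurable_sets[OF X A]]) (use ae in auto)
qed auto

abbreviation (input) "predictable_process \<equiv> predictable M F"

lemma predictable_generators:
 "{{0} \<times> A | A. A \<in> sets (F 0)} \<union> {{s<..t} \<times> A | s t A. 0 <= s \<and> s <= t \<and> A \<in> sets (F s)} \<subseteq> Pow ({0..} \<times> space M)"
proof -
 have "A \<subseteq> space M" if "A \<in> sets (F s)" for A s using sets.sets_into_space[OF that] by simp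
 thus ?thesis by auto
qed

lemma predictable_generator_cases:
 assumes "y \<in> {{0} \<times> A | A. A \<in> sets (F 0)} \<union> {{s<..t} \<times> A | s t A. 0 <= s \<and> s <= t \<and> A \<in> sets (F s)}"
 shows "\<exists>S u A. y = S \<times> A \<and> A \<in> sets (F u) \<and> S \<in> sets borel \<and> S \<subseteq> {0..} \<and> (\<forall>t\<in>S. u <= t)"
 using assms
proof
 assume "y \<in> {{0} \<times> A | A. A \<in> sets (F 0)}"
 then obtain A where "y = {0} \<times> A" "A \<in> sets (F 0)" by blast
 thus ?thesis by (intro exI[of _ "{0}"] exI[of _ 0] exI[of _ A]) simp
next
 assume "y \<in> {{s<..t} \<times> A | s t A. 0 <= s \<and> s <= t \<and> A \<in> sets (F s)}"
 then obtain s t A where "y = {s<..t} \<times> A" "0 <= s" "A \<in> sets (F s)" by blast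
 thus ?thesis by (intro exI[of _ "{s<..t}"] exI[of _ s] exI[of _ A]) auto
qed

lemma space_predictable: "space (predictable_algebra M F) = {0..} \<times> space M"
 unfolding predictable_algebra_def by (rule space_measure_of[OF predictable_generators])

lemma predictable_rect0: "A \<in> sets (F 0) ==> {0} \<times> A \<in> sets (predictable_algebra M F)"
 unfolding predictable_algebra_def by (subst sets_measure_of[OF predictable_generators]) auto

lemma predictable_rect: "0 <= s ==> s <= t ==> A \<in> sets (F s) ==> {s<..t} \<times> A \<in> sets (predictable_algebra M F)"
 unfolding predictable_algebra_def by (subst sets_measure_of[OF predictable_generators]) blast

lemma predictable_section:
 assumes t: "0 <= t" shows "(%w. (t, w)) \<in> measurable (F t) (predictable_algebra M F)"
 unfolding predictable_algebra_def
proof (rule measurable_measure_of[OF predictable_generators])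
 show "(%w. (t, w)) \<in> space (F t) \<rightarrow> {0..} \<times> space M" using t by auto
 fix y assume "y \<in> {{0} \<times> A | A. A \<in> sets (F 0)} \<union> {{s<..t} \<times> A | s t A. 0 <= s \<and> s <= t \<and> A \<in> sets (F s)}"
 from predictable_generator_cases[OF this] obtain S u A
  where y: "y = S \<times> A" "A \<in> sets (F u)" "t \<in> S ==> u <= t" by blast
 have "(%w. (t, w)) -` y \<inter> space (F t) = (if t \<in> S then A else {})"
  using y sets.sets_into_space[OF y(2)] by auto
 thus "(%w. (t, w)) -` y \<inter> space (F t) \<in> sets (F t)" using y(2) F_mono[OF y(3)] by (simp add: subset_eq)
qed

lemma predictable_adapted: "predictable M F H ==> 0 <= t ==> H t \<in> borel_measurable (F t)"
 using measurable_compose[OF predictable_section, of t "%(t, w). H t w" borel] unfolding predictable_def by simp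

lemma predictable_subalgebra:
 "(%x. x) \<in> measurable (restrict_space (lborel \<Otimes>\<^sub>M M) ({0..} \<times> space M)) (predictable_algebra M F)"
 unfolding predictable_algebra_def
proof (rule measurable_measure_of[OF predictable_generators])
 let ?a = "restrict_space (lborel \<Otimes>\<^sub>M M) ({0..} \<times> space M)"
 show "(%x. x) \<in> space ?a \<rightarrow> {0..} \<times> space M"
  by (auto simp: space_restrict_space)
 fix y assume "y \<in> {{0} \<times> A | A. A \<in> sets (F 0)} \<union> {{s<..t} \<times> A | s t A. 0 <= s \<and> s <= t \<and> A \<in> sets (F s)}"
 from predictable_generator_cases[OF this] obtain S u A
  where y: "y = S \<times> A" "A \<in> sets (F u)" "S \<in> sets borel" "S \<subseteq> {0..}" by blast
 have "y \<in> sets (lborel \<Otimes>\<^sub>M M)" using y sets_F[OF y(2)] by (auto intro!: pair_measureI)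
 moreover have "y \<subseteq> {0..} \<times> space M" using y sets.sets_into_space[OF y(2)] by auto
 ultimately show "(%x. x) -` y \<inter> space ?a \<in> sets ?a"
  by (auto simp: sets_restrict_space space_restrict_space image_iff intro!: bexI[of _ y])
qed

text \<open>The factor \<open>indicator {0..}\<close> leaves the values at negative times
  unconstrained, in accordance with \<open>predictable\<close>, whose underlying space has
  nonnegative times only.\<close>

definition jointly :: "(real => 'w => 'b::real_normed_vector) => bool" where
 "jointly H \<longleftrightarrow> (%(t, w). indicator {0..} t *\<^sub>R H t w) \<in> borel_measurable (lborel \<Otimes>\<^sub>M M)"

lemma predictable_jointly:
 assumes "predictable M F H" shows "jointly H"
proof -
 have "(%(t, w). H t w) \<in> borel_measurable (restrict_space (lborel \<Otimes>\<^sub>M M) ({0..} \<times> space M))"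
  using measurable_compose[OF predictable_subalgebra assms[unfolded predictable_def]] by simp
 hence m: "(%x. indicator ({0..} \<times> space M) x *\<^sub>R (case x of (t, w) => H t w)) \<in> borel_measurable (lborel \<Otimes>\<^sub>M M)"
  by (subst (asm) borel_measurable_restrict_space_iff) auto
 show ?thesis unfolding jointly_def
  by (rule measurable_cong[THEN iffD1, OF _ m]) (auto simp: space_pair_measure indicator_def)
qed

lemma predictable_Pair:
 fixes H :: "real => 'w => 'b::second_countable_topology" and H' :: "real => 'w => 'c::second_countable_topology"
 assumes "predictable M F H" "predictable M F H'" "(%x. f (fst x) (snd x)) \<in> borel_measurable borel"
 shows "predictable M F (%t w. f (H t w) (H' t w))"
proof -
 have "(%x. (case x of (t, w) => H t w, case x of (t, w) => H' t w)) \<in> borel_measurable (predictable_algebra M F)"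
  using assms(1,2) unfolding predictable_def by (rule borel_measurable_Pair)
 from measurable_compose[OF this assms(3)] show ?thesis
  unfolding predictable_def by (simp add: case_prod_beta)
qed

lemma predictable_compose:
 assumes "predictable M F H" "f \<in> borel_measurable borel"
 shows "predictable M F (%t w. f (H t w))"
 using measurable_compose[OF assms(1)[unfolded predictable_def] assms(2)] unfolding predictable_def
 by (simp add: case_prod_beta)

text \<open>Sampling the process at the left end of each half-open grid cell gives predictable
  processes, since the sampled value is known when the cell begins. They converge to the process by
  continuity.\<close>

lemma adapted_continuous_predictable:
 assumes X: "adapted_continuous M F X" shows "predictable M F X"
 unfolding predictable_def
proof (rule borel_measurable_LIMSEQ_real)
 let ?a = "%k t. nat \<lceil>real (Suc k) * t\<rceil> - 1"
 let ?b = "%l k A. (%(t, w). X (l k t) w) -` A \<inter> space (predictable_algebra M F)"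
 let ?c = "%i k. real i / real (Suc k)"
 \<comment> \<open>The left end of the cell \<open>{i/(k+1)<..(i+1)/(k+1)}\<close> that contains t:
   the ceiling is i + 1, hence the subtraction of 1. The time 0 lies in no cell and is its own
   sampling point.\<close>
 define l where "l = (%(k::nat) t. if t = 0 then 0 else real (?a k t) / real (Suc k))"
 have l: "0 <= l k t" "\<bar>l k t - t\<bar> <= 1 / real (Suc k)" if "0 <= t" for k t
 proof -
  show "0 <= l k t" by (simp add: l_def)
  show "\<bar>l k t - t\<bar> <= 1 / real (Suc k)"
  proof (cases "t = 0")
   case False
   hence "0 < real (Suc k) * t" using that by simp
   hence "real (?a k t) = of_int \<lceil>real (Suc k) * t\<rceil> - 1"
    by (subst of_nat_diff) (auto simp: Suc_le_eq)
   hence "\<bar>real (?a k t) - real (Suc k) * t\<bar> <= 1" by linarith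
   moreover have "l k t - t = (real (?a k t) - real (Suc k) * t) / real (Suc k)"
    using False unfolding l_def by (simp add: diff_divide_distrib del: of_nat_Suc)
   ultimately show ?thesis by (simp add: divide_right_mono del: of_nat_Suc)
  qed (simp add: l_def)
 qed
 show "(%(t, w). X (l k t) w) \<in> borel_measurable (predictable_algebra M F)" for k
 proof (rule measurableI)
  fix A :: "real set" assume A: "A \<in> sets borel"
  define S where "S = (%i::nat. {real i / real (Suc k)<..real (Suc i) / real (Suc k)})"
  define E where "E = (%i. X i -` A \<inter> space M)"
  have E: "E i \<in> sets (F i)" if "0 <= i" for i
   using measurable_sets[of "X i" "F i" borel A] X A that unfolding E_def adapted_continuous_def by auto
  have lS: "l k t = ?c i k" if "t \<in> S i" for t i
  proof -
   have "real i < real (Suc k) * t" "real (Suc k) * t <= real (Suc i)"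
    using that unfolding S_def by (simp_all add: field_simps)
   hence "\<lceil>real (Suc k) * t\<rceil> = int (Suc i)" by (intro ceiling_unique) auto
   moreover have "0 <= ?c i k" by simp
   moreover have "?c i k < t" using that unfolding S_def by (simp only: greaterThanAtMost_iff)
   ultimately have "t ~= 0" by linarith
   moreover note \<open>\<lceil>real (Suc k) * t\<rceil> = int (Suc i)\<close>
   ultimately show ?thesis by (simp add: l_def)
  qed
  have cover: "\<exists>i. t \<in> S i" if "0 < t" for t
  proof -
   define n where "n = nat \<lceil>real (Suc k) * t\<rceil> - 1"
   have "0 < real (Suc k) * t" using that by simp
   hence "real n = of_int \<lceil>real (Suc k) * t\<rceil> - 1" unfolding n_def
    by (subst of_nat_diff) (auto simp: Suc_le_eq)
   hence "real n < real (Suc k) * t" "real (Suc k) * t <= real (Suc n)" by linarith+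
   thus ?thesis unfolding S_def by (intro exI[of _ n]) (simp add: field_simps)
  qed
  have "?b l k A
    = ({0} \<times> E 0) \<union> (\<Union>i. S i \<times> E (real i / real (Suc k)))" (is "?L = ?R")
  proof (intro equalityI subsetI)
   fix x assume "x \<in> ?L"
   then obtain t w where x: "x = (t, w)" "0 <= t" "w \<in> space M" "X (l k t) w \<in> A" by (auto simp: space_predictable)
   show "x \<in> ?R"
   proof (cases "t = 0")
    case True thus ?thesis using x by (simp add: l_def E_def)
   next
    case False
    then obtain i where "t \<in> S i" using cover[of t] x by auto
    thus ?thesis using x lS by (auto simp: E_def)
   qed
  next
   fix x assume x: "x \<in> ?R"
   have "0 <= t" if "t \<in> S i" for t i
   proof -
    have "0 <= ?c i k" by simp
    moreover have "?c i k < t" using that unfolding S_def by (simp only: greaterThanAtMost_iff)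
    ultimately show ?thesis by linarith
   qed
   moreover have "l k 0 = 0" by (simp add: l_def)
   ultimately show "x \<in> ?L" using x lS by (auto simp: space_predictable E_def simp del: of_nat_Suc)
  qed
  also have "... \<in> sets (predictable_algebra M F)"
   using E unfolding S_def
   by (intro sets.Un sets.countable_UN predictable_rect0 image_subsetI predictable_rect) (auto simp: field_simps)
  finally show "?b l k A \<in> sets (predictable_algebra M F)" .
 qed simp
 fix x assume "x \<in> space (predictable_algebra M F)"
 then obtain t w where x: "x = (t, w)" "0 <= t" "w \<in> space M" by (auto simp: space_predictable)
 have "(%k. l k t) \<longlonglongrightarrow> t"
  using l(2)[OF x(2)] LIMSEQ_inverse_real_of_nat
  by (intro LIM_zero_cancel[OF Lim_null_comparison[of "%k. l k t - t" "%k. 1 / real (Suc k)"]])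
    (auto simp: inverse_eq_divide simp del: of_nat_Suc)
 hence "(%k. X (l k t) w) \<longlonglongrightarrow> X t w"
  using X x l(1) unfolding adapted_continuous_def
  by (intro continuous_on_tendsto_compose[of "{0..}" "%t. X t w"]) auto
 thus "(%k. case x of (t, w) => X (l k t) w) \<longlonglongrightarrow> (case x of (t, w) => X t w)" by (simp add: x)
qed

lemma jointly_section: "jointly H ==> 0 <= t ==> H t \<in> borel_measurable M"
 unfolding jointly_def
 by (drule measurable_compose[of "%w. (t, w)" M "lborel \<Otimes>\<^sub>M M", rotated]) (measurable, simp)

lemma jointly_linear:
 fixes H H' :: "real => 'w => 'b::{second_countable_topology, real_normed_vector}"
 assumes "jointly H" "jointly H'"
 shows "jointly (%t w. a *\<^sub>R H t w + b *\<^sub>R H' t w)"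
proof -
 have "(%x. a *\<^sub>R (case x of (t, w) => indicator {0..} t *\<^sub>R H t w) + b *\<^sub>R (case x of (t, w) => indicator {0..} t *\<^sub>R H' t w))
   \<in> borel_measurable (lborel \<Otimes>\<^sub>M M)"
  using assms unfolding jointly_def by measurable
 thus ?thesis unfolding jointly_def
  by (rule measurable_cong[THEN iffD1, rotated]) (auto simp: scaleR_add_right mult.commute)
qed

lemma jointly_diff:
 fixes H H' :: "real => 'w => 'b::{second_countable_topology, real_normed_vector}"
 shows "jointly H ==> jointly H' ==> jointly (%t w. H t w - H' t w)"
 using jointly_linear[of H H' 1 "-1"] by simp

lemma jointly_compose:
 fixes H :: "real => 'w => 'b::real_normed_vector" and f :: "'b => 'c::{second_countable_topology, real_normed_vector}"
 assumes "jointly H" "f \<in> borel_measurable borel"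
 shows "jointly (%t w. f (H t w))"
proof -
 have "(%x. indicator {0..} (fst x) *\<^sub>R f (case x of (t, w) => indicator {0..} t *\<^sub>R H t w)) \<in> borel_measurable (lborel \<Otimes>\<^sub>M M)"
  by (intro borel_measurable_scaleR measurable_compose[OF assms(1)[unfolded jointly_def] assms(2)]) measurable
 thus ?thesis unfolding jointly_def
  by (rule measurable_cong[THEN iffD1, rotated]) (auto simp: indicator_def)
qed

section \<open>Energies of integrands and convergence in probability\<close>

definition energy :: "real => (real => 'w => 'b::real_normed_vector) => 'w => ennreal" where
 "energy t H w = nnint {0..t} (%s. esq (norm (H s w)))"

lemma energy_measurable [measurable]:
 fixes H :: "real => 'w => 'b::{second_countable_topology, real_normed_vector}"
 assumes H: "jointly H" shows "energy t H \<in> borel_measurable M"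
proof -
 have [measurable]: "(%(t, w). indicator {0..} t *\<^sub>R H t w) \<in> borel_measurable (lborel \<Otimes>\<^sub>M M)"
  using H unfolding jointly_def .
 have "(%w. nnint {0..t} (%s. esq (norm (case (s, w) of (t, w) => indicator {0..} t *\<^sub>R H t w)))) \<in> borel_measurable M"
  by measurable
 moreover have "nnint {0..t} (%s. esq (norm (case (s, w) of (t, w) => indicator {0..} t *\<^sub>R H t w))) = energy t H w" for w
  unfolding energy_def by (intro nn_integral_cong) (auto simp: indicator_def)
 ultimately show ?thesis by (simp cong: measurable_cong)
qed

lemma sq_norm_add_le: "(norm (x + y))^2 <= 2 * (norm x)^2 + 2 * (norm (y::'b::real_normed_vector))^2"
proof -
 have "(norm (x + y))^2 <= (norm x + norm y)^2" by (intro power_mono norm_triangle_ineq) auto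
 thus ?thesis using sum_squares_bound[of "norm x" "norm y"] by (simp add: power2_sum)
qed

lemma energy_add_le:
 fixes H H' :: "real => 'w => 'b::{second_countable_topology, real_normed_vector}"
 assumes "jointly H" "jointly H'" and w: "w \<in> space M"
 shows "energy t (%t w. a *\<^sub>R H t w + b *\<^sub>R H' t w) w <= ennreal (2 * a^2) * energy t H w + ennreal (2 * b^2) * energy t H' w"
proof -
 let ?a = "borel_measurable lborel"
 have sec: "(%s. indicator {0..} s *\<^sub>R H s w) \<in> ?a" if "jointly H" for H :: "real => 'w => 'b"
  using measurable_compose[OF _ that[unfolded jointly_def], of "%s. (s, w)" lborel] w by simp
 have m: "(%s. esq (norm (H s w)) * indicator {0..t} s) \<in> ?a" if "jointly H" for H :: "real => 'w => 'b"
 proof -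
  have "(%s. esq (norm (indicator {0..} s *\<^sub>R H s w)) * indicator {0..t} s) \<in> ?a"
   using sec[OF that] by measurable
  thus ?thesis by (rule measurable_cong[THEN iffD1, rotated]) (auto simp: indicator_def)
 qed
 have "energy t (%t w. a *\<^sub>R H t w + b *\<^sub>R H' t w) w
   <= (\<L> s. ennreal (2 * a^2) * (esq (norm (H s w)) * indicator {0..t} s)
     + ennreal (2 * b^2) * (esq (norm (H' s w)) * indicator {0..t} s))"
  unfolding energy_def
 proof (rule nn_integral_mono)
  fix s
  have "esq (norm (a *\<^sub>R H s w + b *\<^sub>R H' s w)) <= ennreal (2 * a^2 * (norm (H s w))^2 + 2 * b^2 * (norm (H' s w))^2)"
   using sq_norm_add_le[of "a *\<^sub>R H s w" "b *\<^sub>R H' s w"] by (intro ennreal_leI) (simp add: power_mult_distrib)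
  also have "... = ennreal (2 * a^2) * esq (norm (H s w)) + ennreal (2 * b^2) * esq (norm (H' s w))"
   by (simp add: ennreal_plus ennreal_mult)
  finally show "esq (norm (a *\<^sub>R H s w + b *\<^sub>R H' s w)) * indicator {0..t} s
    <= ennreal (2 * a^2) * (esq (norm (H s w)) * indicator {0..t} s)
     + ennreal (2 * b^2) * (esq (norm (H' s w)) * indicator {0..t} s)"
   by (auto simp: indicator_def)
 qed
 also have "... = ennreal (2 * a^2) * energy t H w + ennreal (2 * b^2) * energy t H' w"
 proof -
  define q where "q = (%s. esq (norm (H s w)) * indicator {0..t} s)"
  define q' where "q' = (%s. esq (norm (H' s w)) * indicator {0..t} s)"
  have [measurable]: "q \<in> ?a" "q' \<in> ?a"
   unfolding q_def q'_def using m[OF assms(1)] m[OF assms(2)] by auto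
  have "(\<L> s. ennreal (2 * a^2) * q s + ennreal (2 * b^2) * q' s)
    = ennreal (2 * a^2) * (\<L> s. q s) + ennreal (2 * b^2) * (\<L> s. q' s)"
   by (simp add: nn_integral_add nn_integral_cmult)
  thus ?thesis by (simp add: q_def q'_def energy_def)
 qed
 finally show ?thesis .
qed

text \<open>Convergence to 0 in probability on the event A. The restriction to an event lets two
  integrals be compared where the paths are bounded, without stopping them.\<close>

definition cip :: "'w set => (nat => 'w => ennreal) => bool" where
 "cip A X \<longleftrightarrow> (\<forall>\<epsilon>>0. (%k. prob (A \<inter> {w \<in> space M. ennreal \<epsilon> < X k w})) \<longlonglongrightarrow> 0)"

lemma cip_subset:
 assumes "cip A X" "B \<subseteq> A" "A \<in> sets M" "\<And>k. X k \<in> borel_measurable M"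
 shows "cip B X"
 unfolding cip_def
proof (intro allI impI)
 fix q :: real assume "0 < q"
 hence "(%k. prob (A \<inter> {w \<in> space M. ennreal q < X k w})) \<longlonglongrightarrow> 0" using assms(1) by (simp add: cip_def)
 thus "(%k. prob (B \<inter> {w \<in> space M. ennreal q < X k w})) \<longlonglongrightarrow> 0"
  by (rule tendsto_sandwich[OF _ _ tendsto_const, rotated 2])
    (use assms(2,3,4) in \<open>auto intro!: always_eventually finite_measure_mono\<close>)
qed

text \<open>A comparison principle: measurability is asked of the dominating variables, so V may be
  an uncountable supremum over times.\<close>

lemma cip_add:
 assumes X: "cip A X" "\<And>k. X k \<in> borel_measurable M" and Y: "cip A Y" "\<And>k. Y k \<in> borel_measurable M"
  and A: "A \<in> sets M" and c: "0 <= c"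
  and le: "\<And>k. AE w in M. w \<in> A \<longrightarrow> V k w <= ennreal c * (X k w + Y k w)"
 shows "cip A V"
 unfolding cip_def
proof (intro allI impI)
 let ?a = "%\<delta> k. A \<inter> {w \<in> space M. ennreal \<delta> < X k w}"
 let ?b = "%\<delta> k. A \<inter> {w \<in> space M. ennreal \<delta> < Y k w}"
 let ?c = "%r k. A \<inter> {w \<in> space M. ennreal r < V k w}"
 fix r :: real assume r: "0 < r"
 \<comment> \<open>Two variables below \<delta> keep V below 2 c \<delta>, hence below r; adding 1
   to c avoids a division by zero.\<close>
 define \<delta> where "\<delta> = r / (2 * (c + 1))"
 have \<delta>: "0 < \<delta>" "2 * (c * \<delta>) <= r" using r c by (simp_all add: \<delta>_def field_simps)
 note [measurable] = X(2) Y(2) A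
 define q where "q = (%k. prob (?a \<delta> k) + prob (?b \<delta> k))"
 have "q \<longlonglongrightarrow> 0 + 0" unfolding q_def using X(1) Y(1) \<delta>(1) by (intro tendsto_add) (auto simp: cip_def)
 hence q: "q \<longlonglongrightarrow> 0" by simp
 have "prob (?c r k) <= q k" for k
 proof -
  have "prob (?c r k)
    <= prob ((?a \<delta> k) \<union> (?b \<delta> k))"
  proof (rule finite_measure_mono_AE)
   show "AE w in M. w \<in> A \<inter> {w \<in> space M. ennreal r < V k w} \<longrightarrow> w \<in> (A \<inter> {w \<in> space M. ennreal \<delta> < X k w}) \<union> (A \<inter> {w \<in> space M. ennreal \<delta> < Y k w})"
    using le[of k]
   proof eventually_elim
    case (elim w)
    show ?case
    proof (intro impI)
     assume *: "w \<in> A \<inter> {w \<in> space M. ennreal r < V k w}"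
     { assume "X k w <= ennreal \<delta>" "Y k w <= ennreal \<delta>"
      hence "ennreal c * (X k w + Y k w) <= ennreal c * (ennreal \<delta> + ennreal \<delta>)" by (intro mult_left_mono add_mono) auto
      also have "... = ennreal (2 * (c * \<delta>))" using \<delta>(1) c by (simp add: ennreal_mult[symmetric] ennreal_plus[symmetric] del: ennreal_plus)
      also have "... <= ennreal r" using \<delta>(2) by (rule ennreal_leI)
      finally have False using * elim by (auto dest: order.strict_trans2 simp: not_less[symmetric]) }
     thus "w \<in> (?a \<delta> k) \<union> (?b \<delta> k)"
      using * by (auto simp: not_less[symmetric])
    qed
   qed
  qed measurable
  also have "... <= q k" unfolding q_def by (intro measure_Un_le) measurable
  finally show ?thesis .
 qed
 thus "(%k. prob (?c r k)) \<longlonglongrightarrow> 0"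
  by (intro tendsto_sandwich[OF _ _ tendsto_const q]) (auto intro!: always_eventually)
qed

lemma step_H_jointly:
 assumes "step_data m \<tau> q" shows "jointly (step_H m \<tau> q)"
proof -
 have [measurable]: "q i \<in> borel_measurable M" if "i < m" for i
  by (rule measurable_F_M) (use assms that in \<open>auto simp: step_data_def\<close>)
 show ?thesis
  unfolding jointly_def step_H_def by measurable
qed

lemma elementary_jointly: "elementary_integral M Z H I ==> jointly H"
 unfolding elementary_integral_iff using step_H_jointly by auto

lemma elementary_measurable: "elementary_integral M Z H I ==> 0 <= t ==> I t \<in> borel_measurable M"
 unfolding elementary_integral_iff by (elim exE conjE) (auto intro: measurable_F_M step_I_measurable)

lemma elementary_energy:
 assumes "step_data m q r" "0 <= t" shows "energy t (step_H m q r) w = ennreal (step_Q m q r t w)"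
 unfolding energy_def by (rule step_Q_integral[OF assms])

lemma elementary_isometry:
 assumes "elementary_integral M Z H I" "0 <= t"
 shows "(\<E> w. esq (I t w)) = (\<E> w. energy t H w)"
  and "integrable M (%w. (I t w)^2)"
  and "(\<E> w. energy t H w) < \<infinity>"
proof -
 let ?a = "\<E> w. energy t H w"
 obtain m q r where *: "step_data m q r" "H = step_H m q r" "I = step_I m q r"
  using assms(1) unfolding elementary_integral_iff by auto
 note iso = step_isometry[OF *(1) assms(2)]
 have 1: "?a = ennreal (expectation (step_Q m q r t))"
  unfolding *(2) elementary_energy[OF *(1) assms(2)]
  using iso by (intro nn_integral_eq_integral) (auto simp: step_Q_nonneg[OF *(1)])
 have 2: "(\<E> w. esq (I t w)) = ennreal (expectation (%w. (step_I m q r t w)^2))"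
  unfolding *(3) using iso by (intro nn_integral_eq_integral) auto
 show "(\<E> w. esq (I t w)) = ?a" "?a < \<infinity>"
  unfolding 1 2 using iso by auto
 show "integrable M (%w. (I t w)^2)" using iso *(3) by simp
qed

text \<open>By \<open>step_Lenglart\<close> an integral above u is as likely as an energy above v,
  up to an error \<open>v / u^2\<close>. Here v is fixed so that the error is r / 2, and only then
  is k taken large.\<close>

lemma elementary_Lenglart:
 assumes el: "\<And>k. elementary_integral M Z (D k) (E k)" and t: "0 <= t" and A: "A \<in> sets M"
  and c: "cip A (%k. energy t (D k))"
 shows "cip A (%k w. ennreal \<bar>E k t w\<bar>)"
 unfolding cip_def
proof (intro allI impI)
 let ?a = "%v k. A \<inter> {w \<in> space M. ennreal v < energy t (D k) w}"
 let ?b = "%u k. A \<inter> {w \<in> space M. u < \<bar>E k t w\<bar>}"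
 fix u :: real assume u: "0 < u"
 have eq: "{w \<in> space M. ennreal u < ennreal \<bar>E k t w\<bar>} = {w \<in> space M. u < \<bar>E k t w\<bar>}" for k
  using u by (auto simp: ennreal_less_iff)
 have bound: "prob (?b u k) <= prob (?a v k) + v / u^2"
  if v: "0 < v" for k v
 proof -
  obtain m q e where *: "step_data m q e" "D k = step_H m q e" "E k = step_I m q e"
   using el[of k] unfolding elementary_integral_iff by auto
  have "{w \<in> space M. ennreal v < energy t (D k) w} = {w \<in> space M. v < step_Q m q e t w}"
   unfolding *(2) elementary_energy[OF *(1) t] using v by (auto simp: ennreal_less_iff)
  thus ?thesis using step_Lenglart[OF *(1) t A u v] *(3) by simp
 qed
 show "(%k. prob (A \<inter> {w \<in> space M. ennreal u < ennreal \<bar>E k t w\<bar>})) \<longlonglongrightarrow> 0"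
  unfolding eq
 proof (rule LIMSEQ_I)
  fix r :: real assume r: "0 < r"
  define v where "v = r * u^2 / 2"
  have v: "0 < v" "v / u^2 = r / 2" using r u by (simp_all add: v_def)
  have "(%k. prob (?a v k)) \<longlonglongrightarrow> 0" using c v(1) by (simp add: cip_def)
  then obtain N where "\<And>k. k \<ge> N ==> prob (?a v k) < r / 2"
   using LIMSEQ_D[of _ 0 "r / 2"] r by fastforce
  hence "prob (?b u k) < r" if "k \<ge> N" for k
   using bound[OF v(1), of k] v(2) that by fastforce
  thus "\<exists>N. \<forall>k\<ge>N. norm (prob (?b u k) - 0) < r" by auto
 qed
qed

text \<open>\<open>ito_at t H V\<close>: \<open>V\<close> is the stochastic integral of \<open>H\<close> over the fixed interval \<open>[0,t]\<close>.\<close>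

definition ito_at :: "real => (real => 'w => real ^ 'n) => ('w => real) => bool" where
 "ito_at t H V \<longleftrightarrow> jointly H \<and> V \<in> borel_measurable M \<and>
   (\<exists>Hs Is. (\<forall>k. elementary_integral M Z (Hs k) (Is k)) \<and>
    cip (space M) (%k. energy t (%s w. Hs k s w - H s w)) \<and>
    cip (space M) (%k w. ennreal \<bar>Is k t w - V w\<bar>))"

lemma energy_zero: "energy t (%s w. 0) w = 0"
 by (simp add: energy_def)

lemma elementary_ito_at: "elementary_integral M Z H I ==> 0 <= t ==> ito_at t H (I t)"
 unfolding ito_at_def
 by (intro conjI elementary_jointly elementary_measurable exI[of _ "%_. H"] exI[of _ "%_. I"])
   (auto simp: cip_def energy_zero)

lemma ito_at_linear:
 assumes 1: "ito_at t H V" and 2: "ito_at t H' V'" and t: "0 <= t"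
 shows "ito_at t (%s w. a *\<^sub>R H s w + b *\<^sub>R H' s w) (%w. a * V w + b * V' w)"
proof -
 let ?a = "%Hs k Hs'. %s w. (a *\<^sub>R Hs k s w + b *\<^sub>R Hs' k s w) - (a *\<^sub>R H s w + b *\<^sub>R H' s w)"
 let ?b = "%Is k w Is'. ennreal (\<bar>a\<bar> + \<bar>b\<bar>) * (ennreal \<bar>Is k t w - V w\<bar> + ennreal \<bar>Is' k t w - V' w\<bar>)"
 obtain Hs Is where H: "jointly H" "V \<in> borel_measurable M" "\<And>k. elementary_integral M Z (Hs k) (Is k)"
  "cip (space M) (%k. energy t (%s w. Hs k s w - H s w))" "cip (space M) (%k w. ennreal \<bar>Is k t w - V w\<bar>)"
  using 1 unfolding ito_at_def by auto
 obtain Hs' Is' where H': "jointly H'" "V' \<in> borel_measurable M" "\<And>k. elementary_integral M Z (Hs' k) (Is' k)"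
  "cip (space M) (%k. energy t (%s w. Hs' k s w - H' s w))" "cip (space M) (%k w. ennreal \<bar>Is' k t w - V' w\<bar>)"
  using 2 unfolding ito_at_def by auto
 have jd: "jointly (%s w. Hs k s w - H s w)" "jointly (%s w. Hs' k s w - H' s w)" for k
  by (intro jointly_diff elementary_jointly[OF H(3)] H(1), intro jointly_diff elementary_jointly[OF H'(3)] H'(1))
 note [measurable] = H(2) H'(2) elementary_measurable[OF H(3) t] elementary_measurable[OF H'(3) t]
 have "cip (space M) (%k. energy t (?a Hs k Hs'))"
 proof (rule cip_add[OF H(4) _ H'(4)])
  fix k
  have eq: "(?a Hs k Hs')
   = (%s w. a *\<^sub>R (Hs k s w - H s w) + b *\<^sub>R (Hs' k s w - H' s w))" by (simp add: algebra_simps)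
  show "AE w in M. w \<in> space M \<longrightarrow> energy t (?a Hs k Hs') w
   <= ennreal (2 * a^2 + 2 * b^2) * (energy t (%s w. Hs k s w - H s w) w + energy t (%s w. Hs' k s w - H' s w) w)"
   unfolding eq
   by (intro AE_I2 impI order_trans[OF energy_add_le[OF jd]])
     (auto simp: distrib_left intro!: add_mono mult_right_mono ennreal_leI)
 qed (auto intro!: energy_measurable jd)
 moreover have "cip (space M) (%k w. ennreal \<bar>(a * Is k t w + b * Is' k t w) - (a * V w + b * V' w)\<bar>)"
 proof (rule cip_add[OF H(5) _ H'(5)])
  fix k
  show "AE w in M. w \<in> space M \<longrightarrow> ennreal \<bar>(a * Is k t w + b * Is' k t w) - (a * V w + b * V' w)\<bar>
   <= ?b Is k w Is'"
  proof (intro AE_I2 impI)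
   fix w
   have "\<bar>(a * Is k t w + b * Is' k t w) - (a * V w + b * V' w)\<bar> = \<bar>a * (Is k t w - V w) + b * (Is' k t w - V' w)\<bar>"
    by (simp add: algebra_simps)
   also have "... <= \<bar>a\<bar> * \<bar>Is k t w - V w\<bar> + \<bar>b\<bar> * \<bar>Is' k t w - V' w\<bar>"
    by (simp add: abs_mult[symmetric])
   also have "... <= (\<bar>a\<bar> + \<bar>b\<bar>) * (\<bar>Is k t w - V w\<bar> + \<bar>Is' k t w - V' w\<bar>)"
    by (simp add: distrib_left distrib_right)
   finally show "ennreal \<bar>(a * Is k t w + b * Is' k t w) - (a * V w + b * V' w)\<bar>
   <= ?b Is k w Is'"
    by (simp add: ennreal_mult[symmetric] ennreal_plus[symmetric] ennreal_leI del: ennreal_plus)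
  qed
 qed auto
 ultimately show ?thesis unfolding ito_at_def
  using jointly_linear[OF H(1) H'(1)] elementary_linear[OF H(3) H'(3)]
  by (intro conjI exI[of _ "%k s w. a *\<^sub>R Hs k s w + b *\<^sub>R Hs' k s w"] exI[of _ "%k s w. a * Is k s w + b * Is' k s w"]) auto
qed

end

section \<open>The Ito integral\<close>

text \<open>A time before T is the limit of rationals to its right that stay below T. The end point
  T has no such approximation inside the interval and is therefore inserted into the dense
  set.\<close>

lemma sup_dense:
 fixes f :: "real => real" and T :: real
 assumes f: "continuous_on {0..} f"
 defines "D \<equiv> {0..T} \<inter> insert T \<rat>"
 shows "(SUP t\<in>D. ennreal \<bar>f t\<bar>) = (SUP t\<in>{0..T}. ennreal \<bar>f t\<bar>)"
proof (rule antisym)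
 let ?a = "SUP t\<in>D. ennreal \<bar>f t\<bar>"
 let ?b = "SUP t\<in>{0..T}. ennreal \<bar>f t\<bar>"
 show "?a <= ?b" unfolding D_def by (intro SUP_subset_mono) auto
 show "?b <= ?a"
 proof (rule SUP_least)
  fix t assume t: "t \<in> {0..T}"
  show "ennreal \<bar>f t\<bar> <= ?a"
  proof (cases "t = T")
   case True thus ?thesis using t by (intro SUP_upper) (auto simp: D_def)
  next
   case False
   have "\<exists>q. q \<in> \<rat> \<and> t < q \<and> q < t + min (T - t) (1 / real (Suc k))" for k
    using t False Rats_dense_in_real[of t "t + min (T - t) (1 / real (Suc k))"] by auto
   then obtain q where q: "\<And>k. q k \<in> \<rat>" "\<And>k. t < q k" "\<And>k. q k < t + min (T - t) (1 / real (Suc k))" by metis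
   have qD: "q k \<in> D" for k using q[of k] t by (auto simp: D_def)
   have "(%k. q k - t) \<longlonglongrightarrow> 0"
   proof (rule Lim_null_comparison[OF _ LIMSEQ_inverse_real_of_nat], intro always_eventually allI)
    fix k
    have "min (T - t) (1 / real (Suc k)) <= inverse (real (Suc k))" by (simp add: inverse_eq_divide del: of_nat_Suc)
    thus "norm (q k - t) <= inverse (real (Suc k))" using q(2,3)[of k] unfolding real_norm_def by linarith
   qed
   hence "q \<longlonglongrightarrow> t" by (rule LIM_zero_cancel)
   hence "(%k. f (q k)) \<longlonglongrightarrow> f t"
    using t q(2) by (intro continuous_on_tendsto_compose[OF f]) (auto intro: always_eventually less_imp_le order.strict_trans1)
   hence "(%k. ennreal \<bar>f (q k)\<bar>) \<longlonglongrightarrow> ennreal \<bar>f t\<bar>" by (intro tendsto_ennrealI tendsto_rabs)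
   thus ?thesis by (rule LIMSEQ_le_const2) (use qD in \<open>auto intro!: SUP_upper\<close>)
  qed
 qed
qed

context brownian
begin

lemma sup_measurable:
 fixes Y :: "real => 'w => real"
 assumes Y: "\<And>t. 0 <= t ==> Y t \<in> borel_measurable M" and ae: "AE w in M. continuous_on {0..} (%t. Y t w)"
 shows "(%w. SUP t\<in>{0..T}. ennreal \<bar>Y t w\<bar>) \<in> borel_measurable M"
proof (rule measurable_M_cong)
 have "countable ({0..T} \<inter> insert T \<rat>)" by (auto intro: countable_subset[OF _ countable_insert[OF countable_rat]])
 thus "(%w. SUP t\<in>{0..T} \<inter> insert T \<rat>. ennreal \<bar>Y t w\<bar>) \<in> borel_measurable M"
  by (intro borel_measurable_SUP) (auto intro!: measurable_compose[OF Y])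
qed (use ae sup_dense in \<open>auto elim!: eventually_mono\<close>)

lemma BM_continuous: "AE w in M. continuous_on {0..} (%t. Z t w)"
 using BM unfolding brownian_motion_def by blast

lemma elementary_continuous:
 assumes "elementary_integral M Z H I" shows "AE w in M. continuous_on {0..} (%t. I t w)"
proof -
 obtain m q r where *: "step_data m q r" "I = step_I m q r" using assms unfolding elementary_integral_iff by auto
 show ?thesis
  using BM_continuous
 proof eventually_elim
  case (elim w)
  have c: "continuous_on {0..} (%t. Z (min t (q i)) w)" if "i <= m" for i
   using step_data_nonneg[OF *(1) that] by (intro continuous_on_compose2[OF elim] continuous_intros) auto
  show ?case unfolding *(2) step_I_def by (intro continuous_intros c) auto
 qed
qed

text \<open>The events in \<open>ito_integral\<close> are expressed through \<open>energy\<close>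
  and through a supremum over times, so that the rules for \<open>cip\<close> apply to both.\<close>

lemma ito_integral_iff:
 "ito_integral M Z H I \<longleftrightarrow> predictable M F H \<and> (AE w in M. \<forall>T\<ge>0. energy T H w < \<infinity>) \<and> adapted_continuous M F I \<and>
  (\<exists>Hs Is. (\<forall>k. elementary_integral M Z (Hs k) (Is k)) \<and>
   (\<forall>T\<ge>0. cip (space M) (%k. energy T (%s w. Hs k s w - H s w)) \<and>
     cip (space M) (%k w. SUP t\<in>{0..T}. ennreal \<bar>Is k t w - I t w\<bar>)))"
proof -
 have 1: "{w \<in> space M. \<exists>t\<in>{0..T}. q < \<bar>Is k t w - I t w\<bar>}
  = space M \<inter> {w \<in> space M. ennreal q < (SUP t\<in>{0..T}. ennreal \<bar>Is k t w - I t w\<bar>)}" if "0 < q" for q T and Is :: "nat => real => 'w => real" and k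
  using that by (auto simp: less_SUP_iff ennreal_less_iff)
 have 2: "{w \<in> space M. ennreal q < nnint {0..T} (%t. esq (norm (Hs k t w - H t w)))}
  = space M \<inter> {w \<in> space M. ennreal q < energy T (%s w. Hs k s w - H s w) w}" for q T and Hs :: "nat => real => 'w => real ^ 'n" and k
  by (auto simp: energy_def)
 show ?thesis
  unfolding ito_integral_def cip_def energy_def[symmetric] using 1 2[unfolded energy_def[symmetric]]
  by (simp cong: conj_cong) meson
qed

lemma ito_integralD:
 assumes "ito_integral M Z H I"
 shows "predictable M F H" "adapted_continuous M F I" "jointly H" "0 <= t ==> I t \<in> borel_measurable (F t)"
  "0 <= t ==> I t \<in> borel_measurable M" "AE w in M. \<forall>T\<ge>0. energy T H w < \<infinity>"
proof -
 show p: "predictable M F H" and a: "adapted_continuous M F I" and "AE w in M. \<forall>T\<ge>0. energy T H w < \<infinity>"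
  using assms unfolding ito_integral_iff by auto
 show "jointly H" by (rule predictable_jointly[OF p])
 show "0 <= t ==> I t \<in> borel_measurable (F t)" using a unfolding adapted_continuous_def by auto
 thus "0 <= t ==> I t \<in> borel_measurable M" by (auto intro: measurable_F_M)
qed

lemma sup_diff_measurable:
 assumes "elementary_integral M Z H' I'" and a: "adapted_continuous M F I"
 shows "(%w. SUP t\<in>{0..T}. ennreal \<bar>I' t w - I t w\<bar>) \<in> borel_measurable M"
proof (rule sup_measurable)
 show "(%w. I' t w - I t w) \<in> borel_measurable M" if "0 <= t" for t
  using that a unfolding adapted_continuous_def
  by (intro borel_measurable_diff elementary_measurable[OF assms(1)]) (auto intro: measurable_F_M)
 have "AE w in M. w \<in> space M" by (rule AE_space)
 thus "AE w in M. continuous_on {0..} (%t. I' t w - I t w)"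
  using elementary_continuous[OF assms(1)]
  by eventually_elim (use a in \<open>auto simp: adapted_continuous_def intro!: continuous_intros\<close>)
qed

lemma ito_integral_at:
 assumes ito: "ito_integral M Z H I" and t: "0 <= t" shows "ito_at t H (I t)"
proof -
 obtain Hs Is where H: "\<And>k. elementary_integral M Z (Hs k) (Is k)"
   "cip (space M) (%k. energy t (%s w. Hs k s w - H s w))"
   "cip (space M) (%k w. SUP s\<in>{0..t}. ennreal \<bar>Is k s w - I s w\<bar>)"
  using ito t unfolding ito_integral_iff by blast
 note D = ito_integralD[OF ito]
 have "cip (space M) (%k w. ennreal \<bar>Is k t w - I t w\<bar>)"
 proof (rule cip_add[OF H(3) _ H(3), of 1])
  show "AE w in M. w \<in> space M \<longrightarrow> ennreal \<bar>Is k t w - I t w\<bar> <= ennreal 1 *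
   ((SUP s\<in>{0..t}. ennreal \<bar>Is k s w - I s w\<bar>) + (SUP s\<in>{0..t}. ennreal \<bar>Is k s w - I s w\<bar>))" for k
   using t by (intro AE_I2 impI) (auto intro!: add_increasing2 SUP_upper)
 qed (auto intro!: sup_diff_measurable[OF H(1) D(2)])
 thus ?thesis unfolding ito_at_def using D(3) D(5)[OF t] H(1,2) by blast
qed

lemma adapted_continuous_linear:
 "adapted_continuous M F I ==> adapted_continuous M F I' ==> adapted_continuous M F (%t w. a * I t w + b * I' t w)"
 unfolding adapted_continuous_def
 by (intro conjI allI impI ballI borel_measurable_add borel_measurable_times borel_measurable_const continuous_intros) simp_all

theorem ito_linear:
 assumes 1: "ito_integral M Z H I" and 2: "ito_integral M Z H' I'"
 shows "ito_integral M Z (%s w. a *\<^sub>R H s w + b *\<^sub>R H' s w) (%t w. a * I t w + b * I' t w)"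
proof -
 let ?a = "%T Is k w Is'. ennreal (\<bar>a\<bar> + \<bar>b\<bar>) * ((SUP t\<in>{0..T}. ennreal \<bar>Is k t w - I t w\<bar>) + (SUP t\<in>{0..T}. ennreal \<bar>Is' k t w - I' t w\<bar>))"
 let ?b = "%Hs k Hs'. %s w. (a *\<^sub>R Hs k s w + b *\<^sub>R Hs' k s w) - (a *\<^sub>R H s w + b *\<^sub>R H' s w)"
 let ?c = "%s w. a *\<^sub>R H s w + b *\<^sub>R H' s w"
 let ?d = "%t w. a * I t w + b * I' t w"
 obtain Hs Is where H: "\<And>k. elementary_integral M Z (Hs k) (Is k)"
   "\<And>t. 0 <= t ==> cip (space M) (%k. energy t (%s w. Hs k s w - H s w))"
   "\<And>t. 0 <= t ==> cip (space M) (%k w. SUP s\<in>{0..t}. ennreal \<bar>Is k s w - I s w\<bar>)"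
  using 1 unfolding ito_integral_iff by blast
 obtain Hs' Is' where H': "\<And>k. elementary_integral M Z (Hs' k) (Is' k)"
   "\<And>t. 0 <= t ==> cip (space M) (%k. energy t (%s w. Hs' k s w - H' s w))"
   "\<And>t. 0 <= t ==> cip (space M) (%k w. SUP s\<in>{0..t}. ennreal \<bar>Is' k s w - I' s w\<bar>)"
  using 2 unfolding ito_integral_iff by blast
 note D = ito_integralD[OF 1] and D' = ito_integralD[OF 2]
 have jd: "jointly (%s w. Hs k s w - H s w)" "jointly (%s w. Hs' k s w - H' s w)" for k
  by (intro jointly_diff elementary_jointly[OF H(1)] D(3), intro jointly_diff elementary_jointly[OF H'(1)] D'(3))
 have c1: "cip (space M) (%k. energy t (?b Hs k Hs'))" if t: "0 <= t" for t
 proof (rule cip_add[OF H(2)[OF t] _ H'(2)[OF t]])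
  fix k
  have eq: "(?b Hs k Hs')
   = (%s w. a *\<^sub>R (Hs k s w - H s w) + b *\<^sub>R (Hs' k s w - H' s w))" by (simp add: algebra_simps)
  show "AE w in M. w \<in> space M \<longrightarrow> energy t (?b Hs k Hs') w
   <= ennreal (2 * a^2 + 2 * b^2) * (energy t (%s w. Hs k s w - H s w) w + energy t (%s w. Hs' k s w - H' s w) w)"
   unfolding eq
   by (intro AE_I2 impI order_trans[OF energy_add_le[OF jd]])
     (auto simp: distrib_left intro!: add_mono mult_right_mono ennreal_leI)
 qed (auto intro!: energy_measurable jd)
 have c2: "cip (space M) (%k w. SUP t\<in>{0..T}. ennreal \<bar>(a * Is k t w + b * Is' k t w) - (?d t w)\<bar>)" if T: "0 <= T" for T
 proof (rule cip_add[OF H(3)[OF T] _ H'(3)[OF T], of "\<bar>a\<bar> + \<bar>b\<bar>"])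
  fix k
  show "AE w in M. w \<in> space M \<longrightarrow> (SUP t\<in>{0..T}. ennreal \<bar>(a * Is k t w + b * Is' k t w) - (?d t w)\<bar>)
   <= ?a T Is k w Is'"
  proof (intro AE_I2 impI SUP_least)
   fix w t assume t: "t \<in> {0..T}"
   have "\<bar>(a * Is k t w + b * Is' k t w) - (?d t w)\<bar> = \<bar>a * (Is k t w - I t w) + b * (Is' k t w - I' t w)\<bar>"
    by (simp add: algebra_simps)
   also have "... <= \<bar>a\<bar> * \<bar>Is k t w - I t w\<bar> + \<bar>b\<bar> * \<bar>Is' k t w - I' t w\<bar>"
    by (simp add: abs_mult[symmetric])
   also have "... <= (\<bar>a\<bar> + \<bar>b\<bar>) * (\<bar>Is k t w - I t w\<bar> + \<bar>Is' k t w - I' t w\<bar>)"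
    by (simp add: distrib_left distrib_right)
   finally have "ennreal \<bar>(a * Is k t w + b * Is' k t w) - (?d t w)\<bar>
    <= ennreal (\<bar>a\<bar> + \<bar>b\<bar>) * (ennreal \<bar>Is k t w - I t w\<bar> + ennreal \<bar>Is' k t w - I' t w\<bar>)"
    by (simp add: ennreal_mult[symmetric] ennreal_plus[symmetric] ennreal_leI del: ennreal_plus)
   also have "... <= ?a T Is k w Is'"
    using t by (intro mult_left_mono add_mono SUP_upper) auto
   finally show "ennreal \<bar>(a * Is k t w + b * Is' k t w) - (?d t w)\<bar> \<le>
    ?a T Is k w Is'" .
  qed
 qed (auto intro!: sup_diff_measurable[OF H(1) D(2)] sup_diff_measurable[OF H'(1) D'(2)])
 have p: "predictable M F ?c"
  by (rule predictable_Pair[OF D(1) D'(1)]) (intro borel_measurable_continuous_onI continuous_intros)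
 have "AE w in M. w \<in> space M" by (rule AE_space)
 hence "AE w in M. \<forall>T\<ge>0. energy T ?c w < \<infinity>"
  using D(6) D'(6)
 proof eventually_elim
  case (elim w)
  show ?case
  proof (intro allI impI)
   fix T :: real assume "0 <= T"
   hence "ennreal (2 * a^2) * energy T H w + ennreal (2 * b^2) * energy T H' w < \<infinity>"
    using elim by (auto simp: ennreal_mult_less_top)
   thus "energy T ?c w < \<infinity>"
    by (rule order.strict_trans1[OF energy_add_le[OF D(3) D'(3) elim(1)]])
  qed
 qed
 thus ?thesis unfolding ito_integral_iff
  using p adapted_continuous_linear[OF D(2) D'(2)] elementary_linear[OF H(1) H'(1)] c1 c2
  by (intro conjI exI[of _ "%k s w. a *\<^sub>R Hs k s w + b *\<^sub>R Hs' k s w"] exI[of _ "%k s w. a * Is k s w + b * Is' k s w"]) auto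
qed

section \<open>Passages between convergence in probability, in mean and almost surely\<close>

lemma cip_pointwise:
 assumes X: "\<And>k. X k \<in> borel_measurable M" and A: "A \<in> sets M" and lim: "\<And>w. w \<in> A ==> (%k. X k w) \<longlonglongrightarrow> 0"
 shows "cip A X"
 unfolding cip_def
proof (intro allI impI)
 fix q :: real assume q: "0 < q"
 note [measurable] = X A
 define S where "S = (%k. A \<inter> {w \<in> space M. ennreal q < X k w})"
 have [measurable]: "S k \<in> sets M" for k unfolding S_def by measurable
 have "(%k. LINT w|M. indicat_real (S k) w) \<longlonglongrightarrow> (LINT w|M. 0)"
 proof (rule integral_dominated_convergence[where w = "%_. 1"])
  show "AE w in M. (%k. indicat_real (S k) w) \<longlonglongrightarrow> 0"
  proof (rule AE_I2)
   fix w
   have "\<forall>\<^sub>F k in sequentially. indicat_real (S k) w = 0"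
   proof (cases "w \<in> A")
    case True
    have "\<forall>\<^sub>F k in sequentially. X k w < ennreal q" using lim[OF True] q by (intro order_tendstoD(2)) auto
    thus ?thesis by eventually_elim (auto simp: S_def indicator_def)
   qed (simp add: S_def)
   thus "(%k. indicat_real (S k) w) \<longlonglongrightarrow> 0" by (rule tendsto_eventually)
  qed
 qed (auto simp: indicator_def)
 thus "(%k. prob (A \<inter> {w \<in> space M. ennreal q < X k w})) \<longlonglongrightarrow> 0" by (simp add: S_def)
qed

lemma cip_of_nn_integral:
 assumes [measurable]: "\<And>k. X k \<in> borel_measurable M" and lim: "(%k. \<E> w. X k w) \<longlonglongrightarrow> 0"
 shows "cip (space M) X"
 unfolding cip_def
proof (intro allI impI)
 let ?a = "%q k. space M \<inter> {w \<in> space M. ennreal q < X k w}"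
 fix q :: real assume q: "0 < q"
 have "ennreal (prob (?a q k)) <= ennreal (1 / q) * (\<E> w. X k w)" for k
 proof -
  have "emeasure M {w \<in> space M. ennreal q < X k w} <= emeasure M ({w \<in> space M. 1 <= ennreal (1 / q) * X k w} \<inter> space M)"
  proof (rule emeasure_mono)
   have "1 <= ennreal (1 / q) * X k w" if "ennreal q < X k w" for w
   proof -
    have "1 = ennreal (1 / q) * ennreal q" using q by (simp add: ennreal_mult[symmetric])
    also have "... <= ennreal (1 / q) * X k w" using that by (intro mult_left_mono) auto
    finally show ?thesis .
   qed
   thus "{w \<in> space M. ennreal q < X k w} \<subseteq> {w \<in> space M. 1 <= ennreal (1 / q) * X k w} \<inter> space M" by auto
  qed measurable
  also have "... <= ennreal (1 / q) * (\<E> w. X k w * indicator (space M) w)"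
   by (rule order_trans[OF _ nn_integral_Markov_inequality[of "X k" "space M" M "ennreal (1 / q)"]])
     (auto intro!: emeasure_mono)
  also have "(\<E> w. X k w * indicator (space M) w) = (\<E> w. X k w)" by (intro nn_integral_cong) simp
  finally show ?thesis by (simp add: emeasure_eq_measure Int_absorb1)
 qed
 note le = this
 have "(%k. ennreal (1 / q) * (\<E> w. X k w)) \<longlonglongrightarrow> ennreal (1 / q) * 0"
  by (intro ennreal_tendsto_cmult lim) simp
 hence lim0: "(%k. ennreal (1 / q) * (\<E> w. X k w)) \<longlonglongrightarrow> 0" by simp
 have "(%k. ennreal (prob (?a q k))) \<longlonglongrightarrow> ennreal 0"
  unfolding ennreal_0
  by (rule tendsto_sandwich[OF _ _ tendsto_const lim0]) (simp_all only: zero_le eventually_True le)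
 thus "(%k. prob (?a q k)) \<longlonglongrightarrow> 0"
  by (subst (asm) tendsto_ennreal_iff) auto
qed

lemma cip_bounded_nn_integral:
 assumes [measurable]: "\<And>k. X k \<in> borel_measurable M" and c: "cip (space M) X"
  and b: "\<And>k w. w \<in> space M ==> X k w <= ennreal C" and C: "0 <= C"
 shows "(%k. \<E> w. X k w) \<longlonglongrightarrow> 0"
proof (rule order_tendstoI)
 fix a :: ennreal assume "0 < a"
 then obtain e where e: "0 < e" "ennreal e < a" by (metis ennreal_less_iff ennreal_rat_dense ennreal_0 less_le_not_le order_refl dense ennreal_cases ennreal_less_top top.not_eq_extremum)
 define S where "S = (%k. {w \<in> space M. ennreal (e / 2) < X k w})"
 have [measurable]: "S k \<in> sets M" for k unfolding S_def by measurable
 have "(%k. prob (S k)) \<longlonglongrightarrow> 0" using c e by (auto simp: cip_def S_def dest!: spec[of _ "e / 2"])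
 hence "(%k. e / 2 + C * prob (S k)) \<longlonglongrightarrow> e / 2 + C * 0" by (intro tendsto_intros)
 hence "\<forall>\<^sub>F k in sequentially. e / 2 + C * prob (S k) < e" using e by (auto dest!: order_tendstoD(2)[of _ _ _ e])
 thus "\<forall>\<^sub>F k in sequentially. (\<E> w. X k w) < a"
 proof eventually_elim
  case (elim k)
  have "(\<E> w. X k w) <= (\<E> w. ennreal (e / 2) + ennreal C * indicator (S k) w)"
   using b by (intro nn_integral_mono) (auto simp: S_def indicator_def not_less intro: add_increasing)
  also have "... = ennreal (e / 2) + ennreal C * emeasure M (S k)"
   by (simp add: nn_integral_add nn_integral_cmult_indicator emeasure_space_1)
  also have "... = ennreal (e / 2 + C * prob (S k))"
   using e C by (simp add: emeasure_eq_measure ennreal_mult ennreal_plus)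
  also have "... < ennreal e" using elim e C by (intro ennreal_lessI) auto
  also have "... < a" by fact
  finally show ?case .
 qed
qed simp

text \<open>Truncation at 1 turns convergence in probability into convergence in mean, which has an
  almost surely convergent subsequence; along it the truncation is eventually inactive.\<close>

lemma cip_AE_subseq:
 assumes [measurable]: "\<And>k. X k \<in> borel_measurable M" "A \<in> sets M" and c: "cip A (%k w. ennreal \<bar>X k w\<bar>)"
 shows "\<exists>r::nat => nat. strict_mono r \<and> (AE w in M. w \<in> A \<longrightarrow> (%k. X (r k) w) \<longlonglongrightarrow> 0)"
proof -
 define u where "u = (%k w. indicator A w * min \<bar>X k w\<bar> 1)"
 have [measurable]: "u k \<in> borel_measurable M" for k unfolding u_def by measurable
 have "cip (space M) (%k w. ennreal (u k w))"
  unfolding cip_def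
 proof (intro allI impI)
  fix e :: real assume e: "0 < e"
  have "(%k. prob (A \<inter> {w \<in> space M. ennreal e < ennreal \<bar>X k w\<bar>})) \<longlonglongrightarrow> 0" using c e by (simp add: cip_def)
  thus "(%k. prob (space M \<inter> {w \<in> space M. ennreal e < ennreal (u k w)})) \<longlonglongrightarrow> 0"
   by (rule Lim_null_comparison[rotated])
    (use e in \<open>auto intro!: always_eventually finite_measure_mono simp: u_def indicator_def ennreal_less_iff split: if_splits\<close>)
 qed
 hence "(%k. \<E> w. ennreal (u k w)) \<longlonglongrightarrow> ennreal 0"
  using cip_bounded_nn_integral[of "%k w. ennreal (u k w)" 1] by (simp add: u_def indicator_def)
 moreover have i: "integrable M (u k)" for k
  by (intro integrable_const_bound[where B = 1]) (auto simp: u_def indicator_def)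
 hence "(\<E> w. ennreal (u k w)) = ennreal (LINT w|M. norm (u k w))" for k
  by (subst nn_integral_eq_integral) (auto simp: u_def)
 ultimately have "(%k. LINT w|M. norm (u k w)) \<longlonglongrightarrow> 0" by (simp add: tendsto_ennreal_iff del: ennreal_0)
 from tendsto_L1_AE_subseq[OF i this] obtain r :: "nat => nat" where r: "strict_mono r" "AE w in M. (%k. u (r k) w) \<longlonglongrightarrow> 0" by blast
 from r(2) have "AE w in M. w \<in> A \<longrightarrow> (%k. X (r k) w) \<longlonglongrightarrow> 0"
 proof eventually_elim
  case (elim w)
  show ?case
  proof
   assume w: "w \<in> A"
   have "\<forall>\<^sub>F k in sequentially. u (r k) w = \<bar>X (r k) w\<bar>"
    using order_tendstoD(2)[OF elim zero_less_one] by eventually_elim (use w in \<open>auto simp: u_def min_def split: if_splits\<close>)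
   from Lim_transform_eventually[OF elim this] show "(%k. X (r k) w) \<longlonglongrightarrow> 0" by (rule tendsto_rabs_zero_cancel)
  qed
 qed
 thus ?thesis using r(1) by blast
qed

text \<open>On A the step processes K approach H in energy, and so does the sequence that defines V.
  By \<open>elementary_Lenglart\<close> the two sequences of integrals have the same limit in
  probability on A. Fatou's lemma along an almost surely convergent subsequence, with the isometry
  for K, gives the bound. That convergence is asked on A only is what makes localisation
  possible.\<close>

lemma ito_at_Fatou:
 assumes ito: "ito_at t H V" and t: "0 <= t" and A: "A \<in> sets M"
  and el: "\<And>k. elementary_integral M Z (K k) (L k)"
  and conv: "cip A (%k. energy t (%s w. K k s w - H s w))"
  and b: "\<And>k. (\<E> w. energy t (K k) w) <= b k" "b \<longlonglongrightarrow> B"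
 shows "(\<integral>\<^sup>+w\<in>A. esq (V w) \<partial>M) <= B"
proof -
 let ?e = "%k Hs. %s w. K k s w - Hs k s w"
 let ?f = "%Hs k. %s w. Hs k s w - H s w"
 obtain Hs Is where H: "jointly H" "V \<in> borel_measurable M" "\<And>k. elementary_integral M Z (Hs k) (Is k)"
  "cip (space M) (%k. energy t (?f Hs k))" "cip (space M) (%k w. ennreal \<bar>Is k t w - V w\<bar>)"
  using ito unfolding ito_at_def by auto
 note [measurable] = H(2) elementary_measurable[OF H(3) t] elementary_measurable[OF el t] A
 have jd: "jointly (?f Hs k)" "jointly (%s w. K k s w - H s w)" for k
  by (intro jointly_diff elementary_jointly[OF H(3)] H(1), intro jointly_diff elementary_jointly[OF el] H(1))
 have sub: "A \<subseteq> space M" using sets.sets_into_space[OF A] .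
 have HsA: "cip A (%k. energy t (?f Hs k))"
  by (rule cip_subset[OF H(4) sub]) (auto intro: energy_measurable jd)
 have el2: "elementary_integral M Z (?e k Hs) (%s w. L k s w - Is k s w)" for k
  using elementary_linear[OF el[of k] H(3)[of k], of 1 "-1"] by simp
 have "cip A (%k. energy t (?e k Hs))"
 proof (rule cip_add[OF conv _ HsA])
  fix k
  have eq: "(?e k Hs) = (%s w. 1 *\<^sub>R (K k s w - H s w) + (-1) *\<^sub>R (Hs k s w - H s w))" by simp
  show "AE w in M. w \<in> A \<longrightarrow> energy t (?e k Hs) w
   <= ennreal 2 * (energy t (%s w. K k s w - H s w) w + energy t (?f Hs k) w)"
   unfolding eq by (intro AE_I2 impI order_trans[OF energy_add_le[OF jd(2,1)]]) (auto simp: distrib_left)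
 qed (auto intro!: energy_measurable jd)
 from elementary_Lenglart[OF el2 t A this] have c1: "cip A (%k w. ennreal \<bar>L k t w - Is k t w\<bar>)" .
 have c2: "cip A (%k w. ennreal \<bar>Is k t w - V w\<bar>)" by (rule cip_subset[OF H(5) sub]) auto
 have c: "cip A (%k w. ennreal \<bar>L k t w - V w\<bar>)"
  by (rule cip_add[OF c1 _ c2, of 1])
    (auto intro!: AE_I2 simp: ennreal_plus[symmetric] ennreal_leI simp del: ennreal_plus)
 obtain r :: "nat => nat" where r: "strict_mono r" "AE w in M. w \<in> A \<longrightarrow> (%k. L (r k) t w - V w) \<longlonglongrightarrow> 0"
  using cip_AE_subseq[OF _ A c] by auto
 have "(\<integral>\<^sup>+w\<in>A. esq (V w) \<partial>M) <= (\<E> w. liminf (%k. esq (L (r k) t w) * indicator A w))"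
 proof (rule nn_integral_mono_AE)
  show "AE w in M. esq (V w) * indicator A w <= liminf (%k. esq (L (r k) t w) * indicator A w)"
   using r(2)
  proof eventually_elim
   case (elim w)
   show ?case
   proof (cases "w \<in> A")
    case True
    hence "(%k. L (r k) t w) \<longlonglongrightarrow> V w" using elim by (simp add: LIM_zero_iff)
    hence "(%k. esq (L (r k) t w)) \<longlonglongrightarrow> esq (V w)" by (intro tendsto_ennrealI tendsto_intros)
    from lim_imp_Liminf[OF _ this] show ?thesis using True by simp
   qed simp
  qed
 qed
 also have "... <= liminf (%k. \<E> w. esq (L (r k) t w) * indicator A w)" by (rule nn_integral_liminf) measurable
 also have "... <= liminf (%k. b (r k))"
 proof (intro Liminf_mono always_eventually allI)
  fix k
  have "(\<E> w. esq (L (r k) t w) * indicator A w) <= (\<E> w. esq (L (r k) t w))"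
   by (intro nn_integral_mono) (auto simp: indicator_def)
  thus "(\<E> w. esq (L (r k) t w) * indicator A w) <= b (r k)"
   using b(1)[of "r k"] elementary_isometry(1)[OF el t, of "r k"] by simp
 qed
 also have "... = B" using LIMSEQ_subseq_LIMSEQ[OF b(2) r(1)] by (intro lim_imp_Liminf) (auto simp: o_def)
 finally show ?thesis .
qed

end

section \<open>Mean-square approximation of the stochastic integral\<close>

context brownian
begin

text \<open>The cell containing t depends on the grid alone. A map applied to all coefficients thus
  acts on the whole step process, as long as it sends 0 to 0.\<close>

lemma step_H_cases:
 fixes r :: "nat => 'w => real ^ 'n"
 assumes sd: "step_data m q r"
 shows "(\<exists>i<m. t \<in> {q i<..q (Suc i)} \<and> (\<forall>r' :: nat => 'w => real ^ 'n. step_H m q r' t = r' i))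
  \<or> (\<forall>r' :: nat => 'w => real ^ 'n. step_H m q r' t = (%w. 0)) \<and> (\<forall>i<m. t \<notin> {q i<..q (Suc i)})"
proof (cases "\<exists>i<m. t \<in> {q i<..q (Suc i)}")
 case True
 then obtain i where i: "i < m" "q i < t" "t <= q (Suc i)" by auto
 have "t \<notin> {q j<..q (Suc j)}" if "j < m" "j ~= i" for j
 proof (cases "j < i")
  case True
  hence "q (Suc j) <= q i" using i by (intro step_data_mono[OF sd]) auto
  thus ?thesis using i by auto
 next
  case False
  hence "q (Suc i) <= q j" using that by (intro step_data_mono[OF sd]) auto
  thus ?thesis using i by auto
 qed
 hence ind: "indicator {q j<..q (Suc j)} t = (if j = i then 1 else 0 :: real)" if "j < m" for j
  using that i by (auto simp: indicator_def)
 have "step_H m q r' t w = r' i w" for r' :: "nat => 'w => real ^ 'n" and w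
 proof -
  have "(\<Sum>j<m. indicat_real {q j<..q (Suc j)} t *\<^sub>R r' j w) = (\<Sum>j<m. if j = i then r' j w else 0)"
   by (intro sum.cong) (auto simp: ind)
  thus ?thesis using i by (simp add: step_H_def)
 qed
 thus ?thesis using i by (intro disjI1 exI[of _ i]) auto
next
 case False
 hence "indicator {q j<..q (Suc j)} t = (0::real)" if "j < m" for j using that by (auto simp: indicator_def)
 hence "step_H m q r' t w = 0" for r' :: "nat => 'w => real ^ 'n" and w unfolding step_H_def by (intro sum.neutral) auto
 thus ?thesis using False by (intro disjI2) (auto intro!: ext)
qed

text \<open>Truncation as the projection on a ball: it fixes 0 and is 1-Lipschitz, so it preserves
  step processes and does not enlarge the energy of a difference.\<close>

abbreviation clip :: "nat => real ^ 'n => real ^ 'n" where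
 "clip n \<equiv> closest_point (cball 0 (real n))"

lemma clip_properties:
 "clip n 0 = 0" "norm (clip n x) <= real n" "norm (clip n x - clip n y) <= norm (x - y)"
 "norm x <= real n ==> clip n x = x" "norm (clip n x - x) <= norm x" "clip n \<in> borel_measurable borel"
proof -
 have S: "convex (cball (0::real ^ 'n) (real n))" "closed (cball (0::real ^ 'n) (real n))" "cball (0::real ^ 'n) (real n) ~= {}" by auto
 show "clip n 0 = 0" "norm x <= real n ==> clip n x = x" by (auto intro!: closest_point_self)
 show "norm (clip n x) <= real n" using closest_point_in_set[OF S(2,3), of x] by simp
 show "norm (clip n x - clip n y) <= norm (x - y)" using closest_point_lipschitz[OF S, of x y] by (simp add: dist_norm)
 show "norm (clip n x - x) <= norm x" using closest_point_le[OF S(2), of 0 x] by (simp add: dist_norm norm_minus_commute)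
 show "clip n \<in> borel_measurable borel" by (intro borel_measurable_continuous_onI continuous_on_closest_point S)
qed

lemma elementary_clip:
 assumes "elementary_integral M Z H I"
 shows "\<exists>I'. elementary_integral M Z (%t w. clip n (H t w)) I'"
proof -
 obtain m q r where *: "step_data m q r" "H = step_H m q r" "I = step_I m q r"
  using assms(1) unfolding elementary_integral_iff by auto
 have "step_data m q (%i w. clip n (r i w))"
  using *(1) clip_properties(2) unfolding step_data_def
  by (auto intro: measurable_compose[OF _ clip_properties(6)])
 moreover have "clip n (H t w) = step_H m q (%i w. clip n (r i w)) t w" for t w
  using step_H_cases[OF *(1), of t] clip_properties(1) unfolding *(2) by auto
 hence "(%t w. clip n (H t w)) = step_H m q (%i w. clip n (r i w))" by blast
 ultimately show ?thesis unfolding elementary_integral_iff by blast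
qed

lemma energy_integrand_measurable:
 fixes H :: "real => 'w => 'b::{second_countable_topology, real_normed_vector}"
 assumes "jointly H" "w \<in> space M"
 shows "(%s. esq (norm (H s w)) * indicator {0..t} s) \<in> borel_measurable lborel"
proof -
 have [measurable]: "(%s. indicator {0..} s *\<^sub>R H s w) \<in> borel_measurable lborel"
  using measurable_compose[OF _ assms(1)[unfolded jointly_def], of "%s. (s, w)" lborel] assms(2) by simp
 have "(%s. esq (norm (indicator {0..} s *\<^sub>R H s w)) * indicator {0..t} s) \<in> borel_measurable lborel"
  by measurable
 thus ?thesis by (rule measurable_cong[THEN iffD1, rotated]) (auto simp: indicator_def)
qed

lemma energy_mono:
 "(\<And>s. 0 <= s ==> s <= t ==> norm (H s w) <= norm (K s w)) ==> energy t H w <= energy t K w"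
 unfolding energy_def by (intro nn_integral_mono) (auto simp: indicator_def intro!: ennreal_leI power_mono)

lemma energy_bound:
 assumes "\<And>s. 0 <= s ==> s <= t ==> norm (H s w) <= C" "0 <= t"
 shows "energy t H w <= ennreal (C^2 * t)"
proof -
 have "energy t H w <= (\<L> s. esq C * indicator {0..t} s)"
  unfolding energy_def using assms by (intro nn_integral_mono) (auto simp: indicator_def intro!: ennreal_leI power_mono)
 also have "... = ennreal (C^2 * t)" using assms(2) by (simp add: nn_integral_cmult_indicator ennreal_mult)
 finally show ?thesis .
qed

lemma energy_diff_le:
 fixes H K L :: "real => 'w => 'b::{second_countable_topology, real_normed_vector}"
 assumes "jointly H" "jointly K" "jointly L" "w \<in> space M"
 shows "energy t (%s w. H s w - L s w) w <= 2 * energy t (%s w. H s w - K s w) w + 2 * energy t (%s w. L s w - K s w) w"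
 using energy_add_le[of "%s w. H s w - K s w" "%s w. L s w - K s w" w t 1 "-1"] assms
 by (simp add: jointly_diff)

text \<open>Dominated convergence twice, in time for a fixed outcome and then over the outcomes. At
  a fixed time and outcome the clipping is inactive for all large n.\<close>

lemma clip_energy_tendsto:
 assumes H: "jointly H" and fin: "(\<E> w. energy t H w) < \<infinity>"
 shows "(%n. \<E> w. energy t (%s w. clip n (H s w) - H s w) w) \<longlonglongrightarrow> 0"
proof -
 let ?a = "%n. %s w. clip n (H s w) - H s w"
 have j: "jointly (?a n)" for n
  by (intro jointly_diff jointly_compose[OF H clip_properties(6)] H)
 have "(%n. \<E> w. energy t (?a n) w) \<longlonglongrightarrow> (\<E> w. 0)"
 proof (rule nn_integral_dominated_convergence[where w = "energy t H"])
  show "AE w in M. energy t (?a n) w <= energy t H w" for n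
   by (intro AE_I2 energy_mono clip_properties(5))
  have "AE w in M. energy t H w ~= \<infinity>" using fin energy_measurable[OF H] by (intro nn_integral_PInf_AE) auto
  moreover have "AE w in M. w \<in> space M" by (rule AE_space)
  ultimately show "AE w in M. (%n. energy t (?a n) w) \<longlonglongrightarrow> 0"
  proof eventually_elim
   case (elim w)
   have "(%n. energy t (?a n) w) \<longlonglongrightarrow> (\<integral>\<^sup>+s. 0 \<partial>(lborel :: real measure))"
    unfolding energy_def
   proof (rule nn_integral_dominated_convergence[where w = "%s. esq (norm (H s w)) * indicator {0..t} s"])
    show "nnint {0..t} (%s. esq (norm (H s w))) < \<infinity>" using elim(1) unfolding energy_def by (simp add: less_top)
    show "AE s in lborel. esq (norm (clip n (H s w) - H s w)) * indicator {0..t} s <= esq (norm (H s w)) * indicator {0..t} s" for n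
     by (intro AE_I2 mult_right_mono ennreal_leI power_mono clip_properties(5)) auto
    show "AE s in lborel. (%n. esq (norm (clip n (H s w) - H s w)) * indicator {0..t} s) \<longlonglongrightarrow> 0"
    proof (intro AE_I2 tendsto_eventually)
     fix s
     obtain N where "norm (H s w) <= real N" using real_arch_simple by blast
     hence "clip n (H s w) - H s w = 0" if "n \<ge> N" for n using that by (simp add: clip_properties(4))
     thus "\<forall>\<^sub>F n in sequentially. esq (norm (clip n (H s w) - H s w)) * indicator {0..t} s = 0"
      unfolding eventually_sequentially by (intro exI[of _ N]) auto
    qed
   qed (use energy_integrand_measurable[OF j elim(2)] energy_integrand_measurable[OF H elim(2)] in auto)
   thus ?case by simp
  qed
 qed (use energy_measurable[OF j] energy_measurable[OF H] fin in auto)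
 thus ?thesis by simp
qed

text \<open>\<open>ito_at\<close> only provides convergence in probability. After clipping at a
  fixed level the energies are bounded, so they converge in mean; the level then grows along a
  diagonal sequence. The integrals follow by \<open>ito_at_Fatou\<close>.\<close>

theorem ito_at_L2:
 assumes ito: "ito_at t H V" and t: "0 <= t" and fin: "(\<E> w. energy t H w) < \<infinity>"
 obtains K L where "\<And>n. elementary_integral M Z (K n) (L n)"
  "(%n. \<E> w. energy t (%s w. K n s w - H s w) w) \<longlonglongrightarrow> 0"
  "(%n. \<E> w. esq (V w - L n t w)) \<longlonglongrightarrow> 0"
proof -
 let ?a = "%n. \<E> w. energy t (%s w. clip n (H s w) - H s w) w"
 let ?b = "%n Hs k. %s w. clip n (Hs k s w) - clip n (H s w)"
 let ?c = "%Hs k. %s w. Hs k s w - H s w"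
 let ?d = "%n. 1 / real (Suc n)"
 let ?e = "%n. %s w. H s w - clip n (H s w)"
 let ?f = "%K m n. %s w. K m s w - K n s w"
 let ?g = "%n. 2 * ennreal (?d n) + 2 * (?a n)"
 let ?h = "%K n. %s w. K n s w - clip n (H s w)"
 obtain Hs Is where H: "jointly H" "V \<in> borel_measurable M" "\<And>k. elementary_integral M Z (Hs k) (Is k)"
  "cip (space M) (%k. energy t (?c Hs k))" "cip (space M) (%k w. ennreal \<bar>Is k t w - V w\<bar>)"
  using ito unfolding ito_at_def by auto
 have jc: "jointly (%s w. clip n (H s w))" for n by (rule jointly_compose[OF H(1) clip_properties(6)])
 have js: "jointly (%s w. clip n (Hs k s w))" for n k by (rule jointly_compose[OF elementary_jointly[OF H(3)] clip_properties(6)])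
 have "\<exists>k. (\<E> w. energy t (?b n Hs k) w) < ennreal (?d n)" for n
 proof -
  have c: "cip (space M) (%k. energy t (?b n Hs k))"
  proof (rule cip_add[OF H(4) _ H(4), of 1])
   show "AE w in M. w \<in> space M \<longrightarrow> energy t (?b n Hs k) w
    <= ennreal 1 * (energy t (?c Hs k) w + energy t (?c Hs k) w)" for k
    using energy_mono[of t "%s w. clip n (Hs k s w) - clip n (H s w)" _ "%s w. Hs k s w - H s w", OF clip_properties(3)]
    by (intro AE_I2) (auto intro: add_increasing2)
  qed (auto intro!: energy_measurable jointly_diff elementary_jointly[OF H(3)] H(1))
  have "(%k. \<E> w. energy t (?b n Hs k) w) \<longlonglongrightarrow> 0"
  proof (rule cip_bounded_nn_integral[OF _ c])
   show "energy t (?b n Hs k) w <= ennreal ((real n + real n)^2 * t)" for k w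
    by (intro energy_bound t order_trans[OF norm_triangle_ineq4] add_mono clip_properties(2))
  qed (use t in \<open>auto intro!: energy_measurable jointly_diff js jc\<close>)
  from order_tendstoD(2)[OF this, of "ennreal (?d n)"] show ?thesis
   by (auto simp: eventually_sequentially ennreal_zero_less_divide)
 qed
 hence "\<exists>k. \<forall>n. (\<E> w. energy t (%s w. clip n (Hs (k n) s w) - clip n (H s w)) w) < ennreal (?d n)"
  by (intro choice allI)
 then obtain k where k: "\<And>n. (\<E> w. energy t (%s w. clip n (Hs (k n) s w) - clip n (H s w)) w) < ennreal (?d n)"
  by blast
 \<comment> \<open>Diagonal sequence: the index \<open>k n\<close> was chosen such that clipping at
   level n leaves an expected energy error below 1/(n+1).\<close>
 define K where "K = (%n s w. clip n (Hs (k n) s w))"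
 have "\<forall>n. \<exists>I'. elementary_integral M Z (K n) I'" unfolding K_def using elementary_clip[OF H(3)] by blast
 then obtain L where L: "\<And>n. elementary_integral M Z (K n) (L n)" by metis
 define e where "e = (%n. \<E> w. energy t (?c K n) w)"
 have jK: "jointly (K n)" for n by (rule elementary_jointly[OF L])
 note mE = energy_measurable[OF jointly_diff[OF jK H(1)]]
 have e0: "e \<longlonglongrightarrow> 0"
 proof (rule tendsto_sandwich[OF _ _ tendsto_const])
  have "?g \<longlonglongrightarrow> 2 * ennreal 0 + 2 * 0"
   by (intro tendsto_add ennreal_tendsto_cmult tendsto_ennrealI clip_energy_tendsto[OF H(1) fin] LIMSEQ_Suc[OF lim_1_over_n]) auto
  thus "?g \<longlonglongrightarrow> 0" by simp
  have "e n <= 2 * ennreal (?d n) + 2 * (?a n)" for n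
  proof -
   have "e n <= (\<E> w. 2 * energy t (?h K n) w + 2 * energy t (?e n) w)"
    unfolding e_def by (intro nn_integral_mono energy_diff_le jK jc H(1)) auto
   also have "... = 2 * (\<E> w. energy t (?h K n) w) + 2 * (\<E> w. energy t (?e n) w)"
    using energy_measurable[OF jointly_diff[OF jK[of n] jc[of n]], of t] energy_measurable[OF jointly_diff[OF H(1) jc[of n]], of t]
    by (simp add: nn_integral_add nn_integral_cmult)
   also have "(%w. energy t (?e n) w) = (%w. energy t (%s w. clip n (H s w) - H s w) w)"
    by (simp only: energy_def norm_minus_commute)
   also have "2 * (\<E> w. energy t (?h K n) w) <= 2 * ennreal (?d n)"
    unfolding K_def by (intro mult_left_mono less_imp_le[OF k]) simp
   finally show ?thesis by (simp add: add_right_mono)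
  qed
  thus "\<forall>\<^sub>F n in sequentially. e n <= 2 * ennreal (?d n) + 2 * (?a n)" by simp
 qed simp
 have V: "(\<E> w. esq (V w - L n t w)) <= 2 * e n" for n
 proof -
  \<comment> \<open>Here n is fixed and the differences K m - K n approximate H - K n as m grows, so
    the error of the integral is bounded by the energy error without an isometry for H.\<close>
  have "(\<integral>\<^sup>+w\<in>space M. esq (V w - L n t w) \<partial>M) <= 2 * 0 + 2 * e n"
  proof (rule ito_at_Fatou[where K = "%m s w. K m s w - K n s w" and L = "%m s w. L m s w - L n s w"])
   show "ito_at t (%s w. H s w - K n s w) (%w. V w - L n t w)"
    using ito_at_linear[OF ito elementary_ito_at[OF L[of n] t] t, of 1 "-1"] by simp
   show "elementary_integral M Z (?f K m n) (?f L m n)" for m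
    using elementary_linear[OF L[of m] L[of n], of 1 "-1"] by simp
   show "cip (space M) (%k. energy t (%s w. K k s w - K n s w - (H s w - K n s w)))"
    using cip_of_nn_integral[OF mE e0[unfolded e_def]] by simp
   show "(\<E> w. energy t (?f K m n) w) <= 2 * e m + 2 * e n" for m
   proof -
    have "(\<E> w. energy t (?f K m n) w)
     <= (\<E> w. 2 * energy t (?c K m) w + 2 * energy t (?c K n) w)"
     by (intro nn_integral_mono energy_diff_le jK H(1)) auto
    thus ?thesis using mE[of t] by (simp add: nn_integral_add nn_integral_cmult e_def)
   qed
   show "(%m. 2 * e m + 2 * e n) \<longlonglongrightarrow> 2 * 0 + 2 * e n" by (intro tendsto_add ennreal_tendsto_cmult e0) auto
  qed (use t in auto)
  also have "(\<integral>\<^sup>+w\<in>space M. esq (V w - L n t w) \<partial>M) = (\<E> w. esq (V w - L n t w))" by (intro nn_integral_cong) simp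
  finally show ?thesis by simp
 qed
 have lim: "(%n. 2 * e n) \<longlonglongrightarrow> 0" using ennreal_tendsto_cmult[OF _ e0, of 2] by simp
 have "(%n. \<E> w. esq (V w - L n t w)) \<longlonglongrightarrow> 0"
  by (rule tendsto_sandwich[OF _ _ tendsto_const lim]) (simp_all only: zero_le eventually_True V)
 from that[OF L e0[unfolded e_def] this] show ?thesis .
qed

end

section \<open>Linear stochastic equations\<close>

text \<open>Inserting the inequality into itself n times bounds Q by n terms of the exponential
  series plus the remainder \<open>C * ((b * t) ^ n / fact n)\<close>, which the a priori bound C
  makes tend to 0.\<close>

lemma Gronwall_nn:
 fixes Q :: "real => ennreal"
 assumes bd: "\<And>t. 0 <= t ==> t <= T ==> Q t <= ennreal C" and C: "0 <= C" "0 <= a" "0 <= b"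
  and le: "\<And>t. 0 <= t ==> t <= T ==> Q t <= ennreal a + ennreal b * nnint {0..t} (%s. Q s)"
  and t: "0 <= t" "t <= T"
 shows "Q t <= ennreal (a * exp (b * t))"
proof -
 define p where "p = (%(n::nat) t. a * (\<Sum>j<n. (b * t) ^ j / fact j) + C * ((b * t) ^ n / fact n))"
 have step: "Q t <= ennreal (p n t)" if "0 <= t" "t <= T" for n t
  using that
 proof (induction n arbitrary: t)
  case 0 thus ?case using bd by (simp add: p_def)
 next
  case (Suc n)
  \<comment> \<open>An antiderivative of \<open>p n\<close> that vanishes at 0; a + b P is the next
    iterate.\<close>
  define P where "P = (%s. a * (\<Sum>j<n. b ^ j * s ^ Suc j / fact (Suc j)) + C * (b ^ n * s ^ Suc n / fact (Suc n)))"
  have der: "(P has_real_derivative p n s) (at s within A)" for s A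
  proof -
   have "((%s. b ^ j * s ^ Suc j / fact (Suc j)) has_real_derivative (b * s) ^ j / fact j) (at s within A)" for j
   proof -
    have "((%s. b ^ j * s ^ Suc j / fact (Suc j)) has_real_derivative b ^ j * (real (Suc j) * s ^ j) / fact (Suc j)) (at s within A)"
     by (intro derivative_eq_intros) (auto simp del: fact_Suc)
    moreover have "b ^ j * (real (Suc j) * s ^ j) / fact (Suc j) = (b * s) ^ j / fact j"
     by (simp add: power_mult_distrib field_simps del: of_nat_Suc)
    ultimately show ?thesis by simp
   qed
   thus ?thesis unfolding P_def p_def by (intro DERIV_add DERIV_cmult DERIV_sum)
  qed
  have pn: "0 <= p n s" if "0 <= s" for s
   using that C unfolding p_def by (intro add_nonneg_nonneg mult_nonneg_nonneg sum_nonneg divide_nonneg_nonneg zero_le_power) auto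
  have "nnint {0..t} (%s. Q s) <= (\<L> s. ennreal (p n s) * indicator {0..t} s)"
   using Suc by (intro nn_integral_mono) (auto simp: indicator_def)
  also have "... = ennreal (P t - P 0)"
   by (rule nn_integral_FTC_Icc) (use Suc.prems der pn in \<open>auto simp: p_def\<close>)
  finally have "Q t <= ennreal a + ennreal b * ennreal (P t)"
   using order_trans[OF le[OF Suc.prems]] by (simp add: P_def add_left_mono mult_left_mono)
  also have "... = ennreal (a + b * P t)"
   using C Suc.prems by (simp add: P_def ennreal_plus ennreal_mult sum_nonneg)
  also have "a + b * P t = p (Suc n) t"
   unfolding p_def sum.lessThan_Suc_shift P_def
   by (simp add: sum_distrib_left algebra_simps power_mult_distrib)
  finally show ?case .
 qed
 have "(%n. (b * t) ^ n /\<^sub>R fact n) sums exp (b * t)" by (rule exp_converges)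
 hence s: "(%n. (b * t) ^ n / fact n) sums exp (b * t)" by (simp add: divide_inverse mult.commute)
 have "(%n. p n t) \<longlonglongrightarrow> a * exp (b * t) + C * 0"
  unfolding p_def using s summable_LIMSEQ_zero[OF sums_summable[OF s]]
  by (intro tendsto_intros) (auto simp: sums_def)
 hence "(%n. ennreal (p n t)) \<longlonglongrightarrow> ennreal (a * exp (b * t))" by (intro tendsto_ennrealI) simp
 thus ?thesis by (rule LIMSEQ_le_const) (use step[OF t] in auto)
qed

lemma square_integral_le:
 fixes a :: "real => real"
 assumes "set_integrable lborel {l..t} a" "l <= t"
 shows "esq (LINT s:{l..t}|lborel. a s) <= ennreal (t - l) * nnint {l..t} (%s. esq (a s))"
proof -
 define q where "q = (%s. indicator {l..t} s *\<^sub>R a s)"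
 have q: "integrable lborel q" using assms(1) unfolding q_def set_integrable_def .
 have [measurable]: "q \<in> borel_measurable lborel" using q by auto
 have "ennreal \<bar>LINT s|lborel. q s\<bar> <= (\<L> s. ennreal \<bar>q s\<bar>)" using integral_norm_bound_ennreal[OF q] by simp
 also have "... = (\<L> s. ennreal \<bar>q s\<bar> * indicator {l..t} s)" by (intro nn_integral_cong) (auto simp: q_def indicator_def)
 finally have "(ennreal \<bar>LINT s|lborel. q s\<bar>)^2 <= (\<L> s. ennreal \<bar>q s\<bar> * indicator {l..t} s)^2" by (rule power_mono) simp
 also have "... <= (\<L> s. (ennreal \<bar>q s\<bar>)^2) * (\<L> s. (indicator {l..t} s)^2)"
  by (rule Cauchy_Schwarz_nn_integral) auto
 also have "(\<L> s. (indicator {l..t} s)^2) = (\<integral>\<^sup>+s. indicator {l..t} s \<partial>(lborel :: real measure))"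
  by (intro nn_integral_cong) (auto simp: indicator_def)
 also have "... = ennreal (t - l)" using assms(2) by simp
 also have "(\<L> s. (ennreal \<bar>q s\<bar>)^2) = nnint {l..t} (%s. esq (a s))"
  by (intro nn_integral_cong) (auto simp: q_def indicator_def ennreal_power)
 finally show ?thesis by (simp add: q_def set_lebesgue_integral_def ennreal_power mult.commute)
qed

section \<open>Localised second moments of linear equations\<close>

context brownian
begin

text \<open>Takes the place of the time at which the modulus of X first exceeds N. The events
  decrease in s, each is known at its own time, and they exhaust the space as N grows.\<close>

definition level :: "(real => 'w => real) => real => real => 'w set" where
 "level X N s = {w \<in> space M. \<forall>u\<in>{0..s}. \<bar>X u w\<bar> <= N}"

lemma level_F:
 assumes X: "adapted_continuous M F X" and N: "0 <= N" and s: "0 <= s"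
 shows "level X N s \<in> sets (F s)"
proof -
 let ?D = "{0..s} \<inter> insert s \<rat>"
 have c: "countable ?D" by (auto intro: countable_subset[OF _ countable_insert[OF countable_rat]])
 have "X u \<in> borel_measurable (F s)" if "u \<in> ?D" for u
  using that X unfolding adapted_continuous_def by (auto intro: measurable_F_mono)
 hence m: "(%w. SUP u\<in>?D. ennreal \<bar>X u w\<bar>) \<in> borel_measurable (F s)"
  using c by (intro borel_measurable_SUP measurable_compose[of _ "F s" borel "%x. ennreal \<bar>x\<bar>"]) auto
 have "level X N s = {w \<in> space (F s). (SUP u\<in>?D. ennreal \<bar>X u w\<bar>) <= ennreal N}"
 proof -
  have "(SUP u\<in>?D. ennreal \<bar>X u w\<bar>) <= ennreal N \<longleftrightarrow> (\<forall>u\<in>{0..s}. \<bar>X u w\<bar> <= N)" if "w \<in> space M" for w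
   using X that N unfolding adapted_continuous_def
   by (subst sup_dense) (auto simp: SUP_le_iff ennreal_le_iff)
  thus ?thesis unfolding level_def by auto
 qed
 also have "... \<in> sets (F s)" using m by measurable
 finally show ?thesis .
qed

lemma level_antimono: "s <= t ==> level X N t \<subseteq> level X N s"
 unfolding level_def by auto

definition grid :: "real => nat => nat => real" where
 "grid t k i = t * real i / real (Suc k)"

lemma grid_props:
 assumes "0 <= t"
 shows "grid t k 0 = 0" "grid t k (Suc k) = t" "grid t k i <= grid t k (Suc i)" "0 <= grid t k i"
  "grid t k (Suc i) - grid t k i = t / real (Suc k)"
 unfolding grid_def using assms
 by (simp_all add: diff_divide_distrib[symmetric] right_diff_distrib[symmetric] divide_right_mono mult_left_mono del: of_nat_Suc)

lemma grid_cover: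
 assumes "0 < s" "s <= t"
 obtains i where "i < Suc k" "s \<in> {grid t k i<..grid t k (Suc i)}"
proof -
 have t: "0 <= t" using assms by simp
 have "(\<Sum>i<Suc k. indicat_real {grid t k i<..grid t k (Suc i)} s) = (\<Sum>i<Suc k. indicat_real {s..} (grid t k (Suc i)) - indicat_real {s..} (grid t k i))"
  using grid_props(3)[OF t] by (intro sum.cong indicator_Ioc_diff) auto
 also have "... = indicat_real {s..} (grid t k (Suc k)) - indicat_real {s..} (grid t k 0)"
  by (rule sum_lessThan_telescope)
 also have "... = 1" using assms unfolding grid_props(1,2)[OF t] by simp
 finally have "\<exists>i\<in>{..<Suc k}. indicat_real {grid t k i<..grid t k (Suc i)} s ~= 0"
  by (metis (no_types, lifting) sum.neutral zero_neq_one)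
 thus ?thesis using that by (auto simp: indicator_def split: if_splits)
qed

lemma step_grid_value:
 fixes q :: "nat => 'w => real ^ 'n"
 assumes sd: "step_data (Suc k) (grid t k) q" and s: "0 < s" "s <= t"
 shows "\<exists>i<Suc k. grid t k i < s \<and> s - grid t k i <= t / real (Suc k) \<and> step_H (Suc k) (grid t k) q s = q i"
proof -
 obtain i where "i < Suc k" "s \<in> {grid t k i<..grid t k (Suc i)}" by (rule grid_cover[OF s])
 then obtain j where "j < Suc k" "s \<in> {grid t k j<..grid t k (Suc j)}" "step_H (Suc k) (grid t k) q s = q j"
  using step_H_cases[OF sd, of s] by auto
 moreover have "s - grid t k j <= t / real (Suc k)"
  using grid_props(5)[of t k j] s calculation(2) by (auto simp del: of_nat_Suc)
 ultimately show ?thesis by auto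
qed

text \<open>The integrand is multiplied by the indicator of the level event and sampled on a grid,
  which yields uniformly bounded step processes. Their expected energies converge to the right-hand
  side by dominated convergence, and on \<open>level X N t\<close> they approximate the original
  integrand, so \<open>ito_at_Fatou\<close> applies on that event.\<close>

theorem ito_localized:
 assumes X: "adapted_continuous M F X" and ito: "ito_integral M Z (%s w. X s w *\<^sub>R v) I"
  and t: "0 < t" and N: "0 <= N"
 defines "Q \<equiv> %s. \<integral>\<^sup>+w\<in>level X N s. esq (X s w) \<partial>M"
 shows "(\<integral>\<^sup>+w\<in>level X N t. esq (I t w) \<partial>M) <= ennreal (v \<bullet> v) * nnint {0..t} (%s. Q s)"
proof -
 let ?a = "%wt. \<integral>\<^sup>+x. (case x of (s, w) => wt s w) \<partial>(lborel \<Otimes>\<^sub>M M)"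
 let ?b = "lborel \<Otimes>\<^sub>M M"
 let ?c = "ennreal (v \<bullet> v) * nnint {0..t} (%s. Q s)"
 let ?d = "%K k. %s w. K k s w - X s w *\<^sub>R v"
 let ?e = "%s w. indicator (level X N s) w * X s w"
 let ?f = "\<integral>\<^sup>+x. esq (N * norm v) * indicator {0<..t} (fst x) \<partial>?b"
 let ?g = "borel_measurable ?b"
 let ?h = "%s. Q s * indicator {0<..t} s"
 let ?i = "%K k s w. norm (K k s w - X s w *\<^sub>R v)"
 let ?j = "%w K k. \<E> w. energy t (K k) w"
 let ?l = "2 * (N * norm v)"
 let ?m = "borel_measurable lborel"
 define r where "r = (%k i w. (indicator (level X N (grid t k i)) w * X (grid t k i) w) *\<^sub>R v)"
 have t0: "0 <= t" using t by simp
 have XF: "X s \<in> borel_measurable (F s)" if "0 <= s" for s using X that unfolding adapted_continuous_def by auto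
 have ind: "(%w. indicator (level X N s) w :: real) \<in> borel_measurable (F s)" if "0 <= s" for s
  by (rule borel_measurable_indicator[OF level_F[OF X N that]])
 have bnd: "\<bar>indicator (level X N s) w * X s w\<bar> <= N" if "0 <= s" for s w
  using that N by (auto simp: level_def indicator_def)
 have sd: "step_data (Suc k) (grid t k) (r k)" for k
  unfolding step_data_def
 proof (intro conjI allI impI)
  show "r k i \<in> borel_measurable (F (grid t k i))" for i
   unfolding r_def using grid_props(4)[OF t0, of k i]
   by (intro borel_measurable_scaleR borel_measurable_times ind XF) auto
  show "\<exists>C. \<forall>i<Suc k. \<forall>w\<in>space M. norm (r k i w) <= C"
   using bnd[OF grid_props(4)[OF t0]] by (intro exI[of _ "N * norm v"]) (auto simp: r_def intro!: mult_right_mono)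
 qed (use grid_props[OF t0] in auto)
 define K where "K = (%k. step_H (Suc k) (grid t k) (r k))"
 have el: "elementary_integral M Z (K k) (step_I (Suc k) (grid t k) (r k))" for k
  unfolding elementary_integral_iff K_def using sd by blast
 have jK: "jointly (K k)" for k by (rule elementary_jointly[OF el])
 have Kbnd: "norm (K k s w) <= N * norm v" if s: "0 < s" "s <= t" for k s w
 proof -
  obtain i where "K k s = r k i" using step_grid_value[OF sd s] unfolding K_def by blast
  thus ?thesis using bnd[OF grid_props(4)[OF t0]] by (auto simp: r_def intro!: mult_right_mono)
 qed
 have Klim: "(%k. K k s w) \<longlonglongrightarrow> (?e s w) *\<^sub>R v" if s: "0 < s" "s <= t" and w: "w \<in> space M" for s w
 proof -
  have c: "continuous_on {0..} (%s. X s w)" using X w unfolding adapted_continuous_def by auto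
  have "\<forall>k. \<exists>l. 0 <= l \<and> l < s \<and> s - l <= t / real (Suc k) \<and> K k s w = (?e l w) *\<^sub>R v"
  proof
   fix k
   obtain i where "grid t k i < s" "s - grid t k i <= t / real (Suc k)" "K k s = r k i"
    using step_grid_value[OF sd s] unfolding K_def by blast
   thus "\<exists>l. 0 <= l \<and> l < s \<and> s - l <= t / real (Suc k) \<and> K k s w = (?e l w) *\<^sub>R v"
    using grid_props(4)[OF t0, of k i] by (intro exI[of _ "grid t k i"]) (simp add: r_def)
  qed
  then obtain l where l: "\<And>k. 0 <= l k" "\<And>k. l k < s" "\<And>k. s - l k <= t / real (Suc k)"
   "\<And>k. K k s w = (indicator (level X N (l k)) w * X (l k) w) *\<^sub>R v" by metis
  have "(%k. s - l k) \<longlonglongrightarrow> 0"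
  proof (rule Lim_null_comparison)
   show "\<forall>\<^sub>F k in sequentially. norm (s - l k) <= t * inverse (real (Suc k))"
    using l(2,3) by (intro always_eventually allI) (simp add: divide_inverse less_imp_le del: of_nat_Suc)
   show "(%k. t * inverse (real (Suc k))) \<longlonglongrightarrow> 0" using tendsto_mult_right_zero[OF LIMSEQ_inverse_real_of_nat] .
  qed
  from tendsto_diff[OF tendsto_const[of s] this] have ls: "l \<longlonglongrightarrow> s" by simp
  have Xl: "(%k. X (l k) w) \<longlonglongrightarrow> X s w"
   using ls l(1) s by (intro continuous_on_tendsto_compose[OF c]) auto
  have "\<forall>\<^sub>F k in sequentially. (indicator (level X N (l k)) w :: real) = indicator (level X N s) w"
  proof (cases "w \<in> level X N s")
   case True
   hence "w \<in> level X N (l k)" for k using level_antimono[OF less_imp_le[OF l(2)]] by auto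
   thus ?thesis using True by simp
  next
   case False
   then obtain u where u: "0 <= u" "u <= s" "N < \<bar>X u w\<bar>" using w by (auto simp: level_def not_le)
   \<comment> \<open>If the level is exceeded at s itself, continuity moves the excess to an earlier
     sampling time. Once the sampling times have passed u', the sampled indicators are 0 as
     well.\<close>
   have "\<exists>u'. 0 <= u' \<and> u' < s \<and> N < \<bar>X u' w\<bar>"
   proof (cases "u < s")
    case True thus ?thesis using u by auto
   next
    case False
    hence "u = s" using u by simp
    have "\<forall>\<^sub>F k in sequentially. N < \<bar>X (l k) w\<bar>"
     using u(3) unfolding \<open>u = s\<close> by (intro order_tendstoD(1)[OF tendsto_rabs[OF Xl]])
    thus ?thesis using l(1,2) by (auto simp: eventually_sequentially)
   qed
   then obtain u' where u': "0 <= u'" "u' < s" "N < \<bar>X u' w\<bar>" by auto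
   have "\<forall>\<^sub>F k in sequentially. u' < l k" using u'(2) ls by (rule order_tendstoD(1)[rotated])
   thus ?thesis
   proof eventually_elim
    case (elim k)
    hence "w \<notin> level X N (l k)" using u' by (auto simp: level_def not_le intro!: bexI[of _ u'])
    thus ?case using False by simp
   qed
  qed
  hence "(%k. indicator (level X N (l k)) w :: real) \<longlonglongrightarrow> indicator (level X N s) w" by (rule tendsto_eventually)
  thus ?thesis unfolding l(4) by (intro tendsto_intros Xl)
 qed
 interpret PM: pair_sigma_finite lborel M ..
 define u where "u = (%k s w. esq (norm (K k s w)) * indicator {0<..t} s)"
 define wt where "wt = (%s w. ennreal (v \<bullet> v) * (esq (X s w) * indicator (level X N s) w) * indicator {0<..t} s)"
 have ulim: "(%k. u k s w) \<longlonglongrightarrow> wt s w" if "w \<in> space M" for s w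
 proof (cases "s \<in> {0<..t}")
  case True
  have "(%k. esq (norm (K k s w))) \<longlonglongrightarrow> esq (norm ((?e s w) *\<^sub>R v))"
   using True that by (intro tendsto_ennrealI tendsto_intros Klim) auto
  also have "esq (norm ((?e s w) *\<^sub>R v)) = wt s w"
   using True by (simp add: wt_def power_mult_distrib indicator_def ennreal_mult power2_norm_eq_inner mult.commute)
  finally show ?thesis using True by (simp add: u_def)
 qed (simp add: u_def wt_def)
 have um: "(%(s, w). u k s w) \<in> ?g" for k
 proof -
  have [measurable]: "(%(t, w). indicator {0..} t *\<^sub>R K k t w) \<in> ?g" using jK[of k] unfolding jointly_def .
  have "(%x. esq (norm (case x of (t, w) => indicator {0..} t *\<^sub>R K k t w)) * indicator {0<..t} (fst x)) \<in> ?g"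
   by measurable
  thus ?thesis by (rule measurable_cong[THEN iffD1, rotated]) (auto simp: u_def indicator_def)
 qed
 have wm: "(%(s, w). wt s w) \<in> ?g"
  by (rule borel_measurable_LIMSEQ_order[where u = "%k. %(s, w). u k s w", OF _ um]) (auto simp: space_pair_measure ulim)
 have "(%k. \<integral>\<^sup>+x. (case x of (s, w) => u k s w) \<partial>?b) \<longlonglongrightarrow> (?a wt)"
 proof (rule nn_integral_dominated_convergence[where w = "%x. esq (N * norm v) * indicator {0<..t} (fst x)"])
  show "AE x in lborel \<Otimes>\<^sub>M M. (case x of (s, w) => u k s w) <= esq (N * norm v) * indicator {0<..t} (fst x)" for k
   using Kbnd by (intro AE_I2) (auto simp: u_def indicator_def intro!: ennreal_leI power_mono)
  have "?f
   = (\<L> s. (\<E> w. esq (N * norm v) * indicator {0<..t} s))"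
   by (subst nn_integral_fst[symmetric]) auto
  also have "... < \<infinity>" using t by (simp add: emeasure_space_1 nn_integral_cmult_indicator ennreal_mult_less_top)
  finally show "?f < \<infinity>" .
  show "AE x in lborel \<Otimes>\<^sub>M M. (%k. case x of (s, w) => u k s w) \<longlonglongrightarrow> (case x of (s, w) => wt s w)"
   by (intro AE_I2) (auto simp: space_pair_measure ulim)
  show "(%x. esq (N * norm v) * indicator {0<..t} (fst x)) \<in> ?g" by measurable
 qed (rule um wm)+
 moreover have "(\<integral>\<^sup>+x. (case x of (s, w) => u k s w) \<partial>?b) = (?j w K k)" for k
 proof -
  have "(\<L> s. u k s w) = energy t (K k) w" for w
   unfolding energy_def u_def
   by (rule nn_integral_cong_AE, rule AE_mp[OF AE_lborel_singleton[of 0]], rule AE_I2) (auto simp: indicator_def)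
  thus ?thesis using PM.nn_integral_snd[OF um[of k]] by simp
 qed
 moreover have wle: "(?a wt) <= ?c"
 proof -
  have Xm: "(%w. esq (X s w) * indicator (level X N s) w) \<in> borel_measurable M" if "0 <= s" for s
   using measurable_F_M[OF XF[OF that]] sets_F[OF level_F[OF X N that]] by measurable
  have "(\<E> w. wt s w) = ennreal (v \<bullet> v) * (?h s)" for s
   using nn_integral_cmult[OF Xm, of s "ennreal (v \<bullet> v)"]
   by (cases "s \<in> {0<..t}") (auto simp: wt_def Q_def)
  hence "(?a wt) = (\<L> s. ennreal (v \<bullet> v) * (?h s))"
   using nn_integral_fst[OF wm] by simp
  also have "... <= ?c"
  proof (cases "v = 0")
   case False
   have mq: "(%s. ennreal (v \<bullet> v) * (?h s)) \<in> ?m"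
    using borel_measurable_nn_integral_fst[OF wm] \<open>\<And>s. (\<integral>\<^sup>+w. wt s w \<partial>M) = ennreal (v \<bullet> v) * (Q s * indicator {0<..t} s)\<close> by simp
   \<comment> \<open>Measurability of Q on \<open>{0<..t}\<close> is recovered from that of (v . v)
     Q, which Fubini's theorem provides.\<close>
   have "(%s. ennreal (1 / (v \<bullet> v)) * (ennreal (v \<bullet> v) * (?h s))) \<in> ?m"
    using mq by measurable
   moreover have "ennreal (1 / (v \<bullet> v)) * (ennreal (v \<bullet> v) * q) = q" for q
    using False by (simp add: mult.assoc[symmetric] ennreal_mult[symmetric])
   ultimately have "(%s. Q s * indicator {0<..t} s) \<in> ?m" by simp
   hence "(\<L> s. ennreal (v \<bullet> v) * (?h s)) = ennreal (v \<bullet> v) * (\<L> s. Q s * indicator {0<..t} s)"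
    by (rule nn_integral_cmult)
   also have "... <= ?c"
    by (intro mult_left_mono nn_integral_mono) (auto simp: indicator_def)
   finally show ?thesis .
  qed simp
  finally show ?thesis .
 qed
 ultimately have lim: "(%k. \<E> w. energy t (K k) w) \<longlonglongrightarrow> (?a wt)" by simp
 have "(\<integral>\<^sup>+w\<in>level X N t. esq (I t w) \<partial>M) <= ?a wt"
 proof (rule ito_at_Fatou[OF ito_integral_at[OF ito t0] t0 _ el _ order_refl lim])
  show "level X N t \<in> sets M" by (rule sets_F[OF level_F[OF X N t0]])
  \<comment> \<open>An outcome in \<open>level X N t\<close> lies in every earlier level event, so
    along it the truncated integrand is the original one on the whole interval.\<close>
  show "cip (level X N t) (%k. energy t (?d K k))"
  proof (rule cip_pointwise[OF _ sets_F[OF level_F[OF X N t0]]])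
   have jd: "jointly (?d K k)" for k by (rule jointly_diff[OF jK ito_integralD(3)[OF ito]])
   thus "energy t (?d K k) \<in> borel_measurable M" for k by (rule energy_measurable)
   fix w assume w: "w \<in> level X N t"
   hence wM: "w \<in> space M" by (simp add: level_def)
   have "(%k. energy t (?d K k) w) \<longlonglongrightarrow> (\<integral>\<^sup>+s. 0 \<partial>(lborel :: real measure))"
    unfolding energy_def
   proof (rule nn_integral_dominated_convergence[where w = "%s. esq ?l * indicator {0..t} s"])
    show "AE s in lborel. esq (?i K k s w) * indicator {0..t} s <= esq ?l * indicator {0..t} s" for k
    proof (rule AE_mp[OF AE_lborel_singleton[of 0]], rule AE_I2, rule impI)
     fix s :: real assume "s ~= 0"
     show "esq (?i K k s w) * indicator {0..t} s <= esq ?l * indicator {0..t} s"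
     proof (cases "s \<in> {0..t}")
      case True
      have "norm (K k s w - X s w *\<^sub>R v) <= N * norm v + N * norm v"
       using True \<open>s \<noteq> 0\<close> w by (intro order_trans[OF norm_triangle_ineq4] add_mono Kbnd) (auto simp: level_def intro!: mult_right_mono)
      thus ?thesis by (intro mult_right_mono ennreal_leI power_mono) auto
     qed simp
    qed
    show "AE s in lborel. (%k. esq (?i K k s w) * indicator {0..t} s) \<longlonglongrightarrow> 0"
    proof (rule AE_mp[OF AE_lborel_singleton[of 0]], rule AE_I2, rule impI)
     fix s :: real assume s: "s ~= 0"
     show "(%k. esq (?i K k s w) * indicator {0..t} s) \<longlonglongrightarrow> 0"
     proof (cases "s \<in> {0..t}")
      case True
      hence "w \<in> level X N s" using w level_antimono[of s t X N] by auto
      hence "(%k. K k s w) \<longlonglongrightarrow> X s w *\<^sub>R v" using Klim[of s w] True s wM by simp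
      hence "(%k. esq (?i K k s w)) \<longlonglongrightarrow> esq (norm (X s w *\<^sub>R v - X s w *\<^sub>R v))"
       by (intro tendsto_ennrealI tendsto_intros)
      thus ?thesis using True by simp
     qed simp
    qed
    show "(\<L> s. esq ?l * indicator {0..t} s) < \<infinity>"
     using t by (simp add: nn_integral_cmult_indicator ennreal_mult_less_top)
   qed (use energy_integrand_measurable[OF jd wM] in auto)
   thus "(%k. energy t (?d K k) w) \<longlonglongrightarrow> 0" by simp
  qed
 qed
 also have "... <= ?c" by (rule wle)
 finally show ?thesis .
qed

lemma level_exhausts:
 assumes "adapted_continuous M F X" "w \<in> space M"
 shows "\<exists>n::nat. \<forall>m\<ge>n. w \<in> level X (real m) t"
proof -
 have "continuous_on {0..t} (%s. X s w)" using assms unfolding adapted_continuous_def by (auto intro: continuous_on_subset)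
 from compact_imp_bounded[OF compact_continuous_image[OF this compact_Icc]]
 obtain C where "\<forall>u\<in>{0..t}. \<bar>X u w\<bar> <= C" unfolding bounded_iff by auto
 moreover obtain n where "C <= real n" using real_arch_simple by blast
 ultimately show ?thesis using assms(2) unfolding level_def by (intro exI[of _ n]) force
qed

text \<open>Over the degenerate interval every energy is 0, so \<open>ito_at_Fatou\<close> bounds
  the second moment by 0.\<close>

lemma ito_at_zero:
 assumes ito: "ito_integral M Z H I" shows "AE w in M. I 0 w = 0"
proof -
 obtain Hs Is where H: "\<And>k. elementary_integral M Z (Hs k) (Is k)"
   "cip (space M) (%k. energy 0 (%s w. Hs k s w - H s w))"
  using ito unfolding ito_integral_iff by blast
 have "energy 0 (Hs k) w = 0" for k w
  unfolding energy_def by (intro nn_integral_zero' AE_mp[OF AE_lborel_singleton[of 0] AE_I2]) auto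
 hence e0: "(\<E> w. energy 0 (Hs k) w) <= 0" for k by simp
 have "(\<integral>\<^sup>+w\<in>space M. esq (I 0 w) \<partial>M) <= 0"
  by (rule ito_at_Fatou[where b = "%k. 0", OF ito_integral_at[OF ito order_refl] order_refl sets.top H e0 tendsto_const])
 hence z: "(\<E> w. esq (I 0 w) * indicator (space M) w) = 0" by simp
 have "(%w. esq (I 0 w) * indicator (space M) w) \<in> borel_measurable M"
  using ito_integralD(5)[OF ito order_refl] by measurable
 from nn_integral_0_iff_AE[OF this] z have "AE w in M. esq (I 0 w) * indicator (space M) w = 0" by simp
 thus ?thesis using AE_space by eventually_elim auto
qed

text \<open>The square of the sum of initial value, drift and integral costs a factor 3;
  Cauchy-Schwarz in time costs a factor T in the drift terms. On the level event for N the second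
  moment is at most N^2, so Gronwall's inequality applies, and its bound is free of N. Monotone
  convergence then removes the level.\<close>

theorem linear_SDE_L2:
 assumes X: "adapted_continuous M F X" and ito: "ito_integral M Z (%s w. X s w *\<^sub>R v) I"
  and int: "AE w in M. \<forall>t\<ge>0. set_integrable lborel {0..t} (%s. a s w)"
  and eq: "AE w in M. \<forall>t\<ge>0. X t w = x + (LINT s:{0..t}|lborel. a s w) + I t w"
  and bound: "AE w in M. \<forall>t\<in>{0..T}. nnint {0..t} (%s. esq (a s w))
   <= ennreal c0 + ennreal c1 * nnint {0..t} (%s. esq (X s w))"
  and c: "0 <= c0" "0 <= c1" and t: "0 <= t" "t <= T"
 shows "(\<E> w. esq (X t w)) <= ennreal ((3 * x^2 + 3 * T * c0) * exp ((3 * T * c1 + 3 * (v \<bullet> v)) * t))"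
proof -
 let ?a = "3 * x^2 + 3 * T * c0"
 let ?b = "%w. %u. esq (X u w)"
 let ?c = "%N s. \<integral>\<^sup>+w\<in>level X N s. esq (I s w) \<partial>M"
 let ?d = "borel_measurable (lborel \<Otimes>\<^sub>M M)"
 let ?e = "borel_measurable M"
 let ?f = "%w s N. \<E> w. nnint {0..s} (?b w) * indicator (level X N s) w"
 let ?g = "%v. 3 * T * c1 + 3 * (v \<bullet> v)"
 let ?h = "%s w. ennreal c0 + ennreal c1 * nnint {0..s} (?b w)"
 let ?i = "%s w. ennreal ?a + ennreal (3 * T * c1) * nnint {0..s} (?b w) + 3 * esq (I s w)"
 have T: "0 <= T" using t by simp
 define Q where "Q = (%N s. \<integral>\<^sup>+w\<in>level X N s. esq (X s w) \<partial>M)"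
 have XF: "X s \<in> borel_measurable (F s)" if "0 <= s" for s using X that unfolding adapted_continuous_def by auto
 note [measurable] = measurable_F_M[OF XF] ito_integralD(5)[OF ito] sets_F[OF level_F[OF X]]
 have jX: "jointly X" by (rule predictable_jointly[OF adapted_continuous_predictable[OF X]])
 note I0 = ito_at_zero[OF ito]
 have QN: "Q N t <= ennreal (?a * exp ((?g v) * t))" if N: "0 <= N" for N
 proof (rule Gronwall_nn[where T = T and C = "N^2"])
  show "Q N s <= esq N" if "0 <= s" for s
  proof -
   have "Q N s <= (\<E> w. esq N)"
    unfolding Q_def using that N by (intro nn_integral_mono) (auto simp: indicator_def level_def intro!: ennreal_leI abs_le_square_iff[THEN iffD1])
   thus ?thesis by (simp add: emeasure_space_1)
  qed
  show "Q N s <= ennreal ?a + ennreal (?g v) * nnint {0..s} (%s. Q N s)"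
   if s: "0 <= s" "s <= T" for s
  proof -
   have "AE w in M. esq (X s w) * indicator (level X N s) w
    <= ennreal ?a + ennreal (3 * T * c1) * (nnint {0..s} (?b w) * indicator (level X N s) w)
     + 3 * (esq (I s w) * indicator (level X N s) w)"
    using int eq bound
   proof eventually_elim
    case (elim w)
    define A where "A = (LINT u:{0..s}|lborel. a u w)"
    have "(u + v + w)^2 <= 3 * u^2 + 3 * v^2 + 3 * w^2" for u v w :: real
     using sum_squares_bound[of u v] sum_squares_bound[of u w] sum_squares_bound[of v w]
     by (simp add: power2_eq_square algebra_simps)
    from this[of x A "I s w"] have "(X s w)^2 <= 3 * x^2 + 3 * A^2 + 3 * (I s w)^2" using elim s by (simp add: A_def)
    hence "esq (X s w) <= ennreal (3 * x^2 + 3 * A^2 + 3 * (I s w)^2)" by (rule ennreal_leI)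
    also have "... = ennreal (3 * x^2) + 3 * esq A + 3 * esq (I s w)"
     by (simp add: ennreal_plus ennreal_mult)
    also have "esq A <= ennreal T * (?h s w)"
    proof -
     have "esq A <= ennreal s * nnint {0..s} (%u. esq (a u w))"
      unfolding A_def using elim(1) s square_integral_le[of 0 s "%u. a u w"] by auto
     also have "... <= ennreal T * (?h s w)"
      using elim(3) s by (intro mult_mono ennreal_leI) auto
     finally show ?thesis .
    qed
    also have "ennreal (3 * x^2) + 3 * (ennreal T * (?h s w)) + 3 * esq (I s w)
     = ?i s w"
     using c T by (simp add: ennreal_plus ennreal_mult distrib_left mult.assoc add.assoc)
    finally have *: "esq (X s w) <= ?i s w"
     by (simp add: add_mono mult_left_mono)
    show ?case
     using * by (cases "w \<in> level X N s") simp_all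
   qed
   hence "Q N s <= (\<E> w. ennreal ?a + ennreal (3 * T * c1) * (nnint {0..s} (?b w) * indicator (level X N s) w)
     + 3 * (esq (I s w) * indicator (level X N s) w))"
    unfolding Q_def by (rule nn_integral_mono_AE)
   also have "... = ennreal ?a + ennreal (3 * T * c1) * (?f w s N)
     + 3 * (?c N s)"
   proof -
    have e: "nnint {0..s} (?b w) = energy s X w" for w by (simp add: energy_def)
    have [measurable]: "level X N s \<in> sets M" "I s \<in> ?e" "energy s X \<in> ?e"
     using sets_F[OF level_F[OF X N s(1)]] ito_integralD(5)[OF ito s(1)] energy_measurable[OF jX] by auto
    have m1: "(%w. ennreal (3 * T * c1) * (energy s X w * indicator (level X N s) w)) \<in> ?e"
     "(%w. energy s X w * indicator (level X N s) w) \<in> ?e"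
     "(%w. esq (I s w) * indicator (level X N s) w) \<in> ?e" by measurable
    show ?thesis unfolding e
     using m1 by (simp add: nn_integral_add nn_integral_cmult emeasure_space_1)
   qed
   \<comment> \<open>Fubini, after which the level event of time s is enlarged to that of the
     earlier time u.\<close>
   also have "(?f w s N) <= nnint {0..s} (%u. Q N u)"
   proof -
    interpret PM: pair_sigma_finite lborel M ..
    have lev: "level X N s \<in> sets M" by (rule sets_F[OF level_F[OF X N s(1)]])
    have m: "(%(u, w). esq (X u w) * indicator {0..s} u * indicator (level X N s) w) \<in> ?d"
    proof -
     have [measurable]: "(%(t, w). indicator {0..} t *\<^sub>R X t w) \<in> ?d" using jX unfolding jointly_def .
     have "(%x. esq (case x of (t, w) => indicator {0..} t *\<^sub>R X t w) * indicator {0..s} (fst x) * indicator (level X N s) (snd x)) \<in> ?d"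
      using lev by measurable
     thus ?thesis by (rule measurable_cong[THEN iffD1, rotated]) (auto simp: indicator_def)
    qed
    have sec: "(%u. esq (X u w) * indicator {0..s} u) \<in> borel_measurable lborel" if "w \<in> space M" for w
     using energy_integrand_measurable[OF jX that, of s] by simp
    have "(?f w s N)
     = (\<E> w. (\<L> u. esq (X u w) * indicator {0..s} u * indicator (level X N s) w))"
     using nn_integral_multc[OF sec] by (intro nn_integral_cong) simp
    also have "... = (\<L> u. (\<E> w. esq (X u w) * indicator {0..s} u * indicator (level X N s) w))"
     by (rule PM.Fubini'[OF m])
    also have "... <= nnint {0..s} (%u. Q N u)"
    proof (rule nn_integral_mono)
     fix u
     show "(\<E> w. esq (X u w) * indicator {0..s} u * indicator (level X N s) w) <= Q N u * indicator {0..s} u"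
     proof (cases "u \<in> {0..s}")
      case True
      thus ?thesis unfolding Q_def
       using level_antimono[of u s X N] by (auto intro!: nn_integral_mono simp: indicator_def)
     qed simp
    qed
    finally show ?thesis .
   qed
   \<comment> \<open>\<open>ito_localized\<close> asks for a positive time; at time 0 the integral
     vanishes.\<close>
   also have "(?c N s) <= ennreal (v \<bullet> v) * nnint {0..s} (%u. Q N u)"
   proof (cases "s = 0")
    case True
    have "(?c N s) = (\<E> w. 0)"
     using I0 True by (intro nn_integral_cong_AE) (auto elim!: eventually_mono)
    thus ?thesis by simp
   next
    case False
    thus ?thesis using ito_localized[OF X ito _ N, of s] s unfolding Q_def by simp
   qed
   also have "ennreal ?a + ennreal (3 * T * c1) * nnint {0..s} (%u. Q N u) + 3 * (ennreal (v \<bullet> v) * nnint {0..s} (%u. Q N u))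
    = ennreal ?a + ennreal (?g v) * nnint {0..s} (%u. Q N u)"
    using c T by (simp add: ennreal_plus ennreal_mult distrib_right add.assoc mult.assoc)
   finally show ?thesis by (simp add: add_mono mult_left_mono)
  qed
 qed (use c T t in auto)
 have "(\<E> w. esq (X t w)) = (\<E> w. (SUP n. esq (X t w) * indicator (level X (real n) t) w))"
 proof (rule nn_integral_cong)
  fix w assume "w \<in> space M"
  then obtain n where n: "w \<in> level X (real n) t" using level_exhausts[OF X] by blast
  show "esq (X t w) = (SUP n. esq (X t w) * indicator (level X (real n) t) w)"
  proof (rule SUP_eqI[symmetric])
   fix y assume "\<And>i. i \<in> UNIV ==> esq (X t w) * indicator (level X (real i) t) w <= y"
   from this[of n] n show "esq (X t w) <= y" by simp
  qed (auto simp: indicator_def)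
 qed
 also have "... = (SUP n. Q (real n) t)"
  unfolding Q_def
 proof (rule nn_integral_monotone_convergence_SUP)
  show "incseq (%n w. esq (X t w) * indicator (level X (real n) t) w)"
   by (auto simp: incseq_def le_fun_def level_def indicator_def intro: order_trans)
  show "(%w. esq (X t w) * indicator (level X (real n) t) w) \<in> ?e" for n
   using measurable_F_M[OF XF[OF t(1)]] sets_F[OF level_F[OF X of_nat_0_le_iff t(1)]] by measurable
 qed
 also have "... <= ennreal (?a * exp ((?g v) * t))"
  using QN by (intro SUP_least) simp
 finally show ?thesis .
qed

end

section \<open>Square-integrable martingales\<close>

context brownian
begin

text \<open>The martingale property in the form in which it is applied: increments after s are
  orthogonal to every square-integrable variable known at s.\<close>

definition L2_martingale :: "(real => 'w => real) => bool" where
 "L2_martingale X \<longleftrightarrow> (\<forall>t\<ge>0. X t \<in> borel_measurable (F t) \<and> integrable M (%w. (X t w)^2)) \<and>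
   (\<forall>s\<ge>0. \<forall>t\<ge>s. \<forall>U\<in>borel_measurable (F s). integrable M (%w. (U w)^2) \<longrightarrow>
    expectation (%w. U w * (X t w - X s w)) = 0)"

lemma integrable_mult_L2:
 fixes f g :: "'w => real"
 assumes [measurable]: "f \<in> borel_measurable M" "g \<in> borel_measurable M"
  and "integrable M (%w. (f w)^2)" "integrable M (%w. (g w)^2)"
 shows "integrable M (%w. f w * g w)"
proof (rule Bochner_Integration.integrable_bound)
 show "integrable M (%w. (f w)^2 + (g w)^2)" using assms by simp
 have "\<bar>f w * g w\<bar> <= (f w)^2 + (g w)^2" for w
 proof -
  have "2 * \<bar>f w\<bar> * \<bar>g w\<bar> <= (f w)^2 + (g w)^2" using sum_squares_bound[of "\<bar>f w\<bar>" "\<bar>g w\<bar>"] by simp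
  moreover have "0 <= \<bar>f w\<bar> * \<bar>g w\<bar>" by simp
  ultimately show ?thesis unfolding abs_mult by linarith
 qed
 thus "AE w in M. norm (f w * g w) <= norm ((f w)^2 + (g w)^2)" by (intro AE_I2) simp
qed measurable

lemma integrable_square_linear:
 fixes f g :: "'w => real"
 assumes "f \<in> borel_measurable M" "g \<in> borel_measurable M"
  and "integrable M (%w. (f w)^2)" "integrable M (%w. (g w)^2)"
 shows "integrable M (%w. (a * f w + b * g w)^2)"
proof -
 have "integrable M (%w. a^2 * (f w)^2 + b^2 * (g w)^2 + 2 * a * b * (f w * g w))"
  using assms integrable_mult_L2[OF assms] by simp
 thus ?thesis by (simp add: power2_sum power_mult_distrib mult_ac)
qed

lemma L2_martingaleD:
 assumes "L2_martingale X" "0 <= t"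
 shows "X t \<in> borel_measurable (F t)" "X t \<in> borel_measurable M" "integrable M (%w. (X t w)^2)" "integrable M (X t)"
proof -
 show F: "X t \<in> borel_measurable (F t)" and sq: "integrable M (%w. (X t w)^2)" using assms unfolding L2_martingale_def by auto
 show m: "X t \<in> borel_measurable M" by (rule measurable_F_M[OF F])
 show "integrable M (X t)" by (rule square_integrable_imp_integrable[OF m sq])
qed

lemma L2_martingale_orth:
 assumes X: "L2_martingale X" and st: "0 <= s" "s <= t" and U: "U \<in> borel_measurable (F s)" "integrable M (%w. (U w)^2)"
 shows "integrable M (%w. U w * (X t w - X s w))" "expectation (%w. U w * (X t w - X s w)) = 0"
proof -
 have t: "0 <= t" using st by simp
 note D = L2_martingaleD[OF X st(1)] L2_martingaleD[OF X t]
 show "expectation (%w. U w * (X t w - X s w)) = 0" using X st U unfolding L2_martingale_def by blast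
 show "integrable M (%w. U w * (X t w - X s w))"
  using integrable_square_linear[OF D(6) D(2) D(7) D(3), of 1 "-1"] D
  by (intro integrable_mult_L2 measurable_F_M[OF U(1)] U(2)) auto
qed

lemma L2_martingale_diff:
 assumes X: "L2_martingale X" and Y: "L2_martingale Y"
 shows "L2_martingale (%t w. X t w - Y t w)"
 unfolding L2_martingale_def
proof (intro conjI allI impI ballI)
 fix t :: real assume t: "0 <= t"
 note D = L2_martingaleD[OF X t] and E = L2_martingaleD[OF Y t]
 show "(%w. X t w - Y t w) \<in> borel_measurable (F t)" by (rule borel_measurable_diff[OF D(1) E(1)])
 show "integrable M (%w. (X t w - Y t w)^2)" using integrable_square_linear[OF D(2) E(2) D(3) E(3), of 1 "-1"] by simp
next
 fix s t and U :: "'w => real" assume st: "0 <= s" "s <= t" and U: "U \<in> borel_measurable (F s)" "integrable M (%w. (U w)^2)"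
 have "(%w. U w * (X t w - Y t w - (X s w - Y s w))) = (%w. U w * (X t w - X s w) - U w * (Y t w - Y s w))"
  by (simp add: algebra_simps)
 thus "expectation (%w. U w * (X t w - Y t w - (X s w - Y s w))) = 0"
  using L2_martingale_orth[OF X st U] L2_martingale_orth[OF Y st U] by simp
qed

text \<open>Between s and t the integral is a sum over the partition points clamped to [s, t]. On
  each clamped cell the product of U and the coefficient is known at the start, so its product with
  the increment has mean 0; a cell that begins after t collapses.\<close>

lemma step_I_martingale:
 assumes sd: "step_data m q r" shows "L2_martingale (step_I m q r)"
 unfolding L2_martingale_def
proof (intro conjI allI impI ballI)
 fix t :: real assume t: "0 <= t"
 show "step_I m q r t \<in> borel_measurable (F t)" by (rule measurable_F_mono[OF step_I_measurable[OF sd t]]) simp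
 show "integrable M (%w. (step_I m q r t w)^2)" using step_isometry[OF sd t] by blast
next
 let ?a = "%U w i. U w *\<^sub>R r i w"
 fix s t and U :: "'w => real" assume st: "0 <= s" "s <= t" and U: "U \<in> borel_measurable (F s)" "integrable M (%w. (U w)^2)"
 obtain C where C: "0 <= C" "\<And>i w. i < m ==> w \<in> space M ==> norm (r i w) <= C" by (rule step_data_bound[OF sd]) blast
 define cl where "cl = (%i. max s (min t (q i)))"
 have Z: "Z (min t (q i)) w - Z (min s (q i)) w = Z (cl i) w - Z s w" for i w
  using st by (auto simp: cl_def min_def max_def)
 have eq: "U w * (step_I m q r t w - step_I m q r s w) = (\<Sum>i<m. (?a U w i) \<bullet> (Z (cl (Suc i)) w - Z (cl i) w))" for w
 proof -
  have "step_I m q r t w - step_I m q r s w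
   = (\<Sum>i<m. r i w \<bullet> ((Z (min t (q (Suc i))) w - Z (min s (q (Suc i))) w) - (Z (min t (q i)) w - Z (min s (q i)) w)))"
   by (simp add: step_I_def sum_subtractf[symmetric] inner_diff_right algebra_simps)
  thus ?thesis unfolding Z by (simp add: sum_distrib_left)
 qed
 have U1: "integrable M U" by (rule square_integrable_imp_integrable[OF measurable_F_M[OF U(1)] U(2)])
 have summand: "integrable M (%w. (?a U w i) \<bullet> (Z (cl (Suc i)) w - Z (cl i) w)) \<and>
   expectation (%w. (?a U w i) \<bullet> (Z (cl (Suc i)) w - Z (cl i) w)) = 0" if i: "i < m" for i
 proof (cases "q i <= t")
  case True
  have r: "r i \<in> borel_measurable (F (q i))" using sd i unfolding step_data_def by simp
  have "q i <= q (Suc i)" using sd i unfolding step_data_def by simp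
  hence c: "0 <= cl i" "cl i <= cl (Suc i)" "q i <= cl i" "s <= cl i" using st True by (auto simp: cl_def)
  have m: "(%w. U w *\<^sub>R r i w) \<in> borel_measurable (F (cl i))"
   by (intro borel_measurable_scaleR measurable_F_mono[OF U(1) c(4)] measurable_F_mono[OF r c(3)])
  have "integrable M (%w. norm (?a U w i))"
  proof (rule Bochner_Integration.integrable_bound)
   show "integrable M (%w. C * U w)" using U1 by simp
   show "AE w in M. norm (norm (?a U w i)) <= norm (C * U w)"
    using C i by (intro AE_I2) (auto simp: abs_mult mult.commute[of C] intro!: mult_left_mono)
   show "(%w. norm (?a U w i)) \<in> borel_measurable M"
    by (rule measurable_compose[OF measurable_F_M[OF m] borel_measurable_norm])
  qed
  from increment_mean[OF c(1,2) m this] show ?thesis by simp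
 next
  case False
  hence "t < q i" "t < q (Suc i)" using sd i unfolding step_data_def by (auto intro: order.strict_trans2)
  hence "cl (Suc i) = cl i" by (simp add: cl_def)
  thus ?thesis by simp
 qed
 show "expectation (%w. U w * (step_I m q r t w - step_I m q r s w)) = 0"
  unfolding eq using summand by (subst Bochner_Integration.integral_sum) auto
qed

lemma martingale_square_sum:
 assumes X: "L2_martingale X" and \<sigma>: "\<And>i. 0 <= \<sigma> i" "\<And>i. \<sigma> i <= \<sigma> (Suc i)"
 shows "expectation (%w. (X (\<sigma> m) w)^2) = expectation (%w. (X (\<sigma> 0) w)^2) + (\<Sum>i<m. expectation (%w. (X (\<sigma> (Suc i)) w - X (\<sigma> i) w)^2))"
proof (induction m)
 let ?a = "%m w. X (\<sigma> (Suc m)) w - X (\<sigma> m) w"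
 case (Suc m)
 note D = L2_martingaleD[OF X \<sigma>(1)[of m]] and E = L2_martingaleD[OF X \<sigma>(1)[of "Suc m"]]
 have i: "integrable M (%w. (?a m w)^2)" using integrable_square_linear[OF E(2) D(2) E(3) D(3), of 1 "-1"] by simp
 have "(X (\<sigma> (Suc m)) w)^2 = (X (\<sigma> m) w)^2 + 2 * (X (\<sigma> m) w * (?a m w)) + (?a m w)^2" for w
  by (simp add: power2_eq_square algebra_simps)
 thus ?case using Suc L2_martingale_orth[OF X \<sigma>(1,2) D(1,3)] D i by simp
qed simp

text \<open>The event is split by the first index j at which q is exceeded. There the square of X T
  is at least q^2 plus twice X (t j) times the later increment, and this product has mean 0 over the
  event since the event is known at t j.\<close>

lemma Kolmogorov_finite:
 fixes n :: nat and t :: "nat => real"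
 assumes X: "L2_martingale X" and t: "\<And>j. j < n ==> 0 <= t j \<and> t j <= T" "\<And>i j. i <= j ==> j < n ==> t i <= t j"
  and q: "0 < q" and T: "0 <= T"
 shows "prob {w \<in> space M. \<exists>j<n. q < \<bar>X (t j) w\<bar>} <= expectation (%w. (X T w)^2) / q^2"
proof -
 let ?a = "%A j. %w. indicator (A j) w * (X T w)^2 - 2 * (indicator (A j) w * X (t j) w * (X T w - X (t j) w))"
 let ?b = "{w \<in> space M. \<exists>j<n. q < \<bar>X (t j) w\<bar>}"
 let ?c = "%A j. %w. indicator (A j) w * (X T w)^2"
 define A where "A = (%j. {w \<in> space M. q < \<bar>X (t j) w\<bar> \<and> (\<forall>i<j. \<bar>X (t i) w\<bar> <= q)})"
 have XF: "X (t i) \<in> borel_measurable (F (t j))" if "i <= j" "j < n" for i j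
  using that t by (intro measurable_F_mono[OF L2_martingaleD(1)[OF X]]) auto
 have AF: "A j \<in> sets (F (t j))" if "j < n" for j
 proof -
  have eq: "A j = (\<Inter>i<j. {w \<in> space (F (t j)). \<bar>X (t i) w\<bar> <= q}) \<inter> {w \<in> space (F (t j)). q < \<bar>X (t j) w\<bar>}" if "0 < j"
   unfolding A_def using that by auto
  have m1: "{w \<in> space (F (t j)). q < \<bar>X (t j) w\<bar>} \<in> sets (F (t j))" using XF[of j j] that by measurable
  have m2: "{w \<in> space (F (t j)). \<bar>X (t i) w\<bar> <= q} \<in> sets (F (t j))" if "i < j" for i
   using XF[OF less_imp_le[OF that] \<open>j < n\<close>] by measurable
  show ?thesis
  proof (cases "j = 0")
   case True thus ?thesis using m1 by (simp add: A_def)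
  next
   case False
   thus ?thesis using eq m1 m2 by (auto intro!: sets.Int sets.finite_INT)
  qed
 qed
 have AM: "A j \<in> sets M" if "j < n" for j by (rule sets_F[OF AF[OF that]])
 have disj: "disjoint_family_on A {..<n}"
 proof -
  have "A i \<inter> A j = {}" if "i < j" for i j using that by (auto simp: A_def not_less[symmetric])
  thus ?thesis unfolding disjoint_family_on_def by (metis inf_commute linorder_neqE_nat)
 qed
 note DT = L2_martingaleD[OF X T]
 have bound: "q^2 * prob (A j) <= expectation (?c A j)" if j: "j < n" for j
 proof -
  have tj: "0 <= t j" "t j <= T" using t j by auto
  note Dj = L2_martingaleD[OF X tj(1)]
  have AMj: "A j \<in> sets M" by (rule AM[OF j])
  have U: "(%w. indicator (A j) w * X (t j) w) \<in> borel_measurable (F (t j))"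
   by (intro borel_measurable_times borel_measurable_indicator AF[OF j] Dj(1))
  have U2: "integrable M (%w. (indicator (A j) w * X (t j) w)^2)"
  proof -
   have "(%w. (indicator (A j) w * X (t j) w)^2) = (%w. (X (t j) w)^2 * indicator (A j) w)" by (auto simp: indicator_def)
   thus ?thesis using integrable_real_mult_indicator[OF AMj Dj(3)] by simp
  qed
  note o = L2_martingale_orth[OF X tj U U2]
  have "q^2 * prob (A j) = expectation (%w. q^2 * indicator (A j) w)" using AMj by simp
  also have "... <= expectation (?a A j)"
  proof (rule integral_mono)
   show "integrable M (%w. q^2 * indicator (A j) w)" using AMj by (intro integrable_mult_right integrable_real_indicator) (auto simp: less_top[symmetric])
   show "integrable M (?a A j)"
    using o(1) integrable_real_mult_indicator[OF AMj DT(3)] by (simp add: mult.commute)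
   fix w
   have "q^2 <= (X (t j) w)^2" if "w \<in> A j" using that q abs_le_square_iff[of q "X (t j) w"] by (auto simp: A_def)
   moreover have "(X T w)^2 - 2 * (X (t j) w * (X T w - X (t j) w)) = (X (t j) w)^2 + (X T w - X (t j) w)^2"
    by (simp add: power2_eq_square algebra_simps)
   ultimately show "q^2 * indicator (A j) w <= indicator (A j) w * (X T w)^2 - 2 * (indicator (A j) w * X (t j) w * (X T w - X (t j) w))"
    by (auto simp: indicator_def intro: add_increasing2)
  qed
  also have "... = expectation (?c A j)"
   using o integrable_real_mult_indicator[OF AMj DT(3)] by (simp add: mult.commute)
  finally show ?thesis .
 qed
 have Un: "?b = (\<Union>j<n. A j)"
 proof (intro equalityI subsetI)
  fix w assume "w \<in> ?b"
  then obtain j where j: "j < n" "q < \<bar>X (t j) w\<bar>" "w \<in> space M" by auto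
  define l where "l = (LEAST j. q < \<bar>X (t j) w\<bar>)"
  have "q < \<bar>X (t l) w\<bar>" "l <= j" "\<And>i. i < l ==> \<not> q < \<bar>X (t i) w\<bar>"
   unfolding l_def using j(2) by (auto intro: LeastI Least_le dest: not_less_Least)
  thus "w \<in> (\<Union>j<n. A j)" using j by (auto simp: A_def not_less intro!: bexI[of _ l])
 qed (auto simp: A_def)
 have "q^2 * prob (\<Union>j<n. A j) = (\<Sum>j<n. q^2 * prob (A j))"
  using AM disj by (subst finite_measure_finite_Union) (auto simp: sum_distrib_left)
 also have "... <= (\<Sum>j<n. expectation (?c A j))" using bound by (intro sum_mono) auto
 also have "... = expectation (%w. \<Sum>j<n. indicator (A j) w * (X T w)^2)"
  using integrable_real_mult_indicator[OF AM DT(3)] by (subst Bochner_Integration.integral_sum) (auto simp: mult.commute)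
 also have "... <= expectation (%w. (X T w)^2)"
 proof (rule integral_mono)
  show "integrable M (%w. \<Sum>j<n. indicator (A j) w * (X T w)^2)"
   using integrable_real_mult_indicator[OF AM DT(3)] by (intro Bochner_Integration.integrable_sum) (auto simp: mult.commute)
  fix w
  have "(\<Sum>j<n. indicator (A j) w) = indicat_real (\<Union>j<n. A j) w" by (simp add: indicator_UN_disjoint[OF _ disj])
  hence "(\<Sum>j<n. indicator (A j) w) <= (1::real)" by (simp add: indicator_def)
  thus "(\<Sum>j<n. indicator (A j) w * (X T w)^2) <= (X T w)^2"
   unfolding sum_distrib_right[symmetric] using mult_right_mono[of _ 1 "(X T w)^2"] by simp
 qed (rule DT(3))
 finally show ?thesis unfolding Un using q by (simp add: field_simps)
qed

text \<open>By continuity the supremum reduces to a countable dense set of times. Its finite initial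
  pieces in an enumeration are sorted to fit \<open>Kolmogorov_finite\<close>, whose bound does not
  depend on the piece.\<close>

theorem Doob_maximal:
 assumes X: "L2_martingale X" and c: "AE w in M. continuous_on {0..} (%t. X t w)" and q: "0 < q" and T: "0 <= T"
 shows "prob {w \<in> space M. ennreal q < (SUP t\<in>{0..T}. ennreal \<bar>X t w\<bar>)} <= expectation (%w. (X T w)^2) / q^2"
proof -
 let ?a = "expectation (%w. (X T w)^2) / q^2"
 let ?b = "%w. SUP t\<in>{0..T}. ennreal \<bar>X t w\<bar>"
 define D where "D = {0..T} \<inter> insert T \<rat>"
 have D: "countable D" "D ~= {}" "D \<subseteq> {0..T}"
  unfolding D_def using T by (auto intro: countable_subset[OF _ countable_insert[OF countable_rat]])
 define B where "B = (%n. {w \<in> space M. \<exists>s\<in>from_nat_into D ` {..n}. q < \<bar>X s w\<bar>})"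
 have Xm: "X s \<in> borel_measurable M" if "s \<in> D" for s using L2_martingaleD(2)[OF X] D(3) that by auto
 have Bm: "B n \<in> sets M" for n
 proof -
  have "B n = (\<Union>s\<in>from_nat_into D ` {..n}. {w \<in> space M. q < \<bar>X s w\<bar>})" by (auto simp: B_def)
  moreover have "{w \<in> space M. q < \<bar>X s w\<bar>} \<in> sets M" if "s \<in> D" for s using Xm[OF that] by measurable
  ultimately show ?thesis using from_nat_into[OF D(2)] by (auto intro!: sets.finite_UN)
 qed
 have Bn: "prob (B n) <= ?a" for n
 proof -
  let ?S = "from_nat_into D ` {..n}"
  have S: "?S \<subseteq> D" using from_nat_into[OF D(2)] by auto
  let ?xs = "sorted_list_of_set ?S"
  have xs: "set ?xs = ?S" "sorted ?xs" by auto
  have "B n = {w \<in> space M. \<exists>j<length ?xs. q < \<bar>X (?xs ! j) w\<bar>}"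
  proof -
   have "(\<exists>s\<in>?S. q < \<bar>X s w\<bar>) \<longleftrightarrow> (\<exists>s\<in>set ?xs. q < \<bar>X s w\<bar>)" for w by (simp only: xs(1))
   thus ?thesis unfolding B_def by (simp only: Bex_def in_set_conv_nth) blast
  qed
  also have "prob ... <= ?a"
  proof (rule Kolmogorov_finite[OF X _ _ q T])
   show "0 <= ?xs ! j \<and> ?xs ! j <= T" if "j < length ?xs" for j
   proof -
    have "?xs ! j \<in> ?S" using nth_mem[OF that] by (simp only: xs(1))
    hence "?xs ! j \<in> {0..T}" using S D(3) by blast
    thus ?thesis by simp
   qed
   show "?xs ! i <= ?xs ! j" if "i <= j" "j < length ?xs" for i j using sorted_nth_mono[OF xs(2) that] .
  qed
  finally show ?thesis .
 qed
 have "(%n. prob (B n)) \<longlonglongrightarrow> prob (\<Union>n. B n)"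
  using Bm by (intro finite_Lim_measure_incseq) (auto simp: incseq_def B_def intro: order_trans)
 hence "prob (\<Union>n. B n) <= ?a" using Bn by (intro LIMSEQ_le_const2) auto
 moreover have "prob {w \<in> space M. ennreal q < (?b w)} <= prob (\<Union>n. B n)"
 proof (rule finite_measure_mono_AE)
  show "AE w in M. w \<in> {w \<in> space M. ennreal q < (?b w)} \<longrightarrow> w \<in> (\<Union>n. B n)"
   using c
  proof eventually_elim
   case (elim w)
   show ?case
   proof
    assume w: "w \<in> {w \<in> space M. ennreal q < (?b w)}"
    hence "ennreal q < (SUP t\<in>D. ennreal \<bar>X t w\<bar>)" unfolding D_def sup_dense[OF elim] by simp
    then obtain s where s: "s \<in> D" "q < \<bar>X s w\<bar>" using q by (auto simp: less_SUP_iff ennreal_less_iff)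
    obtain n where "from_nat_into D n = s" using from_nat_into_surj[OF D(1) s(1)] by blast
    thus "w \<in> (\<Union>n. B n)" using w s by (auto simp: B_def intro!: exI[of _ n] bexI[of _ n])
   qed
  qed
  show "(\<Union>n. B n) \<in> sets M" using Bm by auto
 qed
 ultimately show ?thesis by linarith
qed

end

section \<open>The stochastic exponential\<close>

text \<open>Sampling at the grid point below s makes the process jointly measurable, and continuity
  gives the limit. The measure N is left open because both M and the members of the filtration are
  inserted for it.\<close>

lemma jointly_measurable_continuous:
 fixes Y :: "real => 'w => real"
 assumes m: "\<And>s. 0 <= s ==> Y s \<in> borel_measurable N" and c: "\<And>w. w \<in> space N ==> continuous_on {0..} (%s. Y s w)"
 shows "(%(s, w). indicator {0..} s * Y s w) \<in> borel_measurable (lborel \<Otimes>\<^sub>M N)"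
proof -
 let ?a = "lborel \<Otimes>\<^sub>M N"
 let ?b = "%k s. nat \<lfloor>real (Suc k) * s\<rfloor>"
 define l where "l = (%k s. real (?b k s) / real (Suc k))"
 show ?thesis
 proof (rule borel_measurable_LIMSEQ_real[where u = "%k x. indicator {0..} (fst x) * Y (l k (fst x)) (snd x)"])
 show "(%x :: real \<times> 'w. indicator {0..} (fst x) * Y (l k (fst x)) (snd x)) \<in> borel_measurable ?a" for k
 proof -
  have a: "(%x. Y (real i / real (Suc k)) (snd x)) \<in> borel_measurable ?a" for i
   by (rule measurable_compose[OF measurable_snd m]) simp
  have b: "(%x. nat \<lfloor>real (Suc k) * fst x\<rfloor>) \<in> measurable ?a (count_space UNIV)" by measurable
  from measurable_compose_countable[OF a b]
  have [measurable]: "(%x :: real \<times> 'w. Y (l k (fst x)) (snd x)) \<in> borel_measurable ?a" by (simp add: l_def)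
  show ?thesis by measurable
 qed
 fix x :: "real \<times> 'w" assume "x \<in> space ?a"
 then obtain s w where x: "x = (s, w)" "w \<in> space N" by (auto simp: space_pair_measure)
 show "(%k. indicator {0..} (fst x) * Y (l k (fst x)) (snd x)) \<longlonglongrightarrow> (case x of (s, w) => indicator {0..} s * Y s w)"
 proof (cases "0 <= s")
  case True
  have b: "norm (l k s - s) <= inverse (real (Suc k))" for k
  proof -
   have "\<bar>real (?b k s) - real (Suc k) * s\<bar> <= 1" using True by (simp del: of_nat_Suc) linarith
   moreover have "l k s - s = (real (?b k s) - real (Suc k) * s) / real (Suc k)"
    unfolding l_def by (simp add: diff_divide_distrib del: of_nat_Suc)
   ultimately show ?thesis by (simp add: divide_inverse abs_mult mult_left_le_one_le del: of_nat_Suc)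
  qed
  have "(%k. l k s - s) \<longlonglongrightarrow> 0"
   by (rule Lim_null_comparison[OF _ LIMSEQ_inverse_real_of_nat]) (use b in simp)
  hence "(%k. l k s) \<longlonglongrightarrow> s" by (rule LIM_zero_cancel)
  moreover have "0 <= l k s" for k by (simp add: l_def)
  ultimately have "(%k. Y (l k s) w) \<longlonglongrightarrow> Y s w"
   using True by (intro continuous_on_tendsto_compose[OF c[OF x(2)]]) auto
  thus ?thesis using True by (simp add: x)
 qed (simp add: x)
 qed
qed

context brownian
begin

lemma time_integral_adapted:
 assumes X: "adapted_continuous M F X"
 shows "adapted_continuous M F (%t w. LINT s:{0..t}|lborel. X s w)"
 unfolding adapted_continuous_def
proof (intro conjI allI impI ballI)
 fix t :: real assume t: "0 <= t"
 have "(%(s, w). indicator {0..} s * X (min s t) w) \<in> borel_measurable (lborel \<Otimes>\<^sub>M F t)"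
 proof (rule jointly_measurable_continuous)
  show "X (min s t) \<in> borel_measurable (F t)" if "0 <= s" for s
  proof (rule measurable_F_mono)
   show "X (min s t) \<in> borel_measurable (F (min s t))" using X t that unfolding adapted_continuous_def by simp
  qed simp
  show "continuous_on {0..} (%s. X (min s t) w)" if "w \<in> space (F t)" for w
  proof -
   have "continuous_on {0..} (%s. X s w)" using X that unfolding adapted_continuous_def by simp
   thus ?thesis by (rule continuous_on_compose2) (use t in \<open>auto intro!: continuous_intros\<close>)
  qed
 qed
 hence m: "(%(w, s). indicator {0..} s * X (min s t) w) \<in> borel_measurable (F t \<Otimes>\<^sub>M lborel)"
  by (subst measurable_pair_swap_iff) simp
 have "(%w. LINT s|lborel. indicator {0..t} s *\<^sub>R (case (w, s) of (w, s) => indicator {0..} s * X (min s t) w)) \<in> borel_measurable (F t)"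
  using m by measurable
 moreover have "(LINT s|lborel. indicator {0..t} s *\<^sub>R (case (w, s) of (w, s) => indicator {0..} s * X (min s t) w)) = (LINT s:{0..t}|lborel. X s w)" for w
  unfolding set_lebesgue_integral_def by (intro Bochner_Integration.integral_cong) (auto simp: indicator_def min_def)
 ultimately show "(%w. LINT s:{0..t}|lborel. X s w) \<in> borel_measurable (F t)" by simp
next
 fix w assume "w \<in> space M"
 hence c: "continuous_on {0..} (%t. X t w)" using X unfolding adapted_continuous_def by auto
 have ci: "continuous_on {0..t} (%t. X t w)" for t by (rule continuous_on_subset[OF c]) auto
 have "continuous_on {0..T} (%t. LINT s:{0..t}|lborel. X s w)" for T
  unfolding set_borel_integral_eq_integral(2)[OF borel_integrable_atLeastAtMost'[OF ci]]
  by (intro indefinite_integral_continuous_1 integrable_continuous_real ci)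
 thus "continuous_on {0..} (%t. LINT s:{0..t}|lborel. X s w)" by (rule continuous_on_halfline)
qed

lemma adapted_continuous_integrable:
 assumes "adapted_continuous M F X" "w \<in> space M" "0 <= a"
 shows "set_integrable lborel {a..b} (%s. X s w)"
 using assms unfolding adapted_continuous_def by (intro borel_integrable_atLeastAtMost') (auto intro: continuous_on_subset)

lemma time_integral_diff:
 assumes "adapted_continuous M F X" "w \<in> space M" "0 <= a" "a <= b"
 shows "(LINT s:{0..b}|lborel. X s w) - (LINT s:{0..a}|lborel. X s w) = (LINT s:{a..b}|lborel. X s w)"
proof -
 note i = set_borel_integral_eq_integral[OF adapted_continuous_integrable[OF assms(1,2)]]
 have "integral {0..a} (%s. X s w) + integral {a..b} (%s. X s w) = integral {0..b} (%s. X s w)"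
  using assms i(1) by (intro Henstock_Kurzweil_Integration.integral_combine) auto
 thus ?thesis using assms i(2) by simp
qed

definition bad :: "'w set" where
 "bad = {w \<in> space M. \<not> (continuous_on {0..} (%t. Z t w) \<and> Z 0 w = 0)}"

lemma bad_null: "bad \<in> null_sets M"
proof -
 have "AE w in M. continuous_on {0..} (%t. Z t w) \<and> Z 0 w = 0"
  using BM unfolding brownian_motion_def by auto
 thus ?thesis unfolding bad_def by (rule AE_null)
qed

lemma not_bad: "AE w in M. w \<notin> bad"
 by (rule AE_not_in[OF bad_null])

text \<open>\<open>adapted_continuous\<close> demands continuity for every outcome, whereas Z is
  continuous only almost surely; the value 1 on the null set \<open>bad\<close> repairs this and
  keeps the process positive.\<close>

definition sexp :: "real => real ^ 'n => real => 'w => real" where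
 "sexp \<alpha> v t w = (if w \<in> bad then 1 else doleans_exponential Z \<alpha> v t w)"

lemma sexp_pos: "0 < sexp \<alpha> v t w"
 by (simp add: sexp_def doleans_exponential_def)

lemma sexp_zero: "w \<in> space M ==> sexp \<alpha> v 0 w = 1"
 by (auto simp: sexp_def doleans_exponential_def bad_def)

lemma sexp_AE: "AE w in M. \<forall>t. sexp \<alpha> v t w = doleans_exponential Z \<alpha> v t w"
 using not_bad by eventually_elim (simp add: sexp_def)

lemma sexp_adapted: "adapted_continuous M F (sexp q v)"
 unfolding adapted_continuous_def
proof (intro conjI allI impI ballI)
 fix t :: real assume t: "0 <= t"
 have "(%w. exp (q * t + v \<bullet> Z t w - (v \<bullet> v) * t / 2)) \<in> borel_measurable (F t)" using Z_F[OF t order_refl] by measurable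
 thus "sexp q v t \<in> borel_measurable (F t)"
  by (rule measurable_F_cong) (use sexp_AE[of q v] in \<open>auto elim!: eventually_mono simp: doleans_exponential_def\<close>)
next
 fix w assume "w \<in> space M"
 thus "continuous_on {0..} (%t. sexp q v t w)"
  by (cases "w \<in> bad") (auto simp: sexp_def doleans_exponential_def bad_def intro!: continuous_intros)
qed

lemma sexp_F: "0 <= t ==> sexp \<alpha> v t \<in> borel_measurable (F t)"
 using sexp_adapted unfolding adapted_continuous_def by auto

lemma sexp_M [measurable]: "0 <= t ==> sexp \<alpha> v t \<in> borel_measurable M"
 by (rule measurable_F_M[OF sexp_F])

lemma sexp_square: "(sexp \<alpha> v t w)^2 = sexp (2 * \<alpha> + v \<bullet> v) (2 *\<^sub>R v) t w"
 by (simp add: sexp_def doleans_exponential_def power2_eq_square exp_add[symmetric] field_simps)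

lemma sexp_step: "w \<notin> bad ==> sexp q v t w = sexp q v s w * exp (q * (t - s) + v \<bullet> (Z t w - Z s w) - (v \<bullet> v) * (t - s) / 2)"
 by (simp add: sexp_def doleans_exponential_def exp_add[symmetric] inner_diff_right field_simps)

lemma drift_factor: "exp (\<alpha> * h + v \<bullet> x - (v \<bullet> v) * h / 2) = exp (\<alpha> * h - (v \<bullet> v) * h / 2) * exp (v \<bullet> x)"
 by (simp add: exp_add[symmetric] algebra_simps)

text \<open>The weak form of a conditional expectation: the growth factor between s and t is
  independent of what is known at s and has mean \<open>exp (q * (t - s))\<close>.\<close>

lemma sexp_cond:
 assumes st: "0 <= s" "s <= t" and U: "U \<in> borel_measurable (F s)" "integrable M (%w. U w * sexp q v s w)"
 shows "has_bochner_integral M (%w. U w * sexp q v t w) (expectation (%w. U w * sexp q v s w) * exp (q * (t - s)))"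
proof (cases "s < t")
 case True
 define g where "g = (%x. exp (q * (t - s) + v \<bullet> x - (v \<bullet> v) * (t - s) / 2))"
 have g: "has_bochner_integral M (%w. g (Z t w - Z s w)) (exp (q * (t - s)))"
  using has_bochner_integral_mult_right[OF increment_exp[OF st, of v], of "exp (q * (t - s) - (v \<bullet> v) * (t - s) / 2)"]
  unfolding g_def drift_factor by (simp add: exp_add[symmetric])
 have m: "(%w. U w * sexp q v s w) \<in> borel_measurable (F s)" by (intro borel_measurable_times U sexp_F st)
 have gm: "g \<in> borel_measurable borel" unfolding g_def by measurable
 from indep_mult[OF st(1) True m U(2) gm] g
 have "has_bochner_integral M (%w. (U w * sexp q v s w) * g (Z t w - Z s w)) (expectation (%w. U w * sexp q v s w) * exp (q * (t - s)))"
  by (simp add: has_bochner_integral_iff)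
 thus ?thesis
 proof (rule has_bochner_integralI_AE)
  show "AE w in M. U w * sexp q v s w * g (Z t w - Z s w) = U w * sexp q v t w"
   using not_bad by eventually_elim (simp add: g_def sexp_step[where s = s and t = t])
  show "(%w. U w * sexp q v t w) \<in> borel_measurable M"
   using st by (intro borel_measurable_times measurable_F_M[OF U(1)] sexp_M) auto
 qed
next
 case False
 hence "t = s" using st by simp
 thus ?thesis using U(2) by (simp add: has_bochner_integral_iff)
qed

lemma sexp_mean: "0 <= t ==> has_bochner_integral M (sexp q v t) (exp (q * t))"
proof -
 assume t: "0 <= t"
 have "integrable M (%w. 1 * sexp q v 0 w)" by (subst Bochner_Integration.integrable_cong[OF refl, of _ _ "%_. 1"]) (auto simp: sexp_zero)
 moreover have "expectation (%w. 1 * sexp q v 0 w) = expectation (%w. 1)" by (intro Bochner_Integration.integral_cong) (auto simp: sexp_zero)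
 ultimately show ?thesis using sexp_cond[OF order_refl t, of "%_. 1" q v] by (simp add: prob_space)
qed

lemma sexp_square_mean: "0 <= t ==> has_bochner_integral M (%w. (sexp \<alpha> v t w)^2) (exp ((2 * \<alpha> + v \<bullet> v) * t))"
 unfolding sexp_square by (rule sexp_mean)

lemma increment_exp_inner:
 assumes "0 <= s" "s <= t"
 shows "has_bochner_integral M (%w. exp (v \<bullet> (Z t w - Z s w)) * (u \<bullet> (Z t w - Z s w))) ((u \<bullet> v) * (t - s) * exp ((v \<bullet> v) * (t - s) / 2))"
proof -
 let ?a = "\<Sum>j\<in>UNIV. u $ j * (v $ j * (t - s) * exp ((v \<bullet> v) * (t - s) / 2))"
 have "has_bochner_integral M (%w. \<Sum>j\<in>UNIV. u $ j * (exp (v \<bullet> (Z t w - Z s w)) * (Z t w - Z s w) $ j))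
   ?a"
  by (intro has_bochner_integral_sum has_bochner_integral_mult_right increment_coordinate_exp assms)
 moreover have "(\<Sum>j\<in>UNIV. u $ j * (exp (v \<bullet> (Z t w - Z s w)) * (Z t w - Z s w) $ j)) = exp (v \<bullet> (Z t w - Z s w)) * (u \<bullet> (Z t w - Z s w))" for w
  unfolding inner_vec_def[of u] sum_distrib_left by (intro sum.cong) auto
 moreover have "?a = (u \<bullet> v) * (t - s) * exp ((v \<bullet> v) * (t - s) / 2)"
  unfolding inner_vec_def[of u] sum_distrib_right by (intro sum.cong) auto
 ultimately show ?thesis by simp
qed

text \<open>The second moment of the one-step error: growth factor of the exponential over a time h,
  minus 1, minus v . (increment of Z).\<close>

definition increment_error :: "real => real ^ 'n => real => real" where
 "increment_error \<alpha> v h = exp ((2 * \<alpha> + v \<bullet> v) * h) - 2 * exp (\<alpha> * h) + 1 - 2 * (v \<bullet> v) * h * exp (\<alpha> * h) + (v \<bullet> v) * h"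

lemma increment_error_integral:
 assumes st: "0 <= s" "s <= t"
 shows "has_bochner_integral M (%w. (exp (q * (t - s) + v \<bullet> (Z t w - Z s w) - (v \<bullet> v) * (t - s) / 2) - 1 - v \<bullet> (Z t w - Z s w))^2) (increment_error q v (t - s))"
proof -
 let ?a = "%h. (v \<bullet> v) * h / 2"
 let ?b = "%d w. v \<bullet> d w"
 let ?c = "%h. 2 * (v \<bullet> v) * h"
 define h where "h = t - s"
 define d where "d = (%w. Z t w - Z s w)"
 define c where "c = exp (q * h - (v \<bullet> v) * h / 2)"
 have 1: "has_bochner_integral M (%w. exp ((2 *\<^sub>R v) \<bullet> d w)) (exp (?c h))"
  using increment_exp[OF st, of "2 *\<^sub>R v"] by (simp add: d_def h_def ac_simps)
 have 2: "has_bochner_integral M (%w. exp (?b d w)) (exp (?a h))"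
  using increment_exp[OF st, of v] by (simp add: d_def h_def)
 have 3: "has_bochner_integral M (%w. exp (?b d w) * (?b d w)) ((v \<bullet> v) * h * exp (?a h))"
  using increment_exp_inner[OF st, of v v] by (simp add: d_def h_def)
 have 4: "has_bochner_integral M (%w. (?b d w)^2) (h * (v \<bullet> v))"
  using increment_square[OF st, of "%_. v"] by (simp add: d_def h_def has_bochner_integral_iff prob_space power2_norm_eq_inner)
 have 5: "has_bochner_integral M (%w. v \<bullet> d w) 0"
  using increment_mean[OF st, of "%_. v"] by (simp add: d_def has_bochner_integral_iff)
 have 6: "has_bochner_integral M (%w. 1 :: real) 1" by (simp add: has_bochner_integral_iff prob_space)
 have "has_bochner_integral M (%w. c^2 * exp ((2 *\<^sub>R v) \<bullet> d w) - 2 * c * exp (?b d w) + 1 - 2 * c * (exp (?b d w) * (?b d w)) + (?b d w)^2 + 2 * (?b d w))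
   (c^2 * exp (?c h) - 2 * c * exp (?a h) + 1 - 2 * c * ((v \<bullet> v) * h * exp (?a h)) + h * (v \<bullet> v) + 2 * 0)"
  by (intro has_bochner_integral_add has_bochner_integral_diff has_bochner_integral_mult_right 1 2 3 4 5 6)
 moreover have "c^2 * exp ((2 *\<^sub>R v) \<bullet> x) - 2 * c * exp (v \<bullet> x) + 1 - 2 * c * (exp (v \<bullet> x) * (v \<bullet> x)) + (v \<bullet> x)^2 + 2 * (v \<bullet> x)
   = (exp (q * h + v \<bullet> x - (v \<bullet> v) * h / 2) - 1 - v \<bullet> x)^2" for x
 proof -
  have "exp ((2 *\<^sub>R v) \<bullet> x) = (exp (v \<bullet> x))^2" by (simp add: power2_eq_square exp_add[symmetric])
  thus ?thesis unfolding drift_factor c_def[symmetric] by (simp add: power2_eq_square algebra_simps)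
 qed
 moreover have "c^2 * exp (?c h) - 2 * c * exp (?a h) + 1 - 2 * c * ((v \<bullet> v) * h * exp (?a h)) + h * (v \<bullet> v) + 2 * 0 = increment_error q v h"
 proof -
  have e: "c * exp (?a h) = exp (q * h)" by (simp add: c_def exp_add[symmetric])
  have e2: "c^2 * exp (?c h) = exp ((2 * q + v \<bullet> v) * h)" by (simp add: c_def power2_eq_square exp_add[symmetric] algebra_simps)
  show ?thesis unfolding increment_error_def e[symmetric] e2[symmetric] by (simp add: algebra_simps)
 qed
 ultimately show ?thesis by (simp add: d_def h_def)
qed

text \<open>Value and derivative at 0 both vanish: the slopes are 2 \<alpha> + v . v, - 2 \<alpha>,
  - 2 (v . v) and v . v. This estimate takes over the role of second-order calculus.\<close>

lemma increment_error_small: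
 assumes "0 < q" shows "\<exists>\<delta>>0. \<forall>h. 0 <= h \<and> h < \<delta> \<longrightarrow> increment_error r v h <= q * h"
proof -
 have "(increment_error r v has_real_derivative 0) (at 0)"
  unfolding increment_error_def by (rule derivative_eq_intros refl | simp)+
 moreover have "increment_error r v 0 = 0" by (simp add: increment_error_def)
 ultimately have "(%h. increment_error r v h / h) \<midarrow>0\<rightarrow> 0" by (simp add: DERIV_def)
 then obtain \<delta> where \<delta>: "0 < \<delta>" "\<And>h. h ~= 0 ==> \<bar>h\<bar> < \<delta> ==> \<bar>increment_error r v h / h\<bar> < q"
  using LIM_D[of "%h. increment_error r v h / h" 0 0 q] assms by (auto simp: )
 have "increment_error r v h <= q * h" if "0 <= h" "h < \<delta>" for h
 proof (cases "h = 0")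
  case True thus ?thesis by (simp add: increment_error_def)
 next
  case False
  hence "increment_error r v h / h < q" using \<delta>(2)[of h] that by (simp add: abs_less_iff del: abs_divide)
  thus ?thesis using False that by (simp add: field_simps)
 qed
 thus ?thesis using \<delta>(1) by blast
qed

end

section \<open>The martingale part of the exponential\<close>

context brownian
begin

lemma sexp_jointly: "jointly (sexp a v)"
 by (rule predictable_jointly[OF adapted_continuous_predictable[OF sexp_adapted]])

lemma sexp_time_L2:
 assumes bc: "0 <= b" "b <= c" "c <= T"
 shows "integrable M (%w. (LINT s:{b..c}|lborel. sexp a v s w)^2)"
  and "expectation (%w. (LINT s:{b..c}|lborel. sexp a v s w)^2) <= (c - b)^2 * exp (\<bar>2 * a + v \<bullet> v\<bar> * T)"
proof -
 let ?a = "borel_measurable (lborel \<Otimes>\<^sub>M M)"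
 let ?b = "%s w. esq (sexp a v s w) * indicator {b..c} s"
 let ?c = "%w. (LINT s:{b..c}|lborel. sexp a v s w)^2"
 let ?d = "2 * a + v \<bullet> v"
 interpret PM: pair_sigma_finite lborel M ..
 define B where "B = (%w. LINT s:{b..c}|lborel. sexp a v s w)"
 define C where "C = exp (\<bar>2 * a + v \<bullet> v\<bar> * T)"
 have "(%w. LINT s:{0..t}|lborel. sexp a v s w) \<in> borel_measurable M" if "0 <= t" for t
  using time_integral_adapted[OF sexp_adapted] that unfolding adapted_continuous_def by (auto intro: measurable_F_M)
 from borel_measurable_diff[OF this this, of c b]
 have Bm: "B \<in> borel_measurable M"
  by (rule measurable_cong[THEN iffD1, rotated]) (use bc in \<open>auto simp: B_def time_integral_diff[OF sexp_adapted]\<close>)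
 have jm: "(%(s, w). esq (sexp a v s w) * indicator {b..c} s) \<in> ?a"
 proof -
  have [measurable]: "(%(t, w). indicator {0..} t *\<^sub>R sexp a v t w) \<in> ?a"
   using sexp_jointly unfolding jointly_def .
  have "(%x. esq (case x of (t, w) => indicator {0..} t *\<^sub>R sexp a v t w) * indicator {b..c} (fst x)) \<in> ?a"
   by measurable
  thus ?thesis by (rule measurable_cong[THEN iffD1, rotated]) (use bc in \<open>auto simp: indicator_def\<close>)
 qed
 have sec: "(%s. esq (sexp a v s w) * indicator {b..c} s) \<in> borel_measurable lborel" if "w \<in> space M" for w
  using measurable_compose[OF measurable_Pair2'[OF that, of lborel] jm] by simp
 have "(\<E> w. esq (B w)) <= (\<E> w. (\<L> s. ennreal (c - b) * (?b s w)))"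
 proof (rule nn_integral_mono)
  fix w assume w: "w \<in> space M"
  show "esq (B w) <= (\<L> s. ennreal (c - b) * (?b s w))"
   unfolding B_def using square_integral_le[OF adapted_continuous_integrable[OF sexp_adapted w bc(1)] bc(2), of a v] sec[OF w]
   by (simp add: nn_integral_cmult)
 qed
 also have "... = (\<L> s. (\<E> w. ennreal (c - b) * (?b s w)))"
  using jm by (intro PM.Fubini') (simp add: case_prod_beta)
 also have "... <= (\<L> s. ennreal ((c - b) * C) * indicator {b..c} s)"
 proof (rule nn_integral_mono)
  fix s
  show "(\<E> w. ennreal (c - b) * (?b s w)) <= ennreal ((c - b) * C) * indicator {b..c} s"
  proof (cases "s \<in> {b..c}")
   case True
   hence s: "0 <= s" using bc by simp
   have "?d * s <= \<bar>2 * a + v \<bullet> v\<bar> * T" using True bc s by (intro mult_mono) auto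
   hence "exp (?d * s) <= C" by (simp add: C_def)
   moreover have "(\<E> w. esq (sexp a v s w)) = ennreal (exp (?d * s))"
    using sexp_square_mean[OF s, of a v] by (subst nn_integral_eq_integral) (auto simp: has_bochner_integral_iff)
   ultimately show ?thesis using True bc sexp_M[OF s, of a v]
    by (subst nn_integral_cmult) (auto simp: ennreal_mult[symmetric] intro!: ennreal_leI mult_left_mono)
  qed simp
 qed
 also have "... = ennreal ((c - b)^2 * C)"
 proof -
  have "0 <= C" by (simp add: C_def)
  thus ?thesis using bc by (subst nn_integral_cmult_indicator) (auto simp: ennreal_mult[symmetric] power2_eq_square mult_ac)
 qed
 finally have le: "(\<E> w. esq (B w)) <= ennreal ((c - b)^2 * C)" .
 have i: "integrable M (%w. (B w)^2)"
  using Bm le by (intro integrableI_bounded) (auto intro: order.strict_trans1)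
 have "0 <= C" by (simp add: C_def)
 hence "expectation (%w. (B w)^2) <= (c - b)^2 * C"
  using le nn_integral_eq_integral[OF i] by (simp add: ennreal_le_iff)
 with i show "integrable M ?c"
  and "expectation ?c <= (c - b)^2 * exp (\<bar>2 * a + v \<bullet> v\<bar> * T)"
  by (simp_all add: B_def C_def)
qed

text \<open>What the equation dS = a S dt + S v . dZ, S(0) = 1, leaves for the stochastic
  integral.\<close>

definition sexp_mart :: "real => real ^ 'n => real => 'w => real" where
 "sexp_mart a v t w = sexp a v t w - 1 - a * (LINT s:{0..t}|lborel. sexp a v s w)"

lemma sexp_mart_adapted: "adapted_continuous M F (sexp_mart a v)"
proof -
 have "adapted_continuous M F (%t w. 1 * (1 * sexp a v t w + (- 1) * 1) + (- a) * (LINT s:{0..t}|lborel. sexp a v s w))"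
  by (intro adapted_continuous_linear sexp_adapted time_integral_adapted) (auto simp: adapted_continuous_def)
 thus ?thesis by (simp add: sexp_mart_def[abs_def])
qed

lemma sexp_mart_diff:
 "w \<in> space M ==> 0 <= s ==> s <= t ==> sexp_mart a v t w - sexp_mart a v s w = sexp a v t w - sexp a v s w - a * (LINT u:{s..t}|lborel. sexp a v u w)"
 unfolding sexp_mart_def time_integral_diff[OF sexp_adapted, symmetric] by (simp add: algebra_simps)

text \<open>Against U the exponential has the mean c exp (a (u - s)) at each time u after s.
  Subtracting a times the time integral removes precisely the growth of this mean from s to
  t.\<close>

lemma sexp_martingale: "L2_martingale (sexp_mart a v)"
 unfolding L2_martingale_def
proof (intro conjI allI impI ballI)
 fix t :: real assume t: "0 <= t"
 show "sexp_mart a v t \<in> borel_measurable (F t)" using sexp_mart_adapted t unfolding adapted_continuous_def by auto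
 have Am: "(%w. LINT s:{0..t}|lborel. sexp a v s w) \<in> borel_measurable M"
  using time_integral_adapted[OF sexp_adapted] t unfolding adapted_continuous_def by (auto intro: measurable_F_M)
 have i: "integrable M (%w. (sexp a v t w)^2)" using sexp_square_mean[OF t, of a v] by (simp add: has_bochner_integral_iff)
 have "integrable M (%w. (sexp a v t w - 1)^2)"
  using integrable_square_linear[of "sexp a v t" "%_. 1" 1 "-1"] t i by simp
 hence "integrable M (%w. (1 * (sexp a v t w - 1) + (- a) * (LINT s:{0..t}|lborel. sexp a v s w))^2)"
  using t by (intro integrable_square_linear Am sexp_time_L2(1)[OF order_refl t order_refl]) auto
 thus "integrable M (%w. (sexp_mart a v t w)^2)" by (simp add: sexp_mart_def)
next
 let ?a = "%U s. %w. \<bar>U w\<bar> * sexp a v s w"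
 let ?b = "borel_measurable (lborel \<Otimes>\<^sub>M M)"
 let ?c = "%U t s. expectation (%w. U w * (sexp_mart a v t w - sexp_mart a v s w))"
 fix s t and U :: "'w => real" assume st: "0 <= s" "s <= t" and U: "U \<in> borel_measurable (F s)" "integrable M (%w. (U w)^2)"
 interpret PM: pair_sigma_finite lborel M ..
 have t: "0 <= t" using st by simp
 have UM: "U \<in> borel_measurable M" by (rule measurable_F_M[OF U(1)])
 have Us: "integrable M (%w. U w * sexp a v s w)"
  using sexp_square_mean[OF st(1)] by (intro integrable_mult_L2 UM U(2) sexp_M[OF st(1)]) (auto simp: has_bochner_integral_iff)
 define c where "c = expectation (%w. U w * sexp a v s w)"
 have cond: "has_bochner_integral M (%w. U w * sexp a v u w) (c * exp (a * (u - s)))" if "s <= u" for u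
  unfolding c_def by (rule sexp_cond[OF st(1) that U(1) Us])
 define f where "f = (%u w. indicator {s..t} u * (U w * sexp a v u w))"
 have fm: "(%(u, w). f u w) \<in> ?b"
 proof -
  have [measurable]: "(%(t, w). indicator {0..} t *\<^sub>R sexp a v t w) \<in> ?b"
   using sexp_jointly unfolding jointly_def .
  have "(%x. indicator {s..t} (fst x) * (U (snd x) * (case x of (t, w) => indicator {0..} t *\<^sub>R sexp a v t w))) \<in> ?b"
   using UM by measurable
  thus ?thesis by (rule measurable_cong[THEN iffD1, rotated]) (use st in \<open>auto simp: f_def indicator_def\<close>)
 qed
 have fi: "integrable (lborel \<Otimes>\<^sub>M M) (%(u, w). f u w)"
 proof (rule PM.Fubini_integrable[OF fm])
  have Uabs: "(%w. \<bar>U w\<bar>) \<in> borel_measurable (F s)" using U(1) by measurable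
  have Uabsi: "integrable M (?a U s)" using integrable_abs[OF Us] sexp_pos[of a v s] by (simp add: abs_mult less_imp_le)
  have "(LINT w|M. norm (case (u, w) of (u, w) => f u w)) = indicator {s..t} u *\<^sub>R (expectation (?a U s) * exp (a * (u - s)))" for u
  proof (cases "u \<in> {s..t}")
   case True
   have "(%w. norm (f u w)) = (?a U u)" using True sexp_pos[of a v u] by (simp add: f_def abs_mult less_imp_le)
   thus ?thesis using sexp_cond[OF st(1) _ Uabs Uabsi, of u] True by (simp add: has_bochner_integral_iff)
  qed (simp add: f_def)
  moreover have "set_integrable lborel {s..t} (%u. expectation (?a U s) * exp (a * (u - s)))"
   by (intro borel_integrable_atLeastAtMost' continuous_intros)
  ultimately show "integrable lborel (%u. LINT w|M. norm (case (u, w) of (u, w) => f u w))"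
   by (simp only: set_integrable_def)
  show "AE u in lborel. integrable M (%w. case (u, w) of (u, w) => f u w)"
   using cond by (intro AE_I2) (auto simp: f_def indicator_def has_bochner_integral_iff)
 qed
 have sw: "(LINT w|M. (LINT u|lborel. f u w)) = (LINT u|lborel. (LINT w|M. f u w))" using PM.Fubini_integral[of f] fi by simp
 have in1: "(LINT u|lborel. f u w) = U w * (LINT u:{s..t}|lborel. sexp a v u w)" for w
  by (simp add: f_def set_lebesgue_integral_def mult.left_commute)
 have in2: "(LINT w|M. f u w) = indicator {s..t} u *\<^sub>R (c * exp (a * (u - s)))" for u
  using cond[of u] by (cases "u \<in> {s..t}") (auto simp: f_def has_bochner_integral_iff)
 have "a * (LINT w|M. U w * (LINT u:{s..t}|lborel. sexp a v u w)) = (LINT u|lborel. indicator {s..t} u *\<^sub>R (c * (a * exp (a * (u - s)))))"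
  unfolding in1[symmetric] sw in2 integral_mult_right_zero[symmetric] by (intro Bochner_Integration.integral_cong) auto
 also have "... = c * exp (a * (t - s)) - c * exp (a * (s - s))"
  by (rule integral_FTC_Icc[OF st(2)]) (auto intro!: derivative_eq_intros continuous_intros simp: has_real_derivative_iff_has_vector_derivative[symmetric])
 finally have key: "a * (LINT w|M. U w * (LINT u:{s..t}|lborel. sexp a v u w)) = c * exp (a * (t - s)) - c" by simp
 have int3: "integrable M (%w. U w * (LINT u:{s..t}|lborel. sexp a v u w))"
  using PM.integrable_snd[of f] fi unfolding in1 by simp
 have "?c U t s
  = expectation (%w. U w * sexp a v t w - U w * sexp a v s w - a * (U w * (LINT u:{s..t}|lborel. sexp a v u w)))"
  by (intro Bochner_Integration.integral_cong) (auto simp: sexp_mart_diff[OF _ st] algebra_simps)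
 also have "... = c * exp (a * (t - s)) - c - (c * exp (a * (t - s)) - c)"
  using cond[OF st(2)] Us int3 key by (simp add: has_bochner_integral_iff c_def)
 finally show "?c U t s = 0" by simp
qed

text \<open>Three errors are collected: the one-step error scaled by the value at b, the drift over
  the cell, and the replacement of the coefficient at b by U. The factor 3 comes from the square of
  a sum of three terms.\<close>

lemma sexp_increment_bound:
 assumes bc: "0 <= b" "b <= c" "c <= T" and U: "U \<in> borel_measurable (F b)" "integrable M (%w. (sexp a v b w - U w)^2)"
 shows "expectation (%w. ((sexp_mart a v c w - sexp_mart a v b w) - (U w *\<^sub>R v) \<bullet> (Z c w - Z b w))^2)
  <= 3 * (exp (\<bar>2 * a + v \<bullet> v\<bar> * T) * (increment_error a v (c - b) + a^2 * (c - b)^2)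
    + (v \<bullet> v) * (c - b) * expectation (%w. (sexp a v b w - U w)^2))"
proof -
 let ?a = "%S w g A V. S w * g (Z c w - Z b w) + a^2 * (A w)^2 + (V w \<bullet> (Z c w - Z b w))^2"
 let ?b = "%w R. (sexp_mart a v c w - sexp_mart a v b w) - (U w *\<^sub>R v) \<bullet> (Z c w - Z b w)"
 let ?c = "%S g. %w. S w * g (Z c w - Z b w)"
 let ?d = "(v \<bullet> v) * expectation (%w. (sexp a v b w - U w)^2)"
 let ?e = "2 * a + v \<bullet> v"
 define C where "C = exp (\<bar>2 * a + v \<bullet> v\<bar> * T)"
 define h where "h = c - b"
 define g where "g = (%x. (exp (a * h + v \<bullet> x - (v \<bullet> v) * h / 2) - 1 - v \<bullet> x)^2)"
 define S where "S = (%w. (sexp a v b w)^2)"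
 define A where "A = (%w. LINT u:{b..c}|lborel. sexp a v u w)"
 define V where "V = (%w. (sexp a v b w - U w) *\<^sub>R v)"
 have bcs: "0 <= b" "b <= c" using bc by auto
 have g: "has_bochner_integral M (%w. g (Z c w - Z b w)) (increment_error a v h)"
  using increment_error_integral[OF bcs, of a v] by (simp add: g_def h_def)
 have gm: "g \<in> borel_measurable borel" unfolding g_def by measurable
 have err: "0 <= increment_error a v h"
  using g Bochner_Integration.integral_nonneg[of M "%w. g (Z c w - Z b w)"] by (simp add: has_bochner_integral_iff g_def)
 have S: "has_bochner_integral M S (exp (?e * b))" unfolding S_def by (rule sexp_square_mean[OF bc(1)])
 have SF: "S \<in> borel_measurable (F b)" unfolding S_def using sexp_F[OF bc(1), of a v] by measurable
 have SC: "exp (?e * b) <= C"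
 proof -
  have "?e * b <= \<bar>2 * a + v \<bullet> v\<bar> * T" using bc by (intro mult_mono) auto
  thus ?thesis by (simp add: C_def)
 qed
 have 1: "integrable M (?c S g)" "expectation (?c S g) <= C * increment_error a v h"
 proof -
  have "has_bochner_integral M (?c S g) (exp (?e * b) * increment_error a v h)"
  proof (cases "b < c")
   case True
   thus ?thesis using indep_mult[OF bc(1) True SF _ gm] S g by (simp add: has_bochner_integral_iff)
  next
   case False
   hence "c = b" using bc by simp
   thus ?thesis by (simp add: g_def h_def increment_error_def has_bochner_integral_zero)
  qed
  thus "integrable M (?c S g)" "expectation (?c S g) <= C * increment_error a v h"
   using SC err by (auto simp: has_bochner_integral_iff intro: mult_right_mono)
 qed
 have 2: "integrable M (%w. (A w)^2)" "expectation (%w. (A w)^2) <= h^2 * C"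
  unfolding A_def h_def C_def by (rule sexp_time_L2[OF bc])+
 have VF: "V \<in> borel_measurable (F b)" unfolding V_def by (intro borel_measurable_scaleR borel_measurable_diff U(1) sexp_F bc) auto
 have V2: "(norm (V w))^2 = (sexp a v b w - U w)^2 * (v \<bullet> v)" for w by (simp add: V_def power_mult_distrib power2_norm_eq_inner)
 have "integrable M (%w. (norm (V w))^2)" unfolding V2 using U(2) by simp
 note 3 = increment_square[OF bcs VF this]
 have dom: "(?b w R)^2
   <= 3 * (?a S w g A V)" if w: "w \<in> space M" "w \<notin> bad" for w
 proof -
  define R where "R = exp (a * h + v \<bullet> (Z c w - Z b w) - (v \<bullet> v) * h / 2)"
  define y where "y = v \<bullet> (Z c w - Z b w)"
  have "sexp a v c w = sexp a v b w * R" using sexp_step[OF w(2), of a v c b] by (simp add: R_def h_def)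
  hence e: "(sexp_mart a v c w - sexp_mart a v b w) - (U w *\<^sub>R v) \<bullet> (Z c w - Z b w)
    = sexp a v b w * (R - 1 - y) + (- a * A w) + (sexp a v b w - U w) * y"
   unfolding sexp_mart_diff[OF w(1) bcs] A_def y_def by (simp add: algebra_simps)
  have sq: "(p + q + r)^2 <= 3 * (p^2 + q^2 + r^2)" for p q r :: real
   using sum_squares_bound[of p q] sum_squares_bound[of p r] sum_squares_bound[of q r]
   by (simp add: power2_eq_square algebra_simps)
  show ?thesis unfolding e
   by (rule order_trans[OF sq]) (simp add: S_def g_def V_def R_def y_def power_mult_distrib)
 qed
 have "expectation (%w. (?b w R)^2)
   <= expectation (%w. 3 * (?a S w g A V))"
 proof (rule integral_mono_AE')
  show "AE w in M. (?b w R)^2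
   <= 3 * (?a S w g A V)"
   using not_bad AE_space by eventually_elim (rule dom)
  show "AE w in M. 0 <= 3 * (?a S w g A V)"
   by (simp add: S_def g_def)
 qed (use 1 2 3 in auto)
 also have "... = 3 * (expectation (?c S g) + a^2 * expectation (%w. (A w)^2) + h * ?d)"
  using 1 2 3 by (simp add: V2 h_def)
 also have "... <= 3 * (C * increment_error a v h + a^2 * (h^2 * C) + h * ?d)"
  using 1 2 bc by (intro mult_left_mono add_mono) (auto simp: h_def)
 finally show ?thesis by (simp add: C_def h_def algebra_simps)
qed

end

section \<open>Step approximation of the exponential and its stochastic integral\<close>

context brownian
begin

text \<open>The k-th grid divides [0, k+1] into (k+1)^2 cells. A single sequence has to serve all
  horizons, so the interval grows while the mesh 1/(k+1) shrinks.\<close>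

definition mesh :: "nat => nat" where "mesh k = (Suc k)^2 - 1"

definition sgrid :: "nat => nat => real" where "sgrid k = grid (real (Suc k)) (mesh k)"

text \<open>The sampled value is capped at k+1, since step processes must have bounded
  coefficients.\<close>

definition sstep :: "real => real ^ 'n => nat => nat => 'w => real ^ 'n" where
 "sstep a v k i w = min (sexp a v (sgrid k i) w) (real (Suc k)) *\<^sub>R v"

lemma sgrid_mesh: "real (Suc k) / real (Suc (mesh k)) = inverse (real (Suc k))"
proof -
 have "Suc (mesh k) = Suc k * Suc k" by (simp add: mesh_def power2_eq_square)
 thus ?thesis by (simp add: field_simps del: of_nat_Suc mult_Suc mult_Suc_right)
qed

lemma sgrid_props:
 "sgrid k 0 = 0" "sgrid k (Suc (mesh k)) = real (Suc k)" "sgrid k i <= sgrid k (Suc i)" "0 <= sgrid k i"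
 "sgrid k (Suc i) - sgrid k i = inverse (real (Suc k))"
 using grid_props[of "real (Suc k)" "mesh k"] unfolding sgrid_def sgrid_mesh by auto

lemma sgrid_mono: "i <= j ==> sgrid k i <= sgrid k j"
 by (rule lift_Suc_mono_le[of "sgrid k"]) (auto simp: sgrid_props)

lemma sstep_data: "step_data (Suc (mesh k)) (sgrid k) (sstep a v k)"
 unfolding step_data_def
proof (intro conjI allI impI exI ballI)
 fix i assume "i < Suc (mesh k)"
 show "sstep a v k i \<in> borel_measurable (F (sgrid k i))"
  unfolding sstep_def using sexp_F[OF sgrid_props(4), of a v k i] by measurable
 fix w show "norm (sstep a v k i w) <= real (Suc k) * norm v"
  using sexp_pos[of a v "sgrid k i" w] by (auto simp: sstep_def intro!: mult_right_mono)
qed (auto simp: sgrid_props)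

text \<open>Once the grid reaches beyond T and the cap exceeds the path on [0, T], the step process
  is the path sampled on the grid, and uniform continuity makes the difference small.\<close>

lemma sstep_energy:
 assumes w: "w \<in> space M" and T: "0 <= T"
 shows "(%k. energy T (%s w. step_H (Suc (mesh k)) (sgrid k) (sstep a v k) s w - sexp a v s w *\<^sub>R v) w) \<longlonglongrightarrow> 0"
proof (rule tendsto_zero_ennreal)
 let ?a = "(norm v)^2 * T + 1"
 let ?b = "%k. %s w. step_H (Suc (mesh k)) (sgrid k) (sstep a v k) s w - sexp a v s w *\<^sub>R v"
 let ?c = "(norm v)^2 * T"
 fix r :: real assume r: "0 < r"
 \<comment> \<open>Chosen so that q^2 times |v|^2 T + 1 equals r / 2; the added 1 keeps the
   denominator positive.\<close>
 define q where "q = sqrt (r / (2 * ?a))"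
 have D: "0 < (norm v)^2 * T + 1" using T by (simp add: add_nonneg_pos)
 have q: "0 < q" using r D by (simp add: q_def)
 have c: "continuous_on {0..T} (%t. sexp a v t w)"
  using sexp_adapted[of a v] w unfolding adapted_continuous_def by (auto intro: continuous_on_subset)
 obtain B where B: "\<forall>s\<in>{0..T}. sexp a v s w <= B"
  using compact_imp_bounded[OF compact_continuous_image[OF c compact_Icc]] unfolding bounded_iff by (auto simp: abs_le_iff)
 obtain \<delta> where \<delta>: "0 < \<delta>" "\<And>s s'. s \<in> {0..T} ==> s' \<in> {0..T} ==> \<bar>s' - s\<bar> < \<delta> ==> \<bar>sexp a v s' w - sexp a v s w\<bar> < q"
  using compact_uniformly_continuous[OF c compact_Icc] q unfolding uniformly_continuous_on_def dist_real_def by metis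
 have "eventually (%k. inverse (real (Suc k)) < \<delta>) sequentially"
  using LIMSEQ_inverse_real_of_nat \<delta>(1) by (rule order_tendstoD(2))
 moreover have "eventually (%k. max T B <= real (Suc k)) sequentially"
  by (rule eventually_mono[OF eventually_ge_at_top[of "nat \<lceil>max T B\<rceil>"]]) linarith
 ultimately show "eventually (%k. energy T (?b k) w < ennreal r) sequentially"
 proof eventually_elim
  case (elim k)
  have "norm (step_H (Suc (mesh k)) (sgrid k) (sstep a v k) s w - sexp a v s w *\<^sub>R v) <= q * norm v" if s: "0 < s" "s <= T" for s
  proof -
   obtain i where i: "sgrid k i < s" "s - sgrid k i <= inverse (real (Suc k))" "step_H (Suc (mesh k)) (sgrid k) (sstep a v k) s = sstep a v k i"
    using step_grid_value[OF sstep_data[unfolded sgrid_def] s(1), of k a v] s elim unfolding sgrid_mesh sgrid_def[symmetric] by auto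
   have p: "sgrid k i \<in> {0..T}" using i s sgrid_props(4)[of k i] by auto
   have "step_H (Suc (mesh k)) (sgrid k) (sstep a v k) s w - sexp a v s w *\<^sub>R v = (sexp a v (sgrid k i) w - sexp a v s w) *\<^sub>R v"
    using bspec[OF B p] elim unfolding i(3) sstep_def by (simp add: scaleR_diff_left min_def)
   moreover have "\<bar>sexp a v (sgrid k i) w - sexp a v s w\<bar> <= q" using \<delta>(2)[of s "sgrid k i"] p s i elim by auto
   ultimately show ?thesis by (simp add: mult_right_mono)
  qed
  hence "energy T (?b k) w
    <= (\<L> s. esq (q * norm v) * indicator {0..T} s)"
   unfolding energy_def using AE_lborel_singleton[of 0]
   by (intro nn_integral_mono_AE) (auto elim!: eventually_mono simp: indicator_def intro!: ennreal_leI power_mono)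
  also have "... = ennreal (q^2 * ?c)"
   using T by (subst nn_integral_cmult_indicator) (auto simp: ennreal_mult[symmetric] power_mult_distrib mult_ac)
  also have "ennreal (q^2 * ?c) < ennreal r"
  proof (rule ennreal_lessI[OF r])
   have "q^2 = r / (2 * ?a)" using r D by (simp add: q_def)
   hence "q^2 * ?a = r / 2" using D by (simp only: times_divide_eq_left) (simp add: divide_simps)
   moreover have "q^2 * ?c <= q^2 * ?a" by (intro mult_left_mono) auto
   ultimately show "q^2 * ?c < r" using r by simp
  qed
  finally show ?case .
 qed
qed

text \<open>Where x exceeds K, x^2 is at most x^4 / K^2. The fourth moment is the second moment of
  the square, which is itself an exponential.\<close>

lemma sexp_truncation:
 assumes b: "0 <= b" "b <= T" and K: "0 < K"
 shows "integrable M (%w. (sexp a v b w - min (sexp a v b w) K)^2)"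
  and "expectation (%w. (sexp a v b w - min (sexp a v b w) K)^2) <= exp (\<bar>2 * (2 * a + v \<bullet> v) + 4 * (v \<bullet> v)\<bar> * T) / K^2"
proof -
 let ?a = "%w. (sexp a v b w - min (sexp a v b w) K)^2"
 define e where "e = 2 * (2 * a + v \<bullet> v) + 4 * (v \<bullet> v)"
 have 4: "has_bochner_integral M (%w. ((sexp a v b w)^2)^2 / K^2) (exp (e * b) / K^2)"
  using has_bochner_integral_mult_left[OF sexp_square_mean[OF b(1), of "2 * a + v \<bullet> v" "2 *\<^sub>R v"], of "inverse (K^2)"]
  unfolding sexp_square[symmetric] by (simp add: e_def divide_inverse)
 have le: "(x - min x K)^2 <= (x^2)^2 / K^2" if "0 < x" for x :: real
 proof (cases "x <= K")
  case False
  hence "(x - min x K)^2 <= x^2" using K that by (intro power_mono) auto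
  also have "... <= x^2 * (x^2 / K^2)"
   using False K mult_left_mono[of 1 "x^2 / K^2" "x^2"] by (simp add: power_mono)
  finally show ?thesis by (simp add: power2_eq_square)
 qed simp
 have dom: "(sexp a v b w - min (sexp a v b w) K)^2 <= ((sexp a v b w)^2)^2 / K^2" for w by (rule le[OF sexp_pos])
 show i: "integrable M ?a"
  by (rule Bochner_Integration.integrable_bound[OF integrable.intros[OF 4]]) (use dom sexp_M[OF b(1), of a v] in auto)
 have "expectation ?a <= exp (e * b) / K^2"
  using integral_mono[OF i integrable.intros[OF 4] dom] unfolding has_bochner_integral_integral_eq[OF 4] .
 also have "... <= exp (\<bar>e\<bar> * T) / K^2" using b by (intro divide_right_mono) (auto intro: mult_mono)
 finally show "expectation ?a <= exp (\<bar>2 * (2 * a + v \<bullet> v) + 4 * (v \<bullet> v)\<bar> * T) / K^2"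
  by (simp add: e_def)
qed

lemma step_I_increment:
 assumes mono: "\<And>i j. i <= j ==> q i <= q j" and i: "i < m"
 shows "step_I m q r (min T (q (Suc i))) w - step_I m q r (min T (q i)) w = r i w \<bullet> (Z (min T (q (Suc i))) w - Z (min T (q i)) w)"
proof -
 let ?a = "min T (q (Suc i))"
 let ?b = "min T (q i)"
 have "step_I m q r ?a w - step_I m q r ?b w
  = (\<Sum>j<m. if j = i then r i w \<bullet> (Z ?a w - Z ?b w) else 0)"
  unfolding step_I_def sum_subtractf[symmetric]
 proof (intro sum.cong refl)
  fix j
  consider "j < i" | "j = i" | "i < j" by linarith
  thus "r j w \<bullet> (Z (min ?a (q (Suc j))) w - Z (min ?a (q j)) w)
   - r j w \<bullet> (Z (min ?b (q (Suc j))) w - Z (min ?b (q j)) w)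
   = (if j = i then r i w \<bullet> (Z ?a w - Z ?b w) else 0)"
  proof cases
   case 1
   thus ?thesis using mono[of "Suc j" i] mono[of "i" "Suc i"] mono[of j i] by (simp add: min.absorb2 min.assoc min.absorb1)
  next
   case 2
   thus ?thesis using mono[of i "Suc i"] by (simp add: min.assoc min.absorb1 min.absorb2)
  next
   case 3
   thus ?thesis using mono[of "Suc i" j] mono[of i j] mono[of j "Suc j"] mono[of "Suc i" "Suc j"] mono[of i "Suc j"] by (simp add: min.assoc min.absorb1)
  qed
 qed
 thus ?thesis using i by simp
qed

text \<open>The error is a square-integrable martingale that starts at 0, so its second moment at T
  is the sum over the cells of the second moments of its increments. Each is at most a constant
  times q times the length of the cell, and the lengths add up to T.\<close>

lemma sstep_error:
 assumes T: "0 <= T" "T <= real (Suc k)" and q: "\<And>h. 0 <= h ==> h <= inverse (real (Suc k)) ==> increment_error a v h <= q * h"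
  and "inverse (real (Suc k)) <= q"
 shows "expectation (%w. (step_I (Suc (mesh k)) (sgrid k) (sstep a v k) T w - sexp_mart a v T w)^2)
  <= 3 * T * (exp (\<bar>2 * a + v \<bullet> v\<bar> * T) * (1 + a^2) + (v \<bullet> v) * exp (\<bar>2 * (2 * a + v \<bullet> v) + 4 * (v \<bullet> v)\<bar> * T)) * q"
proof -
 let ?a = "%C C4. C * (1 + a^2) + (v \<bullet> v) * C4"
 let ?b = "%s i U. %w. (sexp a v (s i) w - U w)^2"
 define K where "K = real (Suc k)"
 define C where "C = exp (\<bar>2 * a + v \<bullet> v\<bar> * T)"
 define C4 where "C4 = exp (\<bar>2 * (2 * a + v \<bullet> v) + 4 * (v \<bullet> v)\<bar> * T)"
 define E where "E = (%t w. step_I (Suc (mesh k)) (sgrid k) (sstep a v k) t w - sexp_mart a v t w)"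
 define s where "s = (%i. min T (sgrid k i))"
 have K: "1 <= K" "inverse K <= q" using assms by (auto simp: K_def)
 have q0: "0 <= q" by (rule order_trans[OF _ K(2)]) (use K in simp)
 have s: "0 <= s i" "s i <= s (Suc i)" "s i <= T" "s (Suc i) - s i <= inverse K" for i
  using T sgrid_props(3,4)[of k i] sgrid_props(5)[of k i] K unfolding K_def[symmetric] by (auto simp: s_def min_def)
 have Em: "L2_martingale E" unfolding E_def by (intro L2_martingale_diff step_I_martingale sstep_data sexp_martingale)
 have E0: "E (s 0) w = 0" if "w \<in> space M" for w
  using that T by (simp add: E_def s_def sgrid_props step_I_def sexp_mart_def sexp_zero min_absorb2 min.absorb1 LINT_singleton)
 have inc: "expectation (%w. (E (s (Suc i)) w - E (s i) w)^2) <= 3 * (?a C C4) * q * (s (Suc i) - s i)" if i: "i < Suc (mesh k)" for i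
 proof -
  define h where "h = s (Suc i) - s i"
  define U where "U = (%w. min (sexp a v (s i) w) K)"
  have h: "0 <= h" "h <= inverse K" using s[of i] by (auto simp: h_def)
  have Um: "U \<in> borel_measurable (F (s i))" unfolding U_def using sexp_F[OF s(1), of a v i] by measurable
  have eq: "(E (s (Suc i)) w - E (s i) w)^2 = ((sexp_mart a v (s (Suc i)) w - sexp_mart a v (s i) w) - (U w *\<^sub>R v) \<bullet> (Z (s (Suc i)) w - Z (s i) w))^2" for w
  proof -
   have "E (s (Suc i)) w - E (s i) w = sstep a v k i w \<bullet> (Z (s (Suc i)) w - Z (s i) w) - (sexp_mart a v (s (Suc i)) w - sexp_mart a v (s i) w)"
    using step_I_increment[of "sgrid k" i, OF sgrid_mono i, of "sstep a v k" T w] by (simp add: E_def s_def)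
   also have "sstep a v k i w \<bullet> (Z (s (Suc i)) w - Z (s i) w) = (U w *\<^sub>R v) \<bullet> (Z (s (Suc i)) w - Z (s i) w)"
   proof (cases "T <= sgrid k i")
    case True
    hence "s (Suc i) = s i" using sgrid_props(3)[of k i] by (simp add: s_def min_def)
    thus ?thesis by simp
   next
    case False
    thus ?thesis by (simp add: sstep_def U_def s_def K_def)
   qed
   finally show ?thesis by (simp add: power2_commute)
  qed
  have "increment_error a v h + a^2 * h^2 <= q * h + a^2 * (h * q)"
   unfolding power2_eq_square[of h] using h K q[of h] by (intro add_mono mult_left_mono) (auto simp: K_def)
  hence 1: "C * (increment_error a v h + a^2 * h^2) <= C * (1 + a^2) * q * h"
   using mult_left_mono[of _ _ C] by (fastforce simp: C_def algebra_simps)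
  have "expectation (?b s i U) <= C4 / K^2"
   unfolding U_def C4_def using K by (intro sexp_truncation s) auto
  \<comment> \<open>Since K is at least 1, 1 / K^2 is at most 1 / K, which is at most q.\<close>
  also have "... <= C4 * q"
  proof -
   have "inverse K * inverse K <= 1 * q" using K by (intro mult_mono) (auto simp: inverse_le_1_iff)
   thus ?thesis unfolding divide_inverse power2_eq_square by (intro mult_left_mono) (auto simp: C4_def)
  qed
  finally have "(v \<bullet> v) * h * expectation (?b s i U) <= (v \<bullet> v) * h * (C4 * q)"
   using h by (intro mult_left_mono) auto
  moreover have "integrable M (?b s i U)" unfolding U_def using K by (intro sexp_truncation s) auto
  note sexp_increment_bound[OF s(1) s(2) s(3) Um this, folded C_def h_def]
  ultimately show ?thesis using 1 unfolding eq h_def[symmetric] by argo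
 qed
 have "s (Suc (mesh k)) = T" using T by (simp add: s_def sgrid_props min_absorb1)
 hence "expectation (%w. (E T w)^2) = (\<Sum>i<Suc (mesh k). expectation (%w. (E (s (Suc i)) w - E (s i) w)^2))"
  using martingale_square_sum[OF Em, of s "Suc (mesh k)"] s Bochner_Integration.integral_cong[OF refl, of M "%w. (E (s 0) w)^2" "%w. 0"] E0
  by (simp del: sum.lessThan_Suc)
 also have "... <= (\<Sum>i<Suc (mesh k). 3 * (?a C C4) * q * (s (Suc i) - s i))"
  by (intro sum_mono inc) auto
 also have "... = 3 * (?a C C4) * q * T"
  unfolding sum_distrib_left[symmetric] sum_lessThan_telescope using \<open>s (Suc (mesh k)) = T\<close> T by (simp add: s_def sgrid_props)
 finally show ?thesis by (simp add: E_def C_def C4_def algebra_simps)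
qed

text \<open>Energies converge path by path by \<open>sstep_energy\<close>, integrals converge in
  mean square at T by \<open>sstep_error\<close>, and Doob's inequality makes the latter uniform on
  [0, T].\<close>

theorem ito_sexp: "ito_integral M Z (%t w. sexp a v t w *\<^sub>R v) (sexp_mart a v)"
 unfolding ito_integral_iff
proof (intro conjI exI allI impI)
 let ?H = "%k. step_H (Suc (mesh k)) (sgrid k) (sstep a v k)" and ?I = "%k. step_I (Suc (mesh k)) (sgrid k) (sstep a v k)"
 let ?a = "%k T. %w. (?I k T w - sexp_mart a v T w)^2"
 let ?b = "%t w. sexp a v t w *\<^sub>R v"
 show pr: "predictable M F ?b"
  by (rule predictable_compose[OF adapted_continuous_predictable[OF sexp_adapted]]) measurable
 show el: "elementary_integral M Z (?H k) (?I k)" for k unfolding elementary_integral_iff using sstep_data by blast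
 show "adapted_continuous M F (sexp_mart a v)" by (rule sexp_mart_adapted)
 show "AE w in M. \<forall>T\<ge>0. energy T ?b w < \<infinity>"
 proof (intro AE_I2 allI impI)
  fix w and T :: real assume w: "w \<in> space M" and T: "0 <= T"
  have c: "continuous_on {0..T} (%t. sexp a v t w)"
   using sexp_adapted[of a v] w unfolding adapted_continuous_def by (auto intro: continuous_on_subset)
  obtain B where B: "\<forall>s\<in>{0..T}. \<bar>sexp a v s w\<bar> <= B"
   using compact_imp_bounded[OF compact_continuous_image[OF c compact_Icc]] unfolding bounded_iff by auto
  have "energy T ?b w <= ennreal ((B * norm v)^2 * T)"
   by (rule energy_bound) (use B T in \<open>auto intro!: mult_right_mono\<close>)
  thus "energy T ?b w < \<infinity>" by (auto intro: order.strict_trans1)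
 qed
 fix T :: real assume T: "0 <= T"
 show "cip (space M) (%k. energy T (%s w. ?H k s w - sexp a v s w *\<^sub>R v))"
  by (intro cip_pointwise energy_measurable jointly_diff elementary_jointly[OF el] predictable_jointly[OF pr] sstep_energy[OF _ T]) auto
 define D where "D = 3 * T * (exp (\<bar>2 * a + v \<bullet> v\<bar> * T) * (1 + a^2) + (v \<bullet> v) * exp (\<bar>2 * (2 * a + v \<bullet> v) + 4 * (v \<bullet> v)\<bar> * T))"
 have D: "0 <= D" unfolding D_def using T by (intro mult_nonneg_nonneg add_nonneg_nonneg) auto
 have conv: "(%k. expectation (?a k T)) \<longlonglongrightarrow> 0"
 proof (rule LIMSEQ_I)
  fix r :: real assume r: "0 < r"
  define u where "u = r / (2 * (D + 1))"
  have u: "0 < u" "D * u < r"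
  proof -
   show "0 < u" using r D by (simp add: u_def)
   hence "D * u <= (D + 1) * u" by simp
   also have "... = r / 2" unfolding u_def using D by (simp only: times_divide_eq_right) (simp add: divide_simps)
   finally show "D * u < r" using r by simp
  qed
  obtain \<delta> where \<delta>: "0 < \<delta>" "\<And>h. 0 <= h ==> h < \<delta> ==> increment_error a v h <= u * h" using increment_error_small[OF u(1)] by blast
  have "eventually (%k. inverse (real (Suc k)) < min \<delta> u) sequentially"
   using LIMSEQ_inverse_real_of_nat \<delta>(1) u(1) by (intro order_tendstoD(2)) auto
  moreover have "eventually (%k. T <= real (Suc k)) sequentially"
   by (rule eventually_mono[OF eventually_ge_at_top[of "nat \<lceil>T\<rceil>"]]) linarith
  ultimately have "eventually (%k. norm (expectation (?a k T) - 0) < r) sequentially"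
  proof eventually_elim
   case (elim k)
   have "expectation (?a k T) <= D * u"
    unfolding D_def by (rule sstep_error[OF T]) (use elim \<delta>(2) in auto)
   thus ?case using u(2) by simp
  qed
  thus "\<exists>no. \<forall>k\<ge>no. norm (expectation (?a k T) - 0) < r"
   by (simp add: eventually_sequentially)
 qed
 show "cip (space M) (%k w. SUP t\<in>{0..T}. ennreal \<bar>?I k t w - sexp_mart a v t w\<bar>)"
  unfolding cip_def
 proof (intro allI impI)
  fix q :: real assume q: "0 < q"
  have "prob {w \<in> space M. ennreal q < (SUP t\<in>{0..T}. ennreal \<bar>?I k t w - sexp_mart a v t w\<bar>)} <= expectation (?a k T) / q^2" for k
  proof (rule Doob_maximal[OF _ _ q T])
   show "L2_martingale (%t w. ?I k t w - sexp_mart a v t w)" by (intro L2_martingale_diff step_I_martingale sstep_data sexp_martingale)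
   show "AE w in M. continuous_on {0..} (%t. ?I k t w - sexp_mart a v t w)"
    using elementary_continuous[OF el] AE_space
    by eventually_elim (use sexp_mart_adapted[of a v] in \<open>auto simp: adapted_continuous_def intro!: continuous_on_diff\<close>)
  qed
  moreover have "space M \<inter> {w \<in> space M. P w} = {w \<in> space M. P w}" for P :: "'w => bool" by auto
  ultimately show "(%k. prob (space M \<inter> {w \<in> space M. ennreal q < (SUP t\<in>{0..T}. ennreal \<bar>?I k t w - sexp_mart a v t w\<bar>)})) \<longlonglongrightarrow> 0"
   by (intro Lim_null_comparison[OF _ tendsto_divide_zero[OF conv]] always_eventually allI) simp
 qed
qed

end

section \<open>Pricing of gains from trade\<close>

lemma vec_nth_measurable [measurable (raw)]:
 "f \<in> borel_measurable N ==> (%x. f x $ i) \<in> borel_measurable N" for f :: "_ => real ^ 'n"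
 by (rule measurable_compose[OF _ borel_measurable_nth])

context brownian
begin

text \<open>Girsanov's theorem for one increment: under the density \<open>sexp 0 v T\<close> the
  increment of Z over (a, b] has the drift v. The density is conditioned from T back to b, and its
  factor over (a, b] supplies the tilted first moment.\<close>

lemma price_increment:
 assumes ab: "0 <= a" "a <= b" "b <= T" and U: "U \<in> borel_measurable (F a)" "\<And>w. w \<in> space M ==> norm (U w) <= C"
 shows "has_bochner_integral M (%w. sexp 0 v T w * (U w \<bullet> (Z b w - Z a w))) ((b - a) * expectation (%w. sexp 0 v T w * (v \<bullet> U w)))"
  and "integrable M (%w. sexp 0 v T w * (v \<bullet> U w))"
proof -
 let ?a = "%j. %w. U w $ j * sexp 0 v T w"
 let ?b = "%w. sexp 0 v T w * (v \<bullet> U w)"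
 let ?c = "\<Sum>j\<in>UNIV. (b - a) * (v $ j * expectation (?a j))"
 have aT: "0 <= b" "a <= T" "0 <= T" using ab by auto
 have Uj: "(%w. U w $ j) \<in> borel_measurable (F a)" for j using U(1) by measurable
 have intN: "integrable M (%w. U w $ j * sexp 0 v t w)" if "0 <= t" for j t
 proof (rule Bochner_Integration.integrable_bound)
  show "integrable M (%w. C * sexp 0 v t w)" using sexp_mean[OF that, of 0 v] by (simp add: has_bochner_integral_iff)
  show "(%w. U w $ j * sexp 0 v t w) \<in> borel_measurable M" using measurable_F_M[OF Uj] sexp_M[OF that] by measurable
  show "AE w in M. norm (U w $ j * sexp 0 v t w) <= norm (C * sexp 0 v t w)"
  proof (rule AE_I2)
   fix w assume "w \<in> space M"
   hence "\<bar>U w $ j\<bar> <= \<bar>C\<bar>" using component_le_norm_cart[of "U w" j] U(2)[of w] by linarith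
   thus "norm (U w $ j * sexp 0 v t w) <= norm (C * sexp 0 v t w)" by (simp add: abs_mult mult_right_mono)
  qed
 qed
 have cond: "expectation (%w. U w $ j * sexp 0 v a w) = expectation (?a j)" for j
  using sexp_cond[OF ab(1) aT(2) Uj intN[OF ab(1)], of j] by (simp add: has_bochner_integral_iff)
 have comp: "has_bochner_integral M (%w. U w $ j * (Z b w - Z a w) $ j * sexp 0 v T w) ((b - a) * (v $ j * expectation (?a j)))" for j
 proof (cases "a < b")
  case True
  define g where "g = (%x. exp (0 * (b - a) + v \<bullet> x - (v \<bullet> v) * (b - a) / 2) * x $ j)"
  have gm: "g \<in> borel_measurable borel" unfolding g_def by measurable
  have g: "has_bochner_integral M (%w. g (Z b w - Z a w)) (v $ j * (b - a))"
   using has_bochner_integral_mult_right[OF increment_coordinate_exp[OF ab(1,2), of v j], of "exp (- (v \<bullet> v) * (b - a) / 2)"]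
   unfolding g_def drift_factor by (simp add: mult_ac exp_minus)
  have "(%w. U w $ j * sexp 0 v a w) \<in> borel_measurable (F a)" by (intro borel_measurable_times Uj sexp_F ab)
  note im = indep_mult[OF ab(1) True this intN[OF ab(1)] gm integrable.intros[OF g]]
  have Um: "(%w. U w $ j * (Z b w - Z a w) $ j) \<in> borel_measurable (F b)"
   using measurable_F_mono[OF Uj ab(2), of j] Z_F[OF aT(1) order_refl] Z_F[OF ab(1,2)] by measurable
  have "has_bochner_integral M (%w. (U w $ j * sexp 0 v a w) * g (Z b w - Z a w)) (expectation (?a j) * (v $ j * (b - a)))"
   using im cond g by (simp add: has_bochner_integral_iff)
  hence hb: "has_bochner_integral M (%w. U w $ j * (Z b w - Z a w) $ j * sexp 0 v b w) (expectation (?a j) * (v $ j * (b - a)))"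
  proof (rule has_bochner_integralI_AE)
   show "AE w in M. (U w $ j * sexp 0 v a w) * g (Z b w - Z a w) = U w $ j * (Z b w - Z a w) $ j * sexp 0 v b w"
    using not_bad by eventually_elim (simp add: g_def sexp_step[where s = a and t = b])
   show "(%w. U w $ j * (Z b w - Z a w) $ j * sexp 0 v b w) \<in> borel_measurable M"
    by (intro borel_measurable_times[OF measurable_F_M[OF Um] sexp_M[OF aT(1)]])
  qed
  from sexp_cond[OF aT(1) ab(3) Um, of 0 v] hb show ?thesis by (simp add: has_bochner_integral_iff mult_ac)
 next
  case False
  hence "b = a" using ab by simp
  thus ?thesis by (simp add: has_bochner_integral_zero)
 qed
 have "has_bochner_integral M (%w. \<Sum>j\<in>UNIV. U w $ j * (Z b w - Z a w) $ j * sexp 0 v T w)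
  ?c"
  by (intro has_bochner_integral_sum comp)
 moreover have "(\<Sum>j\<in>UNIV. U w $ j * (Z b w - Z a w) $ j * sexp 0 v T w) = sexp 0 v T w * (U w \<bullet> (Z b w - Z a w))" for w
  by (simp add: inner_vec_def sum_distrib_left mult_ac)
 moreover have e: "sexp 0 v T w * (v \<bullet> U w) = (\<Sum>j\<in>UNIV. v $ j * (U w $ j * sexp 0 v T w))" for w
  by (simp add: inner_vec_def sum_distrib_left mult_ac)
 moreover have "?c = (b - a) * expectation ?b"
  unfolding e using intN[OF aT(3)] by (simp add: sum_distrib_left)
 ultimately show "has_bochner_integral M (%w. sexp 0 v T w * (U w \<bullet> (Z b w - Z a w))) ((b - a) * expectation ?b)"
  by simp
 show "integrable M ?b" unfolding e using intN[OF aT(3)] by simp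
qed

lemma step_H_time_integral:
 assumes sd: "step_data m q r" and T: "0 <= T"
 shows "(LINT s:{0..T}|lborel. v \<bullet> step_H m q r s w) = (\<Sum>i<m. (min T (q (Suc i)) - min T (q i)) * (v \<bullet> r i w))"
  and "set_integrable lborel {0..T} (%s. v \<bullet> step_H m q r s w)"
proof -
 let ?a = "\<Sum>i<m. (min T (q (Suc i)) - min T (q i)) * (v \<bullet> r i w)"
 have e: "indicator {0..T} s *\<^sub>R (v \<bullet> step_H m q r s w) = (\<Sum>i<m. indicator {min T (q i)<..min T (q (Suc i))} s * (v \<bullet> r i w))" for s
  unfolding step_H_def inner_sum_right scaleR_sum_right
 proof (intro sum.cong refl)
  fix i assume "i \<in> {..<m}"
  hence "0 <= q i" using step_data_nonneg[OF sd, of i] by simp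
  thus "indicator {0..T} s *\<^sub>R (v \<bullet> indicator {q i<..q (Suc i)} s *\<^sub>R r i w) = indicator {min T (q i)<..min T (q (Suc i))} s * (v \<bullet> r i w)"
   by (auto simp: indicator_def)
 qed
 have le: "min T (q i) <= min T (q (Suc i))" if "i < m" for i
  using step_data_mono[OF sd, of i "Suc i"] that by auto
 have "has_bochner_integral lborel (%s. \<Sum>i<m. indicator {min T (q i)<..min T (q (Suc i))} s * (v \<bullet> r i w))
  ?a"
 proof (intro has_bochner_integral_sum has_bochner_integral_mult_left)
  fix i assume "i \<in> {..<m}"
  thus "has_bochner_integral lborel (indicator {min T (q i)<..min T (q (Suc i))}) (min T (q (Suc i)) - min T (q i))"
   using le[of i] by (auto simp: has_bochner_integral_iff)
 qed
 thus "(LINT s:{0..T}|lborel. v \<bullet> step_H m q r s w) = ?a"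
  and "set_integrable lborel {0..T} (%s. v \<bullet> step_H m q r s w)"
  unfolding set_lebesgue_integral_def set_integrable_def e by (auto simp: has_bochner_integral_iff)
qed

lemma step_price:
 assumes sd: "step_data m q r" and T: "0 <= T" "T <= S"
 shows "has_bochner_integral M (%w. sexp 0 v S w * (step_I m q r T w - (LINT s:{0..T}|lborel. v \<bullet> step_H m q r s w))) 0"
proof -
 let ?a = "%i w. r i w \<bullet> (Z (min T (q (Suc i))) w - Z (min T (q i)) w)"
 let ?b = "%i. min T (q (Suc i)) - min T (q i)"
 let ?c = "%w i. sexp 0 v S w * (v \<bullet> r i w)"
 obtain C where "\<forall>i<m. \<forall>w\<in>space M. norm (r i w) <= C" using sd unfolding step_data_def by auto
 hence C: "\<And>i w. i < m ==> w \<in> space M ==> norm (r i w) <= C" by auto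
 have "has_bochner_integral M (%w. \<Sum>i<m. sexp 0 v S w * (?a i w)
  - (?b i) * (?c w i)) (\<Sum>i<m. 0)"
 proof (rule has_bochner_integral_sum)
  fix i assume i: "i \<in> {..<m}"
  have q: "0 <= q i" "q i <= q (Suc i)" using step_data_nonneg[OF sd, of i] step_data_mono[OF sd, of i "Suc i"] i by auto
  show "has_bochner_integral M (%w. sexp 0 v S w * (?a i w)
   - (?b i) * (?c w i)) 0"
  proof (cases "T <= q i")
   case True
   thus ?thesis using q by (simp add: min_absorb1 has_bochner_integral_zero)
  next
   case False
   have "r i \<in> borel_measurable (F (min T (q i)))" using sd i False unfolding step_data_def by (simp add: min_absorb2)
   note p = price_increment[of "min T (q i)" "min T (q (Suc i))" S, OF _ _ _ this C, of v]
   show ?thesis using p q T i by (auto simp: has_bochner_integral_iff)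
  qed
 qed
 moreover have "sexp 0 v S w * (step_I m q r T w - (LINT s:{0..T}|lborel. v \<bullet> step_H m q r s w))
  = (\<Sum>i<m. sexp 0 v S w * (?a i w)
  - (?b i) * (?c w i))" for w
  unfolding step_H_time_integral(1)[OF sd T(1)] step_I_def right_diff_distrib sum_distrib_left sum_subtractf[symmetric]
  by (intro sum.cong) (auto simp: algebra_simps)
 ultimately show ?thesis by simp
qed

lemma jointly_time_integral:
 fixes \<psi> :: "real => 'w => real ^ 'n"
 assumes j: "jointly \<psi>"
 shows "(%w. LINT s:{0..T}|lborel. v \<bullet> \<psi> s w) \<in> borel_measurable M"
proof -
 have "(%(w, s). indicator {0..} s *\<^sub>R \<psi> s w) \<in> borel_measurable (M \<Otimes>\<^sub>M lborel)"
  using j unfolding jointly_def by (subst measurable_pair_swap_iff) simp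
 hence "(%w. LINT s|lborel. indicator {0..T} s *\<^sub>R (v \<bullet> (case (w, s) of (w, s) => indicator {0..} s *\<^sub>R \<psi> s w))) \<in> borel_measurable M"
  by measurable
 moreover have "(LINT s|lborel. indicator {0..T} s *\<^sub>R (v \<bullet> (case (w, s) of (w, s) => indicator {0..} s *\<^sub>R \<psi> s w))) = (LINT s:{0..T}|lborel. v \<bullet> \<psi> s w)" for w
  unfolding set_lebesgue_integral_def by (intro Bochner_Integration.integral_cong) (auto simp: indicator_def)
 ultimately show ?thesis by simp
qed

lemma energy_integrable:
 fixes \<psi> :: "real => 'w => real ^ 'n"
 assumes j: "jointly \<psi>" and w: "w \<in> space M" and fin: "energy T \<psi> w < \<infinity>"
 shows "set_integrable lborel {0..T} (%s. v \<bullet> \<psi> s w)"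
  and "0 <= T ==> esq (LINT s:{0..T}|lborel. v \<bullet> \<psi> s w) <= ennreal (T * (v \<bullet> v)) * energy T \<psi> w"
proof -
 let ?a = "%s. esq (v \<bullet> \<psi> s w)"
 let ?b = "esq (LINT s:{0..T}|lborel. v \<bullet> \<psi> s w)"
 let ?c = "ennreal (v \<bullet> v) * energy T \<psi> w"
 have m: "(%s. indicator {0..} s *\<^sub>R \<psi> s w) \<in> borel_measurable lborel"
  using measurable_compose[OF measurable_Pair2'[OF w, of lborel] j[unfolded jointly_def]] by simp
 have "(%s. indicator {0..T} s *\<^sub>R (v \<bullet> (indicator {0..} s *\<^sub>R \<psi> s w))) \<in> borel_measurable lborel" using m by measurable
 hence m': "set_borel_measurable lborel {0..T} (%s. v \<bullet> \<psi> s w)"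
  unfolding set_borel_measurable_def by (rule measurable_cong[THEN iffD1, rotated]) (auto simp: indicator_def)
 have "nnint {0..T} ?a <= (\<L> s. ennreal (v \<bullet> v) * (esq (norm (\<psi> s w)) * indicator {0..T} s))"
  using Cauchy_Schwarz_ineq[of v] by (intro nn_integral_mono) (auto simp: indicator_def ennreal_mult[symmetric] power2_norm_eq_inner intro!: ennreal_leI)
 also have "... = ?c"
  unfolding energy_def by (intro nn_integral_cmult energy_integrand_measurable[OF j w])
 finally have le: "nnint {0..T} ?a <= ?c" .
 also have "... < \<infinity>" using fin by (simp add: ennreal_mult_less_top)
 finally show i: "set_integrable lborel {0..T} (%s. v \<bullet> \<psi> s w)" by (rule set_integrable_of_square[OF m'])
 assume T: "0 <= T"
 have "?b <= ennreal (T - 0) * nnint {0..T} ?a"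
  by (rule square_integral_le[OF i T])
 also have "... <= ennreal T * (ennreal (v \<bullet> v) * energy T \<psi> w)" using le by (simp add: mult_left_mono)
 finally show "?b <= ennreal (T * (v \<bullet> v)) * energy T \<psi> w"
  using T by (simp add: ennreal_mult mult.assoc)
qed

text \<open>Cauchy-Schwarz makes the mean of the modulus of N (X - Xs n) tend to 0; as soon as one
  of these means is finite, N X is integrable.\<close>

lemma L2_limit_orthogonal:
 fixes N :: "'w => real"
 assumes N: "N \<in> borel_measurable M" "integrable M (%w. (N w)^2)" and X: "X \<in> borel_measurable M"
  and Xn: "\<And>n. has_bochner_integral M (%w. N w * Xs n w) 0" "\<And>n. Xs n \<in> borel_measurable M"
  and lim: "(%n. \<E> w. esq (X w - Xs n w)) \<longlonglongrightarrow> 0"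
 shows "has_bochner_integral M (%w. N w * X w) 0"
proof -
 let ?a = "%w. N w * X w"
 note [measurable] = N(1) X Xn(2)
 define u where "u = (%n. \<E> w. ennreal \<bar>N w * (X w - Xs n w)\<bar>)"
 have u0: "u \<longlonglongrightarrow> 0"
 proof (rule sq_tendsto_ennreal_zero[OF lim])
  show "(\<E> w. esq (N w)) < \<top>" using N(2) by (simp add: nn_integral_eq_integral)
  show "(u n)^2 <= (\<E> w. esq (X w - Xs n w)) * (\<E> w. esq (N w))" for n
  proof -
   have "(u n)^2 = (\<E> w. ennreal \<bar>N w\<bar> * ennreal \<bar>X w - Xs n w\<bar>)^2" by (simp add: u_def abs_mult ennreal_mult)
   also have "... <= (\<E> w. (ennreal \<bar>N w\<bar>)^2) * (\<E> w. (ennreal \<bar>X w - Xs n w\<bar>)^2)"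
    by (rule Cauchy_Schwarz_nn_integral) measurable
   finally show ?thesis by (simp add: ennreal_power mult.commute)
  qed
 qed
 hence "eventually (%n. u n < 1) sequentially" by (rule order_tendstoD) simp
 then obtain n where n: "u n < 1" by (auto simp: eventually_sequentially)
 have "integrable M (%w. N w * (X w - Xs n w))"
 proof (rule integrableI_bounded)
  show "(\<E> w. ennreal (norm (N w * (X w - Xs n w)))) < \<infinity>" using n by (simp add: u_def order.strict_trans[OF _ ennreal_one_less_top])
 qed measurable
 from Bochner_Integration.integrable_add[OF this integrable.intros[OF Xn(1)[of n]]]
 have i: "integrable M ?a" by (simp add: algebra_simps)
 have "ennreal \<bar>expectation ?a\<bar> <= u n" for n
 proof -
  have j: "integrable M (%w. N w * (X w - Xs n w))" using i integrable.intros[OF Xn(1)[of n]] by (simp add: right_diff_distrib)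
  have "expectation ?a = expectation (%w. N w * (X w - Xs n w))"
   using i Xn(1)[of n] by (simp add: right_diff_distrib has_bochner_integral_iff)
  thus ?thesis unfolding u_def using integral_norm_bound_ennreal[OF j] by simp
 qed
 hence "ennreal \<bar>expectation ?a\<bar> <= 0" by (intro LIMSEQ_le_const[OF u0]) auto
 thus ?thesis using i by (simp add: has_bochner_integral_iff)
qed

text \<open>Girsanov's theorem in integrated form, applied later with v equal to minus the market
  price of risk. Step integrands satisfy it by \<open>step_price\<close>; by
  \<open>ito_at_L2\<close> and Cauchy-Schwarz in time, both the integral and its compensator are
  limits in mean square.\<close>

theorem gains_price_zero:
 assumes ito: "ito_at T \<psi> V" and T: "0 <= T" "T <= S" and fin: "(\<E> w. energy T \<psi> w) < \<infinity>"
 shows "has_bochner_integral M (%w. sexp 0 v S w * (V w - (LINT s:{0..T}|lborel. v \<bullet> \<psi> s w))) 0"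
proof -
 let ?a = "%w L n K. (V w - (LINT s:{0..T}|lborel. v \<bullet> \<psi> s w)) - (L n T w - (LINT s:{0..T}|lborel. v \<bullet> K n s w))"
 let ?b = "%K n. %s w. K n s w - \<psi> s w"
 let ?c = "T * (v \<bullet> v)"
 let ?d = "%K n w. LINT s:{0..T}|lborel. v \<bullet> K n s w"
 let ?e = "borel_measurable M"
 let ?f = "%w L K. %n. 2 * (\<E> w. esq (V w - L n T w)) + ennreal (2 * ?c) * (\<E> w. energy T (?b K n) w)"
 let ?g = "%w L n K. 2 * (\<E> w. esq (V w - L n T w)) + ennreal (2 * ?c) * (\<E> w. energy T (?b K n) w)"
 let ?h = "%L n K. has_bochner_integral M (%w. sexp 0 v S w * (L n T w - (?d K n w))) 0"
 have j: "jointly \<psi>" and V: "V \<in> ?e" using ito unfolding ito_at_def by auto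
 obtain K L where el: "\<And>n. elementary_integral M Z (K n) (L n)"
  and K: "(%n. \<E> w. energy T (?b K n) w) \<longlonglongrightarrow> 0"
  and L: "(%n. \<E> w. esq (V w - L n T w)) \<longlonglongrightarrow> 0"
  using ito_at_L2[OF ito T(1) fin] by blast
 have Kj: "jointly (K n)" "jointly (?b K n)" for n using elementary_jointly[OF el] j by (auto intro: jointly_diff)
 have Lm: "L n T \<in> ?e" for n by (rule elementary_measurable[OF el T(1)])
 note [measurable] = V Lm jointly_time_integral[OF j] jointly_time_integral[OF Kj(1)] energy_measurable[OF Kj(2)]
 have el_price: "?h L n K" for n
  using el[of n] step_price[OF _ T, of _ _ _ v] unfolding elementary_integral_iff by auto
 have Kint: "set_integrable lborel {0..T} (%s. v \<bullet> K n s w)" for n w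
  using el[of n] step_H_time_integral(2)[OF _ T(1), of _ _ _ v w] unfolding elementary_integral_iff by auto
 have ae: "AE w in M. energy T \<psi> w ~= \<infinity>" by (rule nn_integral_PInf_AE) (use fin energy_measurable[OF j] in auto)
 show ?thesis
 proof (rule L2_limit_orthogonal[where Xs = "%n w. L n T w - (?d K n w)"])
  show "integrable M (%w. (sexp 0 v S w)^2)" by (rule integrable.intros[OF sexp_square_mean]) (use T in simp)
  have "(\<E> w. esq (?a w L n K))
   <= (\<E> w. 2 * esq (V w - L n T w) + ennreal (2 * ?c) * energy T (?b K n) w)" for n
  proof (rule nn_integral_mono_AE)
   show "AE w in M. esq (?a w L n K)
    <= 2 * esq (V w - L n T w) + ennreal (2 * ?c) * energy T (?b K n) w"
    using ae AE_space
   proof eventually_elim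
    case (elim w)
    define D where "D = (LINT s:{0..T}|lborel. v \<bullet> (K n s w - \<psi> s w))"
    have D: "D = (?d K n w) - (LINT s:{0..T}|lborel. v \<bullet> \<psi> s w)"
     unfolding D_def inner_diff_right
     by (rule set_integral_diff(2)[OF Kint energy_integrable(1)[OF j elim(2)]]) (use elim(1) in \<open>simp add: less_top\<close>)
    have a: "esq D <= ennreal ?c * energy T (?b K n) w"
    proof (cases "energy T (?b K n) w < \<infinity>")
     case True
     thus ?thesis unfolding D_def by (rule energy_integrable(2)[OF Kj(2) elim(2) _ T(1)])
    next
     case False
     hence top: "energy T (?b K n) w = \<top>" by (simp add: less_top[symmetric])
     show ?thesis
     \<comment> \<open>An infinite energy makes the bound trivial unless its factor is 0, and in
       that case D itself vanishes.\<close>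
     proof (cases "T * (v \<bullet> v) = 0")
      case True
      hence "T = 0 \<or> v = 0" by simp
      hence "D = 0" by (auto simp: D_def LINT_singleton)
      thus ?thesis by simp
     next
      case False
      hence "0 < T * (v \<bullet> v)" using T by (simp add: less_le)
      hence "ennreal ?c ~= 0" by (simp only: ennreal_eq_0_iff not_le)
      thus ?thesis unfolding top by (simp only: ennreal_mult_top if_False top_greatest)
     qed
    qed
    have b: "(?a w L n K)^2 <= 2 * (V w - L n T w)^2 + 2 * D^2" (is "?X^2 <= _")
     using sq_norm_add_le[of "V w - L n T w" D] by (simp add: D algebra_simps)
    have "ennreal (?X^2) <= 2 * esq (V w - L n T w) + 2 * esq D"
      using ennreal_leI[OF b] by (simp add: ennreal_plus ennreal_mult)
     also have "... <= 2 * esq (V w - L n T w) + 2 * (ennreal ?c * energy T (?b K n) w)"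
      using a by (intro add_left_mono mult_left_mono) auto
     finally show ?case using T by (simp add: ennreal_mult mult.assoc)
   qed
  qed
  also have "(\<E> w. 2 * esq (V w - L n T w) + ennreal (2 * ?c) * energy T (?b K n) w)
   = ?g w L n K" for n
   by (simp add: nn_integral_add nn_integral_cmult)
  finally have le: "(\<E> w. esq (?a w L n K))
   <= ?g w L n K" for n .
  have "(?f w L K) \<longlonglongrightarrow> 2 * 0 + ennreal (2 * ?c) * 0"
   by (rule tendsto_add[OF ennreal_tendsto_cmult[OF _ L] ennreal_tendsto_cmult[OF _ K]]) simp_all
  hence R: "(?f w L K) \<longlonglongrightarrow> 0"
   by (simp only: mult_zero_right add_0_right)
  show "(%n. \<E> w. esq (?a w L n K)) \<longlonglongrightarrow> 0"
   by (rule tendsto_sandwich[OF always_eventually always_eventually tendsto_const R]) (intro allI zero_le le)+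
  show "sexp 0 v S \<in> ?e" by (rule sexp_M) (use T in simp)
  show "?h L n K" for n by (rule el_price)
  show "(%w. V w - (LINT s:{0..T}|lborel. v \<bullet> \<psi> s w)) \<in> ?e"
   "(%w. L n T w - (?d K n w)) \<in> ?e" for n
   by (intro borel_measurable_diff V Lm jointly_time_integral j Kj)+
 qed
qed

text \<open>A crude bound suffices: an approximant within 1 in expected energy and in mean square
  gives 2 * 1 + 2 * (2 * 1 + 2 e) = 6 + 4 e for the expected energy e.\<close>

lemma ito_at_second_moment:
 assumes ito: "ito_at T \<psi> V" and T: "0 <= T" and fin: "(\<E> w. energy T \<psi> w) < \<infinity>"
 shows "(\<E> w. esq (V w)) <= 6 + 4 * (\<E> w. energy T \<psi> w)"
proof -
 let ?a = "%K n. %s w. K n s w - \<psi> s w"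
 let ?b = "%w. \<E> w. energy T \<psi> w"
 have j: "jointly \<psi>" and V: "V \<in> borel_measurable M" using ito unfolding ito_at_def by auto
 obtain K L where el: "\<And>n. elementary_integral M Z (K n) (L n)"
  and K: "(%n. \<E> w. energy T (?a K n) w) \<longlonglongrightarrow> 0"
  and L: "(%n. \<E> w. esq (V w - L n T w)) \<longlonglongrightarrow> 0"
  using ito_at_L2[OF ito T fin] by blast
 have "eventually (%n. (\<E> w. energy T (?a K n) w) < 1 \<and> (\<E> w. esq (V w - L n T w)) < 1) sequentially"
  using order_tendstoD(2)[OF K, of 1] order_tendstoD(2)[OF L, of 1] by (simp add: eventually_conj_iff)
 then obtain n where n: "(\<E> w. energy T (?a K n) w) < 1" "(\<E> w. esq (V w - L n T w)) < 1"
  by (auto simp: eventually_sequentially)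
 have Kj: "jointly (K n)" "jointly (?a K n)" using elementary_jointly[OF el] j by (auto intro: jointly_diff)
 note [measurable] = V elementary_measurable[OF el T, of n] energy_measurable[OF Kj(1)] energy_measurable[OF Kj(2)] energy_measurable[OF j]
 have "(\<E> w. esq (V w)) <= (\<E> w. 2 * esq (V w - L n T w) + 2 * esq (L n T w))"
 proof (rule nn_integral_mono)
  fix w
  have "(V w)^2 <= 2 * (V w - L n T w)^2 + 2 * (L n T w)^2" using sq_norm_add_le[of "V w - L n T w" "L n T w"] by simp
  from ennreal_leI[OF this] show "esq (V w) <= 2 * esq (V w - L n T w) + 2 * esq (L n T w)"
   by (simp add: ennreal_plus ennreal_mult)
 qed
 also have "... = 2 * (\<E> w. esq (V w - L n T w)) + 2 * (\<E> w. energy T (K n) w)"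
  unfolding elementary_isometry(1)[OF el T, symmetric] by (simp add: nn_integral_add nn_integral_cmult)
 also have "... <= 2 * 1 + 2 * (2 * 1 + 2 * (?b w))"
 proof (intro add_mono mult_left_mono)
  have "(\<E> w. energy T (K n) w) <= (\<E> w. 2 * energy T (?a K n) w + 2 * energy T \<psi> w)"
  proof (rule nn_integral_mono)
   fix w assume w: "w \<in> space M"
   show "energy T (K n) w <= 2 * energy T (?a K n) w + 2 * energy T \<psi> w"
    using energy_add_le[OF Kj(2) j w, of T 1 1] by simp
  qed
  also have "... = 2 * (\<E> w. energy T (?a K n) w) + 2 * (?b w)"
   by (simp add: nn_integral_add nn_integral_cmult)
  also have "... <= 2 * 1 + 2 * (?b w)" using n by (intro add_mono mult_left_mono) auto
  finally show "(\<E> w. energy T (K n) w) <= 2 * 1 + 2 * (?b w)" .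
 qed (use n in auto)
 also have "... = 6 + 4 * (?b w)" by (simp add: distrib_left add.assoc[symmetric] mult.assoc[symmetric])
 finally show ?thesis .
qed

end

section \<open>The budget constraint\<close>

text \<open>Integration by parts without touching the stochastic integral, which is not of bounded
  variation: only the absolutely continuous parts go through \<open>discounted_primitive\<close>.
  The gains A(t) = I(t) + (integral of \<pi> up to t) remain as values at T and under a time
  integral, so a zero price of each A(s) can be used directly.\<close>

lemma discounted_wealth:
 fixes X I C \<pi> :: "real => real"
 assumes X: "continuous_on {0..T} X" and A: "continuous_on {0..T} (%t. I t + (LINT s:{0..t}|lborel. \<pi> s))"
  and \<pi>: "set_integrable lborel {0..T} \<pi>" and g: "set_integrable lborel {0..T} (%s. R * X s - C s + \<pi> s)"
  and eq: "\<And>t. 0 <= t ==> t <= T ==> X t = x + (LINT s:{0..t}|lborel. R * X s - C s + \<pi> s) + I t"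
  and T: "0 <= T"
 shows "set_integrable lborel {0..T} C"
  "exp (- R * T) * X T + (LINT s:{0..T}|lborel. exp (- R * s) * C s)
   = x + exp (- R * T) * (I T + (LINT s:{0..T}|lborel. \<pi> s)) + (LINT s:{0..T}|lborel. R * exp (- R * s) * (I s + (LINT u:{0..s}|lborel. \<pi> u)))"
proof -
 let ?a = "%Y. LINT s:{0..T}|lborel. R * exp (- R * s) * Y s"
 let ?b = "(LINT s:{0..T}|lborel. R * exp (- R * s) * X s) - (LINT s:{0..T}|lborel. exp (- R * s) * C s) + (LINT s:{0..T}|lborel. exp (- R * s) * \<pi> s)"
 let ?c = "LINT s:{0..T}|lborel. exp (- R * s) * (R * X s - C s + \<pi> s)"
 let ?d = "%P. LINT s:{0..T}|lborel. R * exp (- R * s) * (I s + P s)"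
 let ?e = "exp (- R * T) * X T + (LINT s:{0..T}|lborel. exp (- R * s) * C s)"
 let ?f = "LINT s:{0..T}|lborel. x * (R * exp (- R * s))"
 let ?g = "LINT s:{0..T}|lborel. R * exp (- R * s) * X s"
 define P where "P = (%t. LINT s:{0..t}|lborel. \<pi> s)"
 define Y where "Y = (%t. LINT s:{0..t}|lborel. R * X s - C s + \<pi> s)"
 have Xi: "set_integrable lborel {0..T} X" by (rule borel_integrable_atLeastAtMost'[OF X])
 have RX: "set_integrable lborel {0..T} (%s. R * X s)" using Xi by simp
 have "set_integrable lborel {0..T} (%s. (R * X s + \<pi> s) - (R * X s - C s + \<pi> s))"
  by (intro set_integral_diff(1) set_integral_add(1) RX \<pi> g)
 thus C: "set_integrable lborel {0..T} C" by simp
 have cont: "continuous_on {0..T} (%s. R * exp (- R * s) * h s)" if "continuous_on {0..T} h" for h :: "real => real"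
  using that by (intro continuous_intros)
 have Z: "Y s - P s = X s - x - (I s + P s)" if "0 <= s" "s <= T" for s
  using eq[OF that] by (simp add: Y_def P_def)
 have contP: "continuous_on {0..T} f ==> set_integrable lborel {0..T} (%s. R * exp (- R * s) * f s)" for f
  by (intro borel_integrable_atLeastAtMost' cont)
 have 1: "(?a Y) = ?c - exp (- R * T) * Y T"
  unfolding Y_def by (rule discounted_primitive[OF g T])
 have 2: "(?a P) = (LINT s:{0..T}|lborel. exp (- R * s) * \<pi> s) - exp (- R * T) * P T"
  unfolding P_def by (rule discounted_primitive[OF \<pi> T])
 have Ai: "set_integrable lborel {0..T} (%s. R * exp (- R * s) * (I s + P s))" by (rule contP) (use A in \<open>simp add: P_def\<close>)
 have "(?a Y) - (?a P)
  = (LINT s:{0..T}|lborel. R * exp (- R * s) * Y s - R * exp (- R * s) * P s)"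
  using continuous_on_LINT[OF g] continuous_on_LINT[OF \<pi>] unfolding Y_def P_def by (intro set_integral_diff(2)[symmetric] contP)
 also have "... = (LINT s:{0..T}|lborel. (R * exp (- R * s) * X s - x * (R * exp (- R * s))) - R * exp (- R * s) * (I s + P s))"
 proof (intro set_lebesgue_integral_cong allI impI)
  fix s assume "s \<in> {0..T}"
  hence "R * exp (- R * s) * (Y s - P s) = R * exp (- R * s) * (X s - x - (I s + P s))" using Z[of s] by simp
  thus "R * exp (- R * s) * Y s - R * exp (- R * s) * P s = (R * exp (- R * s) * X s - x * (R * exp (- R * s))) - R * exp (- R * s) * (I s + P s)"
   by (simp only: right_diff_distrib) (simp only: mult_ac)
 qed simp
 also have "... = (?g - ?f) - (?d P)"
 proof -
  have xi: "set_integrable lborel {0..T} (%s. x * (R * exp (- R * s)))" by (intro borel_integrable_atLeastAtMost' continuous_intros)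
  show ?thesis unfolding set_integral_diff(2)[OF set_integral_diff(1)[OF contP[OF X] xi] Ai] set_integral_diff(2)[OF contP[OF X] xi] ..
 qed
 also have "?f = x * (1 - exp (- R * T))"
  using has_bochner_integral_integral_eq[OF exp_integral[OF T, of R]] by (simp add: set_lebesgue_integral_def mult.left_commute)
 finally have 3: "(?a Y) - (?a P)
  = ?g - x * (1 - exp (- R * T)) - (?d P)" .
 have "?c
  = (LINT s:{0..T}|lborel. (R * exp (- R * s) * X s - exp (- R * s) * C s) + exp (- R * s) * \<pi> s)"
  by (simp add: algebra_simps)
 also have "... = ?b"
  unfolding set_integral_add(2)[OF set_integral_diff(1)[OF contP[OF X] set_integrable_exp_mult[OF C]] set_integrable_exp_mult[OF \<pi>]]
   set_integral_diff(2)[OF contP[OF X] set_integrable_exp_mult[OF C]] ..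
 finally have 4: "?c
  = ?b" .
 have 5: "Y T - P T = X T - x - (I T + P T)" by (rule Z[OF T order_refl])
 have "exp (- R * T) * (Y T - P T) = exp (- R * T) * (X T - x - (I T + P T))" unfolding 5 ..
 moreover have "x * exp (- R * T) = exp (- R * T) * x" by (rule mult.commute)
 ultimately have "?e
   = x + exp (- R * T) * (I T + P T) + (?d P)"
  using 1 2 3 4 by (simp only: right_diff_distrib distrib_left mult_1_right)
 thus "?e
   = x + exp (- R * T) * (I T + (LINT s:{0..T}|lborel. \<pi> s)) + (LINT s:{0..T}|lborel. R * exp (- R * s) * (I s + (LINT u:{0..s}|lborel. \<pi> u)))"
  by (simp only: P_def)
qed

context brownian
begin

lemma sexp_cond_nn:
 assumes st: "0 <= s" "s <= t" and U: "U \<in> borel_measurable (F s)"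
 shows "(\<E> w. U w * ennreal (sexp 0 v t w)) = (\<E> w. U w * ennreal (sexp 0 v s w))"
proof (cases "s < t")
 case True
 define g where "g = (%x. ennreal (exp (0 * (t - s) + v \<bullet> x - (v \<bullet> v) * (t - s) / 2)))"
 have gm: "g \<in> borel_measurable borel" unfolding g_def by measurable
 have "has_bochner_integral M (%w. exp (0 * (t - s) + v \<bullet> (Z t w - Z s w) - (v \<bullet> v) * (t - s) / 2)) 1"
  using has_bochner_integral_mult_right[OF increment_exp[OF st, of v], of "exp (0 * (t - s) - (v \<bullet> v) * (t - s) / 2)"]
  unfolding drift_factor by (simp add: exp_add[symmetric])
 hence "(\<E> w. g (Z t w - Z s w)) = 1"
  unfolding g_def by (subst nn_integral_eq_integral) (auto simp: has_bochner_integral_iff)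
 moreover have "(%w. U w * ennreal (sexp 0 v s w)) \<in> borel_measurable (F s)" using U sexp_F[OF st(1), of 0 v] by measurable
 ultimately have "(\<E> w. (U w * ennreal (sexp 0 v s w)) * g (Z t w - Z s w)) = (\<E> w. U w * ennreal (sexp 0 v s w))"
  using indep_mult_nn[OF st(1) True _ gm] by simp
 moreover have "(\<E> w. (U w * ennreal (sexp 0 v s w)) * g (Z t w - Z s w)) = (\<E> w. U w * ennreal (sexp 0 v t w))"
 proof (rule nn_integral_cong_AE)
  show "AE w in M. (U w * ennreal (sexp 0 v s w)) * g (Z t w - Z s w) = U w * ennreal (sexp 0 v t w)"
   using not_bad
  proof eventually_elim
   case (elim w)
   show ?case unfolding sexp_step[OF elim, of 0 v t s] g_def using sexp_pos[of 0 v s w] by (subst ennreal_mult) (auto simp: mult.assoc)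
  qed
 qed
 ultimately show ?thesis by simp
qed (use st in simp)

text \<open>Fubini: the product of N and B is dominated by N^2 + B^2, whose means are bounded
  uniformly over the interval.\<close>

lemma mean_zero_time_integral:
 assumes N: "N \<in> borel_measurable M" "integrable M (%w. (N w)^2)" and B: "jointly B" and T: "0 <= T"
  and mean: "\<And>s. 0 <= s ==> s <= T ==> has_bochner_integral M (%w. N w * B s w) 0"
  and K: "\<And>s. 0 <= s ==> s <= T ==> (\<E> w. esq (B s w)) <= K" "K < \<infinity>"
  and r: "r \<in> borel_measurable borel" "\<And>s. 0 <= s ==> s <= T ==> \<bar>r s\<bar> <= c"
 shows "has_bochner_integral M (%w. N w * (LINT s:{0..T}|lborel. r s * B s w)) (0 :: real)"
proof -
 let ?a = "lborel \<Otimes>\<^sub>M M"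
 interpret PM: pair_sigma_finite lborel M ..
 note [measurable] = N(1) r(1)
 have [measurable]: "(%(t, w). indicator {0..} t *\<^sub>R B t w) \<in> borel_measurable ?a" using B unfolding jointly_def .
 define f where "f = (%s w. indicator {0..T} s * (r s * (N w * B s w)))"
 have c: "0 <= c" using r(2)[of 0] T by simp
 have m: "(%(s, w). f s w) \<in> borel_measurable ?a"
 proof -
  have "(%x. indicator {0..T} (fst x) * (r (fst x) * (N (snd x) * (case x of (t, w) => indicator {0..} t *\<^sub>R B t w)))) \<in> borel_measurable ?a" by measurable
  thus ?thesis by (rule measurable_cong[THEN iffD1, rotated]) (auto simp: f_def indicator_def)
 qed
 define E where "E = (\<E> w. esq (N w)) + K"
 have "(\<integral>\<^sup>+x. ennreal (norm (case x of (s, w) => f s w)) \<partial>?a) = (\<L> s. \<E> w. ennreal (norm (f s w)))"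
  by (subst nn_integral_fst[symmetric]) (use m in measurable)
 also have "... <= (\<L> s. (ennreal c * E) * indicator {0..T} s)"
 proof (rule nn_integral_mono)
  fix s
  show "(\<E> w. ennreal (norm (f s w))) <= (ennreal c * E) * indicator {0..T} s"
  proof (cases "s \<in> {0..T}")
   case True
   hence [measurable]: "B s \<in> borel_measurable M" using jointly_section[OF B] by simp
   have le: "norm (f s w) <= c * ((N w)^2 + (B s w)^2)" for w
   proof -
    have "\<bar>N w * B s w\<bar> <= (N w)^2 + (B s w)^2"
     unfolding abs_mult using sum_squares_bound[of "\<bar>N w\<bar>" "\<bar>B s w\<bar>"] mult_nonneg_nonneg[OF abs_ge_zero abs_ge_zero, of "N w" "B s w"]
     by (simp only: power2_abs)
    thus ?thesis using True r(2)[of s] c unfolding f_def by (auto simp: abs_mult intro!: mult_mono)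
   qed
   have "(\<E> w. ennreal (norm (f s w))) <= (\<E> w. ennreal c * (esq (N w) + esq (B s w)))"
    using ennreal_leI[OF le] c by (intro nn_integral_mono) (simp add: ennreal_mult ennreal_plus)
   also have "... <= ennreal c * E"
    using K(1)[of s] True unfolding E_def by (simp add: nn_integral_cmult nn_integral_add mult_left_mono)
   finally show ?thesis using True by simp
  qed (simp add: f_def)
 qed
 also have "... = ennreal c * E * ennreal T" using T by (subst nn_integral_cmult_indicator) auto
 also have "... < \<infinity>" using K(2) N(2) by (simp add: E_def nn_integral_eq_integral ennreal_mult_less_top)
 finally have fi: "integrable ?a (%(s, w). f s w)" by (rule integrableI_bounded[OF m])
 have in1: "(LINT s|lborel. f s w) = N w * (LINT s:{0..T}|lborel. r s * B s w)" for w
  by (simp add: f_def set_lebesgue_integral_def mult.left_commute)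
 have in2: "(LINT w|M. f s w) = 0" for s using mean[of s] by (cases "s \<in> {0..T}") (auto simp: f_def has_bochner_integral_iff)
 have "(LINT w|M. (LINT s|lborel. f s w)) = (LINT s|lborel. (LINT w|M. f s w))" using PM.Fubini_integral[of f] fi by simp
 thus ?thesis using PM.integrable_snd[of f] fi unfolding in1 in2 by (simp add: has_bochner_integral_iff)
qed

text \<open>For a finite horizon T the exponential at time t is replaced by its terminal value N, so
  that a single weight multiplies the whole path. The pathwise identity
  \<open>discounted_wealth\<close>, weighted with N, has the mean x because all gains have price 0.
  The horizon is then removed by monotone convergence.\<close>

theorem budget:
 assumes X: "adapted_continuous M F X" and ito: "ito_integral M Z \<psi> I" and C: "predictable M F C" and R: "0 <= R"
  and fin: "\<And>T. 0 <= T ==> (\<E> w. energy T \<psi> w) < \<infinity>"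
  and int: "AE w in M. \<forall>t\<ge>0. set_integrable lborel {0..t} (%s. R * X s w - C s w + k \<bullet> \<psi> s w)"
  and eq: "AE w in M. \<forall>t\<ge>0. X t w = x + (LINT s:{0..t}|lborel. R * X s w - C s w + k \<bullet> \<psi> s w) + I t w"
  and pos: "AE w in M. \<forall>t\<ge>0. 0 <= X t w" "AE w in M. AE s in lborel. 0 <= s \<longrightarrow> 0 <= C s w"
 shows "(\<E> w. nnint {0..} (%t. ennreal (exp (- R * t) * sexp 0 (- k) t w * C t w))) <= ennreal x"
proof -
 let ?a = "borel_measurable (M \<Otimes>\<^sub>M lborel)"
 let ?b = "%T B w. LINT s:{0..T}|lborel. R * exp (- R * s) * B s w"
 let ?c = "%T w. LINT s:{0..T}|lborel. exp (- R * s) * C s w"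
 let ?d = "%T. T * (k \<bullet> k)"
 let ?e = "%y f n. case y of (w, t) => f w t * indicator {0..real n} t"
 let ?f = "%N w. %s. ennreal (exp (- R * s) * N w * C s w)"
 let ?g = "%N w B T. N w * x + N w * B T w * exp (- R * T) + N w * (?b T B w)"
 let ?h = "(%(w, t). ennreal (C t w) * indicator {0..} t) \<in> ?a"
 let ?i = "M \<Otimes>\<^sub>M lborel"
 let ?j = "borel_measurable M"
 let ?k = "%x. case x of (w, t) => indicator {0..} t *\<^sub>R C t w"
 interpret PM: pair_sigma_finite M lborel ..
 define f where "f = (%w t. ennreal (exp (- R * t) * sexp 0 (- k) t w * C t w) * indicator {0..} t)"
 have j: "jointly \<psi>" and Ia: "adapted_continuous M F I" using ito_integralD[OF ito] by auto
 have fm: "(%(w, t). f w t) \<in> ?a"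
  and fm': "?h"
 proof -
  have *: "(%(w, t). indicator {0..} t *\<^sub>R H t w) \<in> ?a" if "jointly H" for H :: "real => 'w => real"
   using that unfolding jointly_def by (subst measurable_pair_swap_iff) simp
  note [measurable] = *[OF predictable_jointly[OF C]] *[OF sexp_jointly[of 0 "- k"]]
  have "(%x. ennreal (exp (- R * snd x) * (case x of (w, t) => indicator {0..} t *\<^sub>R sexp 0 (- k) t w) * (?k x)) * indicator {0..} (snd x)) \<in> ?a"
   by measurable
  thus "(%(w, t). f w t) \<in> ?a"
   by (rule measurable_cong[THEN iffD1, rotated]) (auto simp: f_def indicator_def)
  have "(%x. ennreal (?k x) * indicator {0..} (snd x)) \<in> ?a"
   by measurable
  thus "?h"
   by (rule measurable_cong[THEN iffD1, rotated]) (auto simp: indicator_def)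
 qed
 have bound: "(\<E> w. (\<L> t. f w t * indicator {0..T} t)) <= ennreal x" if T: "0 <= T" for T
 proof -
  define N where "N = sexp 0 (- k) T"
  define Gd where "Gd = {w \<in> space M. \<forall>T\<ge>0. energy T \<psi> w < \<infinity>}"
  define A where "A = (%t w. I t w + (LINT s:{0..t}|lborel. k \<bullet> \<psi> s w))"
  \<comment> \<open>The compensator is a continuous path where all energies are finite; B is set to
    0 elsewhere so that it is continuous for every outcome.\<close>
  define B where "B = (%t w. indicator Gd w * A t w)"
  have Gd: "Gd \<in> sets M" "AE w in M. w \<in> Gd"
   using AE_null[OF ito_integralD(6)[OF ito]] ito_integralD(6)[OF ito] M_cong[of "space M" Gd] by (auto simp: Gd_def elim!: eventually_mono)
  have pint: "set_integrable lborel {0..t} (%s. k \<bullet> \<psi> s w)" if "w \<in> Gd" "0 <= t" for w t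
   using energy_integrable(1)[OF j, of w t k] that by (auto simp: Gd_def)
  have Bc: "continuous_on {0..} (%t. B t w)" if w: "w \<in> space M" for w
  proof (cases "w \<in> Gd")
   case True
   have "continuous_on {0..b} (%t. LINT s:{0..t}|lborel. k \<bullet> \<psi> s w)" if "0 <= b" for b by (intro continuous_on_LINT pint True that)
   hence "continuous_on {0..} (%t. LINT s:{0..t}|lborel. k \<bullet> \<psi> s w)" by (rule continuous_on_halfline)
   thus ?thesis using True Ia w unfolding B_def A_def adapted_continuous_def by (auto intro!: continuous_intros)
  qed (simp add: B_def)
  have Am: "A t \<in> ?j" if "0 <= t" for t
   unfolding A_def by (intro borel_measurable_add ito_integralD(5)[OF ito] jointly_time_integral j that)
  have Bm: "B t \<in> ?j" if "0 <= t" for t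
   unfolding B_def using Am[OF that] Gd(1) by measurable
  have Bj: "jointly B" using jointly_measurable_continuous[of B M, OF Bm Bc] by (simp add: jointly_def)
  have Bmean: "has_bochner_integral M (%w. N w * B s w) 0" if s: "0 <= s" "s <= T" for s
  proof (rule has_bochner_integralI_AE[OF gains_price_zero[OF ito_integral_at[OF ito s(1)] s fin[OF s(1)], of "- k"]])
   show "AE w in M. sexp 0 (- k) T w * (I s w - (LINT u:{0..s}|lborel. - k \<bullet> \<psi> u w)) = N w * B s w"
    using Gd(2) by eventually_elim (simp add: N_def B_def A_def set_lebesgue_integral_def)
   show "(%w. N w * B s w) \<in> ?j" unfolding N_def by (intro borel_measurable_times Bm sexp_M s T)
  qed
  define e where "e = (\<E> w. energy T \<psi> w)"
  define K where "K = 2 * (6 + 4 * e) + ennreal (2 * (?d T)) * e"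
  have K: "K < \<infinity>" using fin[OF T] by (simp add: K_def e_def ennreal_mult_less_top)
  have B2: "(\<E> w. esq (B s w)) <= K" if s: "0 <= s" "s <= T" for s
  proof -
   have es: "energy s \<psi> w <= energy T \<psi> w" for w
    unfolding energy_def using s by (intro nn_integral_mono mult_left_mono) (auto simp: indicator_def)
   have "(\<E> w. esq (B s w)) <= (\<E> w. 2 * esq (I s w) + ennreal (2 * (?d T)) * energy T \<psi> w)"
   proof (rule nn_integral_mono)
    fix w assume w: "w \<in> space M"
    define L where "L = (LINT s:{0..s}|lborel. k \<bullet> \<psi> s w)"
    show "esq (B s w) <= 2 * esq (I s w) + ennreal (2 * (?d T)) * energy T \<psi> w"
    proof (cases "w \<in> Gd")
     case True
     have "esq L <= ennreal (?d s) * energy s \<psi> w"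
      unfolding L_def using True s by (intro energy_integrable(2)[OF j w]) (auto simp: Gd_def)
     also have "... <= ennreal (?d T) * energy T \<psi> w" by (intro mult_mono ennreal_leI mult_right_mono s es) auto
     finally have L: "2 * esq L <= ennreal (2 * (?d T)) * energy T \<psi> w"
      using T by (simp add: ennreal_mult mult.assoc mult_left_mono)
     have "(B s w)^2 <= 2 * (I s w)^2 + 2 * L^2" using sq_norm_add_le[of "I s w" L] True by (simp add: B_def A_def L_def)
     from ennreal_leI[OF this] have "esq (B s w) <= 2 * esq (I s w) + 2 * esq L" by (simp add: ennreal_plus ennreal_mult)
     also have "... <= 2 * esq (I s w) + ennreal (2 * (?d T)) * energy T \<psi> w" by (intro add_left_mono L)
     finally show ?thesis .
    qed (simp add: B_def)
   qed
   also have "... = 2 * (\<E> w. esq (I s w)) + ennreal (2 * (?d T)) * e"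
    using ito_integralD(5)[OF ito s(1)] energy_measurable[OF j, of T] unfolding e_def by (simp add: nn_integral_add nn_integral_cmult)
   also have "(\<E> w. esq (I s w)) <= 6 + 4 * (\<E> w. energy s \<psi> w)"
    by (rule ito_at_second_moment[OF ito_integral_at[OF ito s(1)] s(1) fin[OF s(1)]])
   also have "... <= 6 + 4 * e" unfolding e_def by (intro add_left_mono mult_left_mono nn_integral_mono es) auto
   finally show ?thesis unfolding K_def by (simp add: add_right_mono mult_left_mono)
  qed
  have Nm: "N \<in> ?j" "integrable M (%w. (N w)^2)" "has_bochner_integral M N 1"
   using sexp_M[OF T] integrable.intros[OF sexp_square_mean[OF T]] sexp_mean[OF T, of 0 "- k"] by (auto simp: N_def)
  have "has_bochner_integral M (%w. N w * (?b T B w)) 0"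
   by (rule mean_zero_time_integral[OF Nm(1,2) Bj T Bmean B2 K, of _ R]) (use R in \<open>auto simp: abs_mult intro!: mult_left_le\<close>)
  from has_bochner_integral_add[OF has_bochner_integral_add[OF has_bochner_integral_mult_left[OF Nm(3), of x] has_bochner_integral_mult_left[OF Bmean[OF T order_refl], of "exp (- R * T)"]] this]
  have rhs: "has_bochner_integral M (%w. N w * x + N w * B T w * exp (- R * T) + N w * (?b T B w)) x" by simp
  have path: "AE w in M. 0 <= N w * x + N w * B T w * exp (- R * T) + N w * (?b T B w) \<and> (nnint {0..T} (?f N w))
   <= ennreal (?g N w B T)"
   using Gd(2) int eq pos AE_space
  proof eventually_elim
   case (elim w)
   have N0: "0 < N w" by (simp add: N_def sexp_pos)
   have Xc: "continuous_on {0..T} (%t. X t w)" using X elim(6) unfolding adapted_continuous_def by (auto intro: continuous_on_subset)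
   have Ac: "continuous_on {0..T} (%t. I t w + (LINT s:{0..t}|lborel. k \<bullet> \<psi> s w))"
    using continuous_on_subset[OF Bc[OF elim(6)], of "{0..T}"] elim(1) by (auto simp: B_def A_def)
   have disc: "set_integrable lborel {0..T} (%s. C s w)"
    "exp (- R * T) * X T w + (?c T w) = x + exp (- R * T) * B T w + (?b T B w)"
    using discounted_wealth[OF Xc Ac pint[OF elim(1) T], of R "%s. C s w" x, OF _ _ T] elim(1,2,3) T by (auto simp: B_def A_def)
   \<comment> \<open>Dropping the nonnegative wealth at T turns the budget identity into an
     inequality.\<close>
   have "0 <= exp (- R * T) * X T w" using elim(4) T by simp
   hence le: "N w * (?c T w) <= N w * x + N w * B T w * exp (- R * T) + N w * (?b T B w)"
    using disc(2) N0 mult_left_mono[of "LINT s:{0..T}|lborel. exp (- R * s) * C s w" "x + exp (- R * T) * B T w + (?b T B w)" "N w"]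
    by (simp add: distrib_left mult_ac)
   have "0 <= (?c T w)"
    unfolding set_lebesgue_integral_def using elim(5) by (intro integral_nonneg_AE) (auto elim!: eventually_mono simp: indicator_def)
   hence "0 <= N w * (?c T w)" using N0 by simp
   note 0 = order_trans[OF this le]
   have "set_integrable lborel {0..T} (%s. exp (- R * s) * C s w)" by (rule set_integrable_exp_mult[OF disc(1)])
   hence si: "integrable lborel (%s. indicator {0..T} s *\<^sub>R (exp (- R * s) * C s w))" unfolding set_integrable_def .
   have "nnint {0..T} (?f N w) = (\<L> s. ennreal (N w * (indicator {0..T} s *\<^sub>R (exp (- R * s) * C s w))))"
    by (intro nn_integral_cong) (auto simp: indicator_def mult_ac)
   also have "... = ennreal (LINT s|lborel. N w * (indicator {0..T} s *\<^sub>R (exp (- R * s) * C s w)))"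
    using elim(5) N0 by (intro nn_integral_eq_integral integrable_mult_right si) (auto elim!: eventually_mono simp: indicator_def)
   also have "... = ennreal (N w * (?c T w))" unfolding set_lebesgue_integral_def by simp
   also have "... <= ennreal (?g N w B T)" by (rule ennreal_leI[OF le])
   finally show ?case using 0 by (rule conjI[rotated])
  qed
  \<comment> \<open>Consumption weighted with the terminal N. Against anything known at s, N has the
    same mean as the exponential at s, so h and f have equal expectations at each time of the
    window.\<close>
  define h where "h = (%w s. ennreal (exp (- R * s)) * ((ennreal (C s w) * indicator {0..} s) * ennreal (N w)) * indicator {0..T} s)"
  have hm: "(%(w, s). h w s) \<in> ?a"
  proof -
   note [measurable] = fm' Nm(1)
   have "(%x. ennreal (exp (- R * snd x)) * ((case x of (w, t) => ennreal (C t w) * indicator {0..} t) * ennreal (N (fst x))) * indicator {0..T} (snd x)) \<in> ?a" by measurable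
   thus ?thesis by (simp add: h_def case_prod_beta)
  qed
  have "(\<E> w. (\<L> t. f w t * indicator {0..T} t)) = (\<L> t. (\<E> w. f w t * indicator {0..T} t))"
   by (rule PM.Fubini'[symmetric]) (use fm in \<open>simp add: case_prod_beta\<close>)
  also have "... = (\<L> t. (\<E> w. h w t))"
  proof (rule nn_integral_cong)
   fix t
   show "(\<E> w. f w t * indicator {0..T} t) = (\<E> w. h w t)"
   proof (cases "t \<in> {0..T}")
    case True
    hence t: "0 <= t" "t <= T" by auto
    have CF: "(%w. ennreal (exp (- R * t)) * ennreal (C t w)) \<in> borel_measurable (F t)"
     using predictable_adapted[OF C t(1)] by measurable
    have "f w t * indicator {0..T} t = ennreal (exp (- R * t)) * ennreal (C t w) * ennreal (sexp 0 (- k) t w)" for w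
     using True sexp_pos[of 0 "- k" t w] by (simp add: f_def ennreal_mult' ennreal_mult'' mult_ac less_imp_le)
    moreover have "h w t = ennreal (exp (- R * t)) * ennreal (C t w) * ennreal (sexp 0 (- k) T w)" for w
     using True by (simp add: h_def N_def mult_ac)
    ultimately show ?thesis using sexp_cond_nn[OF t CF, of "- k"] by simp
   qed (simp add: h_def)
  qed
  also have "... = (\<E> w. (\<L> t. h w t))" by (rule PM.Fubini'[OF hm])
  also have "... = (\<E> w. nnint {0..T} (?f N w))"
  proof (intro nn_integral_cong)
   fix w s
   have "0 < N w" by (simp add: N_def sexp_pos)
   thus "h w s = ennreal (exp (- R * s) * N w * C s w) * indicator {0..T} s"
    by (auto simp: h_def ennreal_mult' ennreal_mult'' mult_ac indicator_def less_imp_le)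
  qed
  also have "... <= (\<E> w. ennreal (?g N w B T))"
   by (rule nn_integral_mono_AE) (use path in \<open>auto elim: eventually_mono\<close>)
  also have "... = ennreal x" using rhs path by (subst nn_integral_eq_integral) (auto simp: has_bochner_integral_iff elim: eventually_mono)
  finally show ?thesis .
 qed
 have "(\<E> w. (\<L> t. f w t)) = (\<integral>\<^sup>+y. (case y of (w, t) => f w t) \<partial>?i)" using lborel.nn_integral_fst[OF fm] by simp
 also have "... = (\<integral>\<^sup>+y. (SUP n. (?e y f n)) \<partial>?i)"
 proof (intro nn_integral_cong)
  fix y :: "'w \<times> real"
  obtain w t where y: "y = (w, t)" by (cases y)
  obtain n where "t <= real n" using real_arch_simple by blast
  hence "f w t <= f w t * indicator {0..real n} t" by (auto simp: f_def indicator_def)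
  hence "f w t <= (SUP n. f w t * indicator {0..real n} t)" by (rule order_trans) (rule SUP_upper, simp)
  moreover have "(SUP n. f w t * indicator {0..real n} t) <= f w t" by (rule SUP_least) (auto simp: indicator_def)
  ultimately show "(case y of (w, t) => f w t) = (SUP n. (?e y f n))" by (simp add: y)
 qed
 also have "... = (SUP n. \<integral>\<^sup>+y. (?e y f n) \<partial>?i)"
  by (rule nn_integral_monotone_convergence_SUP) (use fm in \<open>auto simp: incseq_def le_fun_def indicator_def case_prod_beta\<close>)
 also have "... = (SUP n. \<E> w. (\<L> t. f w t * indicator {0..real n} t))"
  using fm by (subst lborel.nn_integral_fst[symmetric]) (auto simp: case_prod_beta)
 also have "... <= ennreal x" by (rule SUP_least) (rule bound, simp)
 finally show ?thesis by (simp add: f_def)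
qed

end

section \<open>Labour income and total wealth\<close>

context brownian
begin

lemma ito_process_linear:
 assumes 1: "ito_process M Z x a b X" and 2: "ito_process M Z x' a' b' X'"
 shows "ito_process M Z (p * x + q * x') (%t w. p * a t w + q * a' t w) (%t w. p *\<^sub>R b t w + q *\<^sub>R b' t w) (%t w. p * X t w + q * X' t w)"
proof -
 obtain I I' where I: "ito_integral M Z b I" "AE w in M. \<forall>t\<ge>0. X t w = x + (LINT s:{0..t}|lborel. a s w) + I t w"
  and I': "ito_integral M Z b' I'" "AE w in M. \<forall>t\<ge>0. X' t w = x' + (LINT s:{0..t}|lborel. a' s w) + I' t w"
  using 1 2 unfolding ito_process_def by blast
 have i: "AE w in M. \<forall>t\<ge>0. set_integrable lborel {0..t} (%s. a s w)" "AE w in M. \<forall>t\<ge>0. set_integrable lborel {0..t} (%s. a' s w)"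
  using 1 2 unfolding ito_process_def by auto
 have "AE w in M. \<forall>t\<ge>0. p * X t w + q * X' t w = (p * x + q * x') + (LINT s:{0..t}|lborel. p * a s w + q * a' s w) + (p * I t w + q * I' t w)"
  using i I(2) I'(2)
 proof eventually_elim
  case (elim w)
  have "(LINT s:{0..t}|lborel. p * a s w + q * a' s w) = p * (LINT s:{0..t}|lborel. a s w) + q * (LINT s:{0..t}|lborel. a' s w)" if "0 <= t" for t
   using elim(1,2) that by (subst set_integral_add(2)) auto
  thus ?case using elim(3,4) by (simp add: algebra_simps)
 qed
 moreover have "AE w in M. \<forall>t\<ge>0. set_integrable lborel {0..t} (%s. p * a s w + q * a' s w)"
  using i by eventually_elim (auto intro!: set_integral_add(1))
 ultimately show ?thesis
  using 1 2 ito_linear[OF I(1) I'(1), of p q] unfolding ito_process_def by (blast intro: adapted_continuous_linear)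
qed

lemma ito_process_sexp: "ito_process M Z x (%t w. x * sexp a v t w * a) (%t w. (x * sexp a v t w) *\<^sub>R v) (%t w. x * sexp a v t w)"
proof -
 have "set_integrable lborel {0..t} (%s. sexp a v s w * a)" if "w \<in> space M" for w t
  using adapted_continuous_integrable[OF sexp_adapted that order_refl] by simp
 hence "ito_process M Z 1 (%t w. sexp a v t w * a) (%t w. sexp a v t w *\<^sub>R v) (sexp a v)"
  unfolding ito_process_def using sexp_adapted ito_sexp[of a v]
  by (intro conjI AE_I2 allI impI exI[of _ "sexp_mart a v"]) (auto simp: sexp_mart_def mult.commute)
 from ito_process_linear[OF this this, of x 0] show ?thesis by (simp add: mult.assoc)
qed

lemma ito_integral_zero: "ito_integral M Z (%t w. 0) (%t w. 0)"
 using ito_linear[OF ito_sexp ito_sexp, of 0 0 0 0 0 0] by simp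

text \<open>The difference to the exponential solves the same equation from 0, so
  \<open>linear_SDE_L2\<close> makes its second moment vanish at every fixed time. Rational times
  and continuity give one null set for all times.\<close>

theorem linear_SDE_unique:
 assumes X: "ito_process M Z x (%t w. X t w * a) (%t w. X t w *\<^sub>R v) X"
 shows "AE w in M. \<forall>t\<ge>0. X t w = x * sexp a v t w"
proof -
 let ?a = "%t n. nat \<lceil>t * real (Suc n)\<rceil>"
 define E where "E = (%t w. X t w - x * sexp a v t w)"
 have E: "ito_process M Z 0 (%t w. E t w * a) (%t w. E t w *\<^sub>R v) E"
  using ito_process_linear[OF X ito_process_sexp[of x a v], of 1 "- 1"]
  by (simp add: E_def left_diff_distrib scaleR_diff_left)
 then obtain I where I: "ito_integral M Z (%t w. E t w *\<^sub>R v) I" "AE w in M. \<forall>t\<ge>0. E t w = 0 + (LINT s:{0..t}|lborel. E s w * a) + I t w"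
  and Ea: "adapted_continuous M F E" and Ei: "AE w in M. \<forall>t\<ge>0. set_integrable lborel {0..t} (%s. E s w * a)"
  unfolding ito_process_def by blast
 have "AE w in M. E t w = 0" if t: "0 <= t" for t
 proof -
  have "nnint {0..u} (%s. esq (E s w * a)) <= ennreal 0 + esq a * nnint {0..u} (%s. esq (E s w))" if w: "w \<in> space M" for w u
  proof -
   have "(%s. esq (norm (E s w)) * indicator {0..u} s) \<in> borel_measurable lborel"
    by (rule energy_integrand_measurable[OF predictable_jointly[OF adapted_continuous_predictable[OF Ea]] w])
   thus ?thesis by (subst nn_integral_cmult[symmetric]) (auto intro!: nn_integral_mono simp: power_mult_distrib ennreal_mult mult_ac)
  qed
  hence "(\<E> w. esq (E t w)) <= ennreal ((3 * 0^2 + 3 * t * 0) * exp ((3 * t * a^2 + 3 * (v \<bullet> v)) * t))"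
   by (intro linear_SDE_L2[OF Ea I(1) Ei I(2)] AE_I2 ballI) (use t in auto)
  hence "(\<E> w. esq (E t w)) = 0" by simp
  moreover have "E t \<in> borel_measurable M" using Ea t unfolding adapted_continuous_def by (auto intro: measurable_F_M)
  ultimately show ?thesis by (subst (asm) nn_integral_0_iff_AE) auto
 qed
 hence "AE w in M. \<forall>t\<in>{0..} \<inter> \<rat>. E t w = 0" by (subst AE_ball_countable) (auto simp: countable_rat)
 thus ?thesis using AE_space
 proof eventually_elim
  case (elim w)
  have c: "continuous_on {0..} (%t. E t w)" using Ea elim(2) unfolding adapted_continuous_def by auto
  have "E t w = 0" if t: "0 <= t" for t
  proof -
   define u where "u = (%n. real (?a t n) / real (Suc n))"
   have u: "u n \<in> {0..} \<inter> \<rat>" for n by (auto simp: u_def)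
   have "norm (u n - t) <= inverse (real (Suc n))" for n
   proof -
    have "real (?a t n) - t * real (Suc n) <= 1" "0 <= real (?a t n) - t * real (Suc n)"
     using t by (simp_all del: of_nat_Suc) linarith+
    moreover have "u n - t = (real (?a t n) - t * real (Suc n)) / real (Suc n)"
     by (simp add: u_def diff_divide_distrib del: of_nat_Suc)
    ultimately show ?thesis by (simp add: divide_inverse abs_mult mult_left_le_one_le del: of_nat_Suc)
   qed
   hence "(%n. u n - t) \<longlonglongrightarrow> 0" by (intro Lim_null_comparison[OF _ LIMSEQ_inverse_real_of_nat]) auto
   hence "u \<longlonglongrightarrow> t" by (rule LIM_zero_cancel)
   hence "(%n. E (u n) w) \<longlonglongrightarrow> E t w" using u t by (intro continuous_on_tendsto_compose[OF c]) auto
   moreover have "E (u n) w = 0" for n using elim(1) u by blast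
   ultimately show ?thesis by (simp add: LIMSEQ_const_iff)
  qed
  thus ?case by (simp add: E_def)
 qed
qed

end

locale income_model = brownian M Z + signed_delay \<phi> "delay p" "interest p + mortality p"
 for M :: "'w measure" and Z :: "real => 'w => real ^ 'n::finite" and p :: "'n market" and \<phi> :: "real set => real" +
 fixes x0 :: real and x1 :: "real => real" and y D :: "real => 'w => real"
 assumes x1: "x1 \<in> L2_window (delay p)"
  and y0: "\<And>w. w \<in> space M ==> y 0 w = x0" and past: "\<And>w s. w \<in> space M ==> - delay p <= s ==> s < 0 ==> y s w = x1 s"
  and D: "AE w in M. delay_term \<phi> (delay p) (%t. y t w) (%t. D t w)"
  and Y: "ito_process M Z x0 (%t w. income_drift p * y t w + D t w) (%t w. y t w *\<^sub>R income_vol p) y"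
  and vol: "invertible (vol p)" and gap: "0 < beta p - beta_inf p \<phi>"
begin

abbreviation rate :: real where "rate \<equiv> interest p + mortality p"
abbreviation mem :: "real => 'w => real" where "mem t w \<equiv> memory (%s. y s w) t"

lemma y_adapted: "adapted_continuous M F y" using Y unfolding ito_process_def by auto

lemma past_square: "nnint {- delay p..<0} (%s. esq (x1 s)) = ennreal (LINT s:{- delay p..<0}|lborel. (x1 s)^2)"
proof -
 have "integrable lborel (%s. indicator {- delay p..<0} s *\<^sub>R (x1 s)^2)" using x1 unfolding L2_window_def set_integrable_def by auto
 from nn_integral_eq_integral[OF this]
 have "(\<L> s. ennreal (indicator {- delay p..<0} s *\<^sub>R (x1 s)^2)) = ennreal (LINT s:{- delay p..<0}|lborel. (x1 s)^2)"
  unfolding set_lebesgue_integral_def by simp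
 thus ?thesis by (subst nn_integral_cong[of _ _ "%s. ennreal (indicator {- delay p..<0} s *\<^sub>R (x1 s)^2)"]) (auto simp: indicator_def)
qed

lemma past_measurable: "(%s. indicator {- delay p..<0} s * x1 s) \<in> borel_measurable borel"
 using x1 unfolding L2_window_def set_borel_measurable_def by simp

lemma y_path:
 assumes w: "w \<in> space M" and T: "0 <= T"
 shows "set_borel_measurable lborel {- delay p..T} (%s. y s w)"
  and "nnint {- delay p..T} (%s. esq (y s w)) = ennreal (LINT s:{- delay p..<0}|lborel. (x1 s)^2) + nnint {0..T} (%s. esq (y s w))"
  and "nnint {- delay p..T} (%s. esq (y s w)) < \<infinity>"
proof -
 let ?a = "%s. esq (y s w)"
 let ?b = "LINT s:{- delay p..<0}|lborel. (x1 s)^2"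
 let ?c = "%s. indicator {0..T} s *\<^sub>R y s w"
 let ?d = "%s. indicator {- delay p..<0} s * x1 s"
 let ?e = "nnint {- delay p..T} ?a"
 have c: "continuous_on {0..T} (%t. y t w)" using y_adapted w unfolding adapted_continuous_def by (auto intro: continuous_on_subset)
 have [measurable]: "(%s. indicator {0..T} s *\<^sub>R y s w) \<in> borel_measurable borel"
  by (rule borel_measurable_continuous_on_indicator[OF _ c]) simp
 note [measurable] = past_measurable
 have e: "indicator {- delay p..T} s *\<^sub>R y s w = indicator {- delay p..<0} s * x1 s + indicator {0..T} s *\<^sub>R y s w" for s
  using past[OF w, of s] T d by (auto simp: indicator_def)
 show m: "set_borel_measurable lborel {- delay p..T} (%s. y s w)" unfolding set_borel_measurable_def e by measurable
 have "?e = (\<L> s. esq (?d s) + esq (?c s))"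
  using past[OF w] T d by (intro nn_integral_cong) (auto simp: indicator_def)
 also have "... = (\<L> s. esq (?d s)) + (\<L> s. esq (?c s))"
  by (rule nn_integral_add) measurable
 also have "(\<L> s. esq (?d s)) = ennreal ?b"
  unfolding past_square[symmetric] by (intro nn_integral_cong) (auto simp: indicator_def)
 also have "(\<L> s. esq (?c s)) = nnint {0..T} ?a"
  by (intro nn_integral_cong) (auto simp: indicator_def)
 finally show eq: "?e = ennreal ?b + nnint {0..T} ?a" .
 obtain C where C: "\<forall>s\<in>{0..T}. \<bar>y s w\<bar> <= C"
  using compact_imp_bounded[OF compact_continuous_image[OF c compact_Icc]] unfolding bounded_iff by auto
 have "nnint {0..T} ?a <= ennreal (C^2 * T)"
  using energy_bound[of T y w C] C T unfolding energy_def by auto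
 thus "?e < \<infinity>" unfolding eq by (auto intro: order.strict_trans1 simp: less_top)
qed

lemma y_integrable: "w \<in> space M ==> 0 <= T ==> set_integrable lborel {- delay p..T} (%s. y s w)"
 by (rule set_integrable_of_square[OF y_path(1,3)])

text \<open>Times before 0 contribute the given past, later times the path frozen at t, so the
  integrand is jointly measurable with respect to \<open>F t\<close>.\<close>

lemma mem_adapted: "adapted_continuous M F mem"
 unfolding adapted_continuous_def
proof (intro conjI allI impI ballI)
 fix t :: real assume t: "0 <= t"
 have ym: "y (min s t) \<in> borel_measurable (F t)" if "0 <= s" for s
 proof (rule measurable_F_mono)
  show "y (min s t) \<in> borel_measurable (F (min s t))" using y_adapted t that unfolding adapted_continuous_def by simp
 qed simp
 have yc: "continuous_on {0..} (%s. y (min s t) w)" if "w \<in> space (F t)" for w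
 proof -
  have "continuous_on {0..} (%s. y s w)" using y_adapted that unfolding adapted_continuous_def by simp
  thus ?thesis by (rule continuous_on_compose2) (use t in \<open>auto intro!: continuous_intros\<close>)
 qed
 have "(%(w, s). indicator {0..} s * y (min s t) w) \<in> borel_measurable (F t \<Otimes>\<^sub>M lborel)"
  using jointly_measurable_continuous[of "%s. y (min s t)" "F t", OF ym yc] by (subst measurable_pair_swap_iff) simp
 have "(%x. (fst x, t + snd x)) \<in> measurable (F t \<Otimes>\<^sub>M lborel) (F t \<Otimes>\<^sub>M lborel)" by measurable
 note m [measurable] = measurable_compose[OF this \<open>(\<lambda>(w, s). indicator {0..} s * y (min s t) w) \<in> _\<close>]
 note [measurable] = past_measurable
 have "(%w. LINT s|lborel. indicator {- delay p..<0} s * (signed_kernel s *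
   ((case (fst (w, s), t + snd (w, s)) of (w, s) => indicator {0..} s * y (min s t) w) + indicator {- delay p..<0} (t + s) * x1 (t + s)))) \<in> borel_measurable (F t)"
  by measurable
 thus "mem t \<in> borel_measurable (F t)"
 proof (rule measurable_cong[THEN iffD1, rotated])
  fix w assume w: "w \<in> space (F t)"
  show "(LINT s|lborel. indicator {- delay p..<0} s * (signed_kernel s *
   ((case (fst (w, s), t + snd (w, s)) of (w, s) => indicator {0..} s * y (min s t) w) + indicator {- delay p..<0} (t + s) * x1 (t + s)))) = mem t w"
   unfolding memory_def set_lebesgue_integral_def
   by (intro Bochner_Integration.integral_cong) (use past[of w] w t in \<open>auto simp: indicator_def\<close>)
 qed
next
 fix w assume "w \<in> space M"
 thus "continuous_on {0..} (%t. mem t w)" by (intro continuous_on_memory y_integrable)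
qed

definition past_memory :: real where
 "past_memory = (LINT s:{- delay p..<0}|lborel. signed_kernel s * x1 s)"

lemma mem_0: "w \<in> space M ==> mem 0 w = past_memory"
 unfolding memory_def past_memory_def by (intro set_lebesgue_integral_cong) (auto simp: past)

text \<open>Path by path this is \<open>delay_term_identity\<close>. The memory has no martingale
  part, and D occurs in its drift with the sign that cancels it in the income equation.\<close>

lemma mem_process: "ito_process M Z past_memory (%t w. rate * mem t w + mass * y t w - D t w) (%t w. 0) mem"
proof -
 let ?a = "%t w. set_integrable lborel {0..t} (%s. rate * mem s w + mass * y s w - D s w)"
 let ?b = "%t w. past_memory + (LINT s:{0..t}|lborel. rate * mem s w + mass * y s w - D s w)"
 have "AE w in M. \<forall>t\<ge>0. ?a t w \<and>
  mem t w = ?b t w"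
  using D AE_space
 proof eventually_elim
  case (elim w)
  show ?case
  proof (intro allI impI)
   fix t :: real assume t: "0 <= t"
   \<comment> \<open>The identity asks for a positive horizon; t + 1 covers t = 0 as well.\<close>
   have t1: "0 <= t + 1" "0 < t + 1" "t <= t + 1" using t by auto
   note i = delay_term_identity[OF y_path(1,3)[OF elim(2) t1(1)] elim(1) t1(2) t t1(3)]
   show "?a t w \<and>
    mem t w = ?b t w"
    using i(1,2) mem_0[OF elim(2)] by auto
  qed
 qed
 thus ?thesis unfolding ito_process_def using mem_adapted ito_integral_zero by (auto intro!: exI[of _ "%t w. 0"] elim: eventually_mono)
qed

text \<open>The L2 bound of the delay term controls the drift by the energy of the path up to the
  present, the given past entering through the constant c0. The result makes the income part of the
  volatility of total wealth have finite expected energy.\<close>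

lemma y_second_moment:
 "\<exists>K\<ge>0. \<forall>t\<in>{0..T}. (\<E> w. esq (y t w)) <= ennreal K"
proof -
 let ?a = "%c0 c1 v. (3 * x0^2 + 3 * T * c0) * exp ((3 * T * c1 + 3 * (v \<bullet> v)) * T)"
 let ?b = "2 * (income_drift p)^2"
 let ?c = "%s w. income_drift p * y s w + D s w"
 let ?d = "borel_measurable lborel"
 obtain I where I: "ito_integral M Z (%t w. y t w *\<^sub>R income_vol p) I"
  "AE w in M. \<forall>t\<ge>0. y t w = x0 + (LINT s:{0..t}|lborel. income_drift p * y s w + D s w) + I t w"
  and i: "AE w in M. \<forall>t\<ge>0. set_integrable lborel {0..t} (%s. income_drift p * y s w + D s w)"
  using Y unfolding ito_process_def by blast
 define q where "q = (LINT s:{- delay p..<0}|lborel. (x1 s)^2)"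
 define c where "c = delay_const \<phi>"
 define c0 c1 where "c0 = 2 * (c * q)" and "c1 = 2 * (income_drift p)^2 + 2 * c"
 have q: "0 <= q" unfolding q_def set_lebesgue_integral_def by (intro integral_nonneg_AE) auto
 have c: "0 <= c" by (simp add: c_def delay_const_def)
 have bd: "AE w in M. \<forall>t\<in>{0..T}. nnint {0..t} (%s. esq (?c s w)) <= ennreal c0 + ennreal c1 * nnint {0..t} (%s. esq (y s w))"
  using D AE_space
 proof eventually_elim
  case (elim w)
  show ?case
  proof
   fix t assume "t \<in> {0..T}"
   hence t: "0 <= t" "0 <= t + 1" "0 < t + 1" "t <= t + 1" by auto
   note i = delay_term_identity(3,4)[OF y_path(1,3)[OF elim(2) t(2)] elim(1) t(3) t(1) t(4)]
   have m: "(%s. esq (D s w) * indicator {0..t} s) \<in> ?d"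
   proof -
    note [measurable] = i(2)
    have "(%s. esq (indicator {0..t} s *\<^sub>R D s w) * indicator {0..t} s) \<in> ?d" by measurable
    thus ?thesis by (rule measurable_cong[THEN iffD1, rotated]) (auto simp: indicator_def)
   qed
   have my: "(%s. esq (y s w) * indicator {0..t} s) \<in> ?d"
    using energy_integrand_measurable[OF predictable_jointly[OF adapted_continuous_predictable[OF y_adapted]] elim(2), of t] by simp
   define Q where "Q = nnint {0..t} (%s. esq (y s w))"
   have "nnint {0..t} (%s. esq (?c s w))
    <= (\<L> s. ennreal ?b * (esq (y s w) * indicator {0..t} s) + 2 * (esq (D s w) * indicator {0..t} s))"
   proof (rule nn_integral_mono)
    fix s
    have "(?c s w)^2 <= 2 * (income_drift p)^2 * (y s w)^2 + 2 * (D s w)^2"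
     using sq_norm_add_le[of "income_drift p * y s w" "D s w"] by (simp add: power_mult_distrib)
    from ennreal_leI[OF this]
    show "esq (?c s w) * indicator {0..t} s
     <= ennreal ?b * (esq (y s w) * indicator {0..t} s) + 2 * (esq (D s w) * indicator {0..t} s)"
     by (auto simp: indicator_def ennreal_plus ennreal_mult)
   qed
   also have "... = ennreal ?b * Q + 2 * nnint {0..t} (%s. esq (D s w))"
    using m my by (simp add: nn_integral_add nn_integral_cmult Q_def)
   also have "... <= ennreal ?b * Q + 2 * (ennreal c * (ennreal q + Q))"
    using i(1) y_path(2)[OF elim(2) t(1)] unfolding c_def q_def Q_def by (intro add_left_mono mult_left_mono) auto
   also have "... = ennreal c0 + ennreal c1 * Q"
    using c q by (simp add: c0_def c1_def ennreal_plus ennreal_mult distrib_left distrib_right mult.assoc add_ac)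
   finally show "nnint {0..t} (%s. esq (?c s w)) <= ennreal c0 + ennreal c1 * nnint {0..t} (%s. esq (y s w))"
    unfolding Q_def .
  qed
 qed
 have c01: "0 <= c0" "0 <= c1" using c q by (auto simp: c0_def c1_def)
 define v where "v = income_vol p"
 have "(\<E> w. esq (y t w)) <= ennreal (?a c0 c1 v)" if t: "t \<in> {0..T}" for t
 proof -
  have "(\<E> w. esq (y t w)) <= ennreal ((3 * x0^2 + 3 * T * c0) * exp ((3 * T * c1 + 3 * (v \<bullet> v)) * t))"
   unfolding v_def using t by (intro linear_SDE_L2[OF y_adapted I(1) i I(2) bd c01]) auto
  also have "... <= ennreal (?a c0 c1 v)"
   using t c01 by (intro ennreal_leI mult_left_mono) (auto intro!: mult_left_mono)
  finally show ?thesis .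
 qed
 moreover have "0 <= max 0 (?a c0 c1 v)" by simp
 ultimately show ?thesis by (intro exI[of _ "max 0 (?a c0 c1 v)"]) (auto intro: order_trans[OF _ ennreal_leI])
qed

lemma mass_eq: "mass = beta_inf p \<phi>" by (simp add: mass_def beta_inf_def)

lemma h_inf_eq: "h_inf p \<phi> s = g_inf p \<phi> * signed_kernel s" by (simp add: h_inf_def signed_kernel_def)

lemma total_wealth_eq: "total_wealth p \<phi> y W t w = W t w + g_inf p \<phi> * (y t w + mem t w)"
 by (simp add: total_wealth_def G_def memory_def distrib_left h_inf_eq mult.assoc)

lemma G_eq: "G p \<phi> w x0 x1 = w + g_inf p \<phi> * (x0 + past_memory)"
 by (simp add: G_def past_memory_def distrib_left h_inf_eq mult.assoc)

lemma human_capital_process: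
 "ito_process M Z (x0 + past_memory) (%t w. (rate + mass) * y t w + (income_drift p - rate) * y t w + rate * mem t w) (%t w. y t w *\<^sub>R income_vol p) (%t w. y t w + mem t w)"
 using ito_process_linear[OF Y mem_process, of 1 1] by (simp add: algebra_simps)

text \<open>The equation \<open>g_inf p \<phi> * (beta p - beta_inf p \<phi>) = 1\<close>
  rearranged. The term -1 absorbs the income that flows into the wealth equation.\<close>

lemma g_gap: "g_inf p \<phi> * (mass + income_drift p - rate) = g_inf p \<phi> * (income_vol p \<bullet> kappa p) - 1"
proof -
 have "g_inf p \<phi> * (beta p - beta_inf p \<phi>) = 1" using gap by (simp add: g_inf_def)
 thus ?thesis by (simp add: mass_eq beta_def algebra_simps)
qed

lemma matrix_inv_mult: "invertible A ==> A ** matrix_inv A = mat 1 \<and> matrix_inv A ** A = mat 1" for A :: "real ^ 'm ^ 'm"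
 unfolding invertible_def matrix_inv_def by (rule someI_ex)

lemma vol_kappa: "(transpose (vol p) *v u) \<bullet> kappa p = u \<bullet> excess_return p"
proof -
 have "vol p *v kappa p = (vol p ** matrix_inv (vol p)) *v excess_return p" by (simp add: kappa_def matrix_vector_mul_assoc)
 also have "... = excess_return p" using matrix_inv_mult[OF vol] by simp
 finally show ?thesis by (metis dot_lmul_matrix transpose_matrix_vector)
qed

text \<open>The coefficients of \<open>y\<close> combine by the choice of \<open>g_inf\<close>.\<close>

lemma total_wealth_process:
 assumes W: "wealth M Z p w0 y (c, B, \<theta>) W"
 shows "ito_process M Z (G p \<phi> w0 x0 x1)
  (%t w. rate * total_wealth p \<phi> y W t w - (c t w + mortality p * B t w) + kappa p \<bullet> (transpose (vol p) *v \<theta> t w + (g_inf p \<phi> * y t w) *\<^sub>R income_vol p))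
  (%t w. transpose (vol p) *v \<theta> t w + (g_inf p \<phi> * y t w) *\<^sub>R income_vol p) (total_wealth p \<phi> y W)"
proof -
 let ?a = "income_drift p - rate"
 define g where "g = g_inf p \<phi>"
 have drift: "1 * (rate * W t w + \<theta> t w \<bullet> excess_return p + y t w - c t w - mortality p * B t w)
   + g * ((rate + mass) * y t w + ?a * y t w + rate * mem t w)
  = rate * (W t w + g * (y t w + mem t w)) - (c t w + mortality p * B t w) + kappa p \<bullet> (transpose (vol p) *v \<theta> t w + (g * y t w) *\<^sub>R income_vol p)" for t w
 proof -
  have "g * ((rate + mass) * y t w + ?a * y t w) = g * (mass + income_drift p - rate) * y t w + rate * (g * y t w)"
   by (simp add: algebra_simps)
  also have "g * (mass + income_drift p - rate) = g * (income_vol p \<bullet> kappa p) - 1" unfolding g_def by (rule g_gap)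
  finally have "g * ((rate + mass) * y t w + ?a * y t w) + y t w = g * y t w * (income_vol p \<bullet> kappa p) + rate * (g * y t w)"
   by (simp add: algebra_simps)
  thus ?thesis
   unfolding inner_add_right inner_commute[of "kappa p" "transpose (vol p) *v \<theta> t w"] vol_kappa
   by (simp add: distrib_left left_diff_distrib inner_commute[of "income_vol p"] mult_ac)
 qed
 have tw: "total_wealth p \<phi> y W = (%t w. 1 * W t w + g * (y t w + mem t w))" by (intro ext) (simp add: total_wealth_eq g_def)
 show ?thesis
  using ito_process_linear[OF W[unfolded wealth.simps] human_capital_process, of 1 g]
  unfolding drift by (simp add: tw G_eq g_def)
qed

end

section \<open>Verification\<close>

text \<open>Concavity on the open half-line puts the utility below its tangent at a. The boundary
  point z = 0, where utility is finite for \<gamma> < 1, is compared directly.\<close>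

lemma crra_tangent:
 fixes a z \<gamma> :: real
 assumes \<gamma>: "0 < \<gamma>" "\<gamma> ~= 1" and a: "0 < a" and z: "0 < z \<or> z = 0 \<and> \<gamma> < 1"
 shows "z powr (1 - \<gamma>) / (1 - \<gamma>) <= a powr (1 - \<gamma>) / (1 - \<gamma>) + a powr (- \<gamma>) * (z - a)"
proof (cases "z = 0")
 case True
 have "a powr (- \<gamma>) * a = a powr (1 - \<gamma>)" using a powr_add[of a "- \<gamma>" 1] by simp
 moreover have "a powr (1 - \<gamma>) * 1 <= a powr (1 - \<gamma>) * (1 / (1 - \<gamma>))" using True z \<gamma> by (intro mult_left_mono) (auto simp: divide_simps)
 ultimately show ?thesis using True by simp
next
 case False
 define f where "f = (%x::real. - (x powr (1 - \<gamma>) / (1 - \<gamma>)))"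
 have d1: "(f has_real_derivative - (x powr (- \<gamma>))) (at x)" if "x \<in> {0<..}" for x
  unfolding f_def using that \<gamma> by (auto intro!: derivative_eq_intros)
 have d2: "((%x. - (x powr (- \<gamma>))) has_real_derivative \<gamma> * x powr (- \<gamma> - 1)) (at x)" if "x \<in> {0<..}" for x
  using that by (auto intro!: derivative_eq_intros)
 have "convex_on {0<..} f" by (rule f''_ge0_imp_convex[OF _ d1 d2]) (use \<gamma> in auto)
 from convex_on_imp_above_tangent[OF this _ _ _ has_field_derivative_at_within[OF d1], of a z] a z False
 have "- (a powr (- \<gamma>)) * (z - a) <= f z - f a" by (auto simp: interior_open)
 thus ?thesis by (simp add: f_def)
qed

lemma crra_real: "x ~= 0 \<or> \<gamma> <= 1 ==> crra \<gamma> x = ereal (x powr (1 - \<gamma>) / (1 - \<gamma>))"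
 by (auto simp: crra_def)

lemma crra_nonneg: "\<gamma> < 1 ==> 0 <= crra \<gamma> x"
 by (simp add: crra_def)

lemma crra_nonpos: "1 < \<gamma> ==> crra \<gamma> x <= 0"
 by (simp add: crra_def divide_le_0_iff)

lemma borel_measurable_crra [measurable]: "crra \<gamma> \<in> borel_measurable borel"
 unfolding crra_def[abs_def] by measurable

section \<open>Integrals over outcomes and time, and the integrability of controls\<close>

context brownian
begin

abbreviation life :: "(real => 'w => ennreal) => ennreal" where
 "life f \<equiv> \<E> w. (\<L> t. f t w * indicator {0..} t)"

lemma jointly_swap:
 assumes "jointly H" shows "(%(w, t). indicator {0..} t *\<^sub>R H t w) \<in> borel_measurable (M \<Otimes>\<^sub>M lborel)"
 using assms unfolding jointly_def by (subst measurable_pair_swap_iff) simp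

lemma AE_swap:
 assumes "AE (t, w) in lborel \<Otimes>\<^sub>M M. P t w" shows "AE w in M. AE t in lborel. P t w"
proof -
 interpret LM: pair_sigma_finite lborel M ..
 interpret QM: pair_sigma_finite M lborel ..
 have "AE x in distr (M \<Otimes>\<^sub>M lborel) (lborel \<Otimes>\<^sub>M M) (%(x, y). (y, x)). case x of (t, w) => P t w"
  by (rule LM.distr_pair_swap[THEN subst, of "%m. AE x in m. case x of (t, w) => P t w", OF assms])
 from AE_distrD[OF measurable_pair_swap' this] have "AE x in M \<Otimes>\<^sub>M lborel. P (snd x) (fst x)" by (simp add: case_prod_beta)
 from QM.AE_pair[OF this] show ?thesis by simp
qed

text \<open>Translates the condition of \<open>controls\<close> on the product space into a finite
  expected energy.\<close>

lemma energy_finite_iff: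
 fixes H :: "real => 'w => 'b::{second_countable_topology, real_normed_vector}"
 assumes H: "jointly H"
 shows "set_integrable (lborel \<Otimes>\<^sub>M M) ({0..T} \<times> space M) (%(t, w). (norm (H t w))^2) \<longleftrightarrow> (\<E> w. energy T H w) < \<infinity>"
proof -
 let ?a = "lborel \<Otimes>\<^sub>M M"
 interpret PM: pair_sigma_finite lborel M ..
 define f where "f = (%x. indicator ({0..T} \<times> space M) x *\<^sub>R (case x of (t, w) => (norm (H t w))^2))"
 have m: "f \<in> borel_measurable ?a"
 proof -
  note [measurable] = H[unfolded jointly_def]
  have "(%x. indicator {0..T} (fst x) * (norm (case x of (t, w) => indicator {0..} t *\<^sub>R H t w))^2) \<in> borel_measurable ?a" by measurable
  thus ?thesis by (rule measurable_cong[THEN iffD1, rotated]) (auto simp: f_def indicator_def space_pair_measure)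
 qed
 have "(\<integral>\<^sup>+x. ennreal (norm (f x)) \<partial>?a) = (\<E> w. \<L> t. ennreal (norm (f (t, w))))"
  by (subst PM.nn_integral_snd[symmetric]) (use m in measurable)
 also have "... = (\<E> w. energy T H w)"
  unfolding energy_def by (intro nn_integral_cong) (auto simp: f_def indicator_def)
 finally show ?thesis unfolding set_integrable_def f_def[symmetric] integrable_iff_bounded using m by simp
qed

lemma L1_of_energy:
 fixes c :: "real => 'w => real"
 assumes c: "jointly c" and fin: "(\<E> w. energy T c w) < \<infinity>"
 shows "set_integrable (lborel \<Otimes>\<^sub>M M) ({0..T} \<times> space M) (%(t, w). c t w)"
proof -
 let ?a = "{0..T} \<times> space M"
 let ?b = "lborel \<Otimes>\<^sub>M M"
 interpret PM: pair_sigma_finite lborel M ..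
 have 2: "integrable ?b (%x. indicator ?a x *\<^sub>R (case x of (t, w) => (norm (c t w))^2))"
  using energy_finite_iff[OF c, of T] fin unfolding set_integrable_def by simp
 have 1: "integrable ?b (indicator ?a :: _ => real)"
  by (intro integrable_real_indicator) (auto simp: emeasure_pair_measure_Times emeasure_space_1 emeasure_lborel_Icc_eq)
 have m: "(%x. indicator ?a x *\<^sub>R (case x of (t, w) => c t w)) \<in> borel_measurable ?b"
 proof -
  note [measurable] = c[unfolded jointly_def]
  have "(%x. indicator {0..T} (fst x) * (case x of (t, w) => indicator {0..} t *\<^sub>R c t w)) \<in> borel_measurable ?b" by measurable
  thus ?thesis by (rule measurable_cong[THEN iffD1, rotated]) (auto simp: indicator_def space_pair_measure)
 qed
 show ?thesis unfolding set_integrable_def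
 proof (rule Bochner_Integration.integrable_bound[OF Bochner_Integration.integrable_add[OF 1 2] m], rule AE_I2)
  fix x :: "real \<times> 'w"
  have "\<bar>r\<bar> <= 1 + r^2" for r :: real using sum_squares_bound[of 1 "\<bar>r\<bar>"] abs_ge_zero[of r] by (simp only: power2_abs one_power2)
  thus "norm (indicator ?a x *\<^sub>R (case x of (t, w) => c t w))
   <= norm (indicator ?a x + indicator ?a x *\<^sub>R (case x of (t, w) => (norm (c t w))^2))"
   by (cases x) (auto simp: indicator_def)
 qed
qed

lemma energy_finite_of_moment:
 fixes X :: "real => 'w => real"
 assumes X: "jointly X" and K: "\<And>t. t \<in> {0..T} ==> (\<E> w. esq (X t w)) <= ennreal K"
 shows "(\<E> w. energy T X w) < \<infinity>"
proof -
 let ?a = "borel_measurable (M \<Otimes>\<^sub>M lborel)"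
 interpret PM: pair_sigma_finite M lborel ..
 have m: "(%(w, t). esq (norm (X t w)) * indicator {0..T} t) \<in> ?a"
 proof -
  note [measurable] = jointly_swap[OF X]
  have "(%x. esq (norm (case x of (w, t) => indicator {0..} t *\<^sub>R X t w)) * indicator {0..T} (snd x)) \<in> ?a" by measurable
  thus ?thesis by (rule measurable_cong[THEN iffD1, rotated]) (auto simp: indicator_def)
 qed
 have "(\<E> w. energy T X w) = (\<L> t. (\<E> w. esq (norm (X t w)) * indicator {0..T} t))"
  unfolding energy_def by (rule PM.Fubini'[OF m, symmetric])
 also have "... <= (\<L> t. ennreal K * indicator {0..T} t)"
 proof (rule nn_integral_mono)
  fix t show "(\<E> w. esq (norm (X t w)) * indicator {0..T} t) <= ennreal K * indicator {0..T} t"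
   using K[of t] by (cases "t \<in> {0..T}") auto
 qed
 also have "... < \<infinity>" by (subst nn_integral_cmult_indicator) (auto simp: ennreal_mult_less_top emeasure_lborel_Icc_eq)
 finally show ?thesis .
qed

lemma energy_linear_image:
 fixes H :: "real => 'w => 'b::{second_countable_topology, real_normed_vector}"
 assumes H: "jointly H" and K: "\<And>t w. norm (H' t w) <= c * norm (H t w)" and fin: "(\<E> w. energy T H w) < \<infinity>"
 shows "(\<E> w. energy T H' w) < \<infinity>"
proof -
 have "(\<E> w. energy T H' w) <= (\<E> w. esq c * energy T H w)"
 proof (rule nn_integral_mono)
  fix w assume w: "w \<in> space M"
  have "energy T H' w <= (\<L> s. esq c * (esq (norm (H s w)) * indicator {0..T} s))"
   unfolding energy_def using power_mono[OF K norm_ge_zero, of _ _ 2]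
   by (intro nn_integral_mono) (auto simp: indicator_def ennreal_mult[symmetric] power_mult_distrib intro!: ennreal_leI)
  also have "... = esq c * energy T H w" unfolding energy_def by (rule nn_integral_cmult[OF energy_integrand_measurable[OF H w]])
  finally show "energy T H' w <= esq c * energy T H w" .
 qed
 also have "... = esq c * (\<E> w. energy T H w)" by (rule nn_integral_cmult[OF energy_measurable[OF H]])
 also have "... < \<infinity>" using fin by (simp add: ennreal_mult_less_top)
 finally show ?thesis .
qed

lemma energy_finite_add:
 fixes H H' :: "real => 'w => 'b::{second_countable_topology, real_normed_vector}"
 assumes H: "jointly H" "jointly H'" and fin: "(\<E> w. energy T H w) < \<infinity>" "(\<E> w. energy T H' w) < \<infinity>"
 shows "(\<E> w. energy T (%t w. H t w + H' t w) w) < \<infinity>"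
proof -
 have "(\<E> w. energy T (%t w. H t w + H' t w) w) <= (\<E> w. 2 * energy T H w + 2 * energy T H' w)"
  using energy_add_le[OF H, of _ T 1 1] by (intro nn_integral_mono) simp
 also have "... = 2 * (\<E> w. energy T H w) + 2 * (\<E> w. energy T H' w)"
  using energy_measurable[OF H(1)] energy_measurable[OF H(2)] by (simp add: nn_integral_add nn_integral_cmult)
 also have "... < \<infinity>" using fin by (simp add: ennreal_mult_less_top)
 finally show ?thesis .
qed

abbreviation life_measurable :: "(real => 'w => ennreal) => bool" where
 "life_measurable f \<equiv> (%(w, t). f t w * indicator {0..} t) \<in> borel_measurable (M \<Otimes>\<^sub>M lborel)"

lemma life_measurable_add: "life_measurable f ==> life_measurable h ==> life_measurable (%t w. f t w + h t w)"
 by (simp add: distrib_right case_prod_beta)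

lemma life_section: "life_measurable f ==> w \<in> space M ==> (%t. f t w * indicator {0..} t) \<in> borel_measurable lborel"
 using measurable_compose[OF measurable_Pair1'[of w M lborel]] by fastforce

lemma life_add:
 assumes "life_measurable f" "life_measurable h"
 shows "life (%t w. f t w + h t w) = life f + life h"
proof -
 have "life (%t w. f t w + h t w) = (\<E> w. (\<L> t. f t w * indicator {0..} t) + (\<L> t. h t w * indicator {0..} t))"
  unfolding distrib_right by (intro nn_integral_cong nn_integral_add life_section assms)
 also have "... = life f + life h"
  using assms[THEN lborel.borel_measurable_nn_integral_fst] by (intro nn_integral_add) auto
 finally show ?thesis .
qed

lemma life_cmult:
 assumes "life_measurable f" shows "life (%t w. a * f t w) = a * life f"
proof -
 have "life (%t w. a * f t w) = (\<E> w. a * (\<L> t. f t w * indicator {0..} t))"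
  unfolding mult.assoc by (intro nn_integral_cong nn_integral_cmult life_section assms)
 also have "... = a * life f"
  using assms[THEN lborel.borel_measurable_nn_integral_fst] by (intro nn_integral_cmult) auto
 finally show ?thesis .
qed

lemma life_mono: "AE w in M. AE t in lborel. 0 <= t \<longrightarrow> f t w <= h t w ==> life f <= life h"
 by (intro nn_integral_mono_AE) (auto elim!: eventually_mono intro!: nn_integral_mono_AE simp: indicator_def)

lemma life_cong: "AE w in M. \<forall>t\<ge>0. f t w = h t w ==> life f = life h"
 by (intro nn_integral_cong_AE) (auto elim!: eventually_mono intro!: nn_integral_cong simp: indicator_def)

end

locale investment_model = income_model M Z p \<phi> x0 x1 y D
 for M :: "'w measure" and Z :: "real => 'w => real ^ 'n::finite" and p \<phi> x0 x1 y D +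
 assumes interest: "0 < interest p" and mortality: "0 < mortality p" and bequest: "0 < bequest p"
  and aversion: "0 < aversion p" "aversion p ~= 1"
  and patience: "0 < discount p + mortality p - (1 - aversion p) * (rate + kappa p \<bullet> kappa p / (2 * aversion p))"
begin

abbreviation "risk \<equiv> aversion p"
abbreviation "f \<equiv> f_inf p"
abbreviation "share \<equiv> 1 + mortality p * bequest p powr (- b_exp p)"
text \<open>Drift rate of optimal total wealth, \<open>expo\<close> being its volatility: the
  candidate is the initial total wealth times \<open>sexp alph expo\<close>.\<close>

definition alph :: real where "alph = rate + kappa p \<bullet> kappa p / risk - inverse f * share"
abbreviation "expo \<equiv> (1 / risk) *\<^sub>R kappa p"
definition deflator :: "real => 'w => real" where
 "deflator t w = exp (- rate * t) * sexp 0 (- kappa p) t w"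
abbreviation util :: "real => real" where "util z \<equiv> z powr (1 - risk) / (1 - risk)"

lemma deflator_pos: "0 < deflator t w" by (simp add: deflator_def sexp_pos)

lemma nu_pos: "0 < nu p" using patience aversion by (simp add: nu_def)
lemma share_pos: "0 < share" using mortality bequest by (simp add: add_pos_nonneg)
lemma f_pos: "0 < f" using nu_pos share_pos by (simp add: f_inf_def)
lemma f_nu: "inverse f * share = 1 / nu p" using nu_pos share_pos by (simp add: f_inf_def divide_simps)

lemma nu_eq: "risk / nu p = discount p + mortality p - (1 - risk) * (rate + kappa p \<bullet> kappa p / (2 * risk))"
 using aversion by (simp add: nu_def)

lemma bequest_powr: "bequest p * (bequest p powr (- b_exp p)) = bequest p powr (1 / risk)"
 using powr_add[of "bequest p" 1 "- b_exp p"] bequest by (simp add: b_exp_def)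

text \<open>With the bequest scaled to k B = k^(1/\<gamma>) z, a unit of money spent on bequest and
  a unit spent on consumption z have equal marginal utility. This is the origin of the ratio
  \<open>bequest p powr (- b_exp p)\<close> between the two optimal controls.\<close>

lemma bequest_marginal: "bequest p * (bequest p powr (1 / risk) * z) powr (- risk) = z powr (- risk)" if "0 <= z"
 using that bequest aversion by (simp add: powr_mult powr_powr powr_minus)

lemma bequest_util: "util (bequest p powr (1 / risk) * z) = bequest p powr (- b_exp p) * util z" if "0 <= z"
proof -
 have "(1 / risk) * (1 - risk) = - b_exp p" using aversion by (simp add: b_exp_def field_simps)
 thus ?thesis using that bequest by (simp add: powr_mult powr_powr)
qed

text \<open>The first-order condition. The powers of f and of G0 factor out, and the remaining
  exponentials agree because of the value of \<open>nu\<close>.\<close>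

lemma marginal_deflator:
 assumes w: "w \<notin> bad" and G: "0 < G0"
 shows "exp (- (discount p + mortality p) * t) * (inverse f * (G0 * sexp alph expo t w)) powr (- risk)
  = f powr risk * G0 powr (- risk) * deflator t w"
proof -
 let ?a = "%z q. alph * t + z / risk - q / risk^2 * t / 2"
 let ?b = "discount p + mortality p"
 define q where "q = kappa p \<bullet> kappa p"
 define z where "z = kappa p \<bullet> Z t w"
 have e: "(expo \<bullet> expo) = q / risk^2" by (simp add: q_def power2_eq_square)
 have s: "sexp alph expo t w = exp (?a z q)"
  using w unfolding sexp_def doleans_exponential_def e by (simp add: z_def)
 have "(inverse f * (G0 * sexp alph expo t w)) powr (- risk) = f powr risk * G0 powr (- risk) * exp (- risk * (?a z q))"
  using f_pos G unfolding s by (simp add: powr_mult inverse_powr powr_minus exp_powr_real exp_minus)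
 moreover have "deflator t w = exp (- rate * t + (- z - q * t / 2))"
  using w by (simp add: deflator_def sexp_def doleans_exponential_def z_def q_def exp_add[symmetric])
 \<comment> \<open>By \<open>nu_eq\<close>, risk * alph = rate + q / 2 + q / (2 * risk) - ?b. The
   Ito correction of the wealth exponential cancels q / (2 * risk), and what is left is the exponent
   of the deflator.\<close>
 moreover have "- ?b * t + - risk * (?a z q) = - rate * t + (- z - q * t / 2)"
 proof -
  have "risk * alph = risk * rate + q - risk / nu p" unfolding alph_def f_nu using aversion by (simp add: q_def algebra_simps)
  hence "risk * alph = risk * rate + q - ?b + (1 - risk) * (rate + q / (2 * risk))" unfolding nu_eq q_def by simp
  hence "risk * alph = rate + q / 2 + q / (2 * risk) - ?b"
   using aversion by (simp add: field_simps)
  hence "risk * alph * t = (rate + q / 2 + q / (2 * risk) - ?b) * t" by simp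
  moreover have "risk * (?a z q) = risk * alph * t + z - q / (2 * risk) * t"
   using aversion by (simp add: field_simps power2_eq_square)
  ultimately show ?thesis by (simp add: algebra_simps)
 qed
 ultimately show ?thesis by (simp add: exp_add[symmetric] mult_ac)
qed

text \<open>The product is again an exponential, with volatility \<open>expo - kappa p\<close> and
  drift - 1 / nu. Its mean decays like exp (- t / nu), which integrates to nu.\<close>

lemma deflated_wealth_value:
 assumes G: "0 <= G0"
 shows "life (%t w. ennreal (deflator t w * (G0 * sexp alph expo t w))) = ennreal (G0 * nu p)"
proof -
 let ?a = "expo - kappa p"
 let ?b = "borel_measurable (M \<Otimes>\<^sub>M lborel)"
 interpret PM: pair_sigma_finite M lborel ..
 define A where "A = alph - rate - kappa p \<bullet> kappa p / risk"
 have A: "A = - (1 / nu p)" unfolding A_def alph_def f_nu by simp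
 have prod: "deflator t w * (G0 * sexp alph expo t w) = G0 * sexp A ?a t w" if "w \<notin> bad" for t w
 proof -
  have "?a \<bullet> ?a = expo \<bullet> expo + kappa p \<bullet> kappa p - 2 * (kappa p \<bullet> kappa p) / risk"
   by (simp add: inner_diff_left inner_diff_right diff_divide_distrib)
  thus ?thesis using that
   by (simp add: deflator_def sexp_def doleans_exponential_def exp_add[symmetric] A_def inner_diff_left) (simp add: field_simps)
 qed
 have m: "(%(w, t). ennreal (G0 * sexp A ?a t w) * indicator {0..} t) \<in> ?b"
 proof -
  note [measurable] = jointly_swap[OF sexp_jointly[of A "expo - kappa p"]]
  have "(%x. ennreal (G0 * (case x of (w, t) => indicator {0..} t *\<^sub>R sexp A ?a t w)) * indicator {0..} (snd x)) \<in> ?b" by measurable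
  thus ?thesis by (rule measurable_cong[THEN iffD1, rotated]) (auto simp: indicator_def)
 qed
 have "life (%t w. ennreal (deflator t w * (G0 * sexp alph expo t w)))
  = life (%t w. ennreal (G0 * sexp A ?a t w))"
 proof (rule nn_integral_cong_AE)
  show "AE w in M. (\<L> t. ennreal (deflator t w * (G0 * sexp alph expo t w)) * indicator {0..} t)
   = (\<L> t. ennreal (G0 * sexp A ?a t w) * indicator {0..} t)"
   using not_bad by eventually_elim (simp only: prod not_False_eq_True)
 qed
 also have "... = (\<L> t. (\<E> w. ennreal (G0 * sexp A ?a t w) * indicator {0..} t))"
  by (rule PM.Fubini'[OF m, symmetric])
 also have "... = (\<L> t. ennreal (G0 * exp (A * t)) * indicator {0..} t)"
 proof (rule nn_integral_cong)
  fix t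
  have "(\<E> w. ennreal (G0 * sexp A ?a t w)) = ennreal (G0 * exp (A * t))" if "0 <= t"
   using sexp_mean[OF that, of A "expo - kappa p"] G sexp_pos[of A "expo - kappa p" t]
   by (subst nn_integral_eq_integral) (auto simp: has_bochner_integral_iff less_imp_le)
  thus "(\<E> w. ennreal (G0 * sexp A ?a t w) * indicator {0..} t) = ennreal (G0 * exp (A * t)) * indicator {0..} t"
   by (cases "0 <= t") auto
 qed
 also have "... = ennreal (0 - (G0 * exp (A * 0) / A))"
 proof (rule nn_integral_FTC_atLeast)
  have An: "A < 0" using A nu_pos by simp
  thus "((%t. G0 * exp (A * t) / A) has_real_derivative G0 * exp (A * x)) (at x)" for x by (auto intro!: derivative_eq_intros)
  have "LIM t at_top. A * t :> at_bot" by (rule filterlim_tendsto_neg_mult_at_bot[OF tendsto_const An filterlim_ident])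
  hence "((%t. exp (A * t)) \<longlongrightarrow> 0) at_top" by (rule filterlim_compose[OF exp_at_bot])
  thus "((%t. G0 * exp (A * t) / A) \<longlongrightarrow> 0) at_top" using tendsto_mult_left[of _ 0 _ "G0 / A"] by (simp add: mult.commute)
 qed (use G in auto)
 also have "0 - (G0 * exp (A * 0) / A) = G0 * nu p" using nu_pos by (simp add: A)
 finally show ?thesis .
qed

lemma deflated_measurable:
 assumes "jointly C"
 shows "life_measurable (%t w. ennreal (l * (deflator t w * C t w)))"
proof -
 note [measurable] = jointly_swap[OF sexp_jointly[of 0 "- kappa p"]] jointly_swap[OF assms]
 have "(%x. ennreal (l * ((exp (- rate * snd x) * (case x of (w, t) => indicator {0..} t *\<^sub>R sexp 0 (- kappa p) t w)) * (case x of (w, t) => indicator {0..} t *\<^sub>R C t w))) * indicator {0..} (snd x)) \<in> borel_measurable (M \<Otimes>\<^sub>M lborel)"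
  by measurable
 thus ?thesis by (rule measurable_cong[THEN iffD1, rotated]) (auto simp: deflator_def indicator_def)
qed

lemma utility_measurable:
 assumes "jointly c" "jointly B"
 shows "life_measurable (%t w. e2ennreal (running_utility p c B t w))"
  "life_measurable (%t w. e2ennreal (- running_utility p c B t w))"
proof -
 let ?a = "borel_measurable (M \<Otimes>\<^sub>M lborel)"
 note [measurable] = jointly_swap[OF assms(1)] jointly_swap[OF assms(2)]
 define U where "U = (%x. ereal (exp (- (discount p + mortality p) * snd x)) * (crra risk (case x of (w, t) => indicator {0..} t *\<^sub>R c t w)
  + ereal (mortality p) * crra risk (bequest p * (case x of (w, t) => indicator {0..} t *\<^sub>R B t w))))"
 have [measurable]: "U \<in> ?a" unfolding U_def by measurable
 have "(%x. e2ennreal (U x) * indicator {0..} (snd x)) \<in> ?a" "(%x. e2ennreal (- U x) * indicator {0..} (snd x)) \<in> ?a" by measurable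
 note m = this
 show "life_measurable (%t w. e2ennreal (running_utility p c B t w))"
  by (rule measurable_cong[THEN iffD1, OF _ m(1)]) (auto simp: U_def running_utility_def indicator_def)
 show "life_measurable (%t w. e2ennreal (- running_utility p c B t w))"
  by (rule measurable_cong[THEN iffD1, OF _ m(2)]) (auto simp: U_def running_utility_def indicator_def)
qed

lemma utility_real:
 assumes "risk < 1 \<or> c t w ~= 0 \<and> B t w ~= 0"
 shows "running_utility p c B t w = ereal (exp (- (discount p + mortality p) * t) * (util (c t w) + mortality p * util (bequest p * B t w)))"
 using assms bequest by (auto simp: running_utility_def crra_real)

lemma utility_infinite:
 assumes "1 < risk" "c t w = 0 \<or> B t w = 0"
 shows "running_utility p c B t w = - \<infinity>"
proof -
 let ?a = "bequest p * B t w"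
 have n: "crra risk x ~= \<infinity>" for x using crra_nonpos[OF assms(1), of x] by auto
 have "crra risk (c t w) + ereal (mortality p) * crra risk ?a = - \<infinity>"
 proof (cases "c t w = 0")
  case True
  have "ereal (mortality p) * crra risk ?a ~= \<infinity>" using n[of "bequest p * B t w"] mortality by (cases "crra risk ?a") auto
  moreover have "crra risk (c t w) = - \<infinity>" using True assms by (simp add: crra_def)
  ultimately show ?thesis by (cases "ereal (mortality p) * crra risk ?a") auto
 next
  case False
  hence "crra risk ?a = - \<infinity>" using assms by (simp add: crra_def)
  thus ?thesis using n[of "c t w"] mortality by (cases "crra risk (c t w)") auto
 qed
 thus ?thesis by (simp add: running_utility_def)
qed

lemma utility_one_sided:
 "life (%t w. e2ennreal (running_utility p c B t w)) = 0 \<or> life (%t w. e2ennreal (- running_utility p c B t w)) = 0"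
proof (cases "risk < 1")
 case True
 have "ereal e * (x + ereal (mortality p) * z) \<ge> 0" if "0 <= x" "0 <= z" "0 <= e" for e x z
  using that mortality by (intro ereal_0_le_mult add_nonneg_nonneg) auto
 hence "0 <= running_utility p c B t w" for t w
  unfolding running_utility_def by (simp add: crra_nonneg[OF True])
 thus ?thesis by (simp add: e2ennreal_neg)
next
 case False
 hence r: "1 < risk" using aversion by simp
 have "running_utility p c B t w <= 0" for t w
 proof (cases "c t w = 0 \<or> B t w = 0")
  case False
  thus ?thesis using r mortality utility_real[of c t w B]
   by (auto simp: mult_le_0_iff intro!: mult_nonneg_nonpos add_nonpos_nonpos divide_nonneg_neg)
 qed (use utility_infinite[OF r, of c t w B] in simp)
 thus ?thesis by (simp add: e2ennreal_neg)
qed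

definition value_at :: "real => real" where
 "value_at G0 = f powr risk * G0 powr (1 - risk) / (1 - risk)"

text \<open>A power utility satisfies u(a) = a u'(a) / (1 - \<gamma>), so by
  \<open>marginal_deflator\<close> the utility rate is a multiple of the deflated spending, which is
  the fraction 1 / nu of deflated total wealth.\<close>

lemma optimal_utility:
 assumes w: "w \<notin> bad" and G: "0 < G0" and c: "c t w = inverse f * (G0 * sexp alph expo t w)"
  and B: "B t w = bequest p powr (- b_exp p) * inverse f * (G0 * sexp alph expo t w)"
 shows "running_utility p c B t w = ereal (f powr risk * G0 powr (- risk) / (nu p * (1 - risk)) * (deflator t w * (G0 * sexp alph expo t w)))"
proof -
 let ?a = "- (discount p + mortality p) * t"
 let ?b = "G0 * sexp alph expo t w"
 define a where "a = inverse f * ?b"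
 have a: "0 < a" using f_pos G sexp_pos by (simp add: a_def)
 have kB: "bequest p * B t w = bequest p powr (1 / risk) * a" unfolding B a_def bequest_powr[symmetric] by (simp add: mult_ac)
 have "c t w ~= 0" "B t w ~= 0" using a bequest unfolding c B a_def by auto
 hence "running_utility p c B t w = ereal (exp ?a * (share * util a))"
  using utility_real[of c t w B] a unfolding kB bequest_util[OF less_imp_le[OF a]] c a_def[symmetric]
  by (simp add: distrib_right add_divide_distrib mult.assoc)
 also have "exp ?a * (share * util a) = (exp ?a * a powr (- risk)) * (share * a) / (1 - risk)"
  using a powr_add[of a "- risk" 1] by (simp add: mult_ac)
 also have "exp ?a * a powr (- risk) = f powr risk * G0 powr (- risk) * deflator t w"
  unfolding a_def by (rule marginal_deflator[OF w G])
 also have "share * a = (inverse f * share) * ?b" by (simp only: a_def mult_ac)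
 also have "... = (1 / nu p) * ?b" unfolding f_nu ..
 finally show ?thesis by (simp add: mult_ac)
qed

text \<open>Tangents at the optimal rates a and a', whose discounted slopes are the same multiple of
  the deflator by \<open>marginal_deflator\<close> and \<open>bequest_marginal\<close>. The amount
  \<open>X / nu p\<close> is the optimal spending, share times a. The terms are arranged for
  integration without subtraction.\<close>

lemma utility_gap:
 assumes w: "w \<notin> bad" and G: "0 < G0" and pos: "0 < c t w \<and> 0 < B t w \<or> risk < 1 \<and> 0 <= c t w \<and> 0 <= B t w"
 defines "l \<equiv> f powr risk * G0 powr (- risk)" and "X \<equiv> G0 * sexp alph expo t w"
 shows "exp (- (discount p + mortality p) * t) * (util (c t w) + mortality p * util (bequest p * B t w)) + l * (deflator t w * (X / nu p))
  <= l / (nu p * (1 - risk)) * (deflator t w * X) + l * (deflator t w * (c t w + mortality p * B t w))"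
proof -
 let ?a = "%a. B t w - bequest p powr (- b_exp p) * a"
 let ?b = "c t w + mortality p * B t w"
 let ?c = "bequest p * B t w"
 define e where "e = exp (- (discount p + mortality p) * t)"
 define a where "a = inverse f * X"
 have a: "0 < a" using f_pos G sexp_pos by (simp add: a_def X_def)
 define a' where "a' = bequest p powr (1 / risk) * a"
 have a': "0 < a'" using a bequest by (simp add: a'_def)
 have m: "e * a powr (- risk) = l * deflator t w" unfolding e_def a_def X_def l_def by (rule marginal_deflator[OF w G])
 have 1: "util (c t w) <= util a + a powr (- risk) * (c t w - a)" by (rule crra_tangent[OF aversion a]) (use pos in auto)
 have "util ?c <= util a' + a' powr (- risk) * (bequest p * B t w - a')"
  by (rule crra_tangent[OF aversion a']) (use pos bequest in \<open>cases "B t w = 0"; auto\<close>)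
 also have "a' powr (- risk) * (bequest p * B t w - a') = a powr (- risk) * (?a a)"
 proof -
  have "a' = bequest p * (bequest p powr (- b_exp p) * a)" unfolding a'_def bequest_powr[symmetric] by (simp add: mult_ac)
  hence "a' powr (- risk) * (bequest p * B t w - a') = (bequest p * a' powr (- risk)) * (?a a)"
   by (simp add: algebra_simps)
  thus ?thesis unfolding a'_def using bequest_marginal[OF less_imp_le[OF a]] by simp
 qed
 finally have 2: "util ?c <= bequest p powr (- b_exp p) * util a + a powr (- risk) * (?a a)"
  unfolding a'_def bequest_util[OF less_imp_le[OF a]] .
 have "util (c t w) + mortality p * util ?c
  <= (util a + a powr (- risk) * (c t w - a)) + mortality p * (bequest p powr (- b_exp p) * util a + a powr (- risk) * (?a a))"
  using mortality by (intro add_mono 1 mult_left_mono 2) auto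
 also have "... = share * util a + a powr (- risk) * (?b - share * a)" by (simp add: algebra_simps add_divide_distrib)
 also have "share * util a = a powr (- risk) * (share * a) / (1 - risk)" using a powr_add[of a "- risk" 1] by (simp add: mult_ac)
 finally have "e * (util (c t w) + mortality p * util ?c)
  <= e * (a powr (- risk) * (share * a) / (1 - risk) + a powr (- risk) * (?b - share * a))"
  by (intro mult_left_mono) (auto simp: e_def)
 also have "... = (e * a powr (- risk)) * ((share * a) / (1 - risk) + (?b - share * a))"
  by (simp add: algebra_simps)
 also have "share * a = X / nu p" using f_nu by (simp add: a_def mult_ac)
 finally have key: "e * (util (c t w) + mortality p * util ?c) <= l * deflator t w * (X / nu p / (1 - risk) + (?b - X / nu p))"
  unfolding m .
 have "b + l * (D * (X / nu p)) <= l / (nu p * (1 - risk)) * (D * X) + l * (D * C)" if "b <= l * D * (X / nu p / (1 - risk) + (C - X / nu p))" for b D C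
  using that by (simp add: algebra_simps)
 from this[OF key] show ?thesis unfolding e_def .
qed

end

section \<open>Upper bound for the objective\<close>

context investment_model
begin

lemma energy_time_mono: "s <= t ==> energy s H w <= energy t H w"
 unfolding energy_def by (intro nn_integral_mono mult_left_mono) (auto simp: indicator_def)

lemma y_energy: "(\<E> w. energy T y w) < \<infinity>"
proof -
 obtain K where "\<forall>t\<in>{0..T}. (\<E> w. esq (y t w)) <= ennreal K" using y_second_moment[of T] by blast
 thus ?thesis by (intro energy_finite_of_moment[OF predictable_jointly[OF adapted_continuous_predictable[OF y_adapted]]]) auto
qed

lemma admissible_budget:
 assumes adm: "(c, B, \<theta>) \<in> admissible M Z p \<phi> w0 y"
 shows "jointly c" "jointly B" "AE w in M. AE t in lborel. 0 <= t \<longrightarrow> 0 <= c t w \<and> 0 <= B t w"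
  "life (%t w. ennreal (deflator t w * (c t w + mortality p * B t w))) <= ennreal (G p \<phi> w0 x0 x1)"
proof -
 let ?a = "%t w. (g_inf p \<phi> * y t w) *\<^sub>R income_vol p"
 let ?b = "%t w. transpose (vol p) *v \<theta> t w"
 have ctl: "(c, B, \<theta>) \<in> controls M Z" using adm unfolding admissible_def by auto
 obtain W where W: "wealth M Z p w0 y (c, B, \<theta>) W" "AE w in M. \<forall>t\<ge>0. 0 <= total_wealth p \<phi> y W t w"
  using adm unfolding admissible_def by auto
 have pr: "predictable M F c" "predictable M F B" "predictable M F \<theta>" using ctl unfolding controls_def by auto
 show j: "jointly c" "jointly B" using pr by (auto intro: predictable_jointly)
 have "AE (t, w) in lborel \<Otimes>\<^sub>M M. 0 <= t \<longrightarrow> 0 <= c t w \<and> 0 <= B t w" using ctl unfolding controls_def by auto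
 from AE_swap[OF this] show pos: "AE w in M. AE t in lborel. 0 <= t \<longrightarrow> 0 <= c t w \<and> 0 <= B t w" .
 let ?\<psi> = "%t w. transpose (vol p) *v \<theta> t w + (g_inf p \<phi> * y t w) *\<^sub>R income_vol p"
 let ?X = "total_wealth p \<phi> y W"
 let ?C = "%t w. c t w + mortality p * B t w"
 have tw: "ito_process M Z (G p \<phi> w0 x0 x1) (%t w. rate * ?X t w - ?C t w + kappa p \<bullet> ?\<psi> t w) ?\<psi> ?X" by (rule total_wealth_process[OF W(1)])
 then obtain I where I: "ito_integral M Z ?\<psi> I"
  "AE w in M. \<forall>t\<ge>0. ?X t w = G p \<phi> w0 x0 x1 + (LINT s:{0..t}|lborel. rate * ?X s w - ?C s w + kappa p \<bullet> ?\<psi> s w) + I t w"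
  unfolding ito_process_def by blast
 have fin: "(\<E> w. energy T ?\<psi> w) < \<infinity>" if T: "0 <= T" for T
 proof -
  have jt: "jointly \<theta>" by (rule predictable_jointly[OF pr(3)])
  \<comment> \<open>\<open>controls\<close> speaks of positive horizons only; T + 1 covers T =
    0.\<close>
  have "set_integrable (lborel \<Otimes>\<^sub>M M) ({0..T + 1} \<times> space M) (%(t, w). (norm (\<theta> t w))^2)" using ctl T unfolding controls_def by auto
  hence "(\<E> w. energy (T + 1) \<theta> w) < \<infinity>" using energy_finite_iff[OF jt] by blast
  hence ft: "(\<E> w. energy T \<theta> w) < \<infinity>" by (rule order.strict_trans1[rotated]) (intro nn_integral_mono energy_time_mono, simp)
  have jy: "jointly y" by (rule predictable_jointly[OF adapted_continuous_predictable[OF y_adapted]])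
  have m: "(%x. transpose (vol p) *v x) \<in> borel_measurable borel"
   by (intro borel_measurable_continuous_onI linear_continuous_on matrix_vector_mul_bounded_linear)
  show ?thesis
  proof (rule energy_finite_add)
   show "jointly ?b" by (rule jointly_compose[OF jt m])
   show "jointly ?a" by (rule jointly_compose[OF jy]) measurable
   show "(\<E> w. energy T ?b w) < \<infinity>"
    by (rule energy_linear_image[OF jt onorm[OF matrix_vector_mul_bounded_linear] ft])
   show "(\<E> w. energy T ?a w) < \<infinity>"
    by (rule energy_linear_image[OF jy _ y_energy, of _ "\<bar>g_inf p \<phi>\<bar> * norm (income_vol p)"]) (simp add: abs_mult mult_ac)
  qed
 qed
 have "(\<E> w. nnint {0..} (%t. ennreal (exp (- rate * t) * sexp 0 (- kappa p) t w * ?C t w))) <= ennreal (G p \<phi> w0 x0 x1)"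
 proof (rule budget[OF _ I(1) _ _ fin _ I(2)])
  show "adapted_continuous M F ?X" "AE w in M. \<forall>t\<ge>0. set_integrable lborel {0..t} (%s. rate * ?X s w - ?C s w + kappa p \<bullet> ?\<psi> s w)"
   using tw unfolding ito_process_def by auto
  show "predictable M F ?C" by (rule predictable_Pair[OF pr(1,2), of "%c B. c + mortality p * B"]) (intro borel_measurable_continuous_onI continuous_intros)
  show "0 <= rate" using interest mortality by simp
  show "AE w in M. AE s in lborel. 0 <= s \<longrightarrow> 0 <= ?C s w"
   using pos by eventually_elim (use mortality in \<open>auto elim!: eventually_mono\<close>)
 qed (use W(2) in auto)
 thus "life (%t w. ennreal (deflator t w * (c t w + mortality p * B t w))) <= ennreal (G p \<phi> w0 x0 x1)"
  unfolding deflator_def .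
qed

text \<open>For negative k both sides are truncated to 0, so positive and negative parts can be
  evaluated by one formula.\<close>

lemma deflated_wealth_scaled:
 assumes "0 < G0"
 shows "life (%t w. ennreal (k * (deflator t w * (G0 * sexp alph expo t w)))) = ennreal (k * G0 * nu p)"
proof (cases "0 <= k")
 case True
 have "k * (deflator t w * (G0 * sexp alph expo t w)) = deflator t w * ((k * G0) * sexp alph expo t w)" for t w by (simp only: mult_ac)
 thus ?thesis using deflated_wealth_value[of "k * G0"] assms True by (simp only: mult_nonneg_nonneg less_imp_le)
next
 case False
 hence "k * (deflator t w * (G0 * sexp alph expo t w)) <= 0" "k * G0 * nu p <= 0" for t w
  using assms nu_pos deflator_pos[of t w] sexp_pos[of alph expo t w] by (simp_all add: mult_le_0_iff zero_le_mult_iff)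
 thus ?thesis by (simp add: ennreal_neg)
qed

lemma value_at_eq: "0 < G0 ==> f powr risk * G0 powr (- risk) * G0 / (1 - risk) = value_at G0"
 using powr_add[of G0 "- risk" 1] by (simp add: value_at_def mult.assoc)

text \<open>Neither part of the expected utility is known to be finite beforehand, so
  \<open>utility_gap\<close> is integrated in \<open>ennreal\<close>, every term being represented
  by its positive and negative parts on opposite sides. The price of the optimal spending, l G0,
  bounds the price of the actual spending and is finite, hence cancels.\<close>

lemma J_upper:
 assumes adm: "(c, B, \<theta>) \<in> admissible M Z p \<phi> w0 y" and G: "0 < G p \<phi> w0 x0 x1"
 shows "J M p c B <= ereal (value_at (G p \<phi> w0 x0 x1))"
proof -
 define G0 where "G0 = G p \<phi> w0 x0 x1"
 define l where "l = f powr risk * G0 powr (- risk)"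
 define k where "k = l / (nu p * (1 - risk))"
 define X where "X = (%t w. deflator t w * (G0 * sexp alph expo t w))"
 define C where "C = (%t w. deflator t w * (c t w + mortality p * B t w))"
 let ?U = "running_utility p c B"
 note bud = admissible_budget[OF adm, folded G0_def]
 have G0: "0 < G0" using G by (simp add: G0_def)
 have l: "0 < l" using f_pos G0 by (simp add: l_def)
 have X: "0 < X t w" for t w using G0 sexp_pos deflator_pos by (simp add: X_def)
 have Xm: "life_measurable (%t w. ennreal (a * X t w))" for a
  unfolding X_def by (rule deflated_measurable[OF jointly_compose[OF sexp_jointly, of "%x. G0 * x"]]) simp
 have Cm: "life_measurable (%t w. ennreal (a * C t w))" for a
  unfolding C_def using deflated_measurable[OF jointly_linear[OF bud(1,2), of 1 "mortality p"]] by simp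
 have val: "life (%t w. ennreal (a * X t w)) = ennreal (a * G0 * nu p)" for a
  unfolding X_def by (rule deflated_wealth_scaled[OF G0])
 have num: "l / nu p * G0 * nu p = l * G0" "k * G0 * nu p = value_at G0"
  using nu_pos aversion value_at_eq[OF G0] unfolding k_def l_def[symmetric] by (auto simp: divide_simps)
 \<comment> \<open>A real inequality in the form in which it survives truncation: a and b may have
   either sign, and only one of their two parts is nonzero.\<close>
 have split: "ennreal a + (ennreal (- b) + ennreal x) <= ennreal (- a) + (ennreal b + ennreal z)"
  if "a + x <= b + z" "0 <= x" "0 <= z" for a b x z :: real
  using that by (cases "0 <= a"; cases "0 <= b") (auto simp: ennreal_neg ennreal_plus[symmetric] simp del: ennreal_plus intro!: ennreal_leI)
 have "AE w in M. AE t in lborel. 0 <= t \<longrightarrow> e2ennreal (?U t w) + (ennreal (- k * X t w) + ennreal (l / nu p * X t w))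
  <= e2ennreal (- ?U t w) + (ennreal (k * X t w) + ennreal (l * C t w))"
  using bud(3) not_bad
 proof eventually_elim
  case (elim w)
  from elim(1) show ?case
  proof eventually_elim
   case (elim t)
   show ?case
   \<comment> \<open>With aversion above 1, zero consumption or bequest has utility minus infinity,
     which makes the right-hand side infinite.\<close>
   proof (intro impI, cases "1 < risk \<and> (c t w = 0 \<or> B t w = 0)")
    case True
    thus "e2ennreal (?U t w) + (ennreal (- k * X t w) + ennreal (l / nu p * X t w)) <= e2ennreal (- ?U t w) + (ennreal (k * X t w) + ennreal (l * C t w))"
     using utility_infinite[of c t w B] by simp
   next
    case False
    assume t: "0 <= t"
    have pos: "0 < c t w \<and> 0 < B t w \<or> risk < 1 \<and> 0 <= c t w \<and> 0 <= B t w" using False elim t aversion by (auto simp: less_le)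
    hence U: "?U t w = ereal (exp (- (discount p + mortality p) * t) * (util (c t w) + mortality p * util (bequest p * B t w)))"
     by (intro utility_real) auto
    have "0 <= C t w" using elim t mortality deflator_pos[of t w] by (simp add: C_def less_imp_le)
    thus "e2ennreal (?U t w) + (ennreal (- k * X t w) + ennreal (l / nu p * X t w)) <= e2ennreal (- ?U t w) + (ennreal (k * X t w) + ennreal (l * C t w))"
     unfolding U e2ennreal_ereal uminus_ereal.simps mult_minus_left[of k]
     using utility_gap[OF \<open>w \<notin> bad\<close> G0, of c t B, OF pos, folded l_def] l nu_pos less_imp_le[OF X, of t w]
     by (intro split) (simp_all add: k_def X_def C_def)
   qed
  qed
 qed
 note life_mono[OF this]
 hence "life (%t w. e2ennreal (?U t w)) + (ennreal (- value_at G0) + ennreal (l * G0))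
  <= life (%t w. e2ennreal (- ?U t w)) + (ennreal (value_at G0) + life (%t w. ennreal (l * C t w)))"
  unfolding life_add[OF utility_measurable(1)[OF bud(1,2)] life_measurable_add[OF Xm Xm]] life_add[OF Xm Xm] life_add[OF Xm Cm]
   life_add[OF utility_measurable(2)[OF bud(1,2)] life_measurable_add[OF Xm Cm]] val unfolding mult_minus_left num .
 also have "life (%t w. ennreal (l * C t w)) <= ennreal (l * G0)"
  using life_cmult[OF Cm[of 1], of "ennreal l"] mult_left_mono[OF bud(4), of "ennreal l"] l by (simp add: C_def ennreal_mult')
 finally have "ennreal (l * G0) + (life (%t w. e2ennreal (?U t w)) + ennreal (- value_at G0))
  <= ennreal (l * G0) + (life (%t w. e2ennreal (- ?U t w)) + ennreal (value_at G0))"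
  by (simp add: add_ac add_left_mono)
 hence le: "life (%t w. e2ennreal (?U t w)) + ennreal (- value_at G0) <= life (%t w. e2ennreal (- ?U t w)) + ennreal (value_at G0)"
  by (simp add: ennreal_add_left_cancel_le)
 have "enn2ereal a - enn2ereal n <= ereal v" if "a + ennreal (- v) <= n + ennreal v" "a = 0 \<or> n = 0" for a n v
  using that by (cases a rule: ennreal_cases; cases n rule: ennreal_cases; cases "0 <= v")
   (auto simp: ennreal_neg top_unique enn2ereal_ennreal zero_ennreal.rep_eq ennreal_plus[symmetric] simp del: ennreal_plus)
 from this[OF le utility_one_sided] show ?thesis unfolding J_def G0_def .
qed

lemma J_optimal:
 assumes G: "0 < G0" and c: "AE w in M. \<forall>t\<ge>0. c t w = inverse f * (G0 * sexp alph expo t w)"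
  and B: "AE w in M. \<forall>t\<ge>0. B t w = bequest p powr (- b_exp p) * inverse f * (G0 * sexp alph expo t w)"
 shows "J M p c B = ereal (value_at G0)"
proof -
 define k where "k = f powr risk * G0 powr (- risk) / (nu p * (1 - risk))"
 have U: "AE w in M. \<forall>t\<ge>0. running_utility p c B t w = ereal (k * (deflator t w * (G0 * sexp alph expo t w)))"
  using c B not_bad
 proof eventually_elim
  case (elim w)
  thus ?case unfolding k_def by (intro allI impI optimal_utility[OF _ G]) auto
 qed
 have num: "k * G0 * nu p = value_at G0"
  using nu_pos aversion value_at_eq[OF G] unfolding k_def by (auto simp: divide_simps)
 have "life (%t w. e2ennreal (running_utility p c B t w)) = life (%t w. ennreal (k * (deflator t w * (G0 * sexp alph expo t w))))"
  "life (%t w. e2ennreal (- running_utility p c B t w)) = life (%t w. ennreal (- k * (deflator t w * (G0 * sexp alph expo t w))))"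
  using U by (auto intro!: life_cong elim!: eventually_mono)
 thus ?thesis unfolding J_def deflated_wealth_scaled[OF G] unfolding mult_minus_left num
  by (cases "0 <= value_at G0") (simp_all add: ennreal_neg enn2ereal_ennreal zero_ennreal.rep_eq)
qed

text \<open>A budget of 0 at positive state prices forces consumption and bequest to vanish almost
  everywhere. Utility is then 0 or minus infinity throughout, according to the aversion.\<close>

lemma J_no_wealth:
 assumes adm: "(c, B, \<theta>) \<in> admissible M Z p \<phi> w0 y" and G: "G p \<phi> w0 x0 x1 = 0"
 shows "J M p c B = ereal (f powr risk) * crra risk 0"
proof -
 let ?a = "life (%t w. e2ennreal (running_utility p c B t w)) <= life (%t w. 0)"
 let ?b = "life (%t w. e2ennreal (- running_utility p c B t w))"
 note bud = admissible_budget[OF adm, unfolded G]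
 have jC: "jointly (%t w. c t w + mortality p * B t w)" using jointly_linear[OF bud(1,2), of 1 "mortality p"] by simp
 note Cm = deflated_measurable[OF jC, of 1, simplified mult_1]
 let ?C = "%w t. ennreal (deflator t w * (c t w + mortality p * B t w)) * indicator {0..} t"
 have "AE w in M. (\<L> t. ?C w t) = 0"
  using bud(4) lborel.borel_measurable_nn_integral_fst[OF Cm] by (subst nn_integral_0_iff_AE[symmetric]) auto
 hence z: "AE w in M. AE t in lborel. 0 <= t \<longrightarrow> c t w = 0 \<and> B t w = 0"
  using bud(3) AE_space
 proof eventually_elim
  case (elim w)
  have "AE t in lborel. ?C w t = 0"
   using elim(1) life_section[OF Cm elim(3)] by (subst (asm) nn_integral_0_iff_AE) auto
  thus ?case using elim(2)
  proof eventually_elim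
   case (elim t)
   show ?case
   proof
    assume t: "0 <= t"
    hence "deflator t w * (c t w + mortality p * B t w) <= 0" using elim(1) by (simp add: ennreal_eq_0_iff)
    hence "c t w + mortality p * B t w <= 0" using deflator_pos[of t w] by (simp add: mult_le_0_iff)
    moreover have "0 <= c t w" "0 <= mortality p * B t w" using elim(2) t mortality by auto
    ultimately have "c t w = 0" "mortality p * B t w = 0" by linarith+
    thus "c t w = 0 \<and> B t w = 0" using mortality by simp
   qed
  qed
 qed
 show ?thesis
 proof (cases "risk < 1")
  case True
  have U: "AE w in M. AE t in lborel. 0 <= t \<longrightarrow> running_utility p c B t w = 0"
   using z by (auto elim!: eventually_mono simp: running_utility_def crra_def less_not_sym[OF True])
  have "?a" "?b <= life (%t w. 0)"
   by (rule life_mono, use U in \<open>force elim!: eventually_mono\<close>)+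
  thus ?thesis using True by (simp add: J_def crra_def zero_ennreal.rep_eq)
 next
  case False
  hence r: "1 < risk" using aversion by simp
  have U: "AE w in M. AE t in lborel. 0 <= t \<longrightarrow> running_utility p c B t w = - \<infinity>"
   using z by (auto elim!: eventually_mono simp: utility_infinite[OF r])
  have "?a" "life (%t w. \<top>) <= ?b"
   by (rule life_mono, use U in \<open>force elim!: eventually_mono simp: e2ennreal_neg\<close>)+
  moreover have "(\<L> t. \<top> * indicator {0::real..} t) = (\<top> :: ennreal)"
  proof -
   have "emeasure lborel {0..1::real} <= emeasure lborel {0::real..}" by (rule emeasure_mono) auto
   hence "emeasure lborel {0::real..} ~= 0" by (auto simp: emeasure_lborel_Icc_eq)
   thus ?thesis by (subst nn_integral_cmult_indicator) (auto simp: ennreal_top_mult)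
  qed
  ultimately show ?thesis using r f_pos by (simp add: J_def crra_def emeasure_space_1 top_unique zero_ennreal.rep_eq)
 qed
qed

end

section \<open>Optimality of the feedback controls\<close>

context investment_model
begin

lemma kappa_transpose: "transpose (vol p) *v (matrix_inv (vol p ** transpose (vol p)) *v excess_return p) = kappa p"
proof -
 let ?u = "matrix_inv (vol p ** transpose (vol p)) *v excess_return p"
 have "vol p *v (transpose (vol p) *v ?u) = excess_return p"
  using matrix_inv_mult[OF invertible_mult[OF vol transpose_invertible[OF vol]]] by (simp add: matrix_vector_mul_assoc matrix_mul_assoc)
 hence "matrix_inv (vol p) *v (vol p *v (transpose (vol p) *v ?u)) = kappa p" by (simp add: kappa_def)
 thus ?thesis using matrix_inv_mult[OF vol] by (simp add: matrix_vector_mul_assoc[of "matrix_inv (vol p)" "vol p"])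
qed

text \<open>The second term of \<open>theta_star\<close> hedges the income risk contained in total
  wealth, so that adding the income volatility leaves a multiple of \<open>kappa p\<close>.\<close>

lemma vol_theta_star:
 "transpose (vol p) *v theta_star p \<phi> y W t w = (total_wealth p \<phi> y W t w / risk) *\<^sub>R kappa p - (g_inf p \<phi> * y t w) *\<^sub>R income_vol p"
proof -
 have "transpose (vol p) *v (matrix_inv (transpose (vol p)) *v income_vol p) = income_vol p"
  using matrix_inv_mult[OF transpose_invertible[OF vol]] by (simp add: matrix_vector_mul_assoc del: transpose_matrix_vector)
 thus ?thesis unfolding theta_star_def
  by (simp only: matrix_vector_mult_diff_distrib matrix_vector_mult_scaleR kappa_transpose)
qed

lemma total_consumption: "c_star p \<phi> y W t w + mortality p * B_star p \<phi> y W t w = inverse f * share * total_wealth p \<phi> y W t w"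
 by (simp add: c_star_def B_star_def algebra_simps)

text \<open>The hedge and the proportional consumption make drift and volatility of total wealth
  proportional to total wealth itself, which identifies it with an exponential by
  \<open>linear_SDE_unique\<close>.\<close>

lemma closed_loop_total_wealth:
 assumes W: "closed_loop_wealth M Z p \<phi> w0 y W"
 shows "ito_process M Z (G p \<phi> w0 x0 x1) (%t w. total_wealth p \<phi> y W t w * alph) (%t w. (total_wealth p \<phi> y W t w / risk) *\<^sub>R kappa p) (total_wealth p \<phi> y W)"
  and "AE w in M. \<forall>t\<ge>0. total_wealth p \<phi> y W t w = G p \<phi> w0 x0 x1 * sexp alph expo t w"
proof -
 let ?X = "total_wealth p \<phi> y W"
 let ?a = "%t w. (?X t w / risk) *\<^sub>R kappa p"
 have psi: "transpose (vol p) *v theta_star p \<phi> y W t w + (g_inf p \<phi> * y t w) *\<^sub>R income_vol p = (?X t w / risk) *\<^sub>R kappa p" for t w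
  by (simp add: vol_theta_star del: transpose_matrix_vector)
 have "rate * X - inverse f * share * X + kappa p \<bullet> (X / risk) *\<^sub>R kappa p = X * alph" for X
  using aversion by (simp add: alph_def algebra_simps)
 with total_wealth_process[OF W[unfolded closed_loop_wealth_def feedback_def]]
 show *: "ito_process M Z (G p \<phi> w0 x0 x1) (%t w. ?X t w * alph) ?a ?X"
  unfolding psi total_consumption by simp
 have e: "?a = (%t w. ?X t w *\<^sub>R expo)" by simp
 show "AE w in M. \<forall>t\<ge>0. ?X t w = G p \<phi> w0 x0 x1 * sexp alph expo t w" by (rule linear_SDE_unique[OF *[unfolded e]])
qed

text \<open>Solved backwards: total wealth is prescribed to be the exponential, and wealth is
  defined as what remains after subtracting the income part. Its equation then follows by
  linearity.\<close>

lemma closed_loop_exists: "\<exists>W. closed_loop_wealth M Z p \<phi> w0 y W"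
proof -
 let ?a = "%t w. (rate + mass) * y t w + (income_drift p - rate) * y t w + rate * mem t w"
 define g where "g = g_inf p \<phi>"
 define G0 where "G0 = G p \<phi> w0 x0 x1"
 define X where "X = (%t w. G0 * sexp alph expo t w)"
 define W where "W = (%t w. 1 * X t w + - g * (y t w + mem t w))"
 have tw: "total_wealth p \<phi> y W t w = X t w" for t w by (simp add: total_wealth_eq W_def g_def)
 have *: "ito_process M Z (1 * G0 + - g * (x0 + past_memory))
  (%t w. 1 * (X t w * alph) + - g * (?a t w))
  (%t w. 1 *\<^sub>R (X t w *\<^sub>R expo) + (- g) *\<^sub>R (y t w *\<^sub>R income_vol p)) W"
  unfolding W_def X_def by (rule ito_process_linear[OF ito_process_sexp human_capital_process])
 have "1 * G0 + - g * (x0 + past_memory) = w0" by (simp add: G0_def g_def G_eq)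
 moreover have "1 *\<^sub>R (X t w *\<^sub>R expo) + (- g) *\<^sub>R (y t w *\<^sub>R income_vol p) = transpose (vol p) *v theta_star p \<phi> y W t w" for t w
  by (simp add: vol_theta_star tw g_def del: transpose_matrix_vector)
 moreover have "1 * (X t w * alph) + - g * (?a t w)
  = rate * W t w + theta_star p \<phi> y W t w \<bullet> excess_return p + y t w - c_star p \<phi> y W t w - mortality p * B_star p \<phi> y W t w" for t w
 proof -
  have "theta_star p \<phi> y W t w \<bullet> excess_return p = X t w / risk * (kappa p \<bullet> kappa p) - g * y t w * (income_vol p \<bullet> kappa p)"
   unfolding vol_kappa[symmetric] vol_theta_star tw by (simp add: inner_diff_left g_def)
  moreover have "g * (mass + income_drift p - rate) * y t w = (g * (income_vol p \<bullet> kappa p) - 1) * y t w" unfolding g_def g_gap ..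
  ultimately show ?thesis using total_consumption[of W t w] unfolding tw by (simp add: W_def alph_def algebra_simps)
 qed
 ultimately have "closed_loop_wealth M Z p \<phi> w0 y W"
  using * unfolding closed_loop_wealth_def feedback_def wealth.simps by (simp only:)
 thus ?thesis by (rule exI[of _ W])
qed

lemma feedback_admissible:
 assumes W: "closed_loop_wealth M Z p \<phi> w0 y W" and G0: "0 <= G p \<phi> w0 x0 x1"
 shows "feedback p \<phi> y W \<in> admissible M Z p \<phi> w0 y"
proof -
 let ?X = "total_wealth p \<phi> y W"
 let ?c = "lborel \<Otimes>\<^sub>M M"
 let ?d = "%T a. set_integrable ?c ({0..T} \<times> space M) (%(t, w). a * ?X t w)"
 note tw = closed_loop_total_wealth[OF W]
 have Xa: "adapted_continuous M F ?X" using tw(1) unfolding ito_process_def by auto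
 have prX: "predictable M F ?X" and pry: "predictable M F y" by (intro adapted_continuous_predictable Xa y_adapted)+
 have pos: "AE w in M. \<forall>t\<ge>0. 0 <= ?X t w" using tw(2) by eventually_elim (use G0 in \<open>simp add: sexp_pos less_imp_le\<close>)
 have XE: "(\<E> w. energy T ?X w) < \<infinity>" for T
 proof (rule energy_finite_of_moment[OF predictable_jointly[OF prX]])
  fix t assume t: "t \<in> {0..T}"
  let ?q = "2 * alph + expo \<bullet> expo"
  have "(\<E> w. esq (?X t w)) = (\<E> w. ennreal ((G p \<phi> w0 x0 x1)^2 * (sexp alph expo t w)^2))"
   using t by (intro nn_integral_cong_AE eventually_mono[OF tw(2)]) (simp add: power_mult_distrib)
  also have "... = ennreal ((G p \<phi> w0 x0 x1)^2 * exp (?q * t))"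
   using sexp_square_mean[of t alph expo] t by (subst nn_integral_eq_integral) (auto simp: has_bochner_integral_iff)
  also have "... <= ennreal ((G p \<phi> w0 x0 x1)^2 * exp (\<bar>?q\<bar> * T))"
  proof -
   have "?q * t <= \<bar>?q\<bar> * T" using t by (intro mult_mono) auto
   thus ?thesis by (intro ennreal_leI mult_left_mono) auto
  qed
  finally show "(\<E> w. esq (?X t w)) <= ennreal ((G p \<phi> w0 x0 x1)^2 * exp (\<bar>?q\<bar> * T))" .
 qed
 have scaled: "predictable M F (%t w. a * ?X t w)" "?d T a" for a T
 proof -
  show pr: "predictable M F (%t w. a * ?X t w)" by (rule predictable_compose[OF prX]) measurable
  show "?d T a"
   by (intro L1_of_energy[OF predictable_jointly[OF pr]] energy_linear_image[OF predictable_jointly[OF prX] _ XE, of _ "\<bar>a\<bar>"]) (simp add: abs_mult)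
 qed
 have "predictable M F (c_star p \<phi> y W)" "predictable M F (B_star p \<phi> y W)"
  "set_integrable ?c ({0..T} \<times> space M) (%(t, w). c_star p \<phi> y W t w)"
  "set_integrable ?c ({0..T} \<times> space M) (%(t, w). B_star p \<phi> y W t w)" for T
  using scaled unfolding c_star_def[abs_def] B_star_def[abs_def] by auto
 moreover have pt: "predictable M F (theta_star p \<phi> y W)"
  unfolding theta_star_def[abs_def]
  by (rule predictable_Pair[OF prX pry, of "%X y. (X / risk) *\<^sub>R (matrix_inv (vol p ** transpose (vol p)) *v excess_return p) - (g_inf p \<phi> * y) *\<^sub>R (matrix_inv (transpose (vol p)) *v income_vol p)"])
   (intro borel_measurable_continuous_onI continuous_intros, use aversion in auto)
 moreover have "set_integrable ?c ({0..T} \<times> space M) (%(t, w). (norm (theta_star p \<phi> y W t w))^2)" for T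
 proof -
  let ?a = "matrix_inv (vol p ** transpose (vol p)) *v excess_return p" and ?b = "matrix_inv (transpose (vol p)) *v income_vol p"
  have e: "theta_star p \<phi> y W = (%t w. (?X t w / risk) *\<^sub>R ?a + (- (g_inf p \<phi> * y t w)) *\<^sub>R ?b)" by (intro ext) (simp add: theta_star_def)
  have "(\<E> w. energy T (theta_star p \<phi> y W) w) < \<infinity>"
   unfolding e
  proof (rule energy_finite_add)
   show "jointly (%t w. (?X t w / risk) *\<^sub>R ?a)" by (rule jointly_compose[OF predictable_jointly[OF prX]]) measurable
   show "jointly (%t w. (- (g_inf p \<phi> * y t w)) *\<^sub>R ?b)" by (rule jointly_compose[OF predictable_jointly[OF pry]]) measurable
   show "(\<E> w. energy T (%t w. (?X t w / risk) *\<^sub>R ?a) w) < \<infinity>"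
    by (rule energy_linear_image[OF predictable_jointly[OF prX] _ XE, of _ "norm ?a / risk"]) (use aversion in \<open>simp add: mult.commute\<close>)
   show "(\<E> w. energy T (%t w. (- (g_inf p \<phi> * y t w)) *\<^sub>R ?b) w) < \<infinity>"
    by (rule energy_linear_image[OF predictable_jointly[OF pry] _ y_energy, of _ "\<bar>g_inf p \<phi>\<bar> * norm ?b"]) (simp add: abs_mult mult_ac)
  qed
  thus ?thesis using energy_finite_iff[OF predictable_jointly[OF pt]] by blast
 qed
 moreover have "AE (t, w) in lborel \<Otimes>\<^sub>M M. 0 <= t \<longrightarrow> 0 <= c_star p \<phi> y W t w \<and> 0 <= B_star p \<phi> y W t w"
 proof -
  \<comment> \<open>Nonnegativity can fail only for outcomes in this null set, whose product with
    the time line is null as well.\<close>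
  define N where "N = {w \<in> space M. \<not> (\<forall>t\<ge>0. 0 <= ?X t w)}"
  have N: "N \<in> null_sets M" using AE_null[OF pos] by (simp add: N_def)
  hence "UNIV \<times> N \<in> null_sets ?c" by (auto simp: null_sets_def emeasure_pair_measure_Times)
  thus ?thesis
  proof (rule AE_I')
   show "{x \<in> space ?c. \<not> (case x of (t, w) => 0 <= t \<longrightarrow> 0 <= c_star p \<phi> y W t w \<and> 0 <= B_star p \<phi> y W t w)} \<subseteq> UNIV \<times> N"
    using f_pos by (auto simp: N_def space_pair_measure c_star_def B_star_def zero_le_mult_iff not_le)
  qed
 qed
 ultimately have "feedback p \<phi> y W \<in> controls M Z" unfolding controls_def feedback_def by auto
 thus ?thesis using W pos unfolding admissible_def closed_loop_wealth_def by auto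
qed

lemma J_feedback:
 assumes W: "closed_loop_wealth M Z p \<phi> w0 y W" and G0: "0 <= G p \<phi> w0 x0 x1"
 shows "J M p (c_star p \<phi> y W) (B_star p \<phi> y W) = ereal (f powr risk) * crra risk (G p \<phi> w0 x0 x1)"
proof (cases "G p \<phi> w0 x0 x1 = 0")
 case True
 thus ?thesis using J_no_wealth[OF feedback_admissible[OF W G0, unfolded feedback_def] True] by simp
next
 case False
 have "J M p (c_star p \<phi> y W) (B_star p \<phi> y W) = ereal (value_at (G p \<phi> w0 x0 x1))"
  using closed_loop_total_wealth(2)[OF W] G0 False by (intro J_optimal) (auto elim!: eventually_mono simp: c_star_def B_star_def)
 thus ?thesis using False by (simp add: value_at_def crra_real)
qed

lemma J_le_value:
 assumes "(c, B, \<theta>) \<in> admissible M Z p \<phi> w0 y" and G0: "0 <= G p \<phi> w0 x0 x1"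
 shows "J M p c B <= ereal (f powr risk) * crra risk (G p \<phi> w0 x0 x1)"
proof (cases "G p \<phi> w0 x0 x1 = 0")
 case True
 thus ?thesis using J_no_wealth[OF assms(1) True] by simp
next
 case False
 thus ?thesis using J_upper[OF assms(1)] G0 by (simp add: value_at_def crra_real)
qed

lemma value_function_eq:
 assumes G0: "0 <= G p \<phi> w0 x0 x1"
 shows "value_function M Z p \<phi> w0 y = ereal (f powr risk) * crra risk (G p \<phi> w0 x0 x1)"
proof -
 let ?a = "SUP (c, B, \<theta>)\<in>admissible M Z p \<phi> w0 y. J M p c B"
 let ?b = "ereal (f powr risk) * crra risk (G p \<phi> w0 x0 x1)"
 obtain W where W: "closed_loop_wealth M Z p \<phi> w0 y W" using closed_loop_exists by blast
 show ?thesis unfolding value_function_def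
 proof (rule antisym)
  show "?a <= ?b"
   by (rule SUP_least) (auto intro: J_le_value[OF _ G0])
  show "?b <= ?a"
   using SUP_upper[OF feedback_admissible[OF W G0], of "%(c, B, \<theta>). J M p c B"] J_feedback[OF W G0] by (simp add: feedback_def)
 qed
qed

end

theorem theorem3p8:
  fixes M :: "'w measure" and Z :: "real \<Rightarrow> 'w \<Rightarrow> real ^ 'n"
    and p :: "'n::finite market" and \<phi> :: "real set \<Rightarrow> real"
    and w x0 :: real and x1 :: "real \<Rightarrow> real" and y :: "real \<Rightarrow> 'w \<Rightarrow> real"
  assumes "prob_space M" and "complete_measure M" and "brownian_motion M Z"
    and "interest p > 0" and "mortality p > 0" and "discount p > 0"
    and "bequest p > 0" and "delay p > 0"
    and "aversion p > 0" and "aversion p \<noteq> 1"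
    and "invertible (vol p)"
    and "\<phi> \<in> radon_measures_no_atom (delay p)"
    and "beta p - beta_inf p \<phi> > 0"
    and "discount p + mortality p - (1 - aversion p) *
           (interest p + mortality p + kappa p \<bullet> kappa p / (2 * aversion p)) > 0"
    and "x1 \<in> L2_window (delay p)"
    and "G p \<phi> w x0 x1 \<ge> 0"
    and "labor_income M Z p \<phi> x0 x1 y"
  shows "nu p > 0 \<and> f_inf p > 0 \<and>
    value_function M Z p \<phi> w y =
      ereal (f_inf p powr aversion p) * crra (aversion p) (G p \<phi> w x0 x1) \<and>
    (\<exists>W. closed_loop_wealth M Z p \<phi> w y W) \<and>
    (\<forall>W. closed_loop_wealth M Z p \<phi> w y W \<longrightarrow>
      feedback p \<phi> y W \<in> admissible M Z p \<phi> w y \<and>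
      J M p (c_star p \<phi> y W) (B_star p \<phi> y W) = value_function M Z p \<phi> w y \<and>
      (let \<Gamma> = total_wealth p \<phi> y W;
           \<alpha> = interest p + mortality p + kappa p \<bullet> kappa p / aversion p
                 - inverse (f_inf p) * (1 + mortality p * bequest p powr (- b_exp p));
           v = (1 / aversion p) *\<^sub>R kappa p
       in ito_process M Z (G p \<phi> w x0 x1)
            (\<lambda>t \<omega>. \<Gamma> t \<omega> * \<alpha>) (\<lambda>t \<omega>. (\<Gamma> t \<omega> / aversion p) *\<^sub>R kappa p) \<Gamma> \<and>
          (AE \<omega> in M. \<Gamma> 0 \<omega> = w + g_inf p \<phi> * x0
             + (LINT s:{- delay p..<0}|lborel. h_inf p \<phi> s * x1 s)) \<and>
          (AE \<omega> in M. \<forall>t\<ge>0. \<Gamma> t \<omega> = \<Gamma> 0 \<omega> * doleans_exponential Z \<alpha> v t \<omega>)))"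
proof -
  obtain D where D: "AE w in M. delay_term \<phi> (delay p) (\<lambda>t. y t w) (\<lambda>t. D t w)"
    and Y: "ito_process M Z x0 (\<lambda>t w. income_drift p * y t w + D t w) (\<lambda>t w. y t w *\<^sub>R income_vol p) y"
    using assms(17) unfolding labor_income_def by blast
  have start: "\<And>w. w \<in> space M \<Longrightarrow> y 0 w = x0" "\<And>w s. w \<in> space M \<Longrightarrow> - delay p \<le> s \<Longrightarrow> s < 0 \<Longrightarrow> y s w = x1 s"
    using assms(17) unfolding labor_income_def by auto
  interpret prob_space M by fact
  interpret investment_model M Z p \<phi> x0 x1 y D
  proof unfold_locales
    show "\<And>A B. B \<subseteq> A \<Longrightarrow> A \<in> null_sets M \<Longrightarrow> B \<in> sets M" by (rule complete_measure.complete[OF assms(2)])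
    show "brownian_motion M Z" "\<phi> \<in> radon_measures_no_atom (delay p)" "0 < delay p" "0 \<le> interest p + mortality p"
      "x1 \<in> L2_window (delay p)" "invertible (vol p)" "0 < beta p - beta_inf p \<phi>" "0 < interest p" "0 < mortality p" "0 < bequest p" "0 < aversion p" "aversion p \<noteq> 1"
      "0 < discount p + mortality p - (1 - aversion p) * (interest p + mortality p + kappa p \<bullet> kappa p / (2 * aversion p))"
      using assms by (assumption | linarith)+
  qed (rule start D Y; assumption)+
  have \<alpha>: "interest p + mortality p + kappa p \<bullet> kappa p / aversion p - inverse (f_inf p) * (1 + mortality p * bequest p powr (- b_exp p)) = alph"
    by (simp add: alph_def)
  have "feedback p \<phi> y W \<in> admissible M Z p \<phi> w y \<and>
      J M p (c_star p \<phi> y W) (B_star p \<phi> y W) = value_function M Z p \<phi> w y \<and>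
      ito_process M Z (G p \<phi> w x0 x1) (\<lambda>t w. total_wealth p \<phi> y W t w * alph)
        (\<lambda>t w. (total_wealth p \<phi> y W t w / aversion p) *\<^sub>R kappa p) (total_wealth p \<phi> y W) \<and>
      (AE \<omega> in M. total_wealth p \<phi> y W 0 \<omega> = w + g_inf p \<phi> * x0 + (LINT s:{- delay p..<0}|lborel. h_inf p \<phi> s * x1 s)) \<and>
      (AE \<omega> in M. \<forall>t\<ge>0. total_wealth p \<phi> y W t \<omega> = total_wealth p \<phi> y W 0 \<omega> * doleans_exponential Z alph expo t \<omega>)"
    if W: "closed_loop_wealth M Z p \<phi> w y W" for W
  proof -
    note \<Gamma> = closed_loop_total_wealth[OF W]
    have "AE \<omega> in M. total_wealth p \<phi> y W 0 \<omega> = G p \<phi> w x0 x1"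
      using \<Gamma>(2) AE_space by eventually_elim (simp add: sexp_zero)
    moreover from this have "AE \<omega> in M. \<forall>t\<ge>0. total_wealth p \<phi> y W t \<omega> = total_wealth p \<phi> y W 0 \<omega> * doleans_exponential Z alph expo t \<omega>"
      using \<Gamma>(2) sexp_AE[of alph expo] by eventually_elim simp
    ultimately show ?thesis
      using feedback_admissible[OF W assms(16)] J_feedback[OF W assms(16)] value_function_eq[OF assms(16)] \<Gamma>(1) by (simp add: G_def)
  qed
  then show ?thesis
    unfolding Let_def \<alpha> using nu_pos f_pos value_function_eq[OF assms(16)] closed_loop_exists by blast
qed

end
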